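(* Let $m\ge2$ be an integer, $r\ge2$, and let $L$ be the span of linearly independent functions $e_1,\dots,e_k$. Let $\Pi_p$ be the kernel of the orthogonal projection onto $L$ in $L_2(\underline a\,\underline b\,g)$, satisfying $\int\Pi_p(x_1,x_2)\Pi_p(x_2,x_3)(\underline a\,\underline b\,g)(x_2)\,d\nu(x_2)=\Pi_p(x_1,x_3)$ for all $x_1,x_3$ and $\sup_x\Pi_p(x,x)\lesssim k$, and let $\Pi_{\hat p}$ be the analogous kernel with $\hat g$ in place of $g$. Assume that the projections $\Pi_p$ and $\Pi_{\hat p}$ map $L_s(\underline a\,\underline b\,g)$ to $L_s(\underline a\,\underline b\,g)$ for every $s\in[r/(r-1),r]\cup\{4\}$ with uniformly bounded norms. Let $$\hat\chi_n=\mathbb P_n\bigl[A\hat a(Z)(Y-\hat b(Z))+\hat b(Z)\bigr]+\sum_{j=2}^m(-1)^{j-1}\,\mathbb U_n\,D_{\hat P}\bigl[\hat A_1\hat\Pi_{1,2}\underline A_2\hat\Pi_{2,3}\underline A_3\cdots\underline A_{j-1}\hat\Pi_{j-1,j}\hat Y_j\bigr],$$ where $\hat\Pi_{i,l}=\Pi_{\hat p}(Z_i,Z_l)$. Then, for a constant $c$ that depends only on the supremum norms of $\underline a,\underline b,1/a,b,p/\hat p,g/\hat g$, the norms of the operators $\Pi^{(0,l]}_{\hat p}:L_s(\underline a\,\underline b\,\hat g)\to L_s(\underline a\,\underline b\,\hat g)$, for $l=1,\dots,k$, and $r$, $$\hat{\mathrm E}_p\hat\chi_n-\chi(p)=O\Bigl(\|\hat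 a-a\|_r\|\hat b-b\|_r\|\hat g-g\|_{(m-1)r/(r-2)}^{m-1}\Bigr)+O\Bigl(\Bigl\|(I-\Pi_p)\frac{\hat a-a}{\underline a}\Bigr\|_2\Bigl\|(I-\Pi_p)\frac{\hat b-b}{\underline b}\Bigr\|_2\Bigr)$$ (with $r/(r-2)=\infty$ if $r=2$), and $$\widehat{\mathrm{var}}_p\hat\chi_n\lesssim\sum_{l=1}^m\Bigl(\sum_{j=l}^mc^jj^{2l}\varepsilon_n^{2(j-l)}\Bigr)\frac{k^{l-1}}{n^l}.$$ Here $\varepsilon_n$ is the maximum of $\|a-\hat a\|_4$, $\|b-\hat b\|_4$ and $\|g-\hat g\|_\infty$.
   Context: Model. $X=(YA,A,Z)$, where $Y,A\in\{0,1\}$ are conditionally independent given $Z\in\mathcal Z$. $Z$ has density $f$ with respect to a measure $\nu$ on $\mathcal Z$; $b(z)=\Pr(Y=1\mid Z=z)$; $1/a(z)=\Pr(A=1\mid Z=z)$; $g=f/a$. The law $P$ (density $p$) corresponds one-to-one to $(a,b,f)$, equivalently $(a,b,g)$. $\chi(p)=\mathrm EY=\int abg\,d\nu$. $\hat p\leftrightarrow(\hat a,\hat b,\hat g)$ (law $\hat P$) is a preliminary estimator based on a sample independent of the i.i.d. observations $X_1,\dots,X_n\sim P$ used in $\mathbb P_n,\mathbb U_n$. Standing assumptions: $1/a,b,1/\hat a,\hat b$ are bounded away from $0$ and $1$; $g,\hat g$ are bounded away from $0$ and $\infty$; $\underline a,\underline b:\mathcal Z\to(0,\infty)$ are fixed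 functions bounded away from $0$ and $\infty$. Notation. $\hat A=(A\hat a(Z)-1)\underline b(Z)$, $\hat Y=A(Y-\hat b(Z))\underline a(Z)$, $\underline A=A\,\underline a(Z)\underline b(Z)$, with index $i$ meaning evaluation at $X_i=(Y_iA_i,A_i,Z_i)$. $\mathbb P_nh=n^{-1}\sum_ih(X_i)$; for $h$ of $j\le n$ arguments $\mathbb U_nh$ is the average of $h(X_{i_1},\dots,X_{i_j})$ over all ordered $j$-tuples of distinct indices. $D_{\hat P}h(X_1,\dots,X_j)=\sum_{B\subset\{1,\dots,j\}}(-1)^{j-|B|}\mathrm E_{\hat P}[h(X_1,\dots,X_j)\mid X_i:i\in B]$ is the degenerate part under $\hat P$ (with $\hat a,\hat b,\hat g$ held fixed). The projection onto $L$ in $L_2(\underline a\,\underline b\,g)$ with kernel $\Pi_p$ acts as $h\mapsto\int\Pi_p(\cdot,z)h(z)(\underline a\,\underline b\,g)(z)\,d\nu(z)$. $\Pi^{(0,l]}_{\hat p}$ is the orthogonal projection in $L_2(\underline a\,\underline b\,\hat g)$ onto the span of $e_1,\dots,e_l$ (so $\Pi^{(0,k]}_{\hat p}=\Pi_{\hat p}$), and $s$ ranges over the exponents in the operator-norm assumption. $\|\cdot\|_s$ is the norm of $L_s(\underline a\,\underline b\,g\,d\nu)$, $\|\cdot\|_\infty$ the uniform norm. $\hat{\mathrm E}_p$, $\widehat{\mathrm{var}}_p$ are conditional expectation and variance under $P$ given the sample used for $\hat p$. $O(\cdot)$ and $\lesssim$ mean up to multiplicative constants; the bounds in the standing assumptions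 and the constant in $\sup_x\Pi_p(x,x)\lesssim k$ are regarded as fixed. *)

theory Defs
  imports "HOL-Probability.Probability"
begin

subsection \<open>The model\<close>

text \<open>
  A law \<open>p\<close> of the model is identified with its parameter \<open>(a, b, g)\<close>, relative to a measure
  \<open>\<nu>\<close> on the space of \<open>Z\<close>. The same type serves for \<open>p\<close> and for its estimate.
\<close>

record 'z param =
  par_a :: "'z \<Rightarrow> real"
  par_b :: "'z \<Rightarrow> real"
  par_g :: "'z \<Rightarrow> real"

text \<open>The density of \<open>Z\<close>; \<open>g = f / a\<close>.\<close>

definition par_f :: "'z param \<Rightarrow> 'z \<Rightarrow> real" where
  "par_f p z = par_a p z * par_g p z"

abbreviation triples :: "'z measure \<Rightarrow> (bool \<times> bool \<times> 'z) measure" where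
  "triples \<nu> \<equiv> count_space UNIV \<Otimes>\<^sub>M (count_space UNIV \<Otimes>\<^sub>M \<nu>)"

text \<open>
  Density and law of the partially unobserved \<open>(Y, A, Z)\<close>: given \<open>Z = z\<close>, the variables \<open>Y\<close> and
  \<open>A\<close> are independent Bernoulli with success probabilities \<open>b z\<close> and \<open>1 / a z\<close>.
\<close>

definition full_density :: "'z param \<Rightarrow> bool \<times> bool \<times> 'z \<Rightarrow> real" where
  "full_density p = (\<lambda>(y, t, z). par_f p z * (if y then par_b p z else 1 - par_b p z) *
     (if t then 1 / par_a p z else 1 - 1 / par_a p z))"

definition full_law :: "'z measure \<Rightarrow> 'z param \<Rightarrow> (bool \<times> bool \<times> 'z) measure" where
  "full_law \<nu> p = density (triples \<nu>) (\<lambda>x. ennreal (full_density p x))"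

text \<open>The law \<open>P\<close> of the observation \<open>X = (YA, A, Z)\<close>, and its density \<open>p\<close>.\<close>

definition law :: "'z measure \<Rightarrow> 'z param \<Rightarrow> (bool \<times> bool \<times> 'z) measure" where
  "law \<nu> p = distr (full_law \<nu> p) (triples \<nu>) (\<lambda>(y, t, z). (y \<and> t, t, z))"

definition obs_density :: "'z param \<Rightarrow> bool \<times> bool \<times> 'z \<Rightarrow> real" where
  "obs_density p = (\<lambda>(u, t, z). \<Sum>y | (y \<and> t) = u. full_density p (y, t, z))"

text \<open>The functional \<open>\<chi>(p) = E Y\<close>.\<close>

definition chi :: "'z measure \<Rightarrow> 'z param \<Rightarrow> real" where
  "chi \<nu> p = (\<integral>(y, t, z). of_bool y \<partial>full_law \<nu> p)"

text \<open>
  The standing assumptions, all bounds being expressed through one constant \<open>\<delta>\<close>. The last clause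
  of \<open>admissible\<close> says that \<open>f\<close> is a probability density.
\<close>

definition admissible :: "real \<Rightarrow> 'z measure \<Rightarrow> 'z param \<Rightarrow> bool" where
  "admissible \<delta> \<nu> p \<longleftrightarrow>
     par_a p \<in> borel_measurable \<nu> \<and> par_b p \<in> borel_measurable \<nu> \<and> par_g p \<in> borel_measurable \<nu> \<and>
     (\<forall>z\<in>space \<nu>. \<delta> \<le> 1 / par_a p z \<and> 1 / par_a p z \<le> 1 - \<delta> \<and>
                  \<delta> \<le> par_b p z \<and> par_b p z \<le> 1 - \<delta> \<and>
                  \<delta> \<le> par_g p z \<and> par_g p z \<le> 1 / \<delta>) \<and>
     (\<integral>\<^sup>+z. ennreal (par_f p z) \<partial>\<nu>) = 1"

definition weight :: "real \<Rightarrow> 'z measure \<Rightarrow> ('z \<Rightarrow> real) \<Rightarrow> bool" where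
  "weight \<delta> \<nu> w \<longleftrightarrow> w \<in> borel_measurable \<nu> \<and> (\<forall>z\<in>space \<nu>. \<delta> \<le> w z \<and> w z \<le> 1 / \<delta>)"


subsection \<open>Norms, projections and kernels\<close>

definition sup_norm :: "'x set \<Rightarrow> ('x \<Rightarrow> real) \<Rightarrow> real" where
  "sup_norm S h = (SUP x\<in>S. \<bar>h x\<bar>)"

definition Lp_space :: "'x measure \<Rightarrow> real \<Rightarrow> ('x \<Rightarrow> real) set" where
  "Lp_space \<mu> s = {h \<in> borel_measurable \<mu>. integrable \<mu> (\<lambda>x. \<bar>h x\<bar> powr s)}"

definition Lp_norm :: "'x measure \<Rightarrow> real \<Rightarrow> ('x \<Rightarrow> real) \<Rightarrow> real" where
  "Lp_norm \<mu> s h = (\<integral>x. \<bar>h x\<bar> powr s \<partial>\<mu>) powr (1 / s)"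

text \<open>
  Here and below \<open>aw\<close> and \<open>bw\<close> are the fixed weight functions (a and b with an underbar); the
  measure has density \<open>aw * bw * g\<close> with respect to \<open>\<nu>\<close>.
\<close>

definition wmeasure ::
  "'z measure \<Rightarrow> ('z \<Rightarrow> real) \<Rightarrow> ('z \<Rightarrow> real) \<Rightarrow> 'z param \<Rightarrow> 'z measure" where
  "wmeasure \<nu> aw bw p = density \<nu> (\<lambda>z. ennreal (aw z * bw z * par_g p z))"

definition span_upto :: "(nat \<Rightarrow> 'z \<Rightarrow> real) \<Rightarrow> nat \<Rightarrow> ('z \<Rightarrow> real) set" where
  "span_upto e l = {h. \<exists>c. h = (\<lambda>z. \<Sum>i=1..l. c i * e i z)}"

definition lin_indep_on :: "'z set \<Rightarrow> (nat \<Rightarrow> 'z \<Rightarrow> real) \<Rightarrow> nat \<Rightarrow> bool" where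
  "lin_indep_on S e k \<longleftrightarrow>
     (\<forall>c. (\<forall>z\<in>S. (\<Sum>i=1..k. c i * e i z) = 0) \<longrightarrow> (\<forall>i\<in>{1..k}. c i = 0))"

text \<open>\<open>v\<close> is (a version of) the orthogonal projection of \<open>h\<close> onto \<open>V\<close> in \<open>L\<^sub>2(\<mu>)\<close>.\<close>

definition is_orth_proj ::
  "'z measure \<Rightarrow> ('z \<Rightarrow> real) set \<Rightarrow> ('z \<Rightarrow> real) \<Rightarrow> ('z \<Rightarrow> real) \<Rightarrow> bool" where
  "is_orth_proj \<mu> V h v \<longleftrightarrow> v \<in> V \<and> (\<forall>w\<in>V. (\<integral>z. (h z - v z) * w z \<partial>\<mu>) = 0)"

definition kernel_op ::
  "'z measure \<Rightarrow> ('z \<Rightarrow> 'z \<Rightarrow> real) \<Rightarrow> ('z \<Rightarrow> real) \<Rightarrow> 'z \<Rightarrow> real" where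
  "kernel_op \<mu> K h x = (\<integral>z. K x z * h z \<partial>\<mu>)"

text \<open>
  \<open>K\<close> is a kernel of the orthogonal projection onto \<open>V\<close> in \<open>L\<^sub>2(\<mu>)\<close>. The image of \<open>h\<close> is only
  determined up to a null set, as an element of \<open>L\<^sub>2(\<mu>)\<close>; the values of \<open>K\<close> at single points
  matter only in the reproducing identity below and in the bound on the diagonal.
\<close>

definition orth_proj_kernel ::
  "'z measure \<Rightarrow> ('z \<Rightarrow> real) set \<Rightarrow> ('z \<Rightarrow> 'z \<Rightarrow> real) \<Rightarrow> bool" where
  "orth_proj_kernel \<mu> V K \<longleftrightarrow>
     (\<lambda>(x, z). K x z) \<in> borel_measurable (\<mu> \<Otimes>\<^sub>M \<mu>) \<and>
     (\<forall>h\<in>Lp_space \<mu> 2.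
        (\<forall>x\<in>space \<mu>. integrable \<mu> (\<lambda>z. K x z * h z)) \<and>
        (\<exists>v. is_orth_proj \<mu> V h v \<and> (AE x in \<mu>. kernel_op \<mu> K h x = v x)))"

definition reproducing :: "'z measure \<Rightarrow> ('z \<Rightarrow> 'z \<Rightarrow> real) \<Rightarrow> bool" where
  "reproducing \<mu> K \<longleftrightarrow> (\<forall>x1\<in>space \<mu>. \<forall>x3\<in>space \<mu>.
     has_bochner_integral \<mu> (\<lambda>x2. K x1 x2 * K x2 x3) (K x1 x3))"

definition exponents :: "real \<Rightarrow> real set" where
  "exponents r = {r / (r - 1) .. r} \<union> {4}"

text \<open>\<open>T\<close> maps \<open>L\<^sub>s(\<mu>)\<close> to itself, with norm at most \<open>B\<close>.\<close>

definition maps_Lp ::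
  "'z measure \<Rightarrow> real \<Rightarrow> (('z \<Rightarrow> real) \<Rightarrow> 'z \<Rightarrow> real) \<Rightarrow> real \<Rightarrow> bool" where
  "maps_Lp \<mu> s T B \<longleftrightarrow>
     (\<forall>h\<in>Lp_space \<mu> s. T h \<in> Lp_space \<mu> s \<and> Lp_norm \<mu> s (T h) \<le> B * Lp_norm \<mu> s h)"

text \<open>
  The orthogonal projection onto \<open>V\<close> in \<open>L\<^sub>2(\<mu>)\<close> has norm at most \<open>B\<close> as an operator on \<open>L\<^sub>s(\<mu>)\<close>.
  For \<open>s < 2\<close> this is its norm on the dense subspace \<open>L\<^sub>s(\<mu>) \<inter> L\<^sub>2(\<mu>)\<close>, which is that of its
  continuous extension.
\<close>

definition proj_norm_le :: "'z measure \<Rightarrow> ('z \<Rightarrow> real) set \<Rightarrow> real \<Rightarrow> real \<Rightarrow> bool" where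
  "proj_norm_le \<mu> V s B \<longleftrightarrow>
     (\<forall>h\<in>Lp_space \<mu> s \<inter> Lp_space \<mu> 2. \<forall>v. is_orth_proj \<mu> V h v \<longrightarrow>
        v \<in> Lp_space \<mu> s \<and> Lp_norm \<mu> s v \<le> B * Lp_norm \<mu> s h)"


subsection \<open>The estimator\<close>

text \<open>
  A sample is a function on indices \<open>1, \<dots>, n\<close>, and a function of \<open>j\<close> arguments is a function of
  such a sequence that only looks at the coordinates \<open>1, \<dots>, j\<close>.
\<close>

definition emp_mean :: "nat \<Rightarrow> ('x \<Rightarrow> real) \<Rightarrow> (nat \<Rightarrow> 'x) \<Rightarrow> real" where
  "emp_mean n h x = (\<Sum>i=1..n. h (x i)) / real n"

definition distinct_tuples :: "nat \<Rightarrow> nat \<Rightarrow> (nat \<Rightarrow> nat) set" where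
  "distinct_tuples n j = {\<sigma> \<in> {1..j} \<rightarrow>\<^sub>E {1..n}. inj_on \<sigma> {1..j}}"

definition ustat :: "nat \<Rightarrow> nat \<Rightarrow> ((nat \<Rightarrow> 'x) \<Rightarrow> real) \<Rightarrow> (nat \<Rightarrow> 'x) \<Rightarrow> real" where
  "ustat n j h x =
     (\<Sum>\<sigma>\<in>distinct_tuples n j. h (\<lambda>i. x (\<sigma> i))) / real (card (distinct_tuples n j))"

text \<open>
  The conditional expectation of \<open>h(X\<^sub>1, \<dots>, X\<^sub>j)\<close> given \<open>X\<^sub>i = x\<^sub>i\<close> for \<open>i \<in> B\<close>, for i.i.d. variables
  with law \<open>Q\<close>, integrates out the coordinates outside \<open>B\<close>.
\<close>

definition cond_exp_iid ::
  "'x measure \<Rightarrow> nat \<Rightarrow> nat set \<Rightarrow> ((nat \<Rightarrow> 'x) \<Rightarrow> real) \<Rightarrow> (nat \<Rightarrow> 'x) \<Rightarrow> real" where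
  "cond_exp_iid Q j B h x =
     (\<integral>y. h (\<lambda>i. if i \<in> B then x i else y i) \<partial>PiM {1..j} (\<lambda>_. Q))"

definition degen ::
  "'x measure \<Rightarrow> nat \<Rightarrow> ((nat \<Rightarrow> 'x) \<Rightarrow> real) \<Rightarrow> (nat \<Rightarrow> 'x) \<Rightarrow> real" where
  "degen Q j h x = (\<Sum>B\<in>Pow {1..j}. (- 1) ^ (j - card B) * cond_exp_iid Q j B h x)"

text \<open>
  In the following functions of \<open>X = (YA, A, Z)\<close>, \<open>A (Y - b)\<close> is written as \<open>A (YA - b)\<close>, which
  is the same because \<open>A\<close> is \<open>0\<close> or \<open>1\<close>.
\<close>

definition A_hat :: "'z param \<Rightarrow> ('z \<Rightarrow> real) \<Rightarrow> bool \<times> bool \<times> 'z \<Rightarrow> real" where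
  "A_hat phat bw = (\<lambda>(u, t, z). (of_bool t * par_a phat z - 1) * bw z)"

definition Y_hat :: "'z param \<Rightarrow> ('z \<Rightarrow> real) \<Rightarrow> bool \<times> bool \<times> 'z \<Rightarrow> real" where
  "Y_hat phat aw = (\<lambda>(u, t, z). of_bool t * (of_bool u - par_b phat z) * aw z)"

definition A_under :: "('z \<Rightarrow> real) \<Rightarrow> ('z \<Rightarrow> real) \<Rightarrow> bool \<times> bool \<times> 'z \<Rightarrow> real" where
  "A_under aw bw = (\<lambda>(u, t, z). of_bool t * aw z * bw z)"

definition linear_part :: "'z param \<Rightarrow> bool \<times> bool \<times> 'z \<Rightarrow> real" where
  "linear_part phat =
     (\<lambda>(u, t, z). of_bool t * par_a phat z * (of_bool u - par_b phat z) + par_b phat z)"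

definition Z_of :: "bool \<times> bool \<times> 'z \<Rightarrow> 'z" where
  "Z_of x = snd (snd x)"

definition chain :: "'z param \<Rightarrow> ('z \<Rightarrow> real) \<Rightarrow> ('z \<Rightarrow> real) \<Rightarrow> ('z \<Rightarrow> 'z \<Rightarrow> real) \<Rightarrow>
    nat \<Rightarrow> (nat \<Rightarrow> bool \<times> bool \<times> 'z) \<Rightarrow> real" where
  "chain phat aw bw K j x =
     A_hat phat bw (x 1) * (\<Prod>i=1..<j. K (Z_of (x i)) (Z_of (x (Suc i)))) *
     (\<Prod>i=2..<j. A_under aw bw (x i)) * Y_hat phat aw (x j)"

definition chi_hat :: "'z measure \<Rightarrow> 'z param \<Rightarrow> ('z \<Rightarrow> real) \<Rightarrow> ('z \<Rightarrow> real) \<Rightarrow>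
    ('z \<Rightarrow> 'z \<Rightarrow> real) \<Rightarrow> nat \<Rightarrow> nat \<Rightarrow> (nat \<Rightarrow> bool \<times> bool \<times> 'z) \<Rightarrow> real" where
  "chi_hat \<nu> phat aw bw K m n x =
     emp_mean n (linear_part phat) x +
     (\<Sum>j=2..m. (- 1) ^ (j - 1) * ustat n j (degen (law \<nu> phat) j (chain phat aw bw K j)) x)"

text \<open>
  The sample behind the preliminary estimator is independent of \<open>X\<^sub>1, \<dots>, X\<^sub>n\<close>, so that the
  conditional law of \<open>X\<^sub>1, \<dots>, X\<^sub>n\<close> given that sample is the \<open>n\<close>-fold product of \<open>P\<close>. Conditional
  means and variances are the ones under this product law, for a fixed value of the estimate.
\<close>

definition sample_law :: "'z measure \<Rightarrow> 'z param \<Rightarrow> nat \<Rightarrow> (nat \<Rightarrow> bool \<times> bool \<times> 'z) measure" where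
  "sample_law \<nu> p n = PiM {1..n} (\<lambda>_. law \<nu> p)"


subsection \<open>Assumptions and error terms\<close>

text \<open>
  \<open>Ck\<close> is the constant in \<open>\<Pi>\<^sub>p(x, x) \<lesssim> k\<close>, and \<open>B\<close> the uniform bound on the operator norms of the
  two projections. Both norms are taken in \<open>L\<^sub>s\<close> for the weight of \<open>p\<close>, although the
  second projection integrates against the weight of the estimate.
\<close>

definition setting :: "real \<Rightarrow> real \<Rightarrow> real \<Rightarrow> real \<Rightarrow> nat \<Rightarrow> 'z measure \<Rightarrow> 'z param \<Rightarrow> 'z param \<Rightarrow>
    ('z \<Rightarrow> real) \<Rightarrow> ('z \<Rightarrow> real) \<Rightarrow> (nat \<Rightarrow> 'z \<Rightarrow> real) \<Rightarrow>
    ('z \<Rightarrow> 'z \<Rightarrow> real) \<Rightarrow> ('z \<Rightarrow> 'z \<Rightarrow> real) \<Rightarrow> bool" where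
  "setting \<delta> Ck r B k \<nu> p phat aw bw e K Khat \<longleftrightarrow>
     admissible \<delta> \<nu> p \<and> admissible \<delta> \<nu> phat \<and> weight \<delta> \<nu> aw \<and> weight \<delta> \<nu> bw \<and>
     1 \<le> k \<and> lin_indep_on (space \<nu>) e k \<and>
     (\<forall>i\<in>{1..k}. e i \<in> Lp_space (wmeasure \<nu> aw bw p) 2) \<and>
     orth_proj_kernel (wmeasure \<nu> aw bw p) (span_upto e k) K \<and>
     reproducing (wmeasure \<nu> aw bw p) K \<and>
     (\<forall>x\<in>space \<nu>. K x x \<le> Ck * real k) \<and>
     orth_proj_kernel (wmeasure \<nu> aw bw phat) (span_upto e k) Khat \<and>
     reproducing (wmeasure \<nu> aw bw phat) Khat \<and>
     (\<forall>s\<in>exponents r.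
        maps_Lp (wmeasure \<nu> aw bw p) s (kernel_op (wmeasure \<nu> aw bw p) K) B \<and>
        maps_Lp (wmeasure \<nu> aw bw p) s (kernel_op (wmeasure \<nu> aw bw phat) Khat) B)"

definition bias_bound :: "real \<Rightarrow> nat \<Rightarrow> 'z measure \<Rightarrow> 'z param \<Rightarrow> 'z param \<Rightarrow>
    ('z \<Rightarrow> real) \<Rightarrow> ('z \<Rightarrow> real) \<Rightarrow> ('z \<Rightarrow> 'z \<Rightarrow> real) \<Rightarrow> real" where
  "bias_bound r m \<nu> p phat aw bw K =
     (let \<mu> = wmeasure \<nu> aw bw p;
          da = (\<lambda>z. par_a phat z - par_a p z);
          db = (\<lambda>z. par_b phat z - par_b p z);
          dg = (\<lambda>z. par_g phat z - par_g p z);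
          resid = (\<lambda>h z. h z - kernel_op \<mu> K h z)
      in Lp_norm \<mu> r da * Lp_norm \<mu> r db *
           (if r = 2 then sup_norm (space \<nu>) dg
            else Lp_norm \<mu> (real (m - 1) * r / (r - 2)) dg) ^ (m - 1)
         + Lp_norm \<mu> 2 (resid (\<lambda>z. da z / aw z)) * Lp_norm \<mu> 2 (resid (\<lambda>z. db z / bw z)))"

definition eps :: "'z measure \<Rightarrow> 'z param \<Rightarrow> 'z param \<Rightarrow> ('z \<Rightarrow> real) \<Rightarrow> ('z \<Rightarrow> real) \<Rightarrow> real" where
  "eps \<nu> p phat aw bw =
     (let \<mu> = wmeasure \<nu> aw bw p
      in Max {Lp_norm \<mu> 4 (\<lambda>z. par_a p z - par_a phat z),
              Lp_norm \<mu> 4 (\<lambda>z. par_b p z - par_b phat z),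
              sup_norm (space \<nu>) (\<lambda>z. par_g p z - par_g phat z)})"

definition var_bound :: "real \<Rightarrow> real \<Rightarrow> nat \<Rightarrow> nat \<Rightarrow> nat \<Rightarrow> real" where
  "var_bound c \<epsilon> k m n =
     (\<Sum>l=1..m. (\<Sum>j=l..m. c ^ j * real j ^ (2 * l) * \<epsilon> ^ (2 * (j - l))) *
        (real k ^ (l - 1) / real n ^ l))"

end

theory Submission
  imports Defs
begin

text \<open>
  The kernel of a finite-rank projection factors as a sum over an orthonormal basis, so the chain
  whose degenerate part enters the estimator is a finite sum of products of functions of a single
  observation. Taking the degenerate part under the estimated law centres each factor, and the mean
  of a centred factor under the true law is small: integrated against a function of \<open>Z\<close>, the
  factors produce the differences of \<open>a\<close>, \<open>b\<close> and \<open>g\<close>.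

  Mean: the term of order \<open>j\<close> has mean \<open>\<integral>U \<Pi> (N \<Pi>)\<^sup>j\<^sup>-\<^sup>2 V\<close> with \<open>\<Pi>\<close> the estimated projection, \<open>N\<close> the
  relative error of \<open>g\<close>, and \<open>U\<close>, \<open>V\<close> the errors of \<open>a\<close>, \<open>b\<close> times \<open>1 + N\<close>. Since both projections have the
  same range, the alternating sum over \<open>j\<close> telescopes; left over are the error of projecting the linear bias and
  a term with \<open>m - 1\<close> factors \<open>N\<close>, bounded by Hoelder's inequality.

  Variance: by Hoeffding's decomposition it is enough to bound, for every nonempty set \<open>B\<close> of \<open>l\<close> coordinates, the
  second moment of the chain with the coordinates outside \<open>B\<close> integrated out under the true law. The
  domination of the true law by the estimated one and the Schur product theorem allow the coordinates
  in \<open>B\<close> to be integrated under the estimated law without centring. What remains is a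
  product along the chain, in which each coordinate outside \<open>B\<close> costs one factor of the order of the error, and each
  coordinate in \<open>B\<close> except one costs a factor \<open>k\<close> through the diagonal of the kernel.
\<close>

subsection \<open>Bounded measurable functions\<close>

text \<open>The estimated kernel is determined only up to null sets and comes without a bound on its
  diagonal, yet the estimator evaluates it at sample points. Both gaps are closed before any moment
  of the estimator is taken: each projection receives an orthonormal basis of bounded functions, the
  diagonal bound passes from the true to the estimated kernel because the two weights are
  comparable, and the estimator is replaced by its finite rank version, which agrees with it almost
  surely. After that all functions are bounded everywhere (\<open>bdd_meas\<close>) on finite
  measures, so integrability and Fubini are immediate. The difficulty in the variance is to spend
  one power of \<open>k\<close> less than there are coordinates in \<open>B\<close> while the errors
  of \<open>a\<close> and \<open>b\<close> are small only in L4. The left part of the chain is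
  therefore carried along as a weight in L2: an error enters it as a square, whose L2 norm is a
  fourth power, and the kernel acts on it through a Schur test. Factors exponential in the order
  \<open>j\<close> (from counting, from the domination, from the operator norms) may accumulate,
  since the bound has room for \<open>c ^ j\<close>.\<close>

definition bdd_meas :: "'a measure \<Rightarrow> ('a \<Rightarrow> real) set" where
  "bdd_meas M = {f \<in> borel_measurable M. \<exists>C. \<forall>x\<in>space M. \<bar>f x\<bar> \<le> C}"

lemma bdd_measI:
  "f \<in> borel_measurable M \<Longrightarrow> (\<And>x. x \<in> space M \<Longrightarrow> \<bar>f x\<bar> \<le> C) \<Longrightarrow> f \<in> bdd_meas M"
  by (auto simp: bdd_meas_def)

lemma bdd_meas_measurable [measurable_dest]: "f \<in> bdd_meas M \<Longrightarrow> f \<in> borel_measurable M"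
  by (simp add: bdd_meas_def)

lemma bdd_meas_bound:
  assumes "f \<in> bdd_meas M"
  obtains C where "0 \<le> C" "\<And>x. x \<in> space M \<Longrightarrow> \<bar>f x\<bar> \<le> C"
proof -
  obtain C where C: "\<forall>x\<in>space M. \<bar>f x\<bar> \<le> C"
    using assms by (auto simp: bdd_meas_def)
  show ?thesis
    by (rule that[of "\<bar>C\<bar>"]) (use C in force)+
qed

lemma bdd_meas_const [simp]: "(\<lambda>_. c) \<in> bdd_meas M"
  by (rule bdd_measI[of _ _ "\<bar>c\<bar>"]) auto

lemma bdd_meas_add:
  assumes "f \<in> bdd_meas M" "g \<in> bdd_meas M"
  shows "(\<lambda>x. f x + g x) \<in> bdd_meas M"
proof -
  obtain C where C: "0 \<le> C" "\<And>x. x \<in> space M \<Longrightarrow> \<bar>f x\<bar> \<le> C"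
    using bdd_meas_bound[OF assms(1)] by metis
  obtain D where D: "0 \<le> D" "\<And>x. x \<in> space M \<Longrightarrow> \<bar>g x\<bar> \<le> D"
    using bdd_meas_bound[OF assms(2)] by metis
  then show ?thesis
    using assms C D by (intro bdd_measI[of _ _ "C + D"])
      (auto dest: bdd_meas_measurable intro!: order_trans[OF abs_triangle_ineq] add_mono)
qed

lemma bdd_meas_mult:
  assumes "f \<in> bdd_meas M" "g \<in> bdd_meas M"
  shows "(\<lambda>x. f x * g x) \<in> bdd_meas M"
proof -
  obtain C where C: "0 \<le> C" "\<And>x. x \<in> space M \<Longrightarrow> \<bar>f x\<bar> \<le> C"
    using bdd_meas_bound[OF assms(1)] by metis
  obtain D where D: "0 \<le> D" "\<And>x. x \<in> space M \<Longrightarrow> \<bar>g x\<bar> \<le> D"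
    using bdd_meas_bound[OF assms(2)] by metis
  then show ?thesis
    using assms C D by (intro bdd_measI[of _ _ "C * D"]) (auto dest: bdd_meas_measurable simp: abs_mult intro!: mult_mono)
qed

lemma bdd_meas_uminus: "f \<in> bdd_meas M \<Longrightarrow> (\<lambda>x. - f x) \<in> bdd_meas M"
  using bdd_meas_mult[of "\<lambda>_. -1" M f] by simp

lemma bdd_meas_diff: "f \<in> bdd_meas M \<Longrightarrow> g \<in> bdd_meas M \<Longrightarrow> (\<lambda>x. f x - g x) \<in> bdd_meas M"
  using bdd_meas_add[OF _ bdd_meas_uminus, of f M g] by simp

lemma bdd_meas_sum: "(\<And>i. i \<in> I \<Longrightarrow> f i \<in> bdd_meas M) \<Longrightarrow> (\<lambda>x. \<Sum>i\<in>I. f i x) \<in> bdd_meas M"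
  by (induction I rule: infinite_finite_induct) (auto intro: bdd_meas_add)

lemma bdd_meas_prod: "(\<And>i. i \<in> I \<Longrightarrow> f i \<in> bdd_meas M) \<Longrightarrow> (\<lambda>x. \<Prod>i\<in>I. f i x) \<in> bdd_meas M"
  by (induction I rule: infinite_finite_induct) (auto intro: bdd_meas_mult)

lemma bdd_meas_power: "f \<in> bdd_meas M \<Longrightarrow> (\<lambda>x. f x ^ n) \<in> bdd_meas M"
  by (induction n) (auto intro: bdd_meas_mult)

lemma bdd_meas_divide: "f \<in> bdd_meas M \<Longrightarrow> (\<lambda>x. f x / c) \<in> bdd_meas M"
  using bdd_meas_mult[of f M "\<lambda>_. 1 / c"] by simp

lemma bdd_meas_abs: "f \<in> bdd_meas M \<Longrightarrow> (\<lambda>x. \<bar>f x\<bar>) \<in> bdd_meas M"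
  by (auto simp: bdd_meas_def)

lemma bdd_meas_comp:
  "f \<in> bdd_meas N \<Longrightarrow> g \<in> measurable M N \<Longrightarrow> (\<lambda>x. f (g x)) \<in> bdd_meas M"
  unfolding bdd_meas_def by (auto dest: measurable_space)

lemmas bdd_meas_intros = bdd_meas_const bdd_meas_add bdd_meas_mult bdd_meas_uminus bdd_meas_diff
  bdd_meas_sum bdd_meas_prod bdd_meas_power bdd_meas_divide bdd_meas_abs

lemma (in finite_measure) bdd_meas_integrable:
  assumes "f \<in> bdd_meas M"
  shows "integrable M f"
proof -
  obtain C where "\<And>x. x \<in> space M \<Longrightarrow> \<bar>f x\<bar> \<le> C"
    using bdd_meas_bound[OF assms] by metis
  then show ?thesis
    using assms by (intro integrable_const_bound[of _ C]) (auto dest: bdd_meas_measurable)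
qed

subsection \<open>Counting injections\<close>

text \<open>Generalises \<open>distinct_tuples\<close> to an arbitrary finite domain, so that
  counting can proceed by adding one element of the domain at a time.\<close>

definition inj_funs :: "'a set \<Rightarrow> 'b set \<Rightarrow> ('a \<Rightarrow> 'b) set" where
  "inj_funs D T = {\<tau> \<in> D \<rightarrow>\<^sub>E T. inj_on \<tau> D}"

lemma inj_funs_empty [simp]: "inj_funs {} T = {\<lambda>_. undefined}"
  by (auto simp: inj_funs_def)

lemma finite_inj_funs: "finite D \<Longrightarrow> finite T \<Longrightarrow> finite (inj_funs D T)"
  unfolding inj_funs_def by (intro finite_subset[OF _ finite_PiE[of D "\<lambda>_. T"]]) auto

text \<open>An injection on \<open>D\<close> extends to \<open>c\<close> by any value outside its
  image, which always leaves \<open>card T - card D\<close> choices. The admissible restrictions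
  \<open>X\<close> are a parameter because the induction is run twice: over all injections, and over
  those that send a given set \<open>B\<close> into \<open>R\<close>.\<close>

lemma card_inj_extend:
  assumes "finite D" "finite T" "c \<notin> D" "X \<subseteq> inj_funs D T"
  shows "card {\<tau> \<in> inj_funs (insert c D) T. restrict \<tau> D \<in> X} = card X * (card T - card D)"
proof -
  let ?S = "SIGMA f:X. T - f ` D"
  have fX: "finite X"
    using assms finite_inj_funs finite_subset by blast
  have X: "f \<in> D \<rightarrow>\<^sub>E T" "inj_on f D" if "f \<in> X" for f
    using that assms by (auto simp: inj_funs_def)
  have res: "restrict (f(c := y)) D = f" if "f \<in> X" for f y
    using X(1)[OF that] assms(3) by (intro ext) (auto simp: restrict_def PiE_def extensional_def)
  have "{\<tau> \<in> inj_funs (insert c D) T. restrict \<tau> D \<in> X} = (\<lambda>(f, y). f(c := y)) ` ?S"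
  proof (intro equalityI subsetI)
    fix \<tau> assume t: "\<tau> \<in> {\<tau> \<in> inj_funs (insert c D) T. restrict \<tau> D \<in> X}"
    have "\<tau> = (restrict \<tau> D)(c := \<tau> c)"
      using t by (intro ext) (auto simp: inj_funs_def PiE_def extensional_def restrict_def)
    moreover have "\<tau> c \<in> T - restrict \<tau> D ` D"
      using t assms(3) by (auto simp: inj_funs_def inj_on_def PiE_def)
    ultimately show "\<tau> \<in> (\<lambda>(f, y). f(c := y)) ` ?S"
      using t by (force intro!: image_eqI[of _ _ "(restrict \<tau> D, \<tau> c)"])
  next
    fix \<tau> assume "\<tau> \<in> (\<lambda>(f, y). f(c := y)) ` ?S"
    then obtain f y where f: "\<tau> = f(c := y)" "f \<in> X" "y \<in> T" "y \<notin> f ` D"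
      by auto
    have "\<tau> \<in> inj_funs (insert c D) T"
      using X[OF f(2)] f assms(3) by (auto simp: inj_funs_def inj_on_def PiE_def extensional_def)
    then show "\<tau> \<in> {\<tau> \<in> inj_funs (insert c D) T. restrict \<tau> D \<in> X}"
      using f res by auto
  qed
  moreover have "inj_on (\<lambda>(f, y). f(c := y)) ?S"
  proof (rule inj_onI, clarify)
    fix f y g z assume h: "f \<in> X" "g \<in> X" "f(c := y) = g(c := z)"
    show "f = g \<and> y = z"
      using res[OF h(1), of y] res[OF h(2), of z] h(3) by (metis fun_upd_same)
  qed
  ultimately have "card {\<tau> \<in> inj_funs (insert c D) T. restrict \<tau> D \<in> X} = card ?S"
    by (simp add: card_image)
  also have "\<dots> = (\<Sum>f\<in>X. card T - card D)"
  proof (subst card_SigmaI)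
    show "(\<Sum>f\<in>X. card (T - f ` D)) = (\<Sum>f\<in>X. card T - card D)"
    proof (rule sum.cong)
      fix f assume "f \<in> X"
      then have "f ` D \<subseteq> T" "card (f ` D) = card D"
        using X by (auto simp: card_image)
      then show "card (T - f ` D) = card T - card D"
        using assms by (simp add: card_Diff_subset)
    qed simp
  qed (use fX assms in auto)
  finally show ?thesis by simp
qed

lemma card_inj_funs:
  assumes "finite D" "finite T"
  shows "card (inj_funs D T) = (\<Prod>i<card D. card T - i)"
  using assms(1)
proof induction
  case empty
  show ?case by simp
next
  case (insert c D)
  have "{\<tau> \<in> inj_funs (insert c D) T. restrict \<tau> D \<in> inj_funs D T} = inj_funs (insert c D) T"
    by (auto simp: inj_funs_def inj_on_def)
  then show ?case
    using card_inj_extend[OF insert(1) assms(2) insert(2) order_refl] insert by simp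
qed

text \<open>The values on \<open>B\<close> are chosen within \<open>R\<close>, and the number of
  extensions to \<open>C\<close> does not depend on \<open>R\<close>. The same second factor thus
  occurs for \<open>R\<close> and for \<open>T\<close>, and it drops out when the two counts are
  compared.\<close>

lemma card_inj_funs_restrict:
  assumes "finite C" "finite B" "finite T" "B \<inter> C = {}" "R \<subseteq> T"
  shows "card {\<tau> \<in> inj_funs (B \<union> C) T. \<tau> ` B \<subseteq> R} =
         card (inj_funs B R) * (\<Prod>i<card C. card T - card B - i)"
  using assms(1,4)
proof induction
  case empty
  have "{\<tau> \<in> inj_funs B T. \<tau> ` B \<subseteq> R} = inj_funs B R"
    using assms(5) by (auto simp: inj_funs_def)
  then show ?case by simp
next
  case (insert c C)
  let ?X = "{\<tau> \<in> inj_funs (B \<union> C) T. \<tau> ` B \<subseteq> R}"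
  have "{\<tau> \<in> inj_funs (insert c (B \<union> C)) T. restrict \<tau> (B \<union> C) \<in> ?X} =
        {\<tau> \<in> inj_funs (B \<union> insert c C) T. \<tau> ` B \<subseteq> R}"
    by (auto simp: inj_funs_def inj_on_def)
  moreover have "card (B \<union> C) = card B + card C"
    using insert assms by (intro card_Un_disjoint) auto
  ultimately show ?case
    using card_inj_extend[of "B \<union> C" T c ?X] insert assms by (auto simp: ac_simps)
qed

text \<open>A random injection sends \<open>B\<close> into \<open>R\<close> with probability the
  product of (|R| - i) / (|T| - i), and each factor is at most |R| / |T|. The inequality is
  multiplied out to stay within the natural numbers.\<close>

lemma card_inj_funs_hit:
  assumes "finite J" "finite T" "B \<subseteq> J" "R \<subseteq> T" "card R \<le> card T"
  shows "card {\<tau> \<in> inj_funs J T. \<tau> ` B \<subseteq> R} * card T ^ card B \<le>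
         card R ^ card B * card (inj_funs J T)"
proof -
  let ?P = "\<Prod>i<card (J - B). card T - card B - i"
  have J: "J = B \<union> (J - B)" "finite B"
    using assms finite_subset by auto
  have 1: "card {\<tau> \<in> inj_funs J T. \<tau> ` B \<subseteq> R} = (\<Prod>i<card B. card R - i) * ?P"
    using card_inj_funs_restrict[of "J - B" B T R] card_inj_funs[of B R] assms J finite_subset[of R T]
    by auto
  have "{\<tau> \<in> inj_funs J T. \<tau> ` B \<subseteq> T} = inj_funs J T"
    using assms by (auto simp: inj_funs_def)
  then have 2: "card (inj_funs J T) = (\<Prod>i<card B. card T - i) * ?P"
    using card_inj_funs_restrict[of "J - B" B T T] card_inj_funs[of B T] assms J by auto
  have "(\<Prod>i<card B. card R - i) * card T ^ card B = (\<Prod>i<card B. (card R - i) * card T)"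
    by (simp add: prod.distrib)
  \<comment> \<open>Factor by factor, with r = |R| \<le> t = |T|: r t - i t \<le> r t - r i, where
    both products distribute over truncated subtraction.\<close>
  also have "\<dots> \<le> (\<Prod>i<card B. card R * (card T - i))"
    using assms(5) by (intro prod_mono) (auto simp: algebra_simps diff_mult_distrib diff_mult_distrib2 intro!: diff_le_mono2)
  also have "\<dots> = card R ^ card B * (\<Prod>i<card B. card T - i)"
    by (simp add: prod.distrib)
  finally have "(\<Prod>i<card B. card R - i) * card T ^ card B * ?P \<le>
      card R ^ card B * (\<Prod>i<card B. card T - i) * ?P"
    by (rule mult_right_mono) simp
  then show ?thesis
    unfolding 1 2 by (simp only: ac_simps)
qed

text \<open>The positions that \<open>\<tau>\<close> sends into \<open>R\<close> form one of at most
  \<open>2 ^ card J\<close> subsets of \<open>J\<close>, and a union bound over this subset reduces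
  the count to \<open>card_inj_funs_hit\<close>. Exponential loss in \<open>card J\<close> is
  affordable here.\<close>

lemma card_inj_funs_overlap:
  assumes "finite J" "finite T" "R \<subseteq> T" "card R = card J" "card J \<le> card T"
  shows "real (card {\<tau> \<in> inj_funs J T. card (\<tau> ` J \<inter> R) = l}) \<le>
         2 ^ card J * (real (card J) / real (card T)) ^ l * real (card (inj_funs J T))"
proof -
  let ?B = "{B. B \<subseteq> J \<and> card B = l}"
  let ?H = "\<lambda>B. {\<tau> \<in> inj_funs J T. \<tau> ` B \<subseteq> R}"
  have fin: "finite (inj_funs J T)" "finite ?B"
    using assms finite_inj_funs by auto
  have H: "real (card (?H B)) \<le> (real (card J) / real (card T)) ^ l * real (card (inj_funs J T))"
    if "B \<in> ?B" for B
  proof (cases "card T = 0")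
    case True
    then have "J = {}" using assms by auto
    then show ?thesis using that by auto
  next
    case False
    have "card (?H B) * card T ^ l \<le> card J ^ l * card (inj_funs J T)"
      using card_inj_funs_hit[of J T B R] that assms by auto
    then have "real (card (?H B)) * real (card T) ^ l \<le> real (card J) ^ l * real (card (inj_funs J T))"
      using of_nat_mono[where 'a = real] by fastforce
    then show ?thesis using False by (simp add: field_simps)
  qed
  have "{\<tau> \<in> inj_funs J T. card (\<tau> ` J \<inter> R) = l} \<subseteq> (\<Union>B\<in>?B. ?H B)"
  proof clarify
    fix \<tau> assume t: "\<tau> \<in> inj_funs J T" and l: "l = card (\<tau> ` J \<inter> R)"
    have "\<tau> ` J \<inter> R = \<tau> ` {i \<in> J. \<tau> i \<in> R}" by auto
    then have "card {i \<in> J. \<tau> i \<in> R} = l"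
      using t l by (metis (no_types, lifting) card_image inj_funs_def inj_on_subset mem_Collect_eq subsetI)
    then show "\<tau> \<in> (\<Union>B\<in>{B. B \<subseteq> J \<and> card B = card (\<tau> ` J \<inter> R)}. ?H B)"
      using t l by (intro UN_I[of "{i \<in> J. \<tau> i \<in> R}"]) auto
  qed
  moreover have "finite (\<Union>B\<in>?B. ?H B)"
    using fin by (auto intro: finite_subset[OF _ fin(1)])
  ultimately have "card {\<tau> \<in> inj_funs J T. card (\<tau> ` J \<inter> R) = l} \<le> card (\<Union>B\<in>?B. ?H B)"
    by (rule card_mono[rotated])
  also have "\<dots> \<le> (\<Sum>B\<in>?B. card (?H B))"
    using fin(2) by (rule card_UN_le)
  finally have "card {\<tau> \<in> inj_funs J T. card (\<tau> ` J \<inter> R) = l} \<le> (\<Sum>B\<in>?B. card (?H B))" .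
  then have "real (card {\<tau> \<in> inj_funs J T. card (\<tau> ` J \<inter> R) = l}) \<le> (\<Sum>B\<in>?B. real (card (?H B)))"
    using of_nat_mono[where 'a = real] by fastforce
  also have "\<dots> \<le> real (card ?B) * ((real (card J) / real (card T)) ^ l * real (card (inj_funs J T)))"
    using H by (rule sum_bounded_above)
  also have "\<dots> \<le> 2 ^ card J * ((real (card J) / real (card T)) ^ l * real (card (inj_funs J T)))"
  proof (rule mult_right_mono)
    have "card ?B \<le> card (Pow J)"
      using assms by (intro card_mono) auto
    then show "real (card ?B) \<le> 2 ^ card J"
      using assms of_nat_mono[where 'a = real] by (fastforce simp: card_Pow)
  qed auto
  finally show ?thesis by (simp add: mult.assoc)
qed

subsection \<open>U-statistics of sums of product functions\<close>

text \<open>A function of several observations in finite rank form; \<open>R\<close> will be the set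
  of paths of basis indices along the chain. Every integral of it, or of a product of two of them,
  over a product measure is a finite sum of products of one-dimensional integrals.\<close>

definition tensor :: "'r set \<Rightarrow> nat set \<Rightarrow> ('r \<Rightarrow> nat \<Rightarrow> 'x \<Rightarrow> real) \<Rightarrow> (nat \<Rightarrow> 'x) \<Rightarrow> real" where
  "tensor R J \<eta> x = (\<Sum>q\<in>R. \<Prod>i\<in>J. \<eta> q i (x i))"

definition partial_mean :: "'x measure \<Rightarrow> nat set \<Rightarrow> ('r \<Rightarrow> nat \<Rightarrow> 'x \<Rightarrow> real) \<Rightarrow> 'r \<Rightarrow> nat \<Rightarrow> 'x \<Rightarrow> real" where
  "partial_mean P B \<eta> q i = (if i \<in> B then \<eta> q i else (\<lambda>_. \<integral>x. \<eta> q i x \<partial>P))"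

text \<open>Moves the factors from positions in the chain to indices in the sample. The default
  value 1 at indices not hit by \<open>\<sigma>\<close> lets two tuples with different images be
  written as products over one common index set.\<close>

definition slot :: "nat set \<Rightarrow> (nat \<Rightarrow> nat) \<Rightarrow> (nat \<Rightarrow> 'x \<Rightarrow> real) \<Rightarrow> nat \<Rightarrow> 'x \<Rightarrow> real" where
  "slot J \<sigma> h s = (if s \<in> \<sigma> ` J then h (inv_into J \<sigma> s) else (\<lambda>_. 1))"

lemma slot_bdd_meas: "(\<And>i. i \<in> J \<Longrightarrow> h i \<in> bdd_meas P) \<Longrightarrow> slot J \<sigma> h s \<in> bdd_meas P"
  by (auto simp: slot_def inv_into_into)

lemma prod_slot:
  assumes "finite I" "inj_on \<sigma> J" "\<sigma> ` J \<subseteq> I"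
  shows "(\<Prod>i\<in>J. h i (x (\<sigma> i))) = (\<Prod>s\<in>I. slot J \<sigma> h s (x s))"
proof -
  have "(\<Prod>s\<in>I. slot J \<sigma> h s (x s)) = (\<Prod>s\<in>\<sigma> ` J. slot J \<sigma> h s (x s))"
    using assms by (intro prod.mono_neutral_right) (auto simp: slot_def)
  also have "\<dots> = (\<Prod>i\<in>J. h i (x (\<sigma> i)))"
    using assms by (subst prod.reindex) (auto simp: slot_def intro!: prod.cong)
  finally show ?thesis ..
qed

lemma (in prob_space) PiM_prod_integral:
  assumes "finite I" "\<And>s. s \<in> I \<Longrightarrow> F s \<in> bdd_meas M"
  shows "integrable (PiM I (\<lambda>_. M)) (\<lambda>x. \<Prod>s\<in>I. F s (x s))"
    and "(\<integral>x. (\<Prod>s\<in>I. F s (x s)) \<partial>PiM I (\<lambda>_. M)) = (\<Prod>s\<in>I. \<integral>x. F s x \<partial>M)"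
proof -
  note int = bdd_meas_integrable
  interpret product_prob_space "\<lambda>_. M" I
    by unfold_locales
  show "integrable (PiM I (\<lambda>_. M)) (\<lambda>x. \<Prod>s\<in>I. F s (x s))"
    using assms by (intro product_integrable_prod) (auto intro: int)
  show "(\<integral>x. (\<Prod>s\<in>I. F s (x s)) \<partial>PiM I (\<lambda>_. M)) = (\<Prod>s\<in>I. \<integral>x. F s x \<partial>M)"
    using assms by (intro product_integral_prod) (auto intro: int)
qed

locale tensor_family = prob_space P for P :: "'x measure" +
  fixes R :: "'r set" and J :: "nat set" and \<eta> :: "'r \<Rightarrow> nat \<Rightarrow> 'x \<Rightarrow> real"
  assumes finR: "finite R" and finJ: "finite J"
    and eta: "\<And>q i. q \<in> R \<Longrightarrow> i \<in> J \<Longrightarrow> \<eta> q i \<in> bdd_meas P"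
begin

lemma tensor_slot:
  fixes I :: "nat set"
  assumes "finite I" "inj_on \<sigma> J" "\<sigma> ` J \<subseteq> I"
  shows "tensor R J \<eta> (\<lambda>i. x (\<sigma> i)) = (\<Sum>q\<in>R. \<Prod>s\<in>I. slot J \<sigma> (\<eta> q) s (x s))"
  unfolding tensor_def using assms by (intro sum.cong prod_slot) auto

lemma tensor_integral:
  fixes I :: "nat set"
  assumes "finite I" "inj_on \<sigma> J" "\<sigma> ` J \<subseteq> I"
  shows "integrable (PiM I (\<lambda>_. P)) (\<lambda>x. tensor R J \<eta> (\<lambda>i. x (\<sigma> i)))"
    and "(\<integral>x. tensor R J \<eta> (\<lambda>i. x (\<sigma> i)) \<partial>PiM I (\<lambda>_. P)) = (\<Sum>q\<in>R. \<Prod>i\<in>J. \<integral>x. \<eta> q i x \<partial>P)"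
proof -
  note bm = slot_bdd_meas[OF eta]
  show "integrable (PiM I (\<lambda>_. P)) (\<lambda>x. tensor R J \<eta> (\<lambda>i. x (\<sigma> i)))"
    unfolding tensor_slot[OF assms] using assms bm
    by (intro Bochner_Integration.integrable_sum PiM_prod_integral) auto
  have "(\<integral>x. tensor R J \<eta> (\<lambda>i. x (\<sigma> i)) \<partial>PiM I (\<lambda>_. P)) =
      (\<Sum>q\<in>R. \<Prod>s\<in>I. \<integral>x. slot J \<sigma> (\<eta> q) s x \<partial>P)"
    unfolding tensor_slot[OF assms] using assms bm
    by (subst Bochner_Integration.integral_sum) (auto intro!: PiM_prod_integral sum.cong)
  also have "\<dots> = (\<Sum>q\<in>R. \<Prod>i\<in>J. \<integral>x. \<eta> q i x \<partial>P)"
  proof (rule sum.cong)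
    fix q
    have "(\<Prod>s\<in>I. \<integral>x. slot J \<sigma> (\<eta> q) s x \<partial>P) = (\<Prod>s\<in>\<sigma> ` J. \<integral>x. slot J \<sigma> (\<eta> q) s x \<partial>P)"
      using assms by (intro prod.mono_neutral_right) (auto simp: slot_def prob_space)
    also have "\<dots> = (\<Prod>i\<in>J. \<integral>x. \<eta> q i x \<partial>P)"
      using assms by (subst prod.reindex) (auto simp: slot_def intro!: prod.cong)
    finally show "(\<Prod>s\<in>I. \<integral>x. slot J \<sigma> (\<eta> q) s x \<partial>P) = (\<Prod>i\<in>J. \<integral>x. \<eta> q i x \<partial>P)" .
  qed simp
  finally show "(\<integral>x. tensor R J \<eta> (\<lambda>i. x (\<sigma> i)) \<partial>PiM I (\<lambda>_. P)) =
      (\<Sum>q\<in>R. \<Prod>i\<in>J. \<integral>x. \<eta> q i x \<partial>P)" .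
qed

lemma tensor_family_partial_mean: "tensor_family P R J (partial_mean P B \<eta>)"
  by unfold_locales (auto simp: partial_mean_def finR finJ eta)

lemma tensor_mult_integral:
  fixes I :: "nat set"
  assumes "tensor_family P R J \<theta>"
    and "finite I" "inj_on \<sigma> J" "\<sigma> ` J \<subseteq> I" "inj_on \<tau> J" "\<tau> ` J \<subseteq> I"
  shows "integrable (PiM I (\<lambda>_. P)) (\<lambda>x. tensor R J \<eta> (\<lambda>i. x (\<sigma> i)) * tensor R J \<theta> (\<lambda>i. x (\<tau> i)))"
    and "(\<integral>x. tensor R J \<eta> (\<lambda>i. x (\<sigma> i)) * tensor R J \<theta> (\<lambda>i. x (\<tau> i)) \<partial>PiM I (\<lambda>_. P)) =
      (\<Sum>q\<in>R. \<Sum>q'\<in>R. \<Prod>s\<in>I. \<integral>x. slot J \<sigma> (\<eta> q) s x * slot J \<tau> (\<theta> q') s x \<partial>P)"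
proof -
  interpret t: tensor_family P R J \<theta> by fact
  note bm = bdd_meas_mult[OF slot_bdd_meas[OF eta] slot_bdd_meas[OF t.eta]]
  have *: "tensor R J \<eta> (\<lambda>i. x (\<sigma> i)) * tensor R J \<theta> (\<lambda>i. x (\<tau> i)) =
      (\<Sum>q\<in>R. \<Sum>q'\<in>R. \<Prod>s\<in>I. slot J \<sigma> (\<eta> q) s (x s) * slot J \<tau> (\<theta> q') s (x s))" for x
    using assms by (simp add: tensor_slot[of I] t.tensor_slot[of I] sum_product prod.distrib)
  show "integrable (PiM I (\<lambda>_. P)) (\<lambda>x. tensor R J \<eta> (\<lambda>i. x (\<sigma> i)) * tensor R J \<theta> (\<lambda>i. x (\<tau> i)))"
    unfolding * using assms bm
    by (intro Bochner_Integration.integrable_sum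
        PiM_prod_integral(1)[where F = "\<lambda>s x. slot J \<sigma> (\<eta> _) s x * slot J \<tau> (\<theta> _) s x"]) auto
  show "(\<integral>x. tensor R J \<eta> (\<lambda>i. x (\<sigma> i)) * tensor R J \<theta> (\<lambda>i. x (\<tau> i)) \<partial>PiM I (\<lambda>_. P)) =
      (\<Sum>q\<in>R. \<Sum>q'\<in>R. \<Prod>s\<in>I. \<integral>x. slot J \<sigma> (\<eta> q) s x * slot J \<tau> (\<theta> q') s x \<partial>P)"
    unfolding * using assms bm
    by (subst Bochner_Integration.integral_sum Bochner_Integration.integral_sum;
        (intro Bochner_Integration.integrable_sum
        PiM_prod_integral(1)[where F = "\<lambda>s x. slot J \<sigma> (\<eta> _) s x * slot J \<tau> (\<theta> _) s x"])?;
        (intro sum.cong refl)?;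
        (subst Bochner_Integration.integral_sum)?;
        (intro sum.cong refl PiM_prod_integral(1)[where F = "\<lambda>s x. slot J \<sigma> (\<eta> _) s x * slot J \<tau> (\<theta> _) s x"]
           PiM_prod_integral(2)[where F = "\<lambda>s x. slot J \<sigma> (\<eta> _) s x * slot J \<tau> (\<theta> _) s x"])?; auto)
qed

text \<open>The second moment of the conditional mean given the coordinates in \<open>B\<close>, not
  centred; \<open>partial_moment_eq\<close> identifies it. The double sum of products is kept as the
  definition because the Schur product theorem acts on it factor by factor.\<close>

definition partial_moment :: "nat set \<Rightarrow> real" where
  "partial_moment B = (\<Sum>q\<in>R. \<Sum>q'\<in>R. \<Prod>i\<in>J.
     \<integral>x. partial_mean P B \<eta> q i x * partial_mean P B \<eta> q' i x \<partial>P)"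

lemma partial_moment_eq:
  fixes I :: "nat set"
  assumes "finite I" "inj_on \<sigma> J" "\<sigma> ` J \<subseteq> I"
  shows "(\<integral>x. (tensor R J (partial_mean P B \<eta>) (\<lambda>i. x (\<sigma> i)))\<^sup>2 \<partial>PiM I (\<lambda>_. P)) = partial_moment B"
proof -
  interpret t: tensor_family P R J "partial_mean P B \<eta>"
    by (rule tensor_family_partial_mean)
  have "(\<Prod>s\<in>I. \<integral>x. slot J \<sigma> (partial_mean P B \<eta> q) s x * slot J \<sigma> (partial_mean P B \<eta> q') s x \<partial>P) =
     (\<Prod>i\<in>J. \<integral>x. partial_mean P B \<eta> q i x * partial_mean P B \<eta> q' i x \<partial>P)" (is "?l = ?r") for q q'
  proof -
    have "?l = (\<Prod>s\<in>\<sigma> ` J. \<integral>x. slot J \<sigma> (partial_mean P B \<eta> q) s x * slot J \<sigma> (partial_mean P B \<eta> q') s x \<partial>P)"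
      using assms by (intro prod.mono_neutral_right) (auto simp: slot_def prob_space)
    also have "\<dots> = ?r"
      using assms by (subst prod.reindex) (auto simp: slot_def intro!: prod.cong)
    finally show ?thesis .
  qed
  then show ?thesis
    unfolding power2_eq_square partial_moment_def
    using t.tensor_mult_integral(2)[OF t.tensor_family_axioms assms assms(2,3)] by simp
qed

text \<open>Coordinates that are not shared by the two arguments may be integrated out beforehand.\<close>

lemma tensor_overlap:
  fixes I :: "nat set"
  assumes "finite I" "inj_on \<sigma> J" "\<sigma> ` J \<subseteq> I" "inj_on \<tau> J" "\<tau> ` J \<subseteq> I"
  shows "(\<integral>x. tensor R J \<eta> (\<lambda>i. x (\<sigma> i)) * tensor R J \<eta> (\<lambda>i. x (\<tau> i)) \<partial>PiM I (\<lambda>_. P)) =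
    (\<integral>x. tensor R J (partial_mean P {i \<in> J. \<sigma> i \<in> \<tau> ` J} \<eta>) (\<lambda>i. x (\<sigma> i)) *
         tensor R J (partial_mean P {i \<in> J. \<tau> i \<in> \<sigma> ` J} \<eta>) (\<lambda>i. x (\<tau> i)) \<partial>PiM I (\<lambda>_. P))"
proof -
  let ?B = "{i \<in> J. \<sigma> i \<in> \<tau> ` J}" and ?C = "{i \<in> J. \<tau> i \<in> \<sigma> ` J}"
  interpret t: tensor_family P R J "partial_mean P ?B \<eta>"
    by (rule tensor_family_partial_mean)
  have "(\<integral>x. slot J \<sigma> (\<eta> q) s x * slot J \<tau> (\<eta> q') s x \<partial>P) =
    (\<integral>x. slot J \<sigma> (partial_mean P ?B \<eta> q) s x * slot J \<tau> (partial_mean P ?C \<eta> q') s x \<partial>P)" for q q' s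
  proof -
    have "\<sigma> (inv_into J \<sigma> s) = s \<and> inv_into J \<sigma> s \<in> J" if "s \<in> \<sigma> ` J"
      using that by (simp add: f_inv_into_f inv_into_into)
    moreover have "\<tau> (inv_into J \<tau> s) = s \<and> inv_into J \<tau> s \<in> J" if "s \<in> \<tau> ` J"
      using that by (simp add: f_inv_into_f inv_into_into)
    ultimately show ?thesis
      by (cases "s \<in> \<sigma> ` J"; cases "s \<in> \<tau> ` J") (simp_all add: slot_def partial_mean_def prob_space)
  qed
  then show ?thesis
    unfolding tensor_mult_integral(2)[OF tensor_family_axioms assms]
      t.tensor_mult_integral(2)[OF tensor_family_partial_mean assms] by simp
qed

text \<open>Without shared indices the two factors are independent. Otherwise each side may be
  replaced by its conditional mean given the shared coordinates, 2 x y \<le> x^2 + y^2 separates the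
  two sides, and the squared mean is dropped. The shared coordinates form different subsets of
  \<open>J\<close> on the two sides but of equal cardinality, which is why \<open>v\<close> is a
  function of the cardinality alone.\<close>

lemma tensor_covariance_le:
  fixes I :: "nat set"
  assumes "finite I" "inj_on \<sigma> J" "\<sigma> ` J \<subseteq> I" "inj_on \<tau> J" "\<tau> ` J \<subseteq> I"
    and v: "\<And>B. B \<subseteq> J \<Longrightarrow> B \<noteq> {} \<Longrightarrow> partial_moment B \<le> v (card B)"
  shows "(\<integral>x. tensor R J \<eta> (\<lambda>i. x (\<sigma> i)) * tensor R J \<eta> (\<lambda>i. x (\<tau> i)) \<partial>PiM I (\<lambda>_. P))
     - (\<Sum>q\<in>R. \<Prod>i\<in>J. \<integral>x. \<eta> q i x \<partial>P)\<^sup>2 \<le> (if \<sigma> ` J \<inter> \<tau> ` J = {} then 0 else v (card (\<tau> ` J \<inter> \<sigma> ` J)))"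
proof -
  let ?B = "{i \<in> J. \<sigma> i \<in> \<tau> ` J}" and ?C = "{i \<in> J. \<tau> i \<in> \<sigma> ` J}"
  let ?S = "PiM I (\<lambda>_. P)"
  interpret S: prob_space ?S
    by (intro prob_space_PiM prob_space_axioms)
  have "h ` {i \<in> J. h i \<in> T} = T \<inter> h ` J" for h :: "nat \<Rightarrow> nat" and T
    by auto
  then have "\<sigma> ` ?B = \<tau> ` J \<inter> \<sigma> ` J" "\<tau> ` ?C = \<tau> ` J \<inter> \<sigma> ` J"
    by (simp_all add: Int_commute)
  then have card: "card ?B = card (\<tau> ` J \<inter> \<sigma> ` J)" "card ?C = card (\<tau> ` J \<inter> \<sigma> ` J)"
    using assms by (metis (no_types, lifting) card_image inj_on_subset mem_Collect_eq subsetI)+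
  show ?thesis
  proof (cases "\<sigma> ` J \<inter> \<tau> ` J = {}")
    case True
    then have "?B = {}" "?C = {}" by auto
    then have "(\<integral>x. tensor R J \<eta> (\<lambda>i. x (\<sigma> i)) * tensor R J \<eta> (\<lambda>i. x (\<tau> i)) \<partial>?S) =
        (\<Sum>q\<in>R. \<Prod>i\<in>J. \<integral>x. \<eta> q i x \<partial>P)\<^sup>2"
      unfolding tensor_overlap[OF assms(1-5)]
      by (simp add: tensor_def partial_mean_def S.prob_space power2_eq_square)
    with True show ?thesis by simp
  next
    case False
    interpret t: tensor_family P R J "partial_mean P ?B \<eta>"
      by (rule tensor_family_partial_mean)
    interpret u: tensor_family P R J "partial_mean P ?C \<eta>"
      by (rule tensor_family_partial_mean)
    let ?F = "\<lambda>x. tensor R J (partial_mean P ?B \<eta>) (\<lambda>i. x (\<sigma> i))"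
    let ?G = "\<lambda>x. tensor R J (partial_mean P ?C \<eta>) (\<lambda>i. x (\<tau> i))"
    have "(\<integral>x. ?F x * ?G x \<partial>?S) \<le> (\<integral>x. ((?F x)\<^sup>2 + (?G x)\<^sup>2) / 2 \<partial>?S)"
    proof (rule integral_mono)
      show "integrable ?S (\<lambda>x. ?F x * ?G x)"
        using t.tensor_mult_integral(1)[OF u.tensor_family_axioms assms(1-5)] .
      show "integrable ?S (\<lambda>x. ((?F x)\<^sup>2 + (?G x)\<^sup>2) / 2)"
        unfolding power2_eq_square
        using t.tensor_mult_integral(1)[OF t.tensor_family_axioms assms(1-3,2,3)]
          u.tensor_mult_integral(1)[OF u.tensor_family_axioms assms(1,4,5,4,5)] by simp
      fix x
      have "0 \<le> (?F x - ?G x)\<^sup>2" by simp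
      then show "?F x * ?G x \<le> ((?F x)\<^sup>2 + (?G x)\<^sup>2) / 2"
        by (simp add: power2_eq_square algebra_simps)
    qed
    also have "\<dots> = (partial_moment ?B + partial_moment ?C) / 2"
      using t.tensor_mult_integral(1)[OF t.tensor_family_axioms assms(1-3,2,3)]
          u.tensor_mult_integral(1)[OF u.tensor_family_axioms assms(1,4,5,4,5)]
          partial_moment_eq[OF assms(1-3)] partial_moment_eq[OF assms(1,4,5)]
      by (simp add: power2_eq_square)
    also have "\<dots> \<le> v (card (\<tau> ` J \<inter> \<sigma> ` J))"
    proof -
      obtain a b where ab: "a \<in> J" "b \<in> J" "\<sigma> a = \<tau> b"
        using False by auto
      have "a \<in> ?B" "b \<in> ?C"
        using ab imageI[of b J \<tau>] imageI[of a J \<sigma>] by simp_all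
      then have "?B \<noteq> {}" "?C \<noteq> {}" "?B \<subseteq> J" "?C \<subseteq> J"
        by (simp_all only: ex_in_conv[symmetric] Collect_subset[of J, simplified]) blast+
      then show ?thesis
        using v[of ?B, unfolded card] v[of ?C, unfolded card] by simp
    qed
    finally have "(\<integral>x. ?F x * ?G x \<partial>?S) \<le> v (card (\<tau> ` J \<inter> \<sigma> ` J))" .
    moreover have "0 \<le> (\<Sum>q\<in>R. \<Prod>i\<in>J. \<integral>x. \<eta> q i x \<partial>P)\<^sup>2"
      by (rule zero_le_power2)
    ultimately show ?thesis
      unfolding tensor_overlap[OF assms(1-5)] if_not_P[OF False] by linarith
  qed
qed

end

lemma distinct_tuples_eq: "distinct_tuples n j = inj_funs {1..j} {1..n}"
  by (simp add: distinct_tuples_def inj_funs_def)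

lemma card_distinct_tuples_pos:
  assumes "j \<le> n"
  shows "0 < card (distinct_tuples n j)"
  unfolding distinct_tuples_eq using assms by (subst card_inj_funs) (auto intro!: prod_pos)

text \<open>The variance is the average of the covariances over all pairs of tuples. For a fixed
  \<open>\<sigma>\<close>, the proportion of tuples sharing exactly \<open>l\<close> indices with it
  is at most \<open>2 ^ j * (j / n) ^ l\<close>, and pairs sharing none contribute nothing.\<close>

lemma ustat_tensor:
  fixes P :: "'x measure" and R :: "'r set"
  assumes "tensor_family P R {1..j} \<eta>" "j \<le> n"
    and v: "\<And>B. B \<subseteq> {1..j} \<Longrightarrow> B \<noteq> {} \<Longrightarrow> tensor_family.partial_moment P R {1..j} \<eta> B \<le> v (card B)"
    and v0: "\<And>l. 0 \<le> v l"
  defines "S \<equiv> PiM {1..n} (\<lambda>_. P)" and "U \<equiv> ustat n j (tensor R {1..j} \<eta>)"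
    and "\<theta> \<equiv> (\<Sum>q\<in>R. \<Prod>i\<in>{1..j}. \<integral>x. \<eta> q i x \<partial>P)"
  shows "integrable S U" "(\<integral>x. U x \<partial>S) = \<theta>" "integrable S (\<lambda>x. (U x - \<theta>)\<^sup>2)"
    "(\<integral>x. (U x - \<theta>)\<^sup>2 \<partial>S) \<le> (\<Sum>l=1..j. 2 ^ j * (real j / real n) ^ l * v l)"
proof -
  interpret tensor_family P R "{1..j}" \<eta> by fact
  let ?J = "{1..j}" and ?I = "{1..n}"
  let ?D = "distinct_tuples n j"
  let ?H = "\<lambda>\<sigma> x. tensor R {1..j} \<eta> (\<lambda>i. x (\<sigma> i))"
  define N where "N = real (card ?D)"
  have N: "0 < N"
    using card_distinct_tuples_pos[OF assms(2)] by (simp add: N_def)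
  have fin: "finite ?D"
    by (simp add: distinct_tuples_eq finite_inj_funs)
  have D: "inj_on \<sigma> ?J" "\<sigma> ` ?J \<subseteq> ?I" if "\<sigma> \<in> ?D" for \<sigma>
    using that by (auto simp: distinct_tuples_def)
  interpret S: prob_space S
    unfolding S_def by (intro prob_space_PiM prob_space_axioms)
  have U: "U x = (\<Sum>\<sigma>\<in>?D. ?H \<sigma> x) / N" for x
    by (simp add: U_def ustat_def N_def)
  have intH: "integrable S (?H \<sigma>)" "(\<integral>x. ?H \<sigma> x \<partial>S) = \<theta>" if "\<sigma> \<in> ?D" for \<sigma>
    unfolding S_def \<theta>_def using tensor_integral[OF _ D[OF that]] by auto
  show iU: "integrable S U"
    unfolding U using intH by auto
  show eU: "(\<integral>x. U x \<partial>S) = \<theta>"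
    unfolding U using intH N by (simp add: Bochner_Integration.integral_sum N_def)
  have U2: "(U x)\<^sup>2 = (\<Sum>\<sigma>\<in>?D. \<Sum>\<tau>\<in>?D. ?H \<sigma> x * ?H \<tau> x) / N\<^sup>2" for x
    by (simp add: U power2_eq_square sum_product)
  have intHH: "integrable S (\<lambda>x. ?H \<sigma> x * ?H \<tau> x)" if "\<sigma> \<in> ?D" "\<tau> \<in> ?D" for \<sigma> \<tau>
    unfolding S_def using tensor_mult_integral(1)[OF tensor_family_axioms _ D[OF that(1)] D[OF that(2)]] by simp
  have iU2: "integrable S (\<lambda>x. (U x)\<^sup>2)"
    unfolding U2 using intHH by auto
  have sq: "(U x - \<theta>)\<^sup>2 = (U x)\<^sup>2 - 2 * \<theta> * U x + \<theta>\<^sup>2" for x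
    by (simp add: power2_eq_square algebra_simps)
  show "integrable S (\<lambda>x. (U x - \<theta>)\<^sup>2)"
    unfolding sq using iU iU2 by auto
  have "(\<integral>x. (U x - \<theta>)\<^sup>2 \<partial>S) = (\<integral>x. (U x)\<^sup>2 \<partial>S) - \<theta>\<^sup>2"
    unfolding sq using iU iU2 eU by (simp add: S.prob_space power2_eq_square)
  also have "\<dots> = (\<Sum>\<sigma>\<in>?D. \<Sum>\<tau>\<in>?D. (\<integral>x. ?H \<sigma> x * ?H \<tau> x \<partial>S) - \<theta>\<^sup>2) / N\<^sup>2"
    unfolding U2 using intHH N
    by (simp add: Bochner_Integration.integral_sum sum_subtractf N_def power2_eq_square field_simps)
  also have "\<dots> \<le> (\<Sum>\<sigma>\<in>?D. \<Sum>l=1..j. 2 ^ j * (real j / real n) ^ l * N * v l) / N\<^sup>2"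
  proof (intro divide_right_mono sum_mono)
    fix \<sigma> assume s: "\<sigma> \<in> ?D"
    let ?c = "\<lambda>\<tau>. card (\<tau> ` ?J \<inter> \<sigma> ` ?J)"
    have "(\<integral>x. ?H \<sigma> x * ?H \<tau> x \<partial>S) - \<theta>\<^sup>2 \<le> (\<Sum>l=1..j. if ?c \<tau> = l then v l else 0)" if t: "\<tau> \<in> ?D" for \<tau>
    proof -
      have "(\<integral>x. ?H \<sigma> x * ?H \<tau> x \<partial>S) - \<theta>\<^sup>2 \<le> (if \<sigma> ` ?J \<inter> \<tau> ` ?J = {} then 0 else v (?c \<tau>))"
        unfolding S_def \<theta>_def
        by (rule tensor_covariance_le[OF _ D[OF s] D[OF t] v]) auto
      also have "\<dots> \<le> (\<Sum>l=1..j. if ?c \<tau> = l then v l else 0)"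
      proof (cases "\<sigma> ` ?J \<inter> \<tau> ` ?J = {}")
        case False
        have "?c \<tau> \<le> card (\<tau> ` ?J)" by (intro card_mono) auto
        also have "\<dots> \<le> j" using card_image_le[of ?J \<tau>] by simp
        finally have "?c \<tau> \<in> {1..j}"
          using False by (auto simp: Suc_le_eq card_gt_0_iff)
        then show ?thesis using False by (simp add: sum.delta)
      qed (use v0 in \<open>auto intro!: sum_nonneg\<close>)
      finally show ?thesis .
    qed
    then have "(\<Sum>\<tau>\<in>?D. (\<integral>x. ?H \<sigma> x * ?H \<tau> x \<partial>S) - \<theta>\<^sup>2) \<le>
        (\<Sum>\<tau>\<in>?D. \<Sum>l=1..j. if ?c \<tau> = l then v l else 0)"
      by (intro sum_mono) auto
    also have "\<dots> = (\<Sum>l=1..j. real (card {\<tau> \<in> ?D. ?c \<tau> = l}) * v l)"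
      using fin by (subst sum.swap) (simp add: sum.If_cases Int_def flip: sum.inter_filter)
    also have "\<dots> \<le> (\<Sum>l=1..j. 2 ^ j * (real j / real n) ^ l * N * v l)"
    proof (intro sum_mono mult_right_mono v0)
      fix l
      show "real (card {\<tau> \<in> ?D. ?c \<tau> = l}) \<le> 2 ^ j * (real j / real n) ^ l * N"
        using card_inj_funs_overlap[of ?J ?I "\<sigma> ` ?J" l] D[OF s] assms(2)
        by (simp add: distinct_tuples_eq N_def card_image)
    qed
    finally show "(\<Sum>\<tau>\<in>?D. (\<integral>x. ?H \<sigma> x * ?H \<tau> x \<partial>S) - \<theta>\<^sup>2) \<le>
        (\<Sum>l=1..j. 2 ^ j * (real j / real n) ^ l * N * v l)" .
  qed simp
  also have "\<dots> = (\<Sum>l=1..j. 2 ^ j * (real j / real n) ^ l * v l)"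
    using N by (simp add: N_def[symmetric] power2_eq_square sum_divide_distrib sum_distrib_left mult.assoc)
  finally show "(\<integral>x. (U x - \<theta>)\<^sup>2 \<partial>S) \<le> (\<Sum>l=1..j. 2 ^ j * (real j / real n) ^ l * v l)" .
qed

lemma (in finite_measure) bdd_meas_Cauchy_Schwarz:
  assumes f: "f \<in> bdd_meas M" and g: "g \<in> bdd_meas M"
  shows "(\<integral>x. f x * g x \<partial>M)\<^sup>2 \<le> (\<integral>x. (f x)\<^sup>2 \<partial>M) * (\<integral>x. (g x)\<^sup>2 \<partial>M)"
proof -
  define F G H where "F = (\<integral>x. (f x)\<^sup>2 \<partial>M)" "G = (\<integral>x. (g x)\<^sup>2 \<partial>M)" "H = (\<integral>x. f x * g x \<partial>M)"
  have int: "integrable M (\<lambda>x. (f x)\<^sup>2)" "integrable M (\<lambda>x. (g x)\<^sup>2)" "integrable M (\<lambda>x. f x * g x)"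
    using f g by (auto intro!: bdd_meas_integrable bdd_meas_intros)
  have quad: "0 \<le> s\<^sup>2 * F + 2 * s * t * H + t\<^sup>2 * G" for s t
  proof -
    have "0 \<le> (\<integral>x. (s * f x + t * g x)\<^sup>2 \<partial>M)" by simp
    also have "(\<lambda>x. (s * f x + t * g x)\<^sup>2) = (\<lambda>x. s\<^sup>2 * (f x)\<^sup>2 + 2 * s * t * (f x * g x) + t\<^sup>2 * (g x)\<^sup>2)"
      by (auto simp: power2_eq_square algebra_simps)
    also have "(\<integral>x. s\<^sup>2 * (f x)\<^sup>2 + 2 * s * t * (f x * g x) + t\<^sup>2 * (g x)\<^sup>2 \<partial>M) =
        s\<^sup>2 * F + 2 * s * t * H + t\<^sup>2 * G"
      using int by (simp add: F_G_H_def)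
    finally show ?thesis .
  qed
  have G0: "0 \<le> G" "0 \<le> F" by (simp_all add: F_G_H_def)
  have "H\<^sup>2 \<le> F * G"
  proof (cases "G = 0")
    case True
    have "H = 0"
    proof (rule ccontr)
      \<comment> \<open>With \<open>G = 0\<close> and \<open>s = 1\<close> the form is affine in
        \<open>t\<close>, and \<open>t = - (F + 1) / (2 * H)\<close> gives it the value -1.\<close>
      assume "H \<noteq> 0"
      then show False
        using quad[of 1 "- (F + 1) / (2 * H)"] True G0 by (simp add: field_simps)
    qed
    then show ?thesis using True by simp
  next
    case False
    have "0 \<le> G\<^sup>2 * F + 2 * G * (- H) * H + (- H)\<^sup>2 * G"
      by (rule quad)
    then have "0 \<le> G * (F * G - H\<^sup>2)"
      by (simp add: power2_eq_square algebra_simps)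
    then show ?thesis using False G0 by (simp add: zero_le_mult_iff)
  qed
  then show ?thesis by (simp add: F_G_H_def)
qed

subsection \<open>Entrywise products of Gram matrices\<close>

text \<open>The Loewner order on matrices indexed by \<open>R\<close>, expressed by quadratic forms.
  A partial moment is the value of such a form at the vector formed from the factors outside
  \<open>B\<close>.\<close>

definition form_le :: "'r set \<Rightarrow> ('r \<Rightarrow> 'r \<Rightarrow> real) \<Rightarrow> ('r \<Rightarrow> 'r \<Rightarrow> real) \<Rightarrow> bool" where
  "form_le R A A' \<longleftrightarrow> (\<forall>c. (\<Sum>q\<in>R. \<Sum>q'\<in>R. c q * c q' * A q q') \<le> (\<Sum>q\<in>R. \<Sum>q'\<in>R. c q * c q' * A' q q'))"

definition gram :: "'x measure \<Rightarrow> ('r \<Rightarrow> 'x \<Rightarrow> real) \<Rightarrow> 'r \<Rightarrow> 'r \<Rightarrow> real" where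
  "gram M u q q' = (\<integral>x. u q x * u q' x \<partial>M)"

lemma form_le_trans: "form_le R A A' \<Longrightarrow> form_le R A' A'' \<Longrightarrow> form_le R A A''"
  unfolding form_le_def by (meson order_trans)

lemma form_le_scale:
  assumes "form_le R A A'" "0 \<le> C"
  shows "form_le R (\<lambda>q q'. C * A q q') (\<lambda>q q'. C * A' q q')"
  unfolding form_le_def
proof
  fix c
  show "(\<Sum>q\<in>R. \<Sum>q'\<in>R. c q * c q' * (C * A q q')) \<le> (\<Sum>q\<in>R. \<Sum>q'\<in>R. c q * c q' * (C * A' q q'))"
    using mult_left_mono[OF assms(1)[unfolded form_le_def, rule_format, of c] assms(2)]
    by (simp add: sum_distrib_left mult.left_commute)
qed

lemma (in finite_measure) gram_form:
  assumes "\<And>q. q \<in> R \<Longrightarrow> u q \<in> bdd_meas M" "finite R"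
  shows "(\<Sum>q\<in>R. \<Sum>q'\<in>R. c q * c q' * (A q q' * gram M u q q')) =
    (\<integral>x. (\<Sum>q\<in>R. \<Sum>q'\<in>R. (c q * u q x) * (c q' * u q' x) * A q q') \<partial>M)"
proof -
  have *: "integrable M (\<lambda>x. c q * u q x * (c q' * u q' x) * A q q')" if "q \<in> R" "q' \<in> R" for q q'
    using that assms by (auto intro!: bdd_meas_integrable bdd_meas_intros simp: mult.assoc)
  have "(\<integral>x. (\<Sum>q\<in>R. \<Sum>q'\<in>R. (c q * u q x) * (c q' * u q' x) * A q q') \<partial>M) =
     (\<Sum>q\<in>R. \<integral>x. (\<Sum>q'\<in>R. (c q * u q x) * (c q' * u q' x) * A q q') \<partial>M)"
    using * by (intro Bochner_Integration.integral_sum Bochner_Integration.integrable_sum)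
  also have "\<dots> = (\<Sum>q\<in>R. \<Sum>q'\<in>R. \<integral>x. (c q * u q x) * (c q' * u q' x) * A q q' \<partial>M)"
    using * by (intro Bochner_Integration.integral_sum sum.cong) auto
  also have "\<dots> = (\<Sum>q\<in>R. \<Sum>q'\<in>R. c q * c q' * (A q q' * gram M u q q'))"
  proof (intro sum.cong refl)
    fix q q'
    have "(\<integral>x. (c q * u q x) * (c q' * u q' x) * A q q' \<partial>M) = (\<integral>x. (c q * c q' * A q q') * (u q x * u q' x) \<partial>M)"
      by (simp add: ac_simps)
    then show "(\<integral>x. (c q * u q x) * (c q' * u q' x) * A q q' \<partial>M) = c q * c q' * (A q q' * gram M u q q')"
      by (simp add: gram_def)
  qed
  finally show ?thesis ..
qed

text \<open>The Schur product theorem.\<close>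

lemma (in finite_measure) form_le_gram:
  assumes u: "\<And>q. q \<in> R \<Longrightarrow> u q \<in> bdd_meas M" and "finite R" and le: "form_le R A A'"
  shows "form_le R (\<lambda>q q'. A q q' * gram M u q q') (\<lambda>q q'. A' q q' * gram M u q q')"
  unfolding form_le_def
proof
  fix c
  let ?f = "\<lambda>X x. \<Sum>q\<in>R. \<Sum>q'\<in>R. c q * u q x * (c q' * u q' x) * X q q'"
  have int: "integrable M (?f X)" for X
    using u assms(2) by (intro Bochner_Integration.integrable_sum)
      (auto intro!: bdd_meas_integrable bdd_meas_intros simp: mult.assoc)
  have "(\<integral>x. ?f A x \<partial>M) \<le> (\<integral>x. ?f A' x \<partial>M)"
  proof (rule integral_mono[OF int int])
    \<comment> \<open>For fixed \<open>x\<close> the two integrands are the two forms at the vector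
      \<open>c q * u q x\<close>.\<close>
    fix x
    show "?f A x \<le> ?f A' x"
      using le unfolding form_le_def by (rule spec)
  qed
  then show "(\<Sum>q\<in>R. \<Sum>q'\<in>R. c q * c q' * (A q q' * gram M u q q')) \<le>
      (\<Sum>q\<in>R. \<Sum>q'\<in>R. c q * c q' * (A' q q' * gram M u q q'))"
    using gram_form[where R = R and u = u, OF u assms(2), of c A]
      gram_form[where R = R and u = u, OF u assms(2), of c A'] by simp
qed

lemma form_le_prod_gram:
  assumes "finite B" "finite R" "finite_measure Q" "form_le R A A'"
    and "\<And>q i. q \<in> R \<Longrightarrow> i \<in> B \<Longrightarrow> w i q \<in> bdd_meas Q"
  shows "form_le R (\<lambda>q q'. A q q' * (\<Prod>i\<in>B. gram Q (w i) q q')) (\<lambda>q q'. A' q q' * (\<Prod>i\<in>B. gram Q (w i) q q'))"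
  using assms(1,5)
proof induction
  case empty
  then show ?case using assms by simp
next
  case (insert b B)
  then have "form_le R (\<lambda>q q'. A q q' * (\<Prod>i\<in>B. gram Q (w i) q q') * gram Q (w b) q q')
      (\<lambda>q q'. A' q q' * (\<Prod>i\<in>B. gram Q (w i) q q') * gram Q (w b) q q')"
    by (intro finite_measure.form_le_gram[OF assms(3)] assms(2)) auto
  then show ?case using insert by (simp add: ac_simps)
qed

text \<open>The factors are exchanged one at a time. Each exchange is an inequality multiplied
  entrywise by the remaining factors, which are Gram matrices and therefore preserve the order; a
  plain entrywise comparison would fail because the entries have no sign.\<close>

lemma form_le_prods:
  assumes "finite B" "finite R" "finite_measure P" "finite_measure Q" "0 \<le> C"
    and "\<And>i. i \<in> B \<Longrightarrow> form_le R (gram P (u i)) (\<lambda>q q'. C * gram Q (w i) q q')"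
    and "\<And>q i. q \<in> R \<Longrightarrow> i \<in> B \<Longrightarrow> u i q \<in> bdd_meas P"
    and "\<And>q i. q \<in> R \<Longrightarrow> i \<in> B \<Longrightarrow> w i q \<in> bdd_meas Q"
  shows "form_le R (\<lambda>q q'. \<Prod>i\<in>B. gram P (u i) q q') (\<lambda>q q'. C ^ card B * (\<Prod>i\<in>B. gram Q (w i) q q'))"
  using assms(1,6-8)
proof induction
  case empty
  then show ?case by (simp add: form_le_def)
next
  case (insert b B)
  have 1: "form_le R (\<lambda>q q'. (\<Prod>i\<in>B. gram P (u i) q q') * gram P (u b) q q')
      (\<lambda>q q'. C ^ card B * (\<Prod>i\<in>B. gram Q (w i) q q') * gram P (u b) q q')"
    using insert by (intro finite_measure.form_le_gram[OF assms(3)] assms(2)) auto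
  have "form_le R (\<lambda>q q'. C ^ card B * (gram P (u b) q q' * (\<Prod>i\<in>B. gram Q (w i) q q')))
      (\<lambda>q q'. C ^ card B * (C * gram Q (w b) q q' * (\<Prod>i\<in>B. gram Q (w i) q q')))"
    using insert assms by (intro form_le_scale form_le_prod_gram) auto
  with 1 show ?case
    using insert by (auto simp: ac_simps elim!: form_le_trans)
qed

text \<open>For each coordinate in \<open>B\<close>, a linear combination of centred factors has its
  second moment under \<open>P\<close> bounded by \<open>C\<close> times the one under
  \<open>Q\<close>, where the centring constants are exactly the means. The exchange takes place
  inside the quadratic form, so it survives the sum over \<open>q\<close> and
  \<open>q'\<close>.\<close>

lemma partial_moment_le:
  fixes P Q :: "'x measure" and \<psi> :: "'r \<Rightarrow> nat \<Rightarrow> 'x \<Rightarrow> real"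
  assumes P: "prob_space P" and Q: "prob_space Q" and sets: "sets P = sets Q"
    and dom: "\<And>h. h \<in> bdd_meas P \<Longrightarrow> (\<And>x. 0 \<le> h x) \<Longrightarrow> (\<integral>x. h x \<partial>P) \<le> C * (\<integral>x. h x \<partial>Q)"
    and C: "0 \<le> C" and fin: "finite R" "finite J"
    and psi: "\<And>q i. q \<in> R \<Longrightarrow> i \<in> J \<Longrightarrow> \<psi> q i \<in> bdd_meas P"
    and B: "B \<subseteq> J"
  defines "\<eta> \<equiv> \<lambda>q i x. \<psi> q i x - (\<integral>y. \<psi> q i y \<partial>Q)"
  defines "d \<equiv> \<lambda>q i. (\<integral>x. \<psi> q i x \<partial>P) - (\<integral>x. \<psi> q i x \<partial>Q)"
  shows "tensor_family P R J \<eta>"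
    and "tensor_family.partial_moment P R J \<eta> B \<le> C ^ card B *
      (\<Sum>q\<in>R. \<Sum>q'\<in>R. \<Prod>i\<in>J. if i \<in> B then \<integral>x. \<psi> q i x * \<psi> q' i x \<partial>Q else d q i * d q' i)"
proof -
  interpret P: prob_space P by fact
  interpret Q: prob_space Q by fact
  have bmeq: "bdd_meas P = bdd_meas Q"
    by (simp add: bdd_meas_def sets_eq_imp_space_eq[OF sets] measurable_cong_sets[OF sets refl])
  have eta: "\<eta> q i \<in> bdd_meas P" if "q \<in> R" "i \<in> J" for q i
    unfolding \<eta>_def using psi[OF that] by (intro bdd_meas_intros)
  show tf: "tensor_family P R J \<eta>"
    using eta fin by unfold_locales auto
  interpret tensor_family P R J \<eta> by fact
  have Peta: "(\<integral>x. \<eta> q i x \<partial>P) = d q i" if "q \<in> R" "i \<in> J" for q i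
    unfolding \<eta>_def d_def using P.bdd_meas_integrable[OF psi[OF that]] by (simp add: P.prob_space)
  have le: "form_le R (gram P (\<lambda>q. \<eta> q i)) (\<lambda>q q'. C * gram Q (\<lambda>q. \<psi> q i) q q')" if i: "i \<in> B" for i
    unfolding form_le_def
  proof
    fix c :: "'r \<Rightarrow> real"
    let ?F = "\<lambda>x. \<Sum>q\<in>R. c q * \<psi> q i x"
    let ?m = "\<integral>x. ?F x \<partial>Q"
    have iJ: "i \<in> J" using i B by auto
    have F: "?F \<in> bdd_meas P" "?F \<in> bdd_meas Q"
      using psi[OF _ iJ] unfolding bmeq[symmetric] by (auto intro!: bdd_meas_intros)
    have m: "?m = (\<Sum>q\<in>R. c q * (\<integral>x. \<psi> q i x \<partial>Q))"
      using psi[OF _ iJ, unfolded bmeq] by (subst Bochner_Integration.integral_sum)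
        (auto intro!: Q.bdd_meas_integrable bdd_meas_intros)
    have "(\<Sum>q\<in>R. \<Sum>q'\<in>R. c q * c q' * (1 * gram P (\<lambda>q. \<eta> q i) q q')) = (\<integral>x. (?F x - ?m)\<^sup>2 \<partial>P)"
      using eta iJ fin(1) unfolding m
      by (subst P.gram_form) (auto simp: power2_eq_square sum_product \<eta>_def sum_subtractf[symmetric] algebra_simps
            intro!: Bochner_Integration.integral_cong)
    also have "\<dots> \<le> C * (\<integral>x. (?F x - ?m)\<^sup>2 \<partial>Q)"
      by (rule dom, intro bdd_meas_power bdd_meas_diff F bdd_meas_const) simp
    also have "(\<integral>x. (?F x - ?m)\<^sup>2 \<partial>Q) = (\<integral>x. (?F x)\<^sup>2 \<partial>Q) - ?m\<^sup>2"
    proof -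
      have "(\<integral>x. (?F x - ?m)\<^sup>2 \<partial>Q) = (\<integral>x. (?F x)\<^sup>2 - 2 * ?m * ?F x + ?m\<^sup>2 \<partial>Q)"
        by (intro Bochner_Integration.integral_cong) (auto simp: power2_eq_square algebra_simps)
      also have "\<dots> = (\<integral>x. (?F x)\<^sup>2 \<partial>Q) - 2 * ?m * ?m + ?m\<^sup>2"
        using Q.bdd_meas_integrable[OF F(2)] Q.bdd_meas_integrable[OF bdd_meas_power[OF F(2)], of 2]
        by (simp add: Q.prob_space)
      finally show ?thesis by (simp add: power2_eq_square)
    qed
    \<comment> \<open>Centring at the \<open>Q\<close>-mean only lowers the second moment under
      \<open>Q\<close>; dropping the squared mean leaves the uncentred factors
      \<open>\<psi>\<close>.\<close>
    also have "C * ((\<integral>x. (?F x)\<^sup>2 \<partial>Q) - ?m\<^sup>2) \<le> C * (\<integral>x. (?F x)\<^sup>2 \<partial>Q)"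
      using C by (intro mult_left_mono) auto
    also have "(\<integral>x. (?F x)\<^sup>2 \<partial>Q) = (\<Sum>q\<in>R. \<Sum>q'\<in>R. c q * c q' * (1 * gram Q (\<lambda>q. \<psi> q i) q q'))"
      using psi[OF _ iJ, unfolded bmeq] fin(1)
      by (subst Q.gram_form) (auto simp: power2_eq_square sum_product)
    finally show "(\<Sum>q\<in>R. \<Sum>q'\<in>R. c q * c q' * gram P (\<lambda>q. \<eta> q i) q q') \<le>
        (\<Sum>q\<in>R. \<Sum>q'\<in>R. c q * c q' * (C * gram Q (\<lambda>q. \<psi> q i) q q'))"
      by (simp add: sum_distrib_left ac_simps)
  qed
  have finB: "finite B" using B fin finite_subset by auto
  have split: "(\<Prod>i\<in>J. if i \<in> B then X i else Y i) = prod X B * prod Y (J - B)" for X Y :: "nat \<Rightarrow> real"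
    using prod.If_cases[OF fin(2), of "\<lambda>i. i \<in> B" X Y] B by (simp add: Int_absorb1 Diff_eq Compl_eq)
  \<comment> \<open>The mean differences of the coordinates outside \<open>B\<close> make up the
    vector at which the forms are compared.\<close>
  let ?c = "\<lambda>q. \<Prod>i\<in>J - B. d q i"
  have "partial_moment B = (\<Sum>q\<in>R. \<Sum>q'\<in>R. \<Prod>i\<in>J. if i \<in> B then gram P (\<lambda>q. \<eta> q i) q q' else d q i * d q' i)"
    unfolding partial_moment_def
    by (intro sum.cong prod.cong refl) (auto simp: partial_mean_def gram_def Peta P.prob_space)
  also have "\<dots> = (\<Sum>q\<in>R. \<Sum>q'\<in>R. ?c q * ?c q' * (\<Prod>i\<in>B. gram P (\<lambda>q. \<eta> q i) q q'))"
    unfolding split by (simp add: prod.distrib mult.commute)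
  also have "\<dots> \<le> (\<Sum>q\<in>R. \<Sum>q'\<in>R. ?c q * ?c q' * (C ^ card B * (\<Prod>i\<in>B. gram Q (\<lambda>q. \<psi> q i) q q')))"
  proof -
    have "form_le R (\<lambda>q q'. \<Prod>i\<in>B. gram P (\<lambda>q. \<eta> q i) q q')
        (\<lambda>q q'. C ^ card B * (\<Prod>i\<in>B. gram Q (\<lambda>q. \<psi> q i) q q'))"
      using B eta psi bmeq
      by (intro form_le_prods finB fin(1) P.finite_measure_axioms Q.finite_measure_axioms C le) auto
    then show ?thesis
      unfolding form_le_def by (rule spec)
  qed
  also have "\<dots> = C ^ card B * (\<Sum>q\<in>R. \<Sum>q'\<in>R. \<Prod>i\<in>J. if i \<in> B then \<integral>x. \<psi> q i x * \<psi> q' i x \<partial>Q else d q i * d q' i)"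
    unfolding split by (simp add: prod.distrib sum_distrib_left gram_def ac_simps)
  finally show "partial_moment B \<le> C ^ card B *
      (\<Sum>q\<in>R. \<Sum>q'\<in>R. \<Prod>i\<in>J. if i \<in> B then \<integral>x. \<psi> q i x * \<psi> q' i x \<partial>Q else d q i * d q' i)" .
qed

section \<open>Sums over index paths, peeled off at the last index\<close>

lemma sum_PiE_Suc:
  fixes F :: "(nat \<Rightarrow> nat) \<Rightarrow> real"
  assumes "finite D"
  shows "(\<Sum>q\<in>{1..Suc i} \<rightarrow>\<^sub>E D. F q) = (\<Sum>q\<in>{1..i} \<rightarrow>\<^sub>E D. \<Sum>a\<in>D. F (q(Suc i := a)))"
proof -
  have inj: "inj_on (\<lambda>(a, q). q(Suc i := a)) (D \<times> ({1..i} \<rightarrow>\<^sub>E D))"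
  proof (rule inj_onI, clarify)
    fix a q b q' assume h: "q \<in> {1..i} \<rightarrow>\<^sub>E D" "q' \<in> {1..i} \<rightarrow>\<^sub>E D" "q(Suc i := a) = q'(Suc i := b)"
    have "q x = q' x" for x
    proof (cases "x = Suc i")
      case True
      then show ?thesis using h(1,2) by (simp add: PiE_def extensional_def)
    next
      case False
      then show ?thesis using fun_cong[OF h(3), of x] by simp
    qed
    then show "a = b \<and> q = q'"
      using fun_cong[OF h(3), of "Suc i"] by auto
  qed
  have "{1..Suc i} \<rightarrow>\<^sub>E D = (\<lambda>(a, q). q(Suc i := a)) ` (D \<times> ({1..i} \<rightarrow>\<^sub>E D))"
    using PiE_insert_eq[of "Suc i" "{1..i}" "\<lambda>_. D"] by (simp add: atLeastAtMostSuc_conv)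
  then have "(\<Sum>q\<in>{1..Suc i} \<rightarrow>\<^sub>E D. F q) = (\<Sum>(a, q)\<in>D \<times> ({1..i} \<rightarrow>\<^sub>E D). F (q(Suc i := a)))"
    using inj by (simp add: sum.reindex o_def case_prod_unfold)
  also have "\<dots> = (\<Sum>q\<in>{1..i} \<rightarrow>\<^sub>E D. \<Sum>a\<in>D. F (q(Suc i := a)))"
    by (subst sum.swap) (simp add: sum.cartesian_product)
  finally show ?thesis .
qed

lemma sum_PiE_1:
  fixes F :: "(nat \<Rightarrow> nat) \<Rightarrow> real"
  assumes "finite D"
  shows "(\<Sum>q\<in>{Suc 0} \<rightarrow>\<^sub>E D. F q) = (\<Sum>a\<in>D. F ((\<lambda>_. undefined)(Suc 0 := a)))"
  using sum_PiE_Suc[OF assms, of F 0] by (simp add: fun_upd_def)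

subsection \<open>Projection kernels of finite rank\<close>

text \<open>With a fixed basis of everywhere bounded functions, projection and kernel become genuine
  functions: \<open>proj_proj\<close>, \<open>proj_ker\<close> and \<open>coef_ker\<close> hold
  pointwise, and the value \<open>ker z\<close> at a single point has a meaning.\<close>

locale bdd_proj = finite_measure M for M :: "'z measure" +
  fixes D :: "nat set" and \<phi> :: "nat \<Rightarrow> 'z \<Rightarrow> real"
  assumes finD: "finite D"
    and phi: "\<And>a. a \<in> D \<Longrightarrow> \<phi> a \<in> bdd_meas M"
    and orth: "\<And>a b. a \<in> D \<Longrightarrow> b \<in> D \<Longrightarrow> (\<integral>z. \<phi> a z * \<phi> b z \<partial>M) = (if a = b then 1 else 0)"
begin

definition coef :: "('z \<Rightarrow> real) \<Rightarrow> nat \<Rightarrow> real" where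
  "coef f a = (\<integral>z. \<phi> a z * f z \<partial>M)"

definition proj :: "('z \<Rightarrow> real) \<Rightarrow> 'z \<Rightarrow> real" where
  "proj f z = (\<Sum>a\<in>D. coef f a * \<phi> a z)"

definition ker :: "'z \<Rightarrow> 'z \<Rightarrow> real" where
  "ker z y = (\<Sum>a\<in>D. \<phi> a z * \<phi> a y)"

lemma ker_bdd [simp]: "ker z \<in> bdd_meas M"
  unfolding ker_def by (intro bdd_meas_intros phi)

lemma proj_bdd [simp]: "proj f \<in> bdd_meas M"
  unfolding proj_def by (intro bdd_meas_intros phi)

lemma integral_sum_phi:
  assumes "f \<in> bdd_meas M"
  shows "(\<integral>z. f z * (\<Sum>a\<in>D. c a * \<phi> a z) \<partial>M) = (\<Sum>a\<in>D. c a * coef f a)"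
proof -
  have "(\<integral>z. f z * (\<Sum>a\<in>D. c a * \<phi> a z) \<partial>M) = (\<integral>z. (\<Sum>a\<in>D. c a * (\<phi> a z * f z)) \<partial>M)"
    by (simp add: sum_distrib_left ac_simps)
  also have "\<dots> = (\<Sum>a\<in>D. c a * coef f a)"
    using assms phi by (subst Bochner_Integration.integral_sum)
      (auto simp: coef_def intro!: bdd_meas_integrable bdd_meas_intros)
  finally show ?thesis .
qed

lemma coef_sum_phi: "a \<in> D \<Longrightarrow> coef (\<lambda>z. \<Sum>b\<in>D. c b * \<phi> b z) a = c a"
  using integral_sum_phi[OF phi, of a c] finD orth
  by (simp add: coef_def if_distrib[of "\<lambda>x. _ * x"] cong: if_cong)

lemma coef_proj: "a \<in> D \<Longrightarrow> coef (proj f) a = coef f a"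
  unfolding proj_def by (rule coef_sum_phi)

lemma proj_proj: "proj (proj f) = proj f"
  unfolding proj_def[of "proj f"] by (intro ext) (simp add: coef_proj proj_def cong: sum.cong)

lemma coef_ker: "a \<in> D \<Longrightarrow> coef (ker z) a = \<phi> a z"
  unfolding ker_def by (rule coef_sum_phi)

lemma proj_ker: "proj (ker z) = ker z"
  by (intro ext) (simp add: proj_def coef_ker ker_def)

lemma integral_proj: "f \<in> bdd_meas M \<Longrightarrow> (\<integral>z. f z * proj h z \<partial>M) = (\<Sum>a\<in>D. coef h a * coef f a)"
  unfolding proj_def by (rule integral_sum_phi)

lemma proj_adjoint:
  "f \<in> bdd_meas M \<Longrightarrow> h \<in> bdd_meas M \<Longrightarrow> (\<integral>z. f z * proj h z \<partial>M) = (\<integral>z. proj f z * h z \<partial>M)"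
  using integral_proj[of f h] integral_proj[of h f] by (simp add: mult.commute)

lemma integral_ker: "f \<in> bdd_meas M \<Longrightarrow> (\<integral>y. ker z y * f y \<partial>M) = proj f z"
  using integral_sum_phi[of f "\<lambda>a. \<phi> a z"] by (simp add: ker_def proj_def mult.commute)

lemma integral_proj_proj: "(\<integral>z. proj f z * proj h z \<partial>M) = (\<Sum>a\<in>D. coef f a * coef h a)"
  using integral_proj[OF proj_bdd, of f h] by (simp add: coef_proj mult.commute)

lemma integral_proj_sq: "(\<integral>z. (proj f z)\<^sup>2 \<partial>M) = (\<Sum>a\<in>D. (coef f a)\<^sup>2)"
  using integral_proj_proj[of f f] by (simp add: power2_eq_square)

lemma integral_ker_sq: "(\<integral>y. (ker z y)\<^sup>2 \<partial>M) = (\<Sum>a\<in>D. (\<phi> a z)\<^sup>2)"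
  using integral_proj_sq[of "ker z"] by (simp add: proj_ker coef_ker)

lemma proj_contraction:
  assumes f: "f \<in> bdd_meas M"
  shows "(\<integral>z. (proj f z)\<^sup>2 \<partial>M) \<le> (\<integral>z. (f z)\<^sup>2 \<partial>M)"
proof -
  have "0 \<le> (\<integral>z. (f z - proj f z)\<^sup>2 \<partial>M)" by simp
  also have "\<dots> = (\<integral>z. (f z)\<^sup>2 - 2 * (f z * proj f z) + (proj f z)\<^sup>2 \<partial>M)"
    by (intro Bochner_Integration.integral_cong) (auto simp: power2_eq_square algebra_simps)
  also have "\<dots> = (\<integral>z. (f z)\<^sup>2 \<partial>M) - 2 * (\<integral>z. f z * proj f z \<partial>M) + (\<integral>z. (proj f z)\<^sup>2 \<partial>M)"
    using bdd_meas_integrable[OF bdd_meas_power[OF f], of 2]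
      bdd_meas_integrable[OF bdd_meas_power[OF proj_bdd], of f 2]
      bdd_meas_integrable[OF bdd_meas_mult[OF f proj_bdd], of f] by simp
  also have "(\<integral>z. f z * proj f z \<partial>M) = (\<integral>z. (proj f z)\<^sup>2 \<partial>M)"
    using integral_proj[OF f, of f] integral_proj_sq[of f] by (simp add: power2_eq_square)
  finally show ?thesis by simp
qed

lemma coef_add:
  "f \<in> bdd_meas M \<Longrightarrow> h \<in> bdd_meas M \<Longrightarrow> a \<in> D \<Longrightarrow> coef (\<lambda>z. f z + h z) a = coef f a + coef h a"
  unfolding coef_def distrib_left
  by (intro Bochner_Integration.integral_add bdd_meas_integrable bdd_meas_intros phi)

lemma coef_sum:
  assumes "\<And>i. i \<in> I \<Longrightarrow> f i \<in> bdd_meas M" "a \<in> D"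
  shows "coef (\<lambda>z. \<Sum>i\<in>I. c i * f i z) a = (\<Sum>i\<in>I. c i * coef (f i) a)"
proof -
  have "coef (\<lambda>z. \<Sum>i\<in>I. c i * f i z) a = (\<integral>z. (\<Sum>i\<in>I. c i * (\<phi> a z * f i z)) \<partial>M)"
    by (simp add: coef_def sum_distrib_left ac_simps)
  also have "\<dots> = (\<Sum>i\<in>I. c i * coef (f i) a)"
    using assms phi by (subst Bochner_Integration.integral_sum)
      (auto simp: coef_def intro!: bdd_meas_integrable bdd_meas_intros)
  finally show ?thesis .
qed

lemma proj_sum:
  assumes "\<And>i. i \<in> I \<Longrightarrow> f i \<in> bdd_meas M"
  shows "proj (\<lambda>z. \<Sum>i\<in>I. c i * f i z) y = (\<Sum>i\<in>I. c i * proj (f i) y)"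
proof -
  have "proj (\<lambda>z. \<Sum>i\<in>I. c i * f i z) y = (\<Sum>a\<in>D. \<Sum>i\<in>I. c i * coef (f i) a * \<phi> a y)"
    using assms by (simp add: proj_def coef_sum sum_distrib_right)
  also have "\<dots> = (\<Sum>i\<in>I. c i * proj (f i) y)"
    unfolding proj_def by (subst sum.swap) (simp add: sum_distrib_left mult.assoc)
  finally show ?thesis .
qed

end

section \<open>Chains alternating the projection with multiplication by the relative error\<close>

text \<open>
  In a chain, \<open>U\<close>, \<open>N\<close> and \<open>V\<close> are the densities with respect to \<open>M\<close> of the differences between the two
  laws of the first, a middle and the last factor, and \<open>w1\<close>, \<open>w2\<close>, \<open>w3\<close> those of the second moments of these
  factors under the estimated law.
\<close>

locale chain_op = bdd_proj M D \<phi> for M :: "'z measure" and D \<phi> +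
  fixes N :: "'z \<Rightarrow> real"
  assumes N: "N \<in> bdd_meas M"
begin

text \<open>One link of the chain whose coordinate has been integrated out. With \<Pi> for the
  projection, \<open>proj\<close> after \<open>S ^^ g\<close> is the operator \<Pi> (N
  \<Pi>)^g.\<close>

definition S :: "('z \<Rightarrow> real) \<Rightarrow> 'z \<Rightarrow> real" where
  "S f z = N z * proj f z"

lemma S_bdd [simp]: "S f \<in> bdd_meas M"
  unfolding S_def by (intro bdd_meas_intros N proj_bdd)

lemma S_pow_bdd: "f \<in> bdd_meas M \<Longrightarrow> (S ^^ g) f \<in> bdd_meas M"
  by (cases g) auto

text \<open>\<Pi> (N \<Pi>)^g is a palindrome in two self-adjoint operators. The induction takes one
  \<open>S\<close> off the inner end on the left of the equation and puts it at the outer end on the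
  right.\<close>

lemma S_symmetric:
  assumes "f \<in> bdd_meas M" "h \<in> bdd_meas M"
  shows "(\<integral>z. h z * proj ((S ^^ g) f) z \<partial>M) = (\<integral>z. f z * proj ((S ^^ g) h) z \<partial>M)"
  using assms
proof (induction g arbitrary: f h)
  case 0
  then show ?case using proj_adjoint[of h f] by (simp add: mult.commute)
next
  case (Suc g)
  have "(\<integral>z. h z * proj ((S ^^ Suc g) f) z \<partial>M) = (\<integral>z. h z * proj ((S ^^ g) (S f)) z \<partial>M)"
    by (simp add: funpow_swap1)
  also have "\<dots> = (\<integral>z. S f z * proj ((S ^^ g) h) z \<partial>M)"
    using Suc.IH[OF S_bdd Suc.prems(2)] .
  also have "\<dots> = (\<integral>z. proj f z * S ((S ^^ g) h) z \<partial>M)"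
    by (simp add: S_def ac_simps)
  also have "\<dots> = (\<integral>z. f z * proj (S ((S ^^ g) h)) z \<partial>M)"
    using proj_adjoint[OF Suc.prems(1) S_bdd] by simp
  finally show ?case by simp
qed

lemma S_pow_sum:
  assumes "\<And>i. i \<in> I \<Longrightarrow> f i \<in> bdd_meas M"
  shows "(S ^^ g) (\<lambda>z. \<Sum>i\<in>I. c i * f i z) y = (\<Sum>i\<in>I. c i * (S ^^ g) (f i) y)"
proof (induction g arbitrary: y)
  case (Suc g)
  then have "(S ^^ g) (\<lambda>z. \<Sum>i\<in>I. c i * f i z) = (\<lambda>z. \<Sum>i\<in>I. c i * (S ^^ g) (f i) z)"
    by auto
  moreover have "(S ^^ Suc g) h y = N y * proj ((S ^^ g) h) y" for h
    by (simp only: funpow.simps o_apply S_def[of "(S ^^ g) h"])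
  ultimately show ?case
    using assms by (simp only: proj_sum S_pow_bdd) (simp add: sum_distrib_left ac_simps)
qed simp

text \<open>The kernel of \<Pi> (N \<Pi>)^g. Defined by applying the operator to sections of
  \<open>ker\<close>, it inherits L2 bounds from the operator; the separable form
  \<open>kap_eq\<close> supplies joint measurability.\<close>

definition kap :: "nat \<Rightarrow> 'z \<Rightarrow> 'z \<Rightarrow> real" where
  "kap g z y = proj ((S ^^ g) (ker z)) y"

lemma kap_eq: "kap g z y = (\<Sum>a\<in>D. \<phi> a z * proj ((S ^^ g) (\<phi> a)) y)"
proof -
  have "(S ^^ g) (ker z) = (\<lambda>y. \<Sum>a\<in>D. \<phi> a z * (S ^^ g) (\<phi> a) y)"
    unfolding ker_def by (intro ext S_pow_sum phi)
  then show ?thesis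
    by (simp add: kap_def proj_sum S_pow_bdd phi)
qed

lemma kap_symmetric: "kap g z y = kap g y z"
proof -
  have "kap g z y = (\<integral>x. ker y x * proj ((S ^^ g) (ker z)) x \<partial>M)" for z y
    by (subst integral_ker) (auto simp: kap_def proj_proj)
  then show ?thesis
    using S_symmetric[OF ker_bdd ker_bdd, of y g z] by simp
qed

lemma kap_bdd: "(\<lambda>(z, y). kap g z y) \<in> bdd_meas (M \<Otimes>\<^sub>M M)"
proof -
  have "(\<lambda>x. \<phi> a (fst x)) \<in> bdd_meas (M \<Otimes>\<^sub>M M)" "(\<lambda>x. proj ((S ^^ g) (\<phi> a)) (snd x)) \<in> bdd_meas (M \<Otimes>\<^sub>M M)"
    if "a \<in> D" for a
    using bdd_meas_comp[OF phi[OF that] measurable_fst] bdd_meas_comp[OF proj_bdd measurable_snd] by blast+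
  then show ?thesis
    unfolding case_prod_unfold kap_eq by (intro bdd_meas_intros)
qed

lemma kap_bdd2: "kap g z \<in> bdd_meas M"
  unfolding kap_def by (rule proj_bdd)

end

lemma (in finite_measure) bdd_meas_partial_integral:
  assumes f: "f \<in> bdd_meas (M \<Otimes>\<^sub>M M)"
  shows "(\<lambda>z. \<integral>y. f (z, y) \<partial>M) \<in> bdd_meas M"
proof -
  obtain C where C: "0 \<le> C" "\<And>x. x \<in> space (M \<Otimes>\<^sub>M M) \<Longrightarrow> \<bar>f x\<bar> \<le> C"
    using bdd_meas_bound[OF f] by metis
  have m [measurable]: "f \<in> borel_measurable (M \<Otimes>\<^sub>M M)"
    using f by (rule bdd_meas_measurable)
  show ?thesis
  proof (rule bdd_measI)
    show "(\<lambda>z. \<integral>y. f (z, y) \<partial>M) \<in> borel_measurable M"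
      by measurable
    fix z assume z: "z \<in> space M"
    have fz: "(\<lambda>y. f (z, y)) \<in> bdd_meas M"
      using f z by (intro bdd_meas_comp[OF f]) measurable
    have "\<bar>\<integral>y. f (z, y) \<partial>M\<bar> \<le> (\<integral>y. \<bar>f (z, y)\<bar> \<partial>M)"
      by (rule integral_abs_bound)
    also have "\<dots> \<le> (\<integral>y. C \<partial>M)"
      using z C fz by (intro integral_mono bdd_meas_integrable bdd_meas_intros) (auto simp: space_pair_measure)
    finally show "\<bar>\<integral>y. f (z, y) \<partial>M\<bar> \<le> measure M (space M) * C"
      by simp
  qed
qed

lemma (in finite_measure) bdd_meas_Fubini:
  assumes f: "f \<in> bdd_meas (M \<Otimes>\<^sub>M M)"
  shows "(\<integral>z. \<integral>y. f (z, y) \<partial>M \<partial>M) = (\<integral>y. \<integral>z. f (z, y) \<partial>M \<partial>M)"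
proof -
  interpret pair_sigma_finite M M ..
  interpret MM: finite_measure "M \<Otimes>\<^sub>M M"
    by (intro finite_measure_pair_measure finite_measure_axioms)
  show ?thesis
    using Fubini_integral[of "\<lambda>z y. f (z, y)"] MM.bdd_meas_integrable[OF f] by simp
qed

context chain_op
begin

lemma S_L2:
  assumes "f \<in> bdd_meas M" and h: "\<And>z. z \<in> space M \<Longrightarrow> \<bar>N z\<bar> \<le> h"
  shows "(\<integral>z. (S f z)\<^sup>2 \<partial>M) \<le> h\<^sup>2 * (\<integral>z. (f z)\<^sup>2 \<partial>M)"
proof -
  have "(\<integral>z. (S f z)\<^sup>2 \<partial>M) \<le> (\<integral>z. h\<^sup>2 * (proj f z)\<^sup>2 \<partial>M)"
  proof (intro integral_mono bdd_meas_integrable bdd_meas_intros S_bdd proj_bdd)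
    fix z assume "z \<in> space M"
    then have "(N z)\<^sup>2 \<le> h\<^sup>2"
      using h power_mono[of "\<bar>N z\<bar>" h 2] by simp
    then show "(S f z)\<^sup>2 \<le> h\<^sup>2 * (proj f z)\<^sup>2"
      by (simp add: S_def power_mult_distrib mult_right_mono)
  qed
  also have "\<dots> \<le> h\<^sup>2 * (\<integral>z. (f z)\<^sup>2 \<partial>M)"
    using proj_contraction[OF assms(1)] by (simp add: mult_left_mono)
  finally show ?thesis .
qed

text \<open>A row of the kernel starts as \<open>ker z\<close>, whose squared norm is the diagonal
  value; projections contract in L2 and each of the \<open>g\<close> multiplications costs
  \<open>h\<^sup>2\<close>.\<close>

lemma kap_L2:
  assumes h: "\<And>z. z \<in> space M \<Longrightarrow> \<bar>N z\<bar> \<le> h"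
    and K: "\<And>z. z \<in> space M \<Longrightarrow> (\<Sum>a\<in>D. (\<phi> a z)\<^sup>2) \<le> K" and z: "z \<in> space M"
  shows "(\<integral>y. (kap g z y)\<^sup>2 \<partial>M) \<le> h ^ (2 * g) * K"
proof -
  have "(\<integral>y. ((S ^^ g) f y)\<^sup>2 \<partial>M) \<le> h ^ (2 * g) * (\<integral>y. (f y)\<^sup>2 \<partial>M)" if f: "f \<in> bdd_meas M" for f
  proof (induction g)
    case (Suc g)
    have "(\<integral>y. ((S ^^ Suc g) f y)\<^sup>2 \<partial>M) \<le> h\<^sup>2 * (\<integral>z. ((S ^^ g) f z)\<^sup>2 \<partial>M)"
      using S_L2[OF S_pow_bdd[OF f] h] by simp
    also have "\<dots> \<le> h\<^sup>2 * (h ^ (2 * g) * (\<integral>y. (f y)\<^sup>2 \<partial>M))"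
      using Suc by (intro mult_left_mono) auto
    finally show ?case by (simp add: power2_eq_square)
  qed simp
  from this[OF ker_bdd, of z] have "(\<integral>y. ((S ^^ g) (ker z) y)\<^sup>2 \<partial>M) \<le> h ^ (2 * g) * (\<Sum>a\<in>D. (\<phi> a z)\<^sup>2)"
    by (simp add: integral_ker_sq)
  also have "\<dots> \<le> h ^ (2 * g) * K"
    using K[OF z] by (intro mult_left_mono) auto
  finally show ?thesis
    unfolding kap_def using proj_contraction[OF S_pow_bdd[OF ker_bdd], of g z] by simp
qed

text \<open>The Schur test for the operator with kernel \<open>kap\<^sup>2\<close>: Cauchy-Schwarz
  within a row uses the row bound once, and after Fubini the column bound is the row bound again by
  symmetry.\<close>

lemma kap_Schur:
  assumes s: "\<And>z. z \<in> space M \<Longrightarrow> (\<integral>y. (kap g z y)\<^sup>2 \<partial>M) \<le> s"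
    and W: "W \<in> bdd_meas M" and s0: "0 \<le> s"
  shows "(\<integral>z. (\<integral>y. (kap g z y)\<^sup>2 * W y \<partial>M)\<^sup>2 \<partial>M) \<le> s\<^sup>2 * (\<integral>y. (W y)\<^sup>2 \<partial>M)"
proof -
  have W2: "(\<lambda>x. (W (snd x))) \<in> bdd_meas (M \<Otimes>\<^sub>M M)"
    by (rule bdd_meas_comp[OF W measurable_snd])
  have k2: "(\<lambda>x. kap g (fst x) (snd x)) \<in> bdd_meas (M \<Otimes>\<^sub>M M)"
    using kap_bdd[of g] by (simp add: case_prod_unfold)
  have kW: "(\<lambda>x. (kap g (fst x) (snd x))\<^sup>2 * (W (snd x))\<^sup>2) \<in> bdd_meas (M \<Otimes>\<^sub>M M)"
    by (intro bdd_meas_intros W2 k2)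
  have kW1: "(\<lambda>x. (kap g (fst x) (snd x))\<^sup>2 * W (snd x)) \<in> bdd_meas (M \<Otimes>\<^sub>M M)"
    by (intro bdd_meas_intros W2 k2)
  have "(\<integral>z. (\<integral>y. (kap g z y)\<^sup>2 * W y \<partial>M)\<^sup>2 \<partial>M) \<le> (\<integral>z. s * (\<integral>y. (kap g z y)\<^sup>2 * (W y)\<^sup>2 \<partial>M) \<partial>M)"
  proof (intro integral_mono bdd_meas_integrable bdd_meas_intros)
    show "(\<lambda>z. \<integral>y. (kap g z y)\<^sup>2 * W y \<partial>M) \<in> bdd_meas M"
      "(\<lambda>z. \<integral>y. (kap g z y)\<^sup>2 * (W y)\<^sup>2 \<partial>M) \<in> bdd_meas M"
      using bdd_meas_partial_integral[OF kW1] bdd_meas_partial_integral[OF kW] by simp_all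
    fix z assume z: "z \<in> space M"
    have "(\<integral>y. (kap g z y)\<^sup>2 * W y \<partial>M)\<^sup>2 = (\<integral>y. kap g z y * (kap g z y * W y) \<partial>M)\<^sup>2"
      by (simp add: power2_eq_square mult.assoc)
    also have "\<dots> \<le> (\<integral>y. (kap g z y)\<^sup>2 \<partial>M) * (\<integral>y. (kap g z y * W y)\<^sup>2 \<partial>M)"
      by (intro bdd_meas_Cauchy_Schwarz bdd_meas_intros kap_bdd2 W)
    also have "\<dots> \<le> s * (\<integral>y. (kap g z y)\<^sup>2 * (W y)\<^sup>2 \<partial>M)"
      using s[OF z] by (intro mult_mono s0) (auto simp: power_mult_distrib)
    finally show "(\<integral>y. (kap g z y)\<^sup>2 * W y \<partial>M)\<^sup>2 \<le> s * (\<integral>y. (kap g z y)\<^sup>2 * (W y)\<^sup>2 \<partial>M)" .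
  qed
  also have "\<dots> = s * (\<integral>y. (W y)\<^sup>2 * (\<integral>z. (kap g y z)\<^sup>2 \<partial>M) \<partial>M)"
    using bdd_meas_Fubini[OF kW] by (simp add: kap_symmetric[of g _ _] mult.commute)
  also have "\<dots> \<le> s * (\<integral>y. (W y)\<^sup>2 * s \<partial>M)"
  proof (intro mult_left_mono s0 integral_mono bdd_meas_integrable bdd_meas_intros W)
    show "(\<lambda>y. \<integral>z. (kap g y z)\<^sup>2 \<partial>M) \<in> bdd_meas M"
      using bdd_meas_partial_integral[OF bdd_meas_power[OF k2, of 2]] by simp
  qed (use s in auto)
  finally show ?thesis
    by (simp add: power2_eq_square ac_simps)
qed

end

section \<open>Path sums as linear functionals and quadratic forms of a test function at the open
  end\<close>

locale chain_sum = chain_op M D \<phi> N for M :: "'z measure" and D \<phi> N +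
  fixes U V w1 w2 w3 :: "'z \<Rightarrow> real"
  assumes U: "U \<in> bdd_meas M" and V: "V \<in> bdd_meas M"
    and w1: "w1 \<in> bdd_meas M" and w2: "w2 \<in> bdd_meas M" and w3: "w3 \<in> bdd_meas M"
begin

text \<open>The index \<open>q i\<close> belongs to the link between positions \<open>i\<close> and
  \<open>i + 1\<close>. The centred factor at an inner position has as its mean the matrix entry of
  multiplication by \<open>N\<close> between the two adjacent links.\<close>

definition lin_step :: "nat \<Rightarrow> (nat \<Rightarrow> nat) \<Rightarrow> real" where
  "lin_step i q = (if i = 1 then coef U (q 1) else coef (\<lambda>z. N z * \<phi> (q i) z) (q (i - 1)))"

definition quad_step :: "nat set \<Rightarrow> nat \<Rightarrow> (nat \<Rightarrow> nat) \<Rightarrow> (nat \<Rightarrow> nat) \<Rightarrow> real" where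
  "quad_step B i q q' = (if i \<in> B then
     (if i = 1 then \<integral>z. w1 z * (\<phi> (q 1) z * \<phi> (q' 1) z) \<partial>M
      else \<integral>z. w2 z * (\<phi> (q (i - 1)) z * \<phi> (q i) z * (\<phi> (q' (i - 1)) z * \<phi> (q' i) z)) \<partial>M)
    else lin_step i q * lin_step i q')"

text \<open>The part of the second moment carried by the first \<open>i\<close> positions. The last
  link is left open and closed by a test function \<open>f\<close>, which stands for the rest of the
  chain; this makes a recursion in \<open>i\<close> possible.\<close>

definition quad :: "nat set \<Rightarrow> nat \<Rightarrow> ('z \<Rightarrow> real) \<Rightarrow> real" where
  "quad B i f = (\<Sum>q\<in>{1..i} \<rightarrow>\<^sub>E D. \<Sum>q'\<in>{1..i} \<rightarrow>\<^sub>E D.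
     (\<Prod>i'\<in>{1..i}. quad_step B i' q q') * (coef f (q i) * coef f (q' i)))"

lemma coef_S:
  assumes "b \<in> D"
  shows "(\<Sum>a\<in>D. coef f a * coef (\<lambda>z. N z * \<phi> a z) b) = coef (S f) b"
proof -
  have "coef (\<lambda>z. \<Sum>a\<in>D. coef f a * (N z * \<phi> a z)) b = (\<Sum>a\<in>D. coef f a * coef (\<lambda>z. N z * \<phi> a z) b)"
    by (intro coef_sum assms bdd_meas_intros N phi)
  moreover have "S f = (\<lambda>z. \<Sum>a\<in>D. coef f a * (N z * \<phi> a z))"
    by (auto simp: S_def proj_def sum_distrib_left ac_simps)
  ultimately show ?thesis by simp
qed

lemma lin_step_upd: "i \<le> n \<Longrightarrow> lin_step i (q(Suc n := a)) = lin_step i q"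
  by (auto simp: lin_step_def)

lemma quad_step_upd:
  "i \<in> {1..n} \<Longrightarrow> quad_step B i (q(Suc n := a)) (q'(Suc n := a')) = quad_step B i q q'"
  by (auto simp: quad_step_def lin_step_upd)

text \<open>A transfer matrix computation: summing out the last index replaces the test function
  \<open>f\<close> by \<open>S f\<close> and shortens the path by one, until only the pairing with
  \<open>U\<close> is left.\<close>

lemma lin_sum:
  "f \<in> bdd_meas M \<Longrightarrow> (\<Sum>q\<in>{1..Suc i} \<rightarrow>\<^sub>E D. (\<Prod>i'\<in>{1..Suc i}. lin_step i' q) * coef f (q (Suc i))) =
    (\<integral>z. U z * proj ((S ^^ i) f) z \<partial>M)"
proof (induction i arbitrary: f)
  case 0
  show ?case
    using integral_proj[OF U, of f] finD by (simp add: sum_PiE_1 lin_step_def mult.commute)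
next
  case (Suc i)
  let ?T = "\<lambda>q. \<Prod>i'\<in>{1..Suc i}. lin_step i' q"
  have "(\<Sum>q\<in>{1..Suc (Suc i)} \<rightarrow>\<^sub>E D. (\<Prod>i'\<in>{1..Suc (Suc i)}. lin_step i' q) * coef f (q (Suc (Suc i)))) =
      (\<Sum>q\<in>{1..Suc i} \<rightarrow>\<^sub>E D. \<Sum>a\<in>D. ?T q * coef (\<lambda>z. N z * \<phi> a z) (q (Suc i)) * coef f a)"
    unfolding sum_PiE_Suc[OF finD]
  proof (intro sum.cong refl)
    fix q a
    have "(\<Prod>i'\<in>{1..Suc i}. lin_step i' (q(Suc (Suc i) := a))) = ?T q"
      by (intro prod.cong refl lin_step_upd) auto
    then show "(\<Prod>i'\<in>{1..Suc (Suc i)}. lin_step i' (q(Suc (Suc i) := a))) * coef f ((q(Suc (Suc i) := a)) (Suc (Suc i)))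
        = ?T q * coef (\<lambda>z. N z * \<phi> a z) (q (Suc i)) * coef f a"
      by (subst prod.nat_ivl_Suc') (auto simp: lin_step_def)
  qed
  also have "\<dots> = (\<Sum>q\<in>{1..Suc i} \<rightarrow>\<^sub>E D. ?T q * coef (S f) (q (Suc i)))"
  proof (intro sum.cong refl)
    fix q assume "q \<in> {1..Suc i} \<rightarrow>\<^sub>E D"
    then have "q (Suc i) \<in> D" by auto
    then show "(\<Sum>a\<in>D. ?T q * coef (\<lambda>z. N z * \<phi> a z) (q (Suc i)) * coef f a) = ?T q * coef (S f) (q (Suc i))"
      by (simp add: coef_S[symmetric] sum_distrib_left ac_simps)
  qed
  also have "\<dots> = (\<integral>z. U z * proj ((S ^^ Suc i) f) z \<partial>M)"
    using Suc.IH[OF S_bdd, of f] by (simp add: funpow_swap1)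
  finally show ?case .
qed

lemma integral_double_sum:
  assumes "h \<in> bdd_meas M" "\<And>q. q \<in> R \<Longrightarrow> u q \<in> bdd_meas M"
  shows "(\<Sum>q\<in>R. \<Sum>q'\<in>R. c q q' * (\<integral>z. h z * (u q z * u q' z) \<partial>M)) =
    (\<integral>z. h z * (\<Sum>q\<in>R. \<Sum>q'\<in>R. c q q' * (u q z * u q' z)) \<partial>M)"
proof -
  have "(\<integral>z. h z * (\<Sum>q\<in>R. \<Sum>q'\<in>R. c q q' * (u q z * u q' z)) \<partial>M) =
      (\<integral>z. (\<Sum>q\<in>R. \<Sum>q'\<in>R. c q q' * (h z * (u q z * u q' z))) \<partial>M)"
    by (simp add: sum_distrib_left ac_simps)
  also have "\<dots> = (\<Sum>q\<in>R. \<integral>z. (\<Sum>q'\<in>R. c q q' * (h z * (u q z * u q' z))) \<partial>M)"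
    using assms by (intro Bochner_Integration.integral_sum bdd_meas_integrable bdd_meas_intros)
  also have "\<dots> = (\<Sum>q\<in>R. \<Sum>q'\<in>R. \<integral>z. c q q' * (h z * (u q z * u q' z)) \<partial>M)"
    using assms by (intro sum.cong refl Bochner_Integration.integral_sum bdd_meas_integrable bdd_meas_intros)
  finally show ?thesis by simp
qed

lemma double_sum_square:
  fixes x :: "'r \<Rightarrow> real"
  shows "(\<Sum>q\<in>R. \<Sum>q'\<in>R. x q * y q') = sum x R * sum y R"
  by (simp add: sum_product)

lemma quad_0:
  assumes f: "f \<in> bdd_meas M"
  shows "quad B 1 f = (if 1 \<in> B then \<integral>z. w1 z * (proj f z)\<^sup>2 \<partial>M else (\<integral>z. U z * proj f z \<partial>M)\<^sup>2)"
proof (cases "1 \<in> B")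
  case True
  have "quad B 1 f = (\<Sum>a\<in>D. \<Sum>a'\<in>D. (coef f a * coef f a') * (\<integral>z. w1 z * (\<phi> a z * \<phi> a' z) \<partial>M))"
    using True finD by (simp add: quad_def sum_PiE_1 quad_step_def mult.commute)
  also have "\<dots> = (\<integral>z. w1 z * (\<Sum>a\<in>D. \<Sum>a'\<in>D. (coef f a * coef f a') * (\<phi> a z * \<phi> a' z)) \<partial>M)"
    by (intro integral_double_sum w1 phi)
  also have "\<dots> = (\<integral>z. w1 z * (proj f z)\<^sup>2 \<partial>M)"
    by (simp add: proj_def power2_eq_square sum_product ac_simps)
  finally show ?thesis using True by simp
next
  case False
  have "quad B 1 f = (\<Sum>a\<in>D. \<Sum>a'\<in>D. (coef f a * coef U a) * (coef f a' * coef U a'))"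
    using False finD by (simp add: quad_def sum_PiE_1 quad_step_def lin_step_def ac_simps)
  also have "\<dots> = (\<integral>z. U z * proj f z \<partial>M)\<^sup>2"
    using integral_proj[OF U, of f] by (simp add: sum_product power2_eq_square)
  finally show ?thesis using False by simp
qed

lemma quad_ker_bdd: "(\<lambda>z. quad B (Suc i) (ker z)) \<in> bdd_meas M"
proof -
  have "quad B (Suc i) (ker z) = (\<Sum>q\<in>{1..Suc i} \<rightarrow>\<^sub>E D. \<Sum>q'\<in>{1..Suc i} \<rightarrow>\<^sub>E D.
     (\<Prod>i'\<in>{1..Suc i}. quad_step B i' q q') * (\<phi> (q (Suc i)) z * \<phi> (q' (Suc i)) z))" for z
    unfolding quad_def
  proof (intro sum.cong refl)
    fix q q' assume "q \<in> {1..Suc i} \<rightarrow>\<^sub>E D" "q' \<in> {1..Suc i} \<rightarrow>\<^sub>E D"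
    then have "q (Suc i) \<in> D" "q' (Suc i) \<in> D" by auto
    then show "(\<Prod>i'\<in>{1..Suc i}. quad_step B i' q q') * (coef (ker z) (q (Suc i)) * coef (ker z) (q' (Suc i))) =
      (\<Prod>i'\<in>{1..Suc i}. quad_step B i' q q') * (\<phi> (q (Suc i)) z * \<phi> (q' (Suc i)) z)"
      by (simp add: coef_ker)
  qed
  then show ?thesis
    by (auto intro!: bdd_meas_intros phi)
qed

text \<open>Since the coefficients of \<open>ker z\<close> are the values at \<open>z\<close> of the
  basis functions, \<open>quad B i (ker z)\<close> is the left part of the chain seen as a function
  of the location \<open>z\<close> of the next coordinate.\<close>

lemma quad_ker_integral:
  assumes h: "h \<in> bdd_meas M"
  shows "(\<integral>z. h z * quad B (Suc i) (ker z) \<partial>M) =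
    (\<Sum>q\<in>{1..Suc i} \<rightarrow>\<^sub>E D. \<Sum>q'\<in>{1..Suc i} \<rightarrow>\<^sub>E D. (\<Prod>i'\<in>{1..Suc i}. quad_step B i' q q') *
       (\<integral>z. h z * (\<phi> (q (Suc i)) z * \<phi> (q' (Suc i)) z) \<partial>M))"
proof -
  have "(\<Sum>q\<in>{1..Suc i} \<rightarrow>\<^sub>E D. \<Sum>q'\<in>{1..Suc i} \<rightarrow>\<^sub>E D. (\<Prod>i'\<in>{1..Suc i}. quad_step B i' q q') *
       (\<integral>z. h z * (\<phi> (q (Suc i)) z * \<phi> (q' (Suc i)) z) \<partial>M)) =
    (\<integral>z. h z * (\<Sum>q\<in>{1..Suc i} \<rightarrow>\<^sub>E D. \<Sum>q'\<in>{1..Suc i} \<rightarrow>\<^sub>E D. (\<Prod>i'\<in>{1..Suc i}. quad_step B i' q q') *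
       (\<phi> (q (Suc i)) z * \<phi> (q' (Suc i)) z)) \<partial>M)"
    by (intro integral_double_sum[where u = "\<lambda>q. \<phi> (q (Suc i))"] h phi) auto
  also have "\<dots> = (\<integral>z. h z * quad B (Suc i) (ker z) \<partial>M)"
    unfolding quad_def
  proof (intro Bochner_Integration.integral_cong sum.cong refl arg_cong2[where f = "(*)"])
    fix z q q' assume q: "q \<in> {1..Suc i} \<rightarrow>\<^sub>E D" "q' \<in> {1..Suc i} \<rightarrow>\<^sub>E D"
    then have "q (Suc i) \<in> D" "q' (Suc i) \<in> D" by auto
    then show "\<phi> (q (Suc i)) z = coef (ker z) (q (Suc i))" "\<phi> (q' (Suc i)) z = coef (ker z) (q' (Suc i))"
      by (simp_all add: coef_ker)
  qed
  finally show ?thesis ..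
qed

text \<open>At a position in \<open>B\<close> both copies of the chain see the same observation.
  Given its location \<open>z\<close> the two sides decouple: the right one contributes
  \<open>(proj f z)\<^sup>2\<close>, the left one \<open>quad\<close> at \<open>ker z\<close>. At a
  position outside \<open>B\<close> each copy is averaged on its own, which replaces
  \<open>f\<close> by \<open>S f\<close>.\<close>

lemma quad_Suc:
  assumes f: "f \<in> bdd_meas M"
  shows "quad B (Suc (Suc i)) f = (if Suc (Suc i) \<in> B
    then \<integral>z. w2 z * (proj f z)\<^sup>2 * quad B (Suc i) (ker z) \<partial>M else quad B (Suc i) (S f))"
proof -
  let ?R = "{1..Suc i} \<rightarrow>\<^sub>E D" and ?j = "Suc (Suc i)"
  let ?T = "\<lambda>q q'. \<Prod>i'\<in>{1..Suc i}. quad_step B i' q q'"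
  let ?u = "\<lambda>q q' a a'. quad_step B ?j (q(?j := a)) (q'(?j := a'))"
  have "quad B ?j f = (\<Sum>q\<in>?R. \<Sum>a\<in>D. \<Sum>q'\<in>?R. \<Sum>a'\<in>D. ?T q q' * (?u q q' a a' * (coef f a * coef f a')))"
    unfolding quad_def sum_PiE_Suc[OF finD]
  proof (intro sum.cong refl)
    fix q a q' a'
    have "(\<Prod>i'\<in>{1..Suc i}. quad_step B i' (q(?j := a)) (q'(?j := a'))) = ?T q q'"
      by (intro prod.cong refl quad_step_upd) auto
    then show "(\<Prod>i'\<in>{1..?j}. quad_step B i' (q(?j := a)) (q'(?j := a'))) *
        (coef f ((q(?j := a)) ?j) * coef f ((q'(?j := a')) ?j)) = ?T q q' * (?u q q' a a' * (coef f a * coef f a'))"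
      by (subst prod.nat_ivl_Suc') (auto simp: ac_simps)
  qed
  also have "\<dots> = (\<Sum>q\<in>?R. \<Sum>q'\<in>?R. \<Sum>a\<in>D. \<Sum>a'\<in>D. ?T q q' * (?u q q' a a' * (coef f a * coef f a')))"
    by (intro sum.cong refl sum.swap)
  also have "\<dots> = (\<Sum>q\<in>?R. \<Sum>q'\<in>?R. ?T q q' * (\<Sum>a\<in>D. \<Sum>a'\<in>D. (coef f a * coef f a') * ?u q q' a a'))"
    by (simp add: sum_distrib_left ac_simps)
  also have "\<dots> = (if ?j \<in> B then \<integral>z. w2 z * (proj f z)\<^sup>2 * quad B (Suc i) (ker z) \<partial>M else quad B (Suc i) (S f))"
  proof (cases "?j \<in> B")
    case True
    have "(\<Sum>a\<in>D. \<Sum>a'\<in>D. (coef f a * coef f a') * ?u q q' a a') =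
      (\<integral>z. (w2 z * (proj f z)\<^sup>2) * (\<phi> (q (Suc i)) z * \<phi> (q' (Suc i)) z) \<partial>M)"
      if q: "q \<in> ?R" "q' \<in> ?R" for q q'
    proof -
      let ?h = "\<lambda>z. w2 z * (\<phi> (q (Suc i)) z * \<phi> (q' (Suc i)) z)"
      have D: "q (Suc i) \<in> D" "q' (Suc i) \<in> D" using q by auto
      have "(\<Sum>a\<in>D. \<Sum>a'\<in>D. (coef f a * coef f a') * ?u q q' a a') =
        (\<Sum>a\<in>D. \<Sum>a'\<in>D. (coef f a * coef f a') * (\<integral>z. ?h z * (\<phi> a z * \<phi> a' z) \<partial>M))"
        using True by (simp add: quad_step_def ac_simps)
      also have "\<dots> = (\<integral>z. ?h z * (\<Sum>a\<in>D. \<Sum>a'\<in>D. (coef f a * coef f a') * (\<phi> a z * \<phi> a' z)) \<partial>M)"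
        by (intro integral_double_sum bdd_meas_intros w2 phi D)
      also have "\<dots> = (\<integral>z. (w2 z * (proj f z)\<^sup>2) * (\<phi> (q (Suc i)) z * \<phi> (q' (Suc i)) z) \<partial>M)"
        by (intro Bochner_Integration.integral_cong refl)
          (simp add: proj_def power2_eq_square sum_product ac_simps)
      finally show ?thesis .
    qed
    then show ?thesis
      using True quad_ker_integral[of "\<lambda>z. w2 z * (proj f z)\<^sup>2" B i]
      by (simp add: bdd_meas_intros w2)
  next
    case False
    have "(\<Sum>a\<in>D. \<Sum>a'\<in>D. (coef f a * coef f a') * ?u q q' a a') =
      coef (S f) (q (Suc i)) * coef (S f) (q' (Suc i))"
      if q: "q \<in> ?R" "q' \<in> ?R" for q q'
    proof -
      have D: "q (Suc i) \<in> D" "q' (Suc i) \<in> D" using q by auto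
      have "(\<Sum>a\<in>D. \<Sum>a'\<in>D. (coef f a * coef f a') * ?u q q' a a') =
        (\<Sum>a\<in>D. \<Sum>a'\<in>D. (coef f a * coef (\<lambda>z. N z * \<phi> a z) (q (Suc i))) *
            (coef f a' * coef (\<lambda>z. N z * \<phi> a' z) (q' (Suc i))))"
        using False by (simp add: quad_step_def lin_step_def ac_simps)
      then show ?thesis
        unfolding double_sum_square coef_S[OF D(1)] coef_S[OF D(2)] .
    qed
    then show ?thesis
      using False by (simp add: quad_def)
  qed
  finally show ?thesis .
qed

end

text \<open>\<open>h\<close> bounds the relative error of \<open>g\<close>; \<open>c0 * kk\<close>
  bounds the diagonal of the kernel; \<open>b\<close> is the fourth power of an operator norm in L4;
  \<open>\<Lambda>\<close> is the price for measuring \<open>U\<close> and \<open>V\<close> in the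
  measure \<open>M\<close>; \<open>m0\<close> bounds the total mass and \<open>\<Omega>\<close> the
  conditional second moments. \<open>A\<close> dominates each product of these that one position of
  the chain can produce, so that the bookkeeping reduces to counting powers of
  \<open>A\<close>.\<close>

locale chain_bound = chain_sum M D \<phi> N U V w1 w2 w3
  for M :: "'z measure" and D \<phi> N U V w1 w2 w3 +
  fixes h b c0 kk \<Lambda> m0 \<Omega> A :: real
  assumes h: "0 \<le> h" "\<And>z. z \<in> space M \<Longrightarrow> \<bar>N z\<bar> \<le> h"
    and K: "\<And>z. z \<in> space M \<Longrightarrow> (\<Sum>a\<in>D. (\<phi> a z)\<^sup>2) \<le> c0 * kk" "0 \<le> c0" "1 \<le> kk"
    and w: "\<And>z. z \<in> space M \<Longrightarrow> 0 \<le> w1 z \<and> w1 z \<le> \<Omega>" "\<And>z. z \<in> space M \<Longrightarrow> 0 \<le> w2 z \<and> w2 z \<le> \<Omega>"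
      "\<And>z. z \<in> space M \<Longrightarrow> 0 \<le> w3 z \<and> w3 z \<le> \<Omega>"
    and L4: "\<And>f. f \<in> bdd_meas M \<Longrightarrow> (\<integral>z. proj f z ^ 4 \<partial>M) \<le> b * (\<integral>z. f z ^ 4 \<partial>M)"
    and U4: "(\<integral>z. U z ^ 4 \<partial>M) \<le> \<Lambda> * h ^ 4" and V4: "(\<integral>z. V z ^ 4 \<partial>M) \<le> \<Lambda> * h ^ 4"
    and mass: "measure M (space M) \<le> m0"
    and ge1: "1 \<le> b" "1 \<le> \<Lambda>" "1 \<le> m0" "1 \<le> \<Omega>"
    and A: "\<Omega> * m0 \<le> A" "\<Omega> * c0 \<le> A" "\<Omega> * b * \<Lambda> \<le> A"
begin

lemma A1: "1 \<le> A" "b * \<Lambda> \<le> A" "m0 \<le> A"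
proof -
  have "1 * (b * \<Lambda>) \<le> \<Omega> * (b * \<Lambda>)" "1 * 1 \<le> b * \<Lambda>" "1 * m0 \<le> \<Omega> * m0"
    using ge1 by (intro mult_mono; simp)+
  then show "1 \<le> A" "b * \<Lambda> \<le> A" "m0 \<le> A"
    using A by (simp_all add: mult.assoc)
qed

text \<open>There are \<open>g + 1\<close> projections, each costing \<open>b\<close>, and
  \<open>g\<close> multiplications by \<open>N\<close>, each costing \<open>h ^ 4\<close>.\<close>

lemma proj_S_L4:
  assumes f: "f \<in> bdd_meas M"
  shows "(\<integral>z. proj ((S ^^ g) f) z ^ 4 \<partial>M) \<le> b ^ Suc g * h ^ (4 * g) * (\<integral>z. f z ^ 4 \<partial>M)"
proof (induction g)
  case 0
  then show ?case using L4[OF f] by simp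
next
  case (Suc g)
  let ?f = "(S ^^ g) f"
  have "(\<integral>z. proj ((S ^^ Suc g) f) z ^ 4 \<partial>M) \<le> b * (\<integral>z. S ?f z ^ 4 \<partial>M)"
    using L4[OF S_bdd] by simp
  also have "(\<integral>z. S ?f z ^ 4 \<partial>M) \<le> (\<integral>z. h ^ 4 * proj ?f z ^ 4 \<partial>M)"
  proof (intro integral_mono bdd_meas_integrable bdd_meas_intros S_bdd proj_bdd)
    fix z assume "z \<in> space M"
    then have "N z ^ 4 \<le> h ^ 4"
      using h(2) power_mono[of "\<bar>N z\<bar>" h 4] by simp
    then show "S ?f z ^ 4 \<le> h ^ 4 * proj ?f z ^ 4"
      unfolding S_def[of ?f] by (simp add: power_mult_distrib mult_right_mono)
  qed
  also have "b * (\<integral>z. h ^ 4 * proj ?f z ^ 4 \<partial>M) \<le> b * (h ^ 4 * (b ^ Suc g * h ^ (4 * g) * (\<integral>z. f z ^ 4 \<partial>M)))"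
    using Suc ge1 by (auto intro!: mult_left_mono)
  finally show ?case
    using ge1 by (simp add: power_add ac_simps)
qed

definition hits :: "nat set \<Rightarrow> nat \<Rightarrow> nat" where
  "hits B i = card (B \<inter> {1..i})"

lemma hits_le: "hits B i \<le> i"
  using card_mono[of "{1..i}" "B \<inter> {1..i}"] by (simp add: hits_def)

lemma hits_Suc: "hits B (Suc i) = (if Suc i \<in> B then Suc (hits B i) else hits B i)"
proof -
  have "B \<inter> {1..Suc i} = (if Suc i \<in> B then insert (Suc i) (B \<inter> {1..i}) else B \<inter> {1..i})"
    by (auto simp: le_Suc_eq)
  then show ?thesis by (simp add: hits_def)
qed

text \<open>
  Before the first coordinate of \<open>B\<close> the form \<open>quad\<close> is the square of a linear functional; afterwards
  it is a weighted \<open>L\<^sub>2\<close> norm, the weight collecting everything to the left of the last coordinate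
  of \<open>B\<close>. The weight is controlled in \<open>L\<^sub>2\<close>.
\<close>

definition weighted :: "nat set \<Rightarrow> nat \<Rightarrow> bool" where
  "weighted B i \<longleftrightarrow> (\<exists>g W. g \<le> i - hits B i \<and> W \<in> bdd_meas M \<and> (\<forall>z\<in>space M. 0 \<le> W z) \<and>
     (\<integral>z. (W z)\<^sup>2 \<partial>M) \<le> (A ^ i * h ^ (2 * (i - hits B i - g)) * kk ^ (hits B i - 1))\<^sup>2 \<and>
     (\<forall>f\<in>bdd_meas M. quad B i f = (\<integral>z. W z * (proj ((S ^^ g) f) z)\<^sup>2 \<partial>M)))"

definition quad_state :: "nat set \<Rightarrow> nat \<Rightarrow> bool" where
  "quad_state B i \<longleftrightarrow> (if hits B i = 0 then
     (\<forall>f\<in>bdd_meas M. quad B i f = (\<integral>z. U z * proj ((S ^^ (i - 1)) f) z \<partial>M)\<^sup>2) else weighted B i)"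

text \<open>When a position with second moment weight \<open>v\<close> belongs to \<open>B\<close>,
  the new weight is \<open>v\<close> times the left part of the chain at that point. If
  \<open>B\<close> was not hit before, the left part is the square of a projected iterate of
  \<open>U\<close>. Otherwise it arises from the old weight by the squared kernel
  \<open>kap g\<close>, where \<open>g\<close> counts the positions passed since the last hit; the
  powers of \<open>h\<close> held back for these positions are paid here, together with one factor
  \<open>kk\<close>.\<close>

lemma weight_step:
  assumes st: "quad_state B (Suc i)" and v: "v \<in> bdd_meas M" "\<And>z. z \<in> space M \<Longrightarrow> 0 \<le> v z \<and> v z \<le> \<Omega>"
  shows "(\<lambda>z. v z * quad B (Suc i) (ker z)) \<in> bdd_meas M"
    and "\<And>z. z \<in> space M \<Longrightarrow> 0 \<le> v z * quad B (Suc i) (ker z)"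
    and "(\<integral>z. (v z * quad B (Suc i) (ker z))\<^sup>2 \<partial>M) \<le>
      (A ^ Suc (Suc i) * h ^ (2 * (Suc i - hits B (Suc i))) * kk ^ hits B (Suc i))\<^sup>2"
proof -
  let ?Q = "\<lambda>z. quad B (Suc i) (ker z)" and ?t = "hits B (Suc i)"
  let ?f = "Suc i - ?t"
  show 1: "(\<lambda>z. v z * ?Q z) \<in> bdd_meas M"
    by (intro bdd_meas_intros v quad_ker_bdd)
  have le: "(\<integral>z. (v z * ?Q z)\<^sup>2 \<partial>M) \<le> \<Omega>\<^sup>2 * (\<integral>z. (?Q z)\<^sup>2 \<partial>M)"
  proof -
    have "(\<integral>z. (v z * ?Q z)\<^sup>2 \<partial>M) \<le> (\<integral>z. \<Omega>\<^sup>2 * (?Q z)\<^sup>2 \<partial>M)"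
      using v(2) by (intro integral_mono bdd_meas_integrable bdd_meas_intros quad_ker_bdd 1)
        (auto simp: power_mult_distrib intro!: mult_right_mono power_mono)
    then show ?thesis by simp
  qed
  have "(\<forall>z\<in>space M. 0 \<le> ?Q z) \<and> (\<integral>z. (?Q z)\<^sup>2 \<partial>M) * \<Omega>\<^sup>2 \<le> (A ^ Suc (Suc i) * h ^ (2 * ?f) * kk ^ ?t)\<^sup>2"
  proof (cases "?t = 0")
    case True
    \<comment> \<open>By symmetry of the chain operator the functional evaluated at
      \<open>ker z\<close> is the value at \<open>z\<close> of a projection, so the integral of
      \<open>?Q\<^sup>2\<close> is a fourth moment.\<close>
    have Q: "?Q z = (proj ((S ^^ i) U) z)\<^sup>2" for z
    proof -
      have "(\<integral>x. U x * proj ((S ^^ i) (ker z)) x \<partial>M) = (\<integral>x. ker z x * proj ((S ^^ i) U) x \<partial>M)"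
        by (rule S_symmetric[OF ker_bdd U])
      also have "\<dots> = proj ((S ^^ i) U) z"
        by (subst integral_ker) (simp_all add: proj_proj)
      finally show ?thesis
        using st True ker_bdd[of z] by (simp add: quad_state_def)
    qed
    have "(\<integral>z. (?Q z)\<^sup>2 \<partial>M) * \<Omega>\<^sup>2 \<le> b ^ Suc i * h ^ (4 * i) * (\<integral>z. U z ^ 4 \<partial>M) * \<Omega>\<^sup>2"
      unfolding Q using proj_S_L4[OF U, of i] by (intro mult_right_mono) auto
    also have "\<dots> \<le> b ^ Suc i * h ^ (4 * i) * (\<Lambda> * h ^ 4) * \<Omega>\<^sup>2"
      using ge1 h U4 by (intro mult_right_mono mult_left_mono) auto
    also have "\<dots> = (b ^ Suc i * \<Lambda> * \<Omega>\<^sup>2) * h ^ (4 * Suc i)"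
      by (simp add: power_add ac_simps)
    also have "\<dots> \<le> (A ^ Suc (Suc i))\<^sup>2 * h ^ (4 * Suc i)"
    proof (rule mult_right_mono)
      \<comment> \<open>Surplus factors \<open>b\<close> and \<open>\<Lambda>\<close>, all at least
        1, are inserted so that everything groups into \<open>b * \<Lambda>\<close> and
        \<open>\<Omega> * b * \<Lambda>\<close>, each at most \<open>A\<close>.\<close>
      have "b ^ Suc i * \<Lambda> * \<Omega>\<^sup>2 \<le> (b ^ Suc i * \<Lambda> ^ Suc i) * (\<Omega> * b * \<Lambda>)\<^sup>2"
      proof (intro mult_mono)
        show "\<Lambda> \<le> \<Lambda> ^ Suc i" using ge1 power_increasing[of 1 "Suc i" \<Lambda>] by simp
        have "\<Omega> * 1 * 1 \<le> \<Omega> * b * \<Lambda>" using ge1 by (intro mult_mono) auto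
        then show "\<Omega>\<^sup>2 \<le> (\<Omega> * b * \<Lambda>)\<^sup>2" using ge1 by (intro power_mono) auto
      qed (use ge1 in auto)
      also have "\<dots> = (b * \<Lambda>) ^ Suc i * (\<Omega> * b * \<Lambda>)\<^sup>2"
        by (simp add: power_mult_distrib)
      also have "\<dots> \<le> A ^ Suc i * A\<^sup>2"
        using A A1 ge1 by (intro mult_mono power_mono) auto
      also have "\<dots> = A ^ (Suc i + 2)"
        by (simp only: power_add)
      also have "\<dots> \<le> A ^ (2 * Suc (Suc i))"
        using A1 by (intro power_increasing) auto
      finally show "b ^ Suc i * \<Lambda> * \<Omega>\<^sup>2 \<le> (A ^ Suc (Suc i))\<^sup>2"
        by (simp only: power_mult[symmetric] mult.commute[of 2])
    qed (use h in auto)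
    also have "\<dots> = (A ^ Suc (Suc i) * h ^ (2 * ?f) * kk ^ ?t)\<^sup>2"
    proof -
      have "h ^ (4 * Suc i) = (h ^ (2 * Suc i))\<^sup>2"
        unfolding power_mult[symmetric] by (rule arg_cong[where f = "(^) h"]) simp
      then show ?thesis
        using True by (simp only: power_mult_distrib) simp
    qed
    finally show ?thesis by (simp add: Q)
  next
    case False
    then obtain g W where W: "g \<le> ?f" "W \<in> bdd_meas M" "\<forall>z\<in>space M. 0 \<le> W z"
      "(\<integral>z. (W z)\<^sup>2 \<partial>M) \<le> (A ^ Suc i * h ^ (2 * (?f - g)) * kk ^ (?t - 1))\<^sup>2"
      "\<forall>f\<in>bdd_meas M. quad B (Suc i) f = (\<integral>z. W z * (proj ((S ^^ g) f) z)\<^sup>2 \<partial>M)"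
      using st unfolding quad_state_def weighted_def by auto
    have Q: "?Q z = (\<integral>y. (kap g z y)\<^sup>2 * W y \<partial>M)" for z
      using W(5) ker_bdd[of z] by (simp add: kap_def mult.commute)
    \<comment> \<open>The row bound of \<open>kap g\<close>. Its square appears because the L2 norm
      of the new weight is estimated squared.\<close>
    let ?s = "h ^ (2 * g) * (c0 * kk)"
    have "(\<integral>z. (?Q z)\<^sup>2 \<partial>M) * \<Omega>\<^sup>2 \<le> ?s\<^sup>2 * (\<integral>y. (W y)\<^sup>2 \<partial>M) * \<Omega>\<^sup>2"
      unfolding Q using kap_L2[OF h(2) K(1)] h K
      by (intro mult_right_mono kap_Schur W(2)) auto
    also have "\<dots> \<le> ?s\<^sup>2 * (A ^ Suc i * h ^ (2 * (?f - g)) * kk ^ (?t - 1))\<^sup>2 * \<Omega>\<^sup>2"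
      using W(4) by (intro mult_right_mono mult_left_mono) auto
    also have "\<dots> = (\<Omega> * c0 * A ^ Suc i * (h ^ (2 * g) * h ^ (2 * (?f - g))) * (kk * kk ^ (?t - 1)))\<^sup>2"
      by (simp add: power_mult_distrib ac_simps)
    also have "\<dots> = (\<Omega> * c0 * A ^ Suc i * h ^ (2 * ?f) * kk ^ ?t)\<^sup>2"
    proof -
      have "h ^ (2 * g) * h ^ (2 * (?f - g)) = h ^ (2 * ?f)"
        unfolding power_add[symmetric] using W(1) by (intro arg_cong[where f = "(^) h"]) simp
      moreover have "kk * kk ^ (?t - 1) = kk ^ ?t"
        using False by (simp add: power_eq_if)
      ultimately show ?thesis by simp
    qed
    also have "\<dots> \<le> (A * A ^ Suc i * h ^ (2 * ?f) * kk ^ ?t)\<^sup>2"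
      using A A1 ge1 K h by (intro power_mono mult_right_mono) auto
    finally have "(\<integral>z. (?Q z)\<^sup>2 \<partial>M) * \<Omega>\<^sup>2 \<le> (A ^ Suc (Suc i) * h ^ (2 * ?f) * kk ^ ?t)\<^sup>2"
      by simp
    moreover have "\<forall>z\<in>space M. 0 \<le> ?Q z"
      unfolding Q using W(3) by (auto intro!: Bochner_Integration.integral_nonneg_AE)
    ultimately show ?thesis by simp
  qed
  then show "\<And>z. z \<in> space M \<Longrightarrow> 0 \<le> v z * ?Q z"
    and "(\<integral>z. (v z * ?Q z)\<^sup>2 \<partial>M) \<le> (A ^ Suc (Suc i) * h ^ (2 * ?f) * kk ^ ?t)\<^sup>2"
    using v(2) le by (auto simp: mult.commute)
qed

text \<open>Induction along the chain. A hit resets the count \<open>g\<close> to 0 and updates the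
  weight by \<open>weight_step\<close>; a position outside \<open>B\<close> leaves the weight
  unchanged and only lengthens the operator applied to the test function, to be paid at the next hit
  or at the end. The first hit creates a weight without a factor \<open>kk\<close> if it is at
  position 1, where \<open>w1\<close> itself is the weight.\<close>

lemma quad_state_holds: "quad_state B (Suc i)"
proof (induction i)
  case 0
  show ?case
  proof (cases "1 \<in> B")
    case True
    have hit: "hits B 1 = 1"
      using True hits_Suc[of B 0] by (simp add: hits_def)
    have "(\<integral>z. (w1 z)\<^sup>2 \<partial>M) \<le> (\<integral>z. \<Omega>\<^sup>2 \<partial>M)"
      using w by (intro integral_mono bdd_meas_integrable bdd_meas_intros w1) (auto intro!: power_mono)
    also have "\<dots> \<le> m0\<^sup>2 * \<Omega>\<^sup>2"
      using mass ge1 power_increasing[of 1 2 m0] by (simp add: mult_right_mono)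
    also have "\<dots> \<le> A\<^sup>2"
      using A ge1 by (simp add: power_mult_distrib[symmetric] mult.commute power_mono)
    finally have "weighted B 1"
      unfolding weighted_def using quad_0 True hit w w1
      by (intro exI[of _ 0] exI[of _ w1]) auto
    then show ?thesis using hit by (simp add: quad_state_def)
  next
    case False
    then have "hits B 1 = 0"
      using hits_Suc[of B 0] by (simp add: hits_def)
    then show ?thesis using quad_0[of _ B] False by (simp add: quad_state_def)
  qed
next
  case (Suc i)
  let ?t = "hits B (Suc i)"
  show ?case
  proof (cases "Suc (Suc i) \<in> B")
    case True
    let ?W = "\<lambda>z. w2 z * quad B (Suc i) (ker z)"
    have hit: "hits B (Suc (Suc i)) = Suc ?t"
      using True by (simp add: hits_Suc)
    note W = weight_step[OF Suc w2 w(2)]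
    have "quad B (Suc (Suc i)) f = (\<integral>z. ?W z * (proj f z)\<^sup>2 \<partial>M)" if "f \<in> bdd_meas M" for f
      using quad_Suc[OF that, of B i] True by (simp add: ac_simps)
    then have "weighted B (Suc (Suc i))"
      unfolding weighted_def hit using W
      by (intro exI[of _ 0] exI[of _ ?W]) auto
    then show ?thesis using hit by (simp add: quad_state_def)
  next
    case False
    have hit: "hits B (Suc (Suc i)) = ?t"
      using False by (simp add: hits_Suc[of B "Suc i"])
    have q: "quad B (Suc (Suc i)) f = quad B (Suc i) (S f)" if "f \<in> bdd_meas M" for f
      using quad_Suc[OF that, of B i] False by simp
    show ?thesis
    proof (cases "?t = 0")
      case True
      then show ?thesis
        using Suc q hit by (simp add: quad_state_def funpow_swap1)
    next
      case False
      then obtain g W where W: "g \<le> Suc i - ?t" "W \<in> bdd_meas M" "\<forall>z\<in>space M. 0 \<le> W z"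
        "(\<integral>z. (W z)\<^sup>2 \<partial>M) \<le> (A ^ Suc i * h ^ (2 * (Suc i - ?t - g)) * kk ^ (?t - 1))\<^sup>2"
        "\<forall>f\<in>bdd_meas M. quad B (Suc i) f = (\<integral>z. W z * (proj ((S ^^ g) f) z)\<^sup>2 \<partial>M)"
        using Suc unfolding quad_state_def weighted_def by auto
      have "Suc (Suc i) - ?t - Suc g = Suc i - ?t - g" "Suc g \<le> Suc (Suc i) - ?t"
        using W(1) hits_le[of B "Suc i"] by auto
      moreover have "(A ^ Suc i * h ^ (2 * (Suc i - ?t - g)) * kk ^ (?t - 1))\<^sup>2 \<le>
          (A ^ Suc (Suc i) * h ^ (2 * (Suc i - ?t - g)) * kk ^ (?t - 1))\<^sup>2"
        using A1 h K by (intro power_mono mult_right_mono power_increasing) auto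
      moreover have "\<forall>f\<in>bdd_meas M. quad B (Suc (Suc i)) f = (\<integral>z. W z * (proj ((S ^^ Suc g) f) z)\<^sup>2 \<partial>M)"
        using W(5) q by (simp add: funpow_swap1)
      ultimately have "weighted B (Suc (Suc i))"
        unfolding weighted_def hit using W
        by (intro exI[of _ "Suc g"] exI[of _ W]) (auto intro: order_trans)
      then show ?thesis using hit False by (simp add: quad_state_def)
    qed
  qed
qed

text \<open>If the last position is in \<open>B\<close>, the final weight is integrated against 1,
  which costs the total mass. If it is not, the current weight is paired with the square of a
  projected iterate of \<open>V\<close>. At one end or the other one hit comes without a factor
  \<open>kk\<close>, whence the exponent \<open>card B - 1\<close>.\<close>

lemma quad_end_bound:
  assumes B: "B \<subseteq> {1..Suc (Suc i)}" "B \<noteq> {}"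
  shows "(if Suc (Suc i) \<in> B then \<integral>z. w3 z * quad B (Suc i) (ker z) \<partial>M else quad B (Suc i) V)
    \<le> A ^ (2 * Suc (Suc i) + 1) * h ^ (2 * (Suc (Suc i) - card B)) * kk ^ (card B - 1)"
proof -
  let ?j = "Suc (Suc i)" and ?t = "hits B (Suc i)"
  have "hits B ?j = card B"
    using B by (simp add: hits_def Int_absorb2)
  then have l: "card B = (if ?j \<in> B then Suc ?t else ?t)"
    by (simp add: hits_Suc)
  show ?thesis
  proof (cases "?j \<in> B")
    case True
    let ?W = "\<lambda>z. w3 z * quad B (Suc i) (ker z)"
    let ?b = "A ^ ?j * h ^ (2 * (Suc i - ?t)) * kk ^ ?t"
    note W = weight_step[OF quad_state_holds[of B i] w3 w(3)]
    have "(\<integral>z. ?W z \<partial>M)\<^sup>2 = (\<integral>z. 1 * ?W z \<partial>M)\<^sup>2" by simp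
    also have "\<dots> \<le> (\<integral>z. 1\<^sup>2 \<partial>M) * (\<integral>z. (?W z)\<^sup>2 \<partial>M)"
      by (intro bdd_meas_Cauchy_Schwarz W bdd_meas_const)
    also have "\<dots> \<le> m0\<^sup>2 * ?b\<^sup>2"
      using W(3) mass ge1 power_increasing[of 1 2 m0] by (intro mult_mono) auto
    also have "\<dots> = (m0 * ?b)\<^sup>2"
      by (simp add: power_mult_distrib)
    finally have "(\<integral>z. ?W z \<partial>M) \<le> m0 * ?b"
      by (rule power2_le_imp_le)
        (intro mult_nonneg_nonneg zero_le_power; use ge1 A1(1) h(1) K(3) in linarith)
    also have "\<dots> \<le> A * ?b"
      by (intro mult_right_mono A1(3) mult_nonneg_nonneg zero_le_power; use A1(1) h(1) K(3) in linarith)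
    also have "\<dots> = A ^ (?j + 1) * h ^ (2 * (Suc i - ?t)) * kk ^ ?t"
      by simp
    also have "\<dots> \<le> A ^ (2 * ?j + 1) * h ^ (2 * (Suc i - ?t)) * kk ^ ?t"
    proof (intro mult_right_mono)
      show "A ^ (?j + 1) \<le> A ^ (2 * ?j + 1)"
        by (rule power_increasing) (use A1(1) in simp_all)
    qed (use h(1) K(3) in simp_all)
    finally show ?thesis using True l by simp
  next
    case False
    then have "card B = ?t" using l by simp
    moreover have "card B \<noteq> 0"
      using B finite_subset[OF B(1)] by simp
    ultimately have t: "card B = ?t" "?t \<noteq> 0" by auto
    then obtain g W where W: "g \<le> Suc i - ?t" "W \<in> bdd_meas M" "\<forall>z\<in>space M. 0 \<le> W z"
      "(\<integral>z. (W z)\<^sup>2 \<partial>M) \<le> (A ^ Suc i * h ^ (2 * (Suc i - ?t - g)) * kk ^ (?t - 1))\<^sup>2"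
      "\<forall>f\<in>bdd_meas M. quad B (Suc i) f = (\<integral>z. W z * (proj ((S ^^ g) f) z)\<^sup>2 \<partial>M)"
      using quad_state_holds[of B i] unfolding quad_state_def weighted_def by auto
    let ?b = "A ^ Suc i * h ^ (2 * (Suc i - ?t - g)) * kk ^ (?t - 1)"
    let ?R = "\<lambda>z. proj ((S ^^ g) V) z"
    have "(quad B (Suc i) V)\<^sup>2 = (\<integral>z. W z * (?R z)\<^sup>2 \<partial>M)\<^sup>2"
      using W(5) V by simp
    \<comment> \<open>The weight is known in L2 and meets a square, so the error of \<open>b\<close>
      is needed in L4.\<close>
    also have "\<dots> \<le> (\<integral>z. (W z)\<^sup>2 \<partial>M) * (\<integral>z. ((?R z)\<^sup>2)\<^sup>2 \<partial>M)"
      by (intro bdd_meas_Cauchy_Schwarz W(2) bdd_meas_intros proj_bdd)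
    also have "\<dots> \<le> ?b\<^sup>2 * (b ^ Suc g * h ^ (4 * g) * (\<integral>z. V z ^ 4 \<partial>M))"
      using proj_S_L4[OF V, of g] W(4) by (intro mult_mono) auto
    also have "\<dots> \<le> ?b\<^sup>2 * (b ^ Suc g * h ^ (4 * g) * (\<Lambda> * h ^ 4))"
      using V4 ge1 h by (intro mult_left_mono) auto
    also have "\<dots> = ?b\<^sup>2 * (b ^ Suc g * \<Lambda> * (h ^ (2 * Suc g))\<^sup>2)"
    proof -
      have "h ^ (4 * g) * h ^ 4 = (h ^ (2 * Suc g))\<^sup>2"
        unfolding power_mult[symmetric] power_add[symmetric] by (rule arg_cong[where f = "(^) h"]) simp
      moreover have "x * y * (z * w) = x * z * (y * w)" for x y z w :: real
        by simp
      ultimately show ?thesis by (simp only:)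
    qed
    also have "\<dots> \<le> ?b\<^sup>2 * ((A ^ Suc g)\<^sup>2 * (h ^ (2 * Suc g))\<^sup>2)"
    proof (intro mult_left_mono mult_right_mono)
      have "b ^ Suc g * \<Lambda> \<le> b ^ Suc g * \<Lambda> ^ Suc g"
        using ge1 power_increasing[of 1 "Suc g" \<Lambda>] by (intro mult_left_mono) auto
      also have "\<dots> = (b * \<Lambda>) ^ Suc g"
        by (simp add: power_mult_distrib)
      also have "\<dots> \<le> A ^ Suc g"
        using A1 ge1 by (intro power_mono) auto
      also have "\<dots> \<le> A ^ (Suc g * 2)"
        using A1 by (intro power_increasing) auto
      finally show "b ^ Suc g * \<Lambda> \<le> (A ^ Suc g)\<^sup>2"
        by (simp only: power_mult)
    qed auto
    also have "\<dots> = (A ^ (Suc i + Suc g) * (h ^ (2 * (Suc i - ?t - g)) * h ^ (2 * Suc g)) * kk ^ (?t - 1))\<^sup>2"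
      by (simp add: power_mult_distrib power_add ac_simps)
    also have "h ^ (2 * (Suc i - ?t - g)) * h ^ (2 * Suc g) = h ^ (2 * (?j - ?t))"
    proof -
      \<comment> \<open>The positions outside \<open>B\<close> split into those left of the last
        hit, the \<open>g\<close> inner ones after it, and the last position, which contributes
        through \<open>V\<close>.\<close>
      have "2 * (Suc i - ?t - g) + 2 * Suc g = 2 * (?j - ?t)"
        using W(1) hits_le[of B "Suc i"] by simp
      then show ?thesis by (simp only: power_add[symmetric])
    qed
    finally have "quad B (Suc i) V \<le> A ^ (Suc i + Suc g) * h ^ (2 * (?j - ?t)) * kk ^ (?t - 1)"
      by (rule power2_le_imp_le)
        (intro mult_nonneg_nonneg zero_le_power; use A1(1) h(1) K(3) in linarith)
    also have "\<dots> \<le> A ^ (2 * ?j + 1) * h ^ (2 * (?j - ?t)) * kk ^ (?t - 1)"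
    proof (intro mult_right_mono)
      show "A ^ (Suc i + Suc g) \<le> A ^ (2 * ?j + 1)"
        by (rule power_increasing) (use A1(1) W(1) in simp_all)
    qed (use h(1) K(3) in simp_all)
    finally show ?thesis using False t by simp
  qed
qed

end

text \<open>For a product function the signed sum over subsets is the expansion of the product of
  the differences between each factor and its mean. Taking the degenerate part therefore keeps the
  tensor form.\<close>

lemma (in tensor_family) degen_tensor:
  assumes J: "J = {1..j}"
  shows "degen P j (tensor R J \<eta>) = tensor R J (\<lambda>q i x. \<eta> q i x - (\<integral>y. \<eta> q i y \<partial>P))"
proof
  fix x
  let ?m = "\<lambda>q i. \<integral>y. \<eta> q i y \<partial>P"
  have ce: "cond_exp_iid P j B (tensor R J \<eta>) x = (\<Sum>q\<in>R. (\<Prod>i\<in>B. \<eta> q i (x i)) * (\<Prod>i\<in>J - B. ?m q i))"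
    if B: "B \<subseteq> J" for B
  proof -
    let ?F = "\<lambda>q i y. if i \<in> B then \<eta> q i (x i) else \<eta> q i y"
    have F: "?F q i \<in> bdd_meas P" if "q \<in> R" "i \<in> J" for q i
      using eta[OF that] by (cases "i \<in> B") auto
    have "cond_exp_iid P j B (tensor R J \<eta>) x = (\<integral>y. (\<Sum>q\<in>R. \<Prod>i\<in>J. ?F q i (y i)) \<partial>PiM J (\<lambda>_. P))"
      unfolding cond_exp_iid_def tensor_def J
      by (intro Bochner_Integration.integral_cong refl sum.cong prod.cong) auto
    also have "\<dots> = (\<Sum>q\<in>R. \<Prod>i\<in>J. \<integral>y. ?F q i y \<partial>P)"
      using F finJ by (subst Bochner_Integration.integral_sum)
        (auto intro!: PiM_prod_integral sum.cong simp del: if_image_distrib)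
    also have "\<dots> = (\<Sum>q\<in>R. \<Prod>i\<in>J. if i \<in> B then \<eta> q i (x i) else ?m q i)"
      by (intro sum.cong prod.cong refl) (auto simp: prob_space)
    also have "\<dots> = (\<Sum>q\<in>R. (\<Prod>i\<in>B. \<eta> q i (x i)) * (\<Prod>i\<in>J - B. ?m q i))"
      using B by (intro sum.cong refl, subst prod.If_cases[OF finJ])
        (simp add: Int_absorb1 Diff_eq Compl_eq)
    finally show ?thesis .
  qed
  have "degen P j (tensor R J \<eta>) x = (\<Sum>B\<in>Pow J. \<Sum>q\<in>R. (-1) ^ (j - card B) *
      ((\<Prod>i\<in>B. \<eta> q i (x i)) * (\<Prod>i\<in>J - B. ?m q i)))"
    unfolding degen_def J[symmetric] by (intro sum.cong refl) (simp add: ce sum_distrib_left)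
  also have "\<dots> = (\<Sum>q\<in>R. \<Sum>B\<in>Pow J. (\<Prod>i\<in>B. \<eta> q i (x i)) * (\<Prod>i\<in>J - B. - ?m q i))"
  proof (subst sum.swap, intro sum.cong refl)
    fix q B assume "B \<in> Pow J"
    then have "card (J - B) = j - card B"
      using card_Diff_subset[of B J] finite_subset[of B J] by (auto simp: J)
    then have "(\<Prod>i\<in>J - B. - ?m q i) = (-1) ^ (j - card B) * (\<Prod>i\<in>J - B. ?m q i)"
      using prod.distrib[of "\<lambda>_. -1" "?m q" "J - B"] by simp
    then show "(-1) ^ (j - card B) * ((\<Prod>i\<in>B. \<eta> q i (x i)) * (\<Prod>i\<in>J - B. ?m q i)) =
        (\<Prod>i\<in>B. \<eta> q i (x i)) * (\<Prod>i\<in>J - B. - ?m q i)"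
      by simp
  qed
  also have "\<dots> = tensor R J (\<lambda>q i x. \<eta> q i x - ?m q i) x"
    unfolding tensor_def using prod_add[OF finJ, of "\<lambda>i. \<eta> _ i (x i)" "\<lambda>i. - ?m _ i"]
    by (intro sum.cong refl) simp
  finally show "degen P j (tensor R J \<eta>) x = tensor R J (\<lambda>q i x. \<eta> q i x - ?m q i) x" .
qed

text \<open>Describes the two laws through integrals of the factors against functions of the
  location \<open>\<zeta> x\<close>. The end factors \<open>\<alpha>\<close> and
  \<open>\<beta>\<close> have conditional mean zero under \<open>Q\<close>; \<open>\<gamma>\<close>
  has not, so for it the difference of the two integrals is prescribed.\<close>

locale chain_model = chain_sum M D \<phi> N U V w1 w2 w3
  for M :: "'z measure" and D \<phi> N U V w1 w2 w3 +
  fixes P Q :: "'x measure" and \<alpha> \<gamma> \<beta> :: "'x \<Rightarrow> real" and \<zeta> :: "'x \<Rightarrow> 'z"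
  assumes prob_P: "prob_space P" and prob_Q: "prob_space Q" and sets_PQ: "sets P = sets Q"
    and \<zeta>: "\<zeta> \<in> measurable P M"
    and bm: "\<alpha> \<in> bdd_meas P" "\<gamma> \<in> bdd_meas P" "\<beta> \<in> bdd_meas P"
    and P\<alpha>: "\<And>f. f \<in> bdd_meas M \<Longrightarrow> (\<integral>x. \<alpha> x * f (\<zeta> x) \<partial>P) = (\<integral>z. U z * f z \<partial>M)"
    and Q\<alpha>: "\<And>f. f \<in> bdd_meas M \<Longrightarrow> (\<integral>x. \<alpha> x * f (\<zeta> x) \<partial>Q) = 0"
    and PQ\<gamma>: "\<And>f. f \<in> bdd_meas M \<Longrightarrow>
      (\<integral>x. \<gamma> x * f (\<zeta> x) \<partial>P) - (\<integral>x. \<gamma> x * f (\<zeta> x) \<partial>Q) = (\<integral>z. N z * f z \<partial>M)"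
    and P\<beta>: "\<And>f. f \<in> bdd_meas M \<Longrightarrow> (\<integral>x. \<beta> x * f (\<zeta> x) \<partial>P) = (\<integral>z. V z * f z \<partial>M)"
    and Q\<beta>: "\<And>f. f \<in> bdd_meas M \<Longrightarrow> (\<integral>x. \<beta> x * f (\<zeta> x) \<partial>Q) = 0"
    and Q\<alpha>2: "\<And>f. f \<in> bdd_meas M \<Longrightarrow> (\<integral>x. (\<alpha> x)\<^sup>2 * f (\<zeta> x) \<partial>Q) = (\<integral>z. w1 z * f z \<partial>M)"
    and Q\<gamma>2: "\<And>f. f \<in> bdd_meas M \<Longrightarrow> (\<integral>x. (\<gamma> x)\<^sup>2 * f (\<zeta> x) \<partial>Q) = (\<integral>z. w2 z * f z \<partial>M)"
    and Q\<beta>2: "\<And>f. f \<in> bdd_meas M \<Longrightarrow> (\<integral>x. (\<beta> x)\<^sup>2 * f (\<zeta> x) \<partial>Q) = (\<integral>z. w3 z * f z \<partial>M)"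
begin

text \<open>Each link index is shared by two neighbouring positions: an inner position carries two
  basis functions, the two ends carry one.\<close>

definition psi :: "nat \<Rightarrow> (nat \<Rightarrow> nat) \<Rightarrow> nat \<Rightarrow> 'x \<Rightarrow> real" where
  "psi j q i x = (if i = 1 then \<alpha> x * \<phi> (q 1) (\<zeta> x)
     else if i = j then \<beta> x * \<phi> (q (i - 1)) (\<zeta> x)
     else \<gamma> x * (\<phi> (q (i - 1)) (\<zeta> x) * \<phi> (q i) (\<zeta> x)))"

abbreviation paths :: "nat \<Rightarrow> (nat \<Rightarrow> nat) set" where
  "paths i \<equiv> {1..i} \<rightarrow>\<^sub>E D"

lemma psi_bdd:
  assumes "q \<in> paths (Suc n)" "i \<in> {1..Suc (Suc n)}"
  shows "psi (Suc (Suc n)) q i \<in> bdd_meas P"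
proof -
  have *: "(\<lambda>x. \<phi> a (\<zeta> x)) \<in> bdd_meas P" if "a \<in> D" for a
    using bdd_meas_comp[OF phi[OF that] \<zeta>] .
  have D: "q i' \<in> D" if "i' \<in> {1..Suc n}" for i'
    using assms(1) that by auto
  show ?thesis
  proof (cases "i = 1 \<or> i = Suc (Suc n)")
    case True
    then show ?thesis
      unfolding psi_def using assms D[of "i - 1"] D[of 1]
      by (auto intro!: bdd_meas_intros bm *)
  next
    case False
    then have "i - 1 \<in> {1..Suc n}" "i \<in> {1..Suc n}"
      using assms(2) by auto
    then show ?thesis
      unfolding psi_def using False
      by (auto intro!: bdd_meas_intros bm * D simp del: One_nat_def)
  qed
qed

lemma psi_mean_diff:
  assumes "q \<in> paths (Suc n)" "i \<in> {1..Suc (Suc n)}"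
  shows "(\<integral>x. psi (Suc (Suc n)) q i x \<partial>P) - (\<integral>x. psi (Suc (Suc n)) q i x \<partial>Q) =
    (if i = Suc (Suc n) then coef V (q (Suc n)) else lin_step i q)"
proof -
  have D: "q i' \<in> D" if "i' \<in> {1..Suc n}" for i'
    using assms(1) that by auto
  consider "i = 1" | "i = Suc (Suc n)" | "i \<in> {2..Suc n}"
    using assms(2) by force
  then show ?thesis
  proof cases
    case 1
    then show ?thesis
      using D[of 1] by (simp add: psi_def lin_step_def P\<alpha> Q\<alpha> phi coef_def mult.commute)
  next
    case 2
    then show ?thesis
      using D[of "Suc n"] by (simp add: psi_def P\<beta> Q\<beta> phi coef_def mult.commute)
  next
    case 3
    then have i: "i \<noteq> 1" "i \<noteq> Suc (Suc n)" "i - 1 \<in> {1..Suc n}" "i \<in> {1..Suc n}"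
      by auto
    then have "q (i - 1) \<in> D" "q i \<in> D"
      using D by blast+
    with i(1,2) have "i \<noteq> 1" "i \<noteq> Suc (Suc n)" "q (i - 1) \<in> D" "q i \<in> D" .
    then show ?thesis
      using PQ\<gamma>[of "\<lambda>z. \<phi> (q (i - 1)) z * \<phi> (q i) z"]
      by (simp add: psi_def lin_step_def phi coef_def bdd_meas_mult ac_simps)
  qed
qed

lemma psi_second_moment:
  assumes "q \<in> paths (Suc n)" "q' \<in> paths (Suc n)" "i \<in> {1..Suc (Suc n)}" "i \<in> B"
  shows "(\<integral>x. psi (Suc (Suc n)) q i x * psi (Suc (Suc n)) q' i x \<partial>Q) =
    (if i = Suc (Suc n) then \<integral>z. w3 z * (\<phi> (q (Suc n)) z * \<phi> (q' (Suc n)) z) \<partial>M else quad_step B i q q')"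
proof -
  have D: "q i' \<in> D" "q' i' \<in> D" if "i' \<in> {1..Suc n}" for i'
    using assms(1,2) that by auto
  consider "i = 1" | "i = Suc (Suc n)" | "i \<in> {2..Suc n}"
    using assms(3) by force
  then show ?thesis
  proof cases
    case 1
    then show ?thesis
      using D[of 1] Q\<alpha>2[of "\<lambda>z. \<phi> (q 1) z * \<phi> (q' 1) z"] assms(4)
      by (simp add: psi_def quad_step_def phi bdd_meas_mult power2_eq_square ac_simps)
  next
    case 2
    then show ?thesis
      using D[of "Suc n"] Q\<beta>2[of "\<lambda>z. \<phi> (q (Suc n)) z * \<phi> (q' (Suc n)) z"]
      by (simp add: psi_def phi bdd_meas_mult power2_eq_square ac_simps)
  next
    case 3
    then have i: "i \<noteq> 1" "i \<noteq> Suc (Suc n)" "i - 1 \<in> {1..Suc n}" "i \<in> {1..Suc n}"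
      by auto
    then have "q (i - 1) \<in> D" "q i \<in> D" "q' (i - 1) \<in> D" "q' i \<in> D"
      using D by blast+
    with i(1,2) have "i \<noteq> 1" "i \<noteq> Suc (Suc n)" "q (i - 1) \<in> D" "q i \<in> D" "q' (i - 1) \<in> D" "q' i \<in> D" .
    then show ?thesis
      using Q\<gamma>2[of "\<lambda>z. \<phi> (q (i - 1)) z * \<phi> (q i) z * (\<phi> (q' (i - 1)) z * \<phi> (q' i) z)"] assms(4)
      by (simp add: psi_def quad_step_def phi bdd_meas_mult power2_eq_square ac_simps)
  qed
qed

lemma mean_sum:
  "(\<Sum>q\<in>paths (Suc n). \<Prod>i\<in>{1..Suc (Suc n)}.
      (\<integral>x. psi (Suc (Suc n)) q i x \<partial>P) - (\<integral>x. psi (Suc (Suc n)) q i x \<partial>Q)) =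
    (\<integral>z. U z * proj ((S ^^ n) V) z \<partial>M)"
proof -
  have "(\<Sum>q\<in>paths (Suc n). \<Prod>i\<in>{1..Suc (Suc n)}.
      (\<integral>x. psi (Suc (Suc n)) q i x \<partial>P) - (\<integral>x. psi (Suc (Suc n)) q i x \<partial>Q)) =
    (\<Sum>q\<in>paths (Suc n). (\<Prod>i\<in>{1..Suc n}. lin_step i q) * coef V (q (Suc n)))"
  proof (intro sum.cong refl)
    fix q assume q: "q \<in> paths (Suc n)"
    have "(\<Prod>i\<in>{1..Suc (Suc n)}. (\<integral>x. psi (Suc (Suc n)) q i x \<partial>P) - (\<integral>x. psi (Suc (Suc n)) q i x \<partial>Q)) =
      (\<Prod>i\<in>{1..Suc (Suc n)}. if i = Suc (Suc n) then coef V (q (Suc n)) else lin_step i q)"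
      by (intro prod.cong refl psi_mean_diff q)
    also have "\<dots> = (\<Prod>i\<in>{1..Suc n}. lin_step i q) * coef V (q (Suc n))"
      by (subst prod.nat_ivl_Suc') (auto simp: mult.commute intro!: prod.cong)
    finally show "(\<Prod>i\<in>{1..Suc (Suc n)}. (\<integral>x. psi (Suc (Suc n)) q i x \<partial>P) - (\<integral>x. psi (Suc (Suc n)) q i x \<partial>Q)) =
      (\<Prod>i\<in>{1..Suc n}. lin_step i q) * coef V (q (Suc n))" .
  qed
  also have "\<dots> = (\<integral>z. U z * proj ((S ^^ n) V) z \<partial>M)"
    by (rule lin_sum[OF V])
  finally show ?thesis .
qed

text \<open>The last position lies outside the range of \<open>quad\<close> and is treated as its
  closing. If it belongs to \<open>B\<close> the two open ends are joined by integrating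
  \<open>ker z\<close> against \<open>w3\<close>; if not, each is closed by
  \<open>V\<close>.\<close>

lemma moment_sum:
  "(\<Sum>q\<in>paths (Suc n). \<Sum>q'\<in>paths (Suc n). \<Prod>i\<in>{1..Suc (Suc n)}.
      if i \<in> B then \<integral>x. psi (Suc (Suc n)) q i x * psi (Suc (Suc n)) q' i x \<partial>Q
      else ((\<integral>x. psi (Suc (Suc n)) q i x \<partial>P) - (\<integral>x. psi (Suc (Suc n)) q i x \<partial>Q)) *
           ((\<integral>x. psi (Suc (Suc n)) q' i x \<partial>P) - (\<integral>x. psi (Suc (Suc n)) q' i x \<partial>Q))) =
   (if Suc (Suc n) \<in> B then \<integral>z. w3 z * quad B (Suc n) (ker z) \<partial>M else quad B (Suc n) V)"
  (is "?lhs = ?rhs")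
proof -
  let ?j = "Suc (Suc n)"
  let ?e = "\<lambda>q q'. if ?j \<in> B then \<integral>z. w3 z * (\<phi> (q (Suc n)) z * \<phi> (q' (Suc n)) z) \<partial>M
     else coef V (q (Suc n)) * coef V (q' (Suc n))"
  have "?lhs = (\<Sum>q\<in>paths (Suc n). \<Sum>q'\<in>paths (Suc n). (\<Prod>i\<in>{1..Suc n}. quad_step B i q q') * ?e q q')"
  proof (intro sum.cong refl)
    fix q q' assume q: "q \<in> paths (Suc n)" "q' \<in> paths (Suc n)"
    have "(\<Prod>i\<in>{1..Suc (Suc n)}.
      if i \<in> B then \<integral>x. psi (Suc (Suc n)) q i x * psi (Suc (Suc n)) q' i x \<partial>Q
      else ((\<integral>x. psi (Suc (Suc n)) q i x \<partial>P) - (\<integral>x. psi (Suc (Suc n)) q i x \<partial>Q)) *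
           ((\<integral>x. psi (Suc (Suc n)) q' i x \<partial>P) - (\<integral>x. psi (Suc (Suc n)) q' i x \<partial>Q))) =
      (\<Prod>i\<in>{1..?j}. if i = ?j then ?e q q' else quad_step B i q q')" (is "?l = _")
    proof (intro prod.cong refl)
      fix i assume i: "i \<in> {1..?j}"
      show "(if i \<in> B then \<integral>x. psi (Suc (Suc n)) q i x * psi (Suc (Suc n)) q' i x \<partial>Q
      else ((\<integral>x. psi (Suc (Suc n)) q i x \<partial>P) - (\<integral>x. psi (Suc (Suc n)) q i x \<partial>Q)) *
           ((\<integral>x. psi (Suc (Suc n)) q' i x \<partial>P) - (\<integral>x. psi (Suc (Suc n)) q' i x \<partial>Q))) =
        (if i = ?j then ?e q q' else quad_step B i q q')"
        unfolding psi_mean_diff[OF q(1) i] psi_mean_diff[OF q(2) i]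
        using psi_second_moment[OF q i, of B]
        by (cases "i = ?j"; cases "i \<in> B") (simp_all add: quad_step_def)
    qed
    also have "\<dots> = (\<Prod>i\<in>{1..Suc n}. quad_step B i q q') * ?e q q'"
      by (subst prod.nat_ivl_Suc') (auto simp: mult.commute intro!: prod.cong)
    finally show "?l = (\<Prod>i\<in>{1..Suc n}. quad_step B i q q') * ?e q q'" .
  qed
  also have "\<dots> = ?rhs"
    using quad_ker_integral[OF w3, of B n] by (simp add: quad_def)
  finally show ?thesis .
qed

text \<open>The product of the kernels over the links is expanded into a sum over paths, and the
  basis functions are then regrouped from links to positions.\<close>

lemma chain_tensor:
  "\<alpha> (x 1) * (\<Prod>i=1..<Suc (Suc n). ker (\<zeta> (x i)) (\<zeta> (x (Suc i)))) *
     (\<Prod>i=2..<Suc (Suc n). \<gamma> (x i)) * \<beta> (x (Suc (Suc n))) =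
   tensor (paths (Suc n)) {1..Suc (Suc n)} (psi (Suc (Suc n))) x"
proof -
  let ?j = "Suc (Suc n)"
  let ?F = "\<lambda>q i. \<phi> (q i) (\<zeta> (x i))" and ?G = "\<lambda>q i. \<phi> (q (i - 1)) (\<zeta> (x i))"
  have iv: "{1..<?j} = {1..Suc n}" "{2..<?j} = {2..Suc n}"
    by auto
  have ker: "(\<Prod>i=1..<?j. ker (\<zeta> (x i)) (\<zeta> (x (Suc i)))) =
      (\<Sum>q\<in>paths (Suc n). \<Prod>i=1..Suc n. ?F q i * ?G q (Suc i))"
    unfolding ker_def iv by (subst prod_sum_PiE) (auto simp: finD)
  have "\<alpha> (x 1) * (\<Prod>i=1..Suc n. ?F q i * ?G q (Suc i)) * (\<Prod>i=2..Suc n. \<gamma> (x i)) * \<beta> (x ?j) =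
      (\<Prod>i\<in>{1..?j}. psi ?j q i (x i))" for q
  proof -
    have F: "(\<Prod>i=1..Suc n. ?F q i) = ?F q 1 * (\<Prod>i=2..Suc n. ?F q i)"
      by (subst prod.atLeast_Suc_atMost) (auto simp: numeral_2_eq_2)
    have "(\<Prod>i=1..Suc n. ?G q (Suc i)) = (\<Prod>i=2..?j. ?G q i)"
      using prod.shift_bounds_cl_Suc_ivl[of "?G q" 1 "Suc n"] by (simp only: Suc_1)
    also have "\<dots> = (\<Prod>i=2..Suc n. ?G q i) * ?G q ?j"
      by (subst prod.nat_ivl_Suc') (simp, rule mult.commute)
    finally have G: "(\<Prod>i=1..Suc n. ?G q (Suc i)) = (\<Prod>i=2..Suc n. ?G q i) * ?G q ?j" .
    have "(\<Prod>i\<in>{1..?j}. psi ?j q i (x i)) = psi ?j q 1 (x 1) * (\<Prod>i=2..?j. psi ?j q i (x i))"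
      by (subst prod.atLeast_Suc_atMost) (auto simp: numeral_2_eq_2)
    also have "(\<Prod>i=2..?j. psi ?j q i (x i)) = (\<Prod>i=2..Suc n. psi ?j q i (x i)) * psi ?j q ?j (x ?j)"
      by (subst prod.nat_ivl_Suc') (simp, rule mult.commute)
    also have "(\<Prod>i=2..Suc n. psi ?j q i (x i)) = (\<Prod>i=2..Suc n. \<gamma> (x i) * (?G q i * ?F q i))"
      by (intro prod.cong refl) (auto simp: psi_def)
    also have "\<dots> = (\<Prod>i=2..Suc n. \<gamma> (x i)) * ((\<Prod>i=2..Suc n. ?G q i) * (\<Prod>i=2..Suc n. ?F q i))"
      by (simp add: prod.distrib)
    also have "psi ?j q 1 (x 1) = \<alpha> (x 1) * ?F q 1"
      by (simp add: psi_def)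
    also have "psi ?j q ?j (x ?j) = \<beta> (x ?j) * ?G q ?j"
      by (simp add: psi_def)
    finally show ?thesis
      unfolding prod.distrib F G by (simp only: ac_simps)
  qed
  note step = this
  show ?thesis
    unfolding ker unfolding iv tensor_def step[symmetric] by (simp only: sum_distrib_left sum_distrib_right)
qed

end

locale chain_estimate = chain_bound M D \<phi> N U V w1 w2 w3 h b c0 kk \<Lambda> m0 \<Omega> A +
  chain_model M D \<phi> N U V w1 w2 w3 P Q \<alpha> \<gamma> \<beta> \<zeta>
  for M :: "'z measure" and D \<phi> N U V w1 w2 w3 h b c0 kk \<Lambda> m0 \<Omega> A
    and P Q :: "'x measure" and \<alpha> \<gamma> \<beta> \<zeta> +
  fixes C :: real
  assumes C0: "0 \<le> C"
    and dom: "\<And>f. f \<in> bdd_meas P \<Longrightarrow> (\<And>x. 0 \<le> f x) \<Longrightarrow> (\<integral>x. f x \<partial>P) \<le> C * (\<integral>x. f x \<partial>Q)"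
begin

definition kchain :: "nat \<Rightarrow> (nat \<Rightarrow> 'x) \<Rightarrow> real" where
  "kchain j x = \<alpha> (x 1) * (\<Prod>i=1..<j. ker (\<zeta> (x i)) (\<zeta> (x (Suc i)))) *
     (\<Prod>i=2..<j. \<gamma> (x i)) * \<beta> (x j)"

text \<open>The partial moments are bounded by a quantity depending on \<open>B\<close> only through
  its cardinality, as \<open>ustat_tensor\<close> demands; the mean factorises along each path into
  the mean differences of the factors.\<close>

lemma ustat_chain:
  assumes j: "2 \<le> j" "j \<le> n"
  defines "\<theta> \<equiv> (\<integral>z. U z * proj ((S ^^ (j - 2)) V) z \<partial>M)"
    and "X \<equiv> PiM {1..n} (\<lambda>_. P)" and "T \<equiv> ustat n j (degen Q j (kchain j))"
  shows "integrable X T" "(\<integral>x. T x \<partial>X) = \<theta>" "integrable X (\<lambda>x. (T x - \<theta>)\<^sup>2)"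
    "(\<integral>x. (T x - \<theta>)\<^sup>2 \<partial>X) \<le> (\<Sum>l=1..j. 2 ^ j * (real j / real n) ^ l *
      (C ^ l * (A ^ (2 * j + 1) * h ^ (2 * (j - l)) * kk ^ (l - 1))))"
proof -
  define i where "i = j - 2"
  have i: "j = Suc (Suc i)"
    using j by (simp add: i_def)
  let ?R = "paths (Suc i)" and ?J = "{1..j}"
  let ?\<eta> = "\<lambda>q i x. psi j q i x - (\<integral>y. psi j q i y \<partial>Q)"
  interpret P: prob_space P by (rule prob_P)
  interpret Q: prob_space Q by (rule prob_Q)
  have bmeq: "bdd_meas P = bdd_meas Q"
    by (simp add: bdd_meas_def sets_eq_imp_space_eq[OF sets_PQ] measurable_cong_sets[OF sets_PQ refl])
  have fin: "finite ?R"
    using finD by (intro finite_PiE) auto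
  have psi: "psi j q i' \<in> bdd_meas P" if "q \<in> ?R" "i' \<in> ?J" for q i'
    using psi_bdd that unfolding i by blast
  interpret Qt: tensor_family Q ?R ?J "psi j"
    using psi fin by unfold_locales (auto simp: bmeq)
  have "kchain j = tensor ?R ?J (psi j)"
    unfolding kchain_def i by (intro ext chain_tensor)
  then have T: "T = ustat n j (tensor ?R ?J ?\<eta>)"
    unfolding T_def using Qt.degen_tensor[OF refl] by simp
  have tf: "tensor_family P ?R ?J ?\<eta>"
    by (rule partial_moment_le(1)[where B = "{}", OF prob_P prob_Q sets_PQ dom C0 fin]) (use psi in auto)
  interpret Pt: tensor_family P ?R ?J ?\<eta> by (rule tf)
  let ?v = "\<lambda>l. C ^ l * (A ^ (2 * j + 1) * h ^ (2 * (j - l)) * kk ^ (l - 1))"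
  have v: "Pt.partial_moment B \<le> ?v (card B)" if B: "B \<subseteq> ?J" "B \<noteq> {}" for B
  proof -
    have "Pt.partial_moment B \<le> C ^ card B *
      (\<Sum>q\<in>?R. \<Sum>q'\<in>?R. \<Prod>i\<in>?J. if i \<in> B then \<integral>x. psi j q i x * psi j q' i x \<partial>Q
        else ((\<integral>x. psi j q i x \<partial>P) - (\<integral>x. psi j q i x \<partial>Q)) *
             ((\<integral>x. psi j q' i x \<partial>P) - (\<integral>x. psi j q' i x \<partial>Q)))"
      by (rule partial_moment_le(2)[OF prob_P prob_Q sets_PQ dom C0 fin]) (use psi B in auto)
    also have "\<dots> = C ^ card B * (if Suc (Suc i) \<in> B then \<integral>z. w3 z * quad B (Suc i) (ker z) \<partial>M
        else quad B (Suc i) V)"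
      unfolding i moment_sum ..
    also have "\<dots> \<le> ?v (card B)"
      using quad_end_bound[of B i] B C0 unfolding i by (intro mult_left_mono) auto
    finally show ?thesis .
  qed
  have v0: "0 \<le> ?v l" for l
    using C0 A1(1) h(1) K(3) by (intro mult_nonneg_nonneg zero_le_power) auto
  have mean: "(\<Sum>q\<in>?R. \<Prod>i\<in>?J. \<integral>x. ?\<eta> q i x \<partial>P) = \<theta>"
  proof -
    have "(\<integral>x. ?\<eta> q i' x \<partial>P) = (\<integral>x. psi j q i' x \<partial>P) - (\<integral>x. psi j q i' x \<partial>Q)"
      if "q \<in> ?R" "i' \<in> ?J" for q i'
      using P.bdd_meas_integrable[OF psi[OF that]] by (simp add: P.prob_space)
    then have "(\<Sum>q\<in>?R. \<Prod>i\<in>?J. \<integral>x. ?\<eta> q i x \<partial>P) =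
      (\<Sum>q\<in>?R. \<Prod>i\<in>?J. (\<integral>x. psi j q i x \<partial>P) - (\<integral>x. psi j q i x \<partial>Q))"
      by (intro sum.cong prod.cong refl)
    then show ?thesis
      unfolding \<theta>_def i mean_sum by simp
  qed
  show "integrable X T" "(\<integral>x. T x \<partial>X) = \<theta>" "integrable X (\<lambda>x. (T x - \<theta>)\<^sup>2)"
    "(\<integral>x. (T x - \<theta>)\<^sup>2 \<partial>X) \<le> (\<Sum>l=1..j. 2 ^ j * (real j / real n) ^ l * ?v l)"
    using ustat_tensor[OF tf j(2) v v0] unfolding mean X_def T by auto
qed

end

subsection \<open>Square integrable functions and finite rank kernels\<close>

lemma Lp_space_2_iff: "f \<in> Lp_space M 2 \<longleftrightarrow> f \<in> borel_measurable M \<and> integrable M (\<lambda>x. (f x)\<^sup>2)"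
  by (simp add: Lp_space_def)

lemma L2_measurable [measurable_dest]: "f \<in> Lp_space M s \<Longrightarrow> f \<in> borel_measurable M"
  by (simp add: Lp_space_def)

lemma L2_mult:
  assumes "f \<in> Lp_space M 2" "g \<in> Lp_space M 2"
  shows "integrable M (\<lambda>x. f x * g x)"
proof (rule Bochner_Integration.integrable_bound)
  show "integrable M (\<lambda>x. (f x)\<^sup>2 + (g x)\<^sup>2)"
    using assms by (simp add: Lp_space_2_iff)
  show "(\<lambda>x. f x * g x) \<in> borel_measurable M"
    using assms by (auto dest: L2_measurable)
  have "\<bar>a * b\<bar> \<le> a\<^sup>2 + b\<^sup>2" for a b :: real
  proof -
    have "0 \<le> (\<bar>a\<bar> - \<bar>b\<bar>)\<^sup>2" "0 \<le> \<bar>a\<bar> * \<bar>b\<bar>" by simp_all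
    then show ?thesis unfolding abs_mult power2_diff power2_abs by linarith
  qed
  then show "AE x in M. norm (f x * g x) \<le> norm ((f x)\<^sup>2 + (g x)\<^sup>2)"
    by simp
qed

lemma L2_scale: "f \<in> Lp_space M 2 \<Longrightarrow> (\<lambda>x. c * f x) \<in> Lp_space M 2"
  by (auto simp: Lp_space_2_iff power_mult_distrib)

lemma L2_add:
  assumes "f \<in> Lp_space M 2" "g \<in> Lp_space M 2"
  shows "(\<lambda>x. f x + g x) \<in> Lp_space M 2"
proof -
  have "integrable M (\<lambda>x. (f x)\<^sup>2 + (g x)\<^sup>2 + 2 * (f x * g x))"
    using assms L2_mult[OF assms] by (simp add: Lp_space_2_iff)
  then show ?thesis
    using assms by (auto simp: Lp_space_2_iff power2_sum mult.assoc)
qed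

lemma L2_diff: "f \<in> Lp_space M 2 \<Longrightarrow> g \<in> Lp_space M 2 \<Longrightarrow> (\<lambda>x. f x - g x) \<in> Lp_space M 2"
  using L2_add[OF _ L2_scale[of g M "-1"], of f] by simp

lemma L2_sum: "(\<And>i. i \<in> I \<Longrightarrow> f i \<in> Lp_space M 2) \<Longrightarrow> (\<lambda>x. \<Sum>i\<in>I. c i * f i x) \<in> Lp_space M 2"
proof (induction I rule: infinite_finite_induct)
  case (insert i I)
  then show ?case
    using L2_add[OF L2_scale[of "f i" M "c i"], of "\<lambda>x. \<Sum>i\<in>I. c i * f i x"] by simp
qed (auto simp: Lp_space_2_iff)

lemma (in finite_measure) bdd_meas_L2: "f \<in> bdd_meas M \<Longrightarrow> f \<in> Lp_space M 2"
  by (auto simp: Lp_space_2_iff intro!: bdd_meas_integrable bdd_meas_intros dest: bdd_meas_measurable)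

lemma L2_inner_sum:
  assumes "\<And>i. i \<in> I \<Longrightarrow> f i \<in> Lp_space M 2" "g \<in> Lp_space M 2"
  shows "(\<integral>x. g x * (\<Sum>i\<in>I. c i * f i x) \<partial>M) = (\<Sum>i\<in>I. c i * (\<integral>x. g x * f i x \<partial>M))"
proof -
  have "(\<integral>x. g x * (\<Sum>i\<in>I. c i * f i x) \<partial>M) = (\<integral>x. (\<Sum>i\<in>I. c i * (g x * f i x)) \<partial>M)"
    by (simp add: sum_distrib_left mult.left_commute)
  also have "\<dots> = (\<Sum>i\<in>I. c i * (\<integral>x. g x * f i x \<partial>M))"
    using assms L2_mult by (subst Bochner_Integration.integral_sum) auto
  finally show ?thesis .
qed

text \<open>Expansions hold almost everywhere and \<open>d\<close> need not be the number of
  generators: functions that are independent pointwise may be dependent almost everywhere.\<close>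

definition onb :: "'z measure \<Rightarrow> ('z \<Rightarrow> real) set \<Rightarrow> nat \<Rightarrow> (nat \<Rightarrow> 'z \<Rightarrow> real) \<Rightarrow> bool" where
  "onb M V d \<psi> \<longleftrightarrow> (\<forall>a<d. \<psi> a \<in> V \<and> \<psi> a \<in> Lp_space M 2) \<and>
     (\<forall>a<d. \<forall>b<d. (\<integral>x. \<psi> a x * \<psi> b x \<partial>M) = (if a = b then 1 else 0)) \<and>
     (\<forall>v\<in>V. AE x in M. v x = (\<Sum>a<d. (\<integral>y. \<psi> a y * v y \<partial>M) * \<psi> a x))"

lemma span_upto_Suc: "span_upto e l \<subseteq> span_upto e (Suc l)"
proof
  fix f assume "f \<in> span_upto e l"
  then obtain c where "f = (\<lambda>z. \<Sum>i=1..l. c i * e i z)"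
    by (auto simp: span_upto_def)
  then have "f = (\<lambda>z. \<Sum>i=1..Suc l. (if i = Suc l then 0 else c i) * e i z)"
    by (auto intro!: sum.cong)
  then show "f \<in> span_upto e (Suc l)"
    unfolding span_upto_def by (intro CollectI exI)
qed

lemma span_upto_lin:
  assumes "\<And>a. a \<in> I \<Longrightarrow> f a \<in> span_upto e l"
  shows "(\<lambda>x. \<Sum>a\<in>I. c a * f a x) \<in> span_upto e l"
proof -
  have "\<forall>a\<in>I. \<exists>u. f a = (\<lambda>z. \<Sum>i=1..l. u i * e i z)"
    using assms by (auto simp: span_upto_def)
  then obtain u where u: "\<And>a. a \<in> I \<Longrightarrow> f a = (\<lambda>z. \<Sum>i=1..l. u a i * e i z)"
    by metis
  have "(\<Sum>a\<in>I. c a * f a x) = (\<Sum>i=1..l. (\<Sum>a\<in>I. c a * u a i) * e i x)" for x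
  proof -
    have "(\<Sum>a\<in>I. c a * f a x) = (\<Sum>a\<in>I. \<Sum>i=1..l. c a * u a i * e i x)"
      using u by (simp add: sum_distrib_left mult.assoc)
    also have "\<dots> = (\<Sum>i=1..l. (\<Sum>a\<in>I. c a * u a i) * e i x)"
      by (subst sum.swap) (simp add: sum_distrib_right)
    finally show ?thesis .
  qed
  then show ?thesis
    unfolding span_upto_def by (intro CollectI exI[of _ "\<lambda>i. \<Sum>a\<in>I. c a * u a i"] ext)
qed

lemma span_upto_base: "1 \<le> i \<Longrightarrow> i \<le> l \<Longrightarrow> e i \<in> span_upto e l"
  unfolding span_upto_def
  by (intro CollectI exI[of _ "\<lambda>i'. if i' = i then 1 else 0"] ext) (simp add: if_distrib[of "\<lambda>x. x * _"] cong: if_cong)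

lemma span_upto_L2:
  assumes "\<forall>i\<in>{1..l}. e i \<in> Lp_space M 2" "f \<in> span_upto e l"
  shows "f \<in> Lp_space M 2"
  using assms by (auto simp: span_upto_def intro!: L2_sum)

text \<open>The residual of the next generator is normalised and appended, unless its norm vanishes;
  then the generator already equals its expansion almost everywhere and the system is kept. Every
  new element is an explicit linear combination, so membership in the span holds pointwise.\<close>

lemma gram_schmidt_generators:
  assumes "\<forall>i\<in>{1..l}. e i \<in> Lp_space M 2"
  shows "\<exists>(d :: nat) \<psi>. (\<forall>a<d. \<psi> a \<in> span_upto e l) \<and>
     (\<forall>a<d. \<forall>b<d. (\<integral>x. \<psi> a x * \<psi> b x \<partial>M) = (if a = b then 1 else 0)) \<and>
     (\<forall>i\<in>{1..l}. AE x in M. e i x = (\<Sum>a<d. (\<integral>y. \<psi> a y * e i y \<partial>M) * \<psi> a x))"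
  using assms
proof (induction l)
  case 0
  show ?case by (rule exI[of _ 0]) simp
next
  case (Suc l)
  then have eA: "\<forall>i\<in>{1..l}. e i \<in> Lp_space M 2" and e': "e (Suc l) \<in> Lp_space M 2"
    by auto
  then have eL: "e i \<in> Lp_space M 2" if "i \<in> {1..l}" for i
    using that by blast
  from Suc.IH[OF eA] obtain d :: nat and \<psi> where span: "\<forall>a<d. \<psi> a \<in> span_upto e l"
    and orth: "\<forall>a<d. \<forall>b<d. (\<integral>x. \<psi> a x * \<psi> b x \<partial>M) = (if a = b then 1 else 0)"
    and exp: "\<forall>i\<in>{1..l}. AE x in M. e i x = (\<Sum>a<d. (\<integral>y. \<psi> a y * e i y \<partial>M) * \<psi> a x)"
    by blast
  have span': "\<psi> a \<in> span_upto e (Suc l)" if "a < d" for a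
    using span span_upto_Suc that by blast
  have psiL: "\<psi> a \<in> Lp_space M 2" if "a < d" for a
    using span_upto_L2[OF eA] span that by blast
  let ?c = "\<lambda>a. \<integral>y. \<psi> a y * e (Suc l) y \<partial>M"
  let ?s = "\<lambda>x. \<Sum>a<d. ?c a * \<psi> a x"
  let ?r = "\<lambda>x. e (Suc l) x - ?s x"
  have sL: "?s \<in> Lp_space M 2"
    using psiL by (intro L2_sum) auto
  have rL: "?r \<in> Lp_space M 2"
    by (intro L2_diff e' sL)
  have psi_s: "(\<integral>x. \<psi> a x * ?s x \<partial>M) = ?c a" if "a < d" for a
    using that orth psiL by (subst L2_inner_sum) (auto simp: if_distrib[of "\<lambda>x. _ * x"] cong: if_cong)
  have psi_r: "(\<integral>x. \<psi> a x * ?r x \<partial>M) = 0" if "a < d" for a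
    using that psi_s[OF that] L2_mult[OF psiL[OF that] e'] L2_mult[OF psiL[OF that] sL]
    by (simp add: right_diff_distrib)
  define n2 where "n2 = (\<integral>x. (?r x)\<^sup>2 \<partial>M)"
  have n20: "0 \<le> n2" by (simp add: n2_def)
  have r_e: "(\<integral>x. ?r x * e (Suc l) x \<partial>M) = n2"
  proof -
    have "(\<integral>x. ?r x * ?s x \<partial>M) = (\<Sum>a<d. ?c a * (\<integral>x. ?r x * \<psi> a x \<partial>M))"
      using psiL rL by (intro L2_inner_sum) auto
    also have "\<dots> = 0"
      using psi_r by (simp add: mult.commute)
    finally have 0: "(\<integral>x. ?r x * ?s x \<partial>M) = 0" .
    have "(\<integral>x. ?r x * e (Suc l) x \<partial>M) = (\<integral>x. (?r x)\<^sup>2 + ?r x * ?s x \<partial>M)"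
      by (intro Bochner_Integration.integral_cong) (auto simp: power2_eq_square algebra_simps)
    also have "\<dots> = n2"
      using L2_mult[OF rL sL] rL 0 by (simp add: n2_def Lp_space_2_iff)
    finally show ?thesis .
  qed
  show ?case
  proof (cases "n2 = 0")
    case True
    have "AE x in M. (?r x)\<^sup>2 = 0"
      using True rL by (subst integral_nonneg_eq_0_iff_AE[symmetric]) (auto simp: n2_def Lp_space_2_iff)
    then have "AE x in M. e (Suc l) x = ?s x"
      by eventually_elim simp
    then have "\<forall>i\<in>{1..Suc l}. AE x in M. e i x = (\<Sum>a<d. (\<integral>y. \<psi> a y * e i y \<partial>M) * \<psi> a x)"
      using exp by (auto simp: le_Suc_eq)
    then show ?thesis
      using span' orth by (intro exI[of _ d] exI[of _ \<psi>]) blast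
  next
    case False
    then have n2: "0 < n2" using n20 by simp
    define u where "u x = ?r x / sqrt n2" for x
    define \<theta> where "\<theta> a = (if a = d then u else \<psi> a)" for a
    have uL: "u \<in> Lp_space M 2"
      unfolding u_def using L2_scale[OF rL, of "1 / sqrt n2"] by simp
    have psi_u: "(\<integral>x. \<psi> a x * u x \<partial>M) = 0" if "a < d" for a
      using psi_r[OF that] by (simp add: u_def)
    have u_u: "(\<integral>x. u x * u x \<partial>M) = 1"
    proof -
      have "u x * u x = (?r x)\<^sup>2 / n2" for x
        using n2 by (simp add: u_def power2_eq_square)
      then show ?thesis
        using n2 by (simp add: n2_def)
    qed
    have u_e: "(\<integral>x. u x * e (Suc l) x \<partial>M) = sqrt n2"
      using r_e n2 by (simp add: u_def real_div_sqrt)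
    have u_span: "u \<in> span_upto e (Suc l)"
    proof -
      let ?f = "\<lambda>a. if a = d then e (Suc l) else \<psi> a"
      let ?k = "\<lambda>a. if a = d then 1 / sqrt n2 else - ?c a / sqrt n2"
      have "(\<lambda>x. \<Sum>a\<in>{..d}. ?k a * ?f a x) \<in> span_upto e (Suc l)"
        using span' span_upto_base[of "Suc l" "Suc l" e] by (intro span_upto_lin) auto
      also have "(\<lambda>x. \<Sum>a\<in>{..d}. ?k a * ?f a x) = u"
        unfolding lessThan_Suc_atMost[symmetric]
        by (auto simp: u_def sum_negf sum_divide_distrib diff_divide_distrib)
      finally show ?thesis .
    qed
    have "\<forall>i\<in>{1..Suc l}. AE x in M. e i x = (\<Sum>a<Suc d. (\<integral>y. \<theta> a y * e i y \<partial>M) * \<theta> a x)"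
    proof
      fix i assume i: "i \<in> {1..Suc l}"
      show "AE x in M. e i x = (\<Sum>a<Suc d. (\<integral>y. \<theta> a y * e i y \<partial>M) * \<theta> a x)"
      proof (cases "i = Suc l")
        case True
        have "e i x = (\<Sum>a<Suc d. (\<integral>y. \<theta> a y * e i y \<partial>M) * \<theta> a x)" for x
          unfolding True using n2 by (simp add: \<theta>_def u_e) (simp add: u_def)
        then show ?thesis by (rule AE_I2)
      next
        case False
        with i have il: "i \<in> {1..l}" by auto
        have "(\<integral>y. u y * e i y \<partial>M) = (\<integral>y. u y * (\<Sum>a<d. (\<integral>y. \<psi> a y * e i y \<partial>M) * \<psi> a y) \<partial>M)"
          using exp il eL[OF il] uL psiL
          by (intro integral_cong_AE) (auto dest!: L2_measurable)
        also have "\<dots> = 0"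
          using psiL uL psi_u by (subst L2_inner_sum) (auto simp: mult.commute)
        finally show ?thesis
          using exp il by (simp add: \<theta>_def)
      qed
    qed
    moreover have "\<forall>a<Suc d. \<theta> a \<in> span_upto e (Suc l)"
      using span' u_span by (auto simp: \<theta>_def)
    moreover have "\<forall>a<Suc d. \<forall>b<Suc d. (\<integral>x. \<theta> a x * \<theta> b x \<partial>M) = (if a = b then 1 else 0)"
      using orth psi_u u_u by (auto simp: \<theta>_def less_Suc_eq mult.commute)
    ultimately show ?thesis by blast
  qed
qed

lemma gram_schmidt:
  assumes e: "\<forall>i\<in>{1..l}. e i \<in> Lp_space M 2"
  obtains d \<psi> where "onb M (span_upto e l) d \<psi>"
proof -
  obtain d :: nat and \<psi> where span: "\<forall>a<d. \<psi> a \<in> span_upto e l"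
    and orth: "\<forall>a<d. \<forall>b<d. (\<integral>x. \<psi> a x * \<psi> b x \<partial>M) = (if a = b then 1 else 0)"
    and exp: "\<forall>i\<in>{1..l}. AE x in M. e i x = (\<Sum>a<d. (\<integral>y. \<psi> a y * e i y \<partial>M) * \<psi> a x)"
    using gram_schmidt_generators[of l e M] e by blast
  have L2: "\<psi> a \<in> Lp_space M 2" if "a < d" for a
    using span_upto_L2[OF e] span that by blast
  have "AE x in M. v x = (\<Sum>a<d. (\<integral>y. \<psi> a y * v y \<partial>M) * \<psi> a x)" if v: "v \<in> span_upto e l" for v
  proof -
    obtain c where c: "v = (\<lambda>z. \<Sum>i=1..l. c i * e i z)"
      using v unfolding span_upto_def by blast
    have "AE x in M. \<forall>i\<in>{1..l}. e i x = (\<Sum>a<d. (\<integral>y. \<psi> a y * e i y \<partial>M) * \<psi> a x)"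
      using exp by (simp add: AE_ball_countable)
    then show ?thesis
    proof eventually_elim
      case (elim x)
      have "v x = (\<Sum>i=1..l. c i * (\<Sum>a<d. (\<integral>y. \<psi> a y * e i y \<partial>M) * \<psi> a x))"
        unfolding c using elim by (intro sum.cong) auto
      also have "\<dots> = (\<Sum>i=1..l. \<Sum>a<d. c i * (\<integral>y. \<psi> a y * e i y \<partial>M) * \<psi> a x)"
        by (simp add: sum_distrib_left mult.assoc)
      also have "\<dots> = (\<Sum>a<d. (\<Sum>i=1..l. c i * (\<integral>y. \<psi> a y * e i y \<partial>M)) * \<psi> a x)"
        by (subst sum.swap) (simp add: sum_distrib_right)
      also have "\<dots> = (\<Sum>a<d. (\<integral>y. \<psi> a y * v y \<partial>M) * \<psi> a x)"
        unfolding c using L2 e by (intro sum.cong refl, subst L2_inner_sum) auto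
      finally show ?case .
    qed
  qed
  then show ?thesis
    using that[of d \<psi>] span orth L2 by (auto simp: onb_def)
qed

lemma onb_proj:
  assumes onb: "onb M V d \<psi>" and h: "h \<in> Lp_space M 2" and V: "V \<subseteq> Lp_space M 2"
    and v: "is_orth_proj M V h v"
  shows "AE x in M. v x = (\<Sum>a<d. (\<integral>y. \<psi> a y * h y \<partial>M) * \<psi> a x)"
proof -
  have vV: "v \<in> V" and orth: "\<And>w. w \<in> V \<Longrightarrow> (\<integral>z. (h z - v z) * w z \<partial>M) = 0"
    using v by (auto simp: is_orth_proj_def)
  have vL: "v \<in> Lp_space M 2" using vV V by blast
  have "(\<integral>y. \<psi> a y * v y \<partial>M) = (\<integral>y. \<psi> a y * h y \<partial>M)" if "a < d" for a
  proof -
    have p: "\<psi> a \<in> V" "\<psi> a \<in> Lp_space M 2"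
      using onb that by (auto simp: onb_def)
    have "(\<integral>z. (h z - v z) * \<psi> a z \<partial>M) = (\<integral>z. \<psi> a z * h z - \<psi> a z * v z \<partial>M)"
      by (intro Bochner_Integration.integral_cong) (auto simp: algebra_simps)
    also have "\<dots> = (\<integral>y. \<psi> a y * h y \<partial>M) - (\<integral>y. \<psi> a y * v y \<partial>M)"
      by (intro Bochner_Integration.integral_diff L2_mult p(2) h vL)
    finally have "(\<integral>z. (h z - v z) * \<psi> a z \<partial>M) = (\<integral>y. \<psi> a y * h y \<partial>M) - (\<integral>y. \<psi> a y * v y \<partial>M)" .
    then show ?thesis using orth[OF p(1)] by simp
  qed
  moreover have "AE x in M. v x = (\<Sum>a<d. (\<integral>y. \<psi> a y * v y \<partial>M) * \<psi> a x)"
    using onb vV by (auto simp: onb_def)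
  ultimately show ?thesis by simp
qed

text \<open>Dynkin's argument: the sets over which \<open>f\<close> integrates to zero are closed
  under complements and disjoint unions and contain the rectangles, hence all measurable
  sets.\<close>

lemma AE_zero_of_rectangles:
  assumes M: "finite_measure M" and f: "integrable (M \<Otimes>\<^sub>M M) f"
    and rect: "\<And>A B. A \<in> sets M \<Longrightarrow> B \<in> sets M \<Longrightarrow> (\<integral>x\<in>A \<times> B. f x \<partial>(M \<Otimes>\<^sub>M M)) = (0 :: real)"
  shows "AE x in M \<Otimes>\<^sub>M M. f x = 0"
proof -
  let ?N = "M \<Otimes>\<^sub>M M"
  let ?G = "{a \<times> b | a b. a \<in> sets M \<and> b \<in> sets M}"
  have si: "set_integrable ?N A f" if "A \<in> sets ?N" for A
    using f that unfolding set_integrable_def by (rule integrable_mult_indicator[rotated])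
  have "(\<integral>x\<in>A. f x \<partial>?N) = 0" if "A \<in> sets ?N" for A
    using Int_stable_pair_measure_generator pair_measure_closed
      that[unfolded sets_pair_measure]
  proof (induction rule: sigma_sets_induct_disjoint)
    case (basic A)
    then show ?case using rect by auto
  next
    case empty
    show ?case by (simp add: set_lebesgue_integral_def)
  next
    case (compl A)
    have A: "A \<in> sets ?N"
      using compl(1) by (simp add: sets_pair_measure)
    have U: "A \<union> (space M \<times> space M - A) = space M \<times> space M"
      using sets.sets_into_space[OF A] by (auto simp: space_pair_measure)
    have C: "space M \<times> space M - A \<in> sets ?N"
      using sets.compl_sets[OF A] by (simp add: space_pair_measure)
    have "(\<integral>x\<in>A \<union> (space M \<times> space M - A). f x \<partial>?N) =
        (\<integral>x\<in>A. f x \<partial>?N) + (\<integral>x\<in>space M \<times> space M - A. f x \<partial>?N)"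
      using si[OF A] si[OF C] by (intro set_integral_Un) auto
    then show ?case
      unfolding U using rect[OF sets.top sets.top] compl by simp
  next
    case (union A)
    have A: "A i \<in> sets ?N" for i
      using union by (auto simp: sets_pair_measure)
    have "(\<integral>x\<in>(\<Union>i. A i). f x \<partial>?N) = (\<Sum>i. \<integral>x\<in>A i. f x \<partial>?N)"
      using A union(1) by (intro lebesgue_integral_countable_add si) (auto simp: disjoint_family_on_def)
    then show ?case using union by simp
  qed
  then show ?thesis
    using density_unique_real[OF f, where f' = "\<lambda>_. 0"] by (auto simp: set_lebesgue_integral_def)
qed

text \<open>The exceptional null set in the last hypothesis depends on \<open>B\<close>. Integrating
  over rectangles combines these countless null sets into one null set of the product.\<close>

lemma kernel_AE_zero:
  fixes f :: "'z \<Rightarrow> 'z \<Rightarrow> real"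
  assumes M: "finite_measure M" and f [measurable]: "(\<lambda>(x, z). f x z) \<in> borel_measurable (M \<Otimes>\<^sub>M M)"
    and int: "\<And>x. x \<in> space M \<Longrightarrow> integrable M (f x)"
    and zero: "\<And>B. B \<in> sets M \<Longrightarrow> AE x in M. (\<integral>z\<in>B. f x z \<partial>M) = 0"
  shows "AE x in M \<Otimes>\<^sub>M M. f (fst x) (snd x) = 0"
proof -
  interpret finite_measure M by fact
  interpret pair_sigma_finite M M ..
  define m where "m x = (\<integral>z. \<bar>f x z\<bar> \<partial>M)" for x
  have m [measurable]: "m \<in> borel_measurable M"
    unfolding m_def by measurable
  have m0: "0 \<le> m x" for x by (simp add: m_def)
  \<comment> \<open>Dividing by \<open>1 + m\<close> makes the kernel jointly integrable.\<close>
  define g where "g x = f (fst x) (snd x) / (1 + m (fst x))" for x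
  have g [measurable]: "g \<in> borel_measurable (M \<Otimes>\<^sub>M M)"
    unfolding g_def using f by (simp add: case_prod_unfold)
  have g_int: "integrable (M \<Otimes>\<^sub>M M) g"
  proof (rule Fubini_integrable[OF g])
    have "(\<lambda>x. \<integral>y. norm (g (x, y)) \<partial>M) = (\<lambda>x. m x / (1 + m x))"
      using m0 by (auto simp: g_def m_def abs_of_nonneg add_nonneg_nonneg)
    moreover have "integrable M (\<lambda>x. m x / (1 + m x))"
      using m0 by (intro integrable_const_bound[of _ 1]) (auto simp: divide_le_eq add_pos_nonneg abs_of_nonneg)
    ultimately show "integrable M (\<lambda>x. \<integral>y. norm (g (x, y)) \<partial>M)" by simp
    show "AE x in M. integrable M (\<lambda>y. g (x, y))"
      using int by (auto simp: g_def)
  qed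
  have "AE x in M \<Otimes>\<^sub>M M. g x = 0"
  proof (rule AE_zero_of_rectangles[OF M g_int])
    fix A B assume AB: "A \<in> sets M" "B \<in> sets M"
    then have [measurable]: "A \<in> sets M" "B \<in> sets M" by auto
    have "integrable (M \<Otimes>\<^sub>M M) (\<lambda>x. indicator (A \<times> B) x *\<^sub>R g x)"
      using AB g_int by (intro integrable_mult_indicator) auto
    then have "(\<integral>x\<in>A \<times> B. g x \<partial>(M \<Otimes>\<^sub>M M)) = (\<integral>x. \<integral>y. indicator (A \<times> B) (x, y) *\<^sub>R g (x, y) \<partial>M \<partial>M)"
      unfolding set_lebesgue_integral_def by (rule integral_fst'[symmetric])
    also have "\<dots> = (\<integral>x. indicator A x / (1 + m x) * (\<integral>y\<in>B. f x y \<partial>M) \<partial>M)"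
    proof (intro Bochner_Integration.integral_cong refl)
      fix x
      have "(\<lambda>y. indicator (A \<times> B) (x, y) *\<^sub>R g (x, y)) =
          (\<lambda>y. indicator A x / (1 + m x) * (indicator B y *\<^sub>R f x y))"
        by (auto simp: g_def indicator_def)
      then show "(\<integral>y. indicator (A \<times> B) (x, y) *\<^sub>R g (x, y) \<partial>M) =
          indicator A x / (1 + m x) * (\<integral>y\<in>B. f x y \<partial>M)"
        by (simp add: set_lebesgue_integral_def)
    qed
    also have "\<dots> = (\<integral>x. 0 \<partial>M)"
      using zero[OF AB(2)] f by (intro integral_cong_AE) (auto simp: set_lebesgue_integral_def case_prod_unfold)
    finally show "(\<integral>x\<in>A \<times> B. g x \<partial>(M \<Otimes>\<^sub>M M)) = 0" by simp
  qed
  then show ?thesis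
    by eventually_elim (use m0 in \<open>auto simp: g_def add_nonneg_eq_0_iff\<close>)
qed

text \<open>The difference between \<open>K\<close> and the basis expansion, tested on indicators,
  vanishes for almost every first argument, because two versions of the projection of an indicator
  agree almost everywhere.\<close>

lemma kernel_finite_rank:
  assumes M: "finite_measure M" and K: "orth_proj_kernel M V K" and V: "V \<subseteq> Lp_space M 2"
    and onb: "onb M V d \<psi>"
  shows "AE x in M \<Otimes>\<^sub>M M. K (fst x) (snd x) = (\<Sum>a<d. \<psi> a (fst x) * \<psi> a (snd x))"
    and "\<And>h. h \<in> Lp_space M 2 \<Longrightarrow> AE x in M. kernel_op M K h x = (\<Sum>a<d. (\<integral>y. \<psi> a y * h y \<partial>M) * \<psi> a x)"
proof -
  interpret finite_measure M by fact
  have psi: "\<psi> a \<in> Lp_space M 2" if "a < d" for a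
    using onb that by (auto simp: onb_def)
  have psi_m [measurable]: "\<psi> a \<in> borel_measurable M" if "a < d" for a
    using psi[OF that] by (rule L2_measurable)
  have K_m [measurable]: "(\<lambda>(x, z). K x z) \<in> borel_measurable (M \<Otimes>\<^sub>M M)"
    using K by (simp add: orth_proj_kernel_def)
  have K_int: "integrable M (\<lambda>z. K x z * h z)" if "h \<in> Lp_space M 2" "x \<in> space M" for h x
    using K that by (auto simp: orth_proj_kernel_def)
  show op: "AE x in M. kernel_op M K h x = (\<Sum>a<d. (\<integral>y. \<psi> a y * h y \<partial>M) * \<psi> a x)" if h: "h \<in> Lp_space M 2" for h
  proof -
    obtain v where v: "is_orth_proj M V h v" "AE x in M. kernel_op M K h x = v x"
      using K h by (auto simp: orth_proj_kernel_def)
    show ?thesis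
      using onb_proj[OF onb h V v(1)] v(2) by eventually_elim simp
  qed
  let ?f = "\<lambda>x z. K x z - (\<Sum>a<d. \<psi> a x * \<psi> a z)"
  have one: "(\<lambda>_. 1) \<in> Lp_space M 2"
    by (rule bdd_meas_L2) simp
  have "AE x in M \<Otimes>\<^sub>M M. ?f (fst x) (snd x) = 0"
  proof (rule kernel_AE_zero[OF M])
    show "(\<lambda>(x, z). ?f x z) \<in> borel_measurable (M \<Otimes>\<^sub>M M)"
      using K_m by (simp add: case_prod_unfold)
    have psi_int: "integrable M (\<psi> a)" if "a < d" for a
      using L2_mult[OF psi[OF that] one] by simp
    show fint: "integrable M (?f x)" if "x \<in> space M" for x
      using K_int[OF one that] psi_int
      by (intro Bochner_Integration.integrable_diff Bochner_Integration.integrable_sum) auto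
    fix B assume B: "B \<in> sets M"
    have ind: "indicator B \<in> Lp_space M 2"
      using B by (intro bdd_meas_L2 bdd_measI[of _ _ 1]) (auto split: split_indicator)
    have "AE x in M. kernel_op M K (indicator B) x = (\<Sum>a<d. (\<integral>y. \<psi> a y * indicator B y \<partial>M) * \<psi> a x)"
      by (rule op[OF ind])
    moreover have "AE x in M. x \<in> space M" by simp
    ultimately show "AE x in M. (\<integral>z\<in>B. ?f x z \<partial>M) = 0"
    proof eventually_elim
      case (elim x)
      have "(\<integral>z\<in>B. ?f x z \<partial>M) = (\<integral>z. K x z * indicator B z - (\<Sum>a<d. \<psi> a x * (\<psi> a z * indicator B z)) \<partial>M)"
        unfolding set_lebesgue_integral_def
        by (intro Bochner_Integration.integral_cong) (auto simp: sum_distrib_left algebra_simps)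
      also have "\<dots> = kernel_op M K (indicator B) x - (\<Sum>a<d. \<psi> a x * (\<integral>y. \<psi> a y * indicator B y \<partial>M))"
        using K_int[OF ind elim(2)] L2_mult[OF psi ind]
        by (subst Bochner_Integration.integral_diff) (auto simp: kernel_op_def)
      also have "\<dots> = 0"
        using elim(1) by (simp add: mult.commute)
      finally show ?case .
    qed
  qed
  then show "AE x in M \<Otimes>\<^sub>M M. K (fst x) (snd x) = (\<Sum>a<d. \<psi> a (fst x) * \<psi> a (snd x))"
    by eventually_elim simp
qed

subsection \<open>Integration under the law of an observation\<close>

lemma finite_measure_triples: "finite_measure \<nu> \<Longrightarrow> finite_measure (triples \<nu>)"
  by (intro finite_measure_pair_measure finite_measure_count_space) auto

lemma integral_bool_pair:
  fixes F :: "bool \<times> 'x \<Rightarrow> real"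
  assumes N: "finite_measure N" and F: "F \<in> bdd_meas (count_space UNIV \<Otimes>\<^sub>M N)"
  shows "(\<integral>x. F x \<partial>(count_space UNIV \<Otimes>\<^sub>M N)) = (\<integral>x. F (True, x) \<partial>N) + (\<integral>x. F (False, x) \<partial>N)"
proof -
  interpret N: finite_measure N by fact
  interpret C: finite_measure "count_space (UNIV :: bool set)"
    by (rule finite_measure_count_space) simp
  interpret pair_sigma_finite "count_space (UNIV :: bool set)" N ..
  interpret CN: finite_measure "count_space (UNIV :: bool set) \<Otimes>\<^sub>M N"
    by (intro finite_measure_pair_measure C.finite_measure_axioms N)
  have "(\<integral>x. F x \<partial>(count_space UNIV \<Otimes>\<^sub>M N)) = (\<integral>t. \<integral>x. F (t, x) \<partial>N \<partial>count_space UNIV)"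
    using CN.bdd_meas_integrable[OF F] by (rule integral_fst'[symmetric])
  then show ?thesis
    by (simp add: lebesgue_integral_count_space_finite UNIV_bool)
qed

lemma bdd_meas_section:
  assumes "F \<in> bdd_meas (count_space UNIV \<Otimes>\<^sub>M N)"
  shows "(\<lambda>x. F (t, x)) \<in> bdd_meas N"
  by (rule bdd_meas_comp[OF assms]) simp

lemma integral_triples:
  fixes F :: "bool \<times> bool \<times> 'z \<Rightarrow> real"
  assumes \<nu>: "finite_measure \<nu>" and F: "F \<in> bdd_meas (triples \<nu>)"
  shows "(\<integral>x. F x \<partial>triples \<nu>) = (\<integral>z. F (True, True, z) + F (True, False, z) +
    F (False, True, z) + F (False, False, z) \<partial>\<nu>)"
proof -
  interpret finite_measure \<nu> by fact
  have fm: "finite_measure (count_space (UNIV :: bool set) \<Otimes>\<^sub>M \<nu>)"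
    by (intro finite_measure_pair_measure finite_measure_count_space \<nu>) auto
  note sec = bdd_meas_section[OF F] bdd_meas_section[OF bdd_meas_section[OF F]]
  show ?thesis
    using integral_bool_pair[OF fm F] integral_bool_pair[OF \<nu> sec(1)]
      bdd_meas_integrable[OF sec(2)] by simp
qed

section \<open>Consequences of the standing assumptions for a single law\<close>

locale model =
  fixes \<delta> :: real and \<nu> :: "'z measure" and p :: "'z param"
  assumes \<delta>: "0 < \<delta>" and adm: "admissible \<delta> \<nu> p"
begin

lemma meas [measurable]: "par_a p \<in> borel_measurable \<nu>" "par_b p \<in> borel_measurable \<nu>"
  "par_g p \<in> borel_measurable \<nu>"
  using adm by (auto simp: admissible_def)

lemma par_f_meas [measurable]: "par_f p \<in> borel_measurable \<nu>"
  unfolding par_f_def by measurable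

lemma bounds:
  assumes "z \<in> space \<nu>"
  shows "1 \<le> par_a p z" "par_a p z \<le> 1 / \<delta>" "\<delta> \<le> 1 - 1 / par_a p z" "\<delta> \<le> 1 / par_a p z"
    "\<delta> \<le> par_b p z" "\<delta> \<le> 1 - par_b p z" "\<delta> \<le> par_g p z" "par_g p z \<le> 1 / \<delta>"
    "\<delta> \<le> par_f p z" "par_f p z \<le> 1 / \<delta>\<^sup>2" "\<delta> \<le> 1"
proof -
  have 1: "\<delta> \<le> 1 / par_a p z" "1 / par_a p z \<le> 1 - \<delta>" "\<delta> \<le> par_b p z" "par_b p z \<le> 1 - \<delta>"
    "\<delta> \<le> par_g p z" "par_g p z \<le> 1 / \<delta>"
    using adm assms by (auto simp: admissible_def)
  then show "\<delta> \<le> 1 - 1 / par_a p z" "\<delta> \<le> 1 / par_a p z" "\<delta> \<le> par_b p z" "\<delta> \<le> 1 - par_b p z"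
    "\<delta> \<le> par_g p z" "par_g p z \<le> 1 / \<delta>" by auto
  have pos: "0 < par_a p z"
    using 1(1) \<delta> by (metis less_le_trans zero_less_divide_1_iff)
  show a: "1 \<le> par_a p z" "par_a p z \<le> 1 / \<delta>"
    using 1(1,2) \<delta> pos mult_pos_pos[OF \<delta> pos] by (auto simp: field_simps)
  show "\<delta> \<le> par_f p z"
    using mult_mono[OF a(1) 1(5)] \<delta> pos by (simp add: par_f_def)
  show "par_f p z \<le> 1 / \<delta>\<^sup>2"
    using mult_mono[OF a(2) 1(6)] \<delta> 1(5) by (simp add: par_f_def power2_eq_square)
  show "\<delta> \<le> 1" using 1(3,4) by simp
qed

lemma nn_f: "(\<integral>\<^sup>+z. ennreal (par_f p z) \<partial>\<nu>) = 1"
  using adm by (simp add: admissible_def)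

text \<open>The density of \<open>Z\<close> is at least \<open>\<delta>\<close> everywhere and
  integrates to 1, which caps the mass at \<open>1 / \<delta>\<close>.\<close>

lemma finite_\<nu>: "finite_measure \<nu>"
proof
  have "ennreal \<delta> * emeasure \<nu> (space \<nu>) = (\<integral>\<^sup>+z. ennreal \<delta> \<partial>\<nu>)"
    by simp
  also have "\<dots> \<le> (\<integral>\<^sup>+z. ennreal (par_f p z) \<partial>\<nu>)"
    by (intro nn_integral_mono ennreal_leI bounds)
  also have "\<dots> = 1" by (rule nn_f)
  finally show "emeasure \<nu> (space \<nu>) \<noteq> \<infinity>"
    using \<delta> by (auto simp: ennreal_mult_top top_unique)
qed

sublocale finite_measure \<nu> by (rule finite_\<nu>)

lemma space_nonempty: "space \<nu> \<noteq> {}"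
proof
  assume "space \<nu> = {}"
  then show False
    using nn_f nn_integral_empty[of \<nu> "\<lambda>z. ennreal (par_f p z)"] by simp
qed

lemma delta_le_1: "\<delta> \<le> 1"
  using space_nonempty bounds(11) by blast

lemma par_bdd: "par_a p \<in> bdd_meas \<nu>" "par_b p \<in> bdd_meas \<nu>" "par_g p \<in> bdd_meas \<nu>" "par_f p \<in> bdd_meas \<nu>"
proof -
  have "\<bar>par_a p z\<bar> \<le> 1 / \<delta>" "\<bar>par_b p z\<bar> \<le> 1" "\<bar>par_g p z\<bar> \<le> 1 / \<delta>" "\<bar>par_f p z\<bar> \<le> 1 / \<delta>\<^sup>2"
    if "z \<in> space \<nu>" for z
    using bounds[OF that] \<delta> by auto
  then show "par_a p \<in> bdd_meas \<nu>" "par_b p \<in> bdd_meas \<nu>" "par_g p \<in> bdd_meas \<nu>" "par_f p \<in> bdd_meas \<nu>"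
    by (auto intro!: bdd_measI)
qed

lemma integral_f: "(\<integral>z. par_f p z \<partial>\<nu>) = 1"
proof -
  have "ennreal (\<integral>z. par_f p z \<partial>\<nu>) = 1"
    using nn_f bounds(9) \<delta>
    by (subst nn_integral_eq_integral[symmetric])
      (auto intro!: bdd_meas_integrable par_bdd AE_I2 order_trans[OF less_imp_le[OF \<delta>]])
  then show ?thesis
    by (metis ennreal_eq_1)
qed

lemma par_inv_a_bdd: "(\<lambda>z. 1 / par_a p z) \<in> bdd_meas \<nu>"
proof (rule bdd_measI)
  fix z assume "z \<in> space \<nu>"
  then show "\<bar>1 / par_a p z\<bar> \<le> 1"
    using bounds(1)[of z] by simp
qed measurable

lemma full_density_bdd: "full_density p \<in> bdd_meas (triples \<nu>)"
proof -
  have m: "(\<lambda>x. snd (snd x)) \<in> measurable (triples \<nu>) \<nu>" by measurable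
  note c = bdd_meas_comp[OF par_bdd(2) m] bdd_meas_comp[OF par_bdd(4) m] bdd_meas_comp[OF par_inv_a_bdd m]
  have i: "(\<lambda>x. if fst x then 1 else 0) \<in> bdd_meas (triples \<nu>)"
    "(\<lambda>x. if fst (snd x) then 1 else 0) \<in> bdd_meas (triples \<nu>)"
    by (rule bdd_measI[of _ _ 1]; (measurable | simp))+
  have "full_density p = (\<lambda>x. par_f p (snd (snd x)) *
     ((if fst x then 1 else 0) * par_b p (snd (snd x)) + (1 - (if fst x then 1 else 0)) * (1 - par_b p (snd (snd x)))) *
     ((if fst (snd x) then 1 else 0) * (1 / par_a p (snd (snd x))) +
       (1 - (if fst (snd x) then 1 else 0)) * (1 - 1 / par_a p (snd (snd x)))))"
    by (auto simp: full_density_def fun_eq_iff)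
  also have "\<dots> \<in> bdd_meas (triples \<nu>)"
    by (intro bdd_meas_mult bdd_meas_add bdd_meas_diff bdd_meas_const c i)
  finally show ?thesis .
qed

lemma full_density_meas [measurable]: "full_density p \<in> borel_measurable (triples \<nu>)"
  using full_density_bdd by (rule bdd_meas_measurable)

lemma full_density_nonneg: "x \<in> space (triples \<nu>) \<Longrightarrow> 0 \<le> full_density p x"
proof -
  assume "x \<in> space (triples \<nu>)"
  then obtain y t z where x: "x = (y, t, z)" "z \<in> space \<nu>"
    by (auto simp: space_pair_measure)
  then show ?thesis
    using bounds[of z] \<delta> by (auto simp: full_density_def intro!: mult_nonneg_nonneg)
qed

lemma T_meas [measurable]: "(\<lambda>(y, t, z). (y \<and> t, t, z)) \<in> measurable (triples \<nu>) (triples \<nu>)"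
  unfolding case_prod_unfold by measurable

lemma integral_full_law:
  assumes h: "h \<in> bdd_meas (triples \<nu>)"
  shows "(\<integral>x. h x \<partial>full_law \<nu> p) = (\<integral>z. par_f p z *
    (par_b p z * (1 / par_a p z) * h (True, True, z) + par_b p z * (1 - 1 / par_a p z) * h (True, False, z) +
    (1 - par_b p z) * (1 / par_a p z) * h (False, True, z) +
    (1 - par_b p z) * (1 - 1 / par_a p z) * h (False, False, z)) \<partial>\<nu>)"
proof -
  have [measurable]: "h \<in> borel_measurable (triples \<nu>)"
    using h by (rule bdd_meas_measurable)
  have "(\<integral>x. h x \<partial>full_law \<nu> p) = (\<integral>x. full_density p x * h x \<partial>triples \<nu>)"
    unfolding full_law_def using full_density_nonneg by (subst integral_density) auto
  also have "\<dots> = (\<integral>z. par_f p z *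
    (par_b p z * (1 / par_a p z) * h (True, True, z) + par_b p z * (1 - 1 / par_a p z) * h (True, False, z) +
    (1 - par_b p z) * (1 / par_a p z) * h (False, True, z) +
    (1 - par_b p z) * (1 - 1 / par_a p z) * h (False, False, z)) \<partial>\<nu>)"
    by (subst integral_triples[OF finite_\<nu> bdd_meas_mult[OF full_density_bdd h]])
      (simp add: full_density_def distrib_left mult.assoc add.assoc)
  finally show ?thesis .
qed

lemma space_law: "space (law \<nu> p) = space (triples \<nu>)" and sets_law [measurable_cong]: "sets (law \<nu> p) = sets (triples \<nu>)"
  by (auto simp: law_def)

lemma bdd_meas_law: "bdd_meas (law \<nu> p) = bdd_meas (triples \<nu>)"
  by (simp add: bdd_meas_def space_law measurable_cong_sets[OF sets_law refl])

text \<open>For \<open>t = False\<close> the outcome is not observed: both cells are sent to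
  \<open>(False, False, z)\<close> and their probabilities add up to
  \<open>1 - 1 / par_a p z\<close>. Three cells remain.\<close>

lemma integral_law:
  assumes h: "h \<in> bdd_meas (triples \<nu>)"
  shows "(\<integral>x. h x \<partial>law \<nu> p) = (\<integral>z. par_f p z *
    (par_b p z * (1 / par_a p z) * h (True, True, z) + (1 - par_b p z) * (1 / par_a p z) * h (False, True, z) +
    (1 - 1 / par_a p z) * h (False, False, z)) \<partial>\<nu>)"
proof -
  have [measurable]: "h \<in> borel_measurable (triples \<nu>)"
    using h by (rule bdd_meas_measurable)
  have T: "(\<lambda>(y, t, z). (y \<and> t, t, z)) \<in> measurable (full_law \<nu> p) (triples \<nu>)"
    using T_meas by (simp add: full_law_def)
  have hT: "(\<lambda>x. h (case x of (y, t, z) \<Rightarrow> (y \<and> t, t, z))) \<in> bdd_meas (triples \<nu>)"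
    by (rule bdd_meas_comp[OF h T_meas])
  have "(\<integral>x. h x \<partial>law \<nu> p) = (\<integral>x. h (case x of (y, t, z) \<Rightarrow> (y \<and> t, t, z)) \<partial>full_law \<nu> p)"
    unfolding law_def by (rule integral_distr[OF T]) measurable
  also have "\<dots> = (\<integral>z. par_f p z *
    (par_b p z * (1 / par_a p z) * h (True, True, z) + par_b p z * (1 - 1 / par_a p z) * h (False, False, z) +
    (1 - par_b p z) * (1 / par_a p z) * h (False, True, z) +
    (1 - par_b p z) * (1 - 1 / par_a p z) * h (False, False, z)) \<partial>\<nu>)"
    by (subst integral_full_law[OF hT]) simp
  also have "\<dots> = (\<integral>z. par_f p z *
    (par_b p z * (1 / par_a p z) * h (True, True, z) + (1 - par_b p z) * (1 / par_a p z) * h (False, True, z) +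
    (1 - 1 / par_a p z) * h (False, False, z)) \<partial>\<nu>)"
  proof (intro Bochner_Integration.integral_cong refl arg_cong2[where f = "(*)"])
    have "b * A * x + b * (1 - A) * y + (1 - b) * A * w + (1 - b) * (1 - A) * y =
        b * A * x + (1 - b) * A * w + (1 - A) * y" for b A x y w :: real
      by (simp add: algebra_simps)
    then show "par_b p z * (1 / par_a p z) * h (True, True, z) + par_b p z * (1 - 1 / par_a p z) * h (False, False, z) +
       (1 - par_b p z) * (1 / par_a p z) * h (False, True, z) +
       (1 - par_b p z) * (1 - 1 / par_a p z) * h (False, False, z) =
       par_b p z * (1 / par_a p z) * h (True, True, z) + (1 - par_b p z) * (1 / par_a p z) * h (False, True, z) +
       (1 - 1 / par_a p z) * h (False, False, z)" for z .
  qed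
  finally show ?thesis .
qed

lemma prob_space_law: "prob_space (law \<nu> p)"
proof -
  interpret t: finite_measure "triples \<nu>"
    by (rule finite_measure_triples[OF finite_\<nu>])
  have "emeasure (full_law \<nu> p) (space (full_law \<nu> p)) = (\<integral>\<^sup>+x. ennreal (full_density p x) \<partial>triples \<nu>)"
    unfolding full_law_def by (subst emeasure_density) (auto intro!: nn_integral_cong)
  also have "\<dots> = ennreal (\<integral>x. full_density p x \<partial>triples \<nu>)"
    using full_density_nonneg by (intro nn_integral_eq_integral t.bdd_meas_integrable full_density_bdd) auto
  also have "(\<integral>x. full_density p x \<partial>triples \<nu>) = (\<integral>z. par_f p z \<partial>\<nu>)"
    by (subst integral_triples[OF finite_\<nu> full_density_bdd])
      (intro Bochner_Integration.integral_cong refl, simp add: full_density_def algebra_simps)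
  also have "ennreal \<dots> = 1"
    by (simp add: integral_f)
  finally have "prob_space (full_law \<nu> p)"
    by (rule prob_spaceI)
  moreover have "(\<lambda>(y, t, z). (y \<and> t, t, z)) \<in> measurable (full_law \<nu> p) (triples \<nu>)"
    using T_meas by (simp add: full_law_def)
  ultimately show ?thesis
    unfolding law_def by (rule prob_space.prob_space_distr)
qed

lemma chi_eq: "chi \<nu> p = (\<integral>z. par_f p z * par_b p z \<partial>\<nu>)"
proof -
  have m: "(\<lambda>x. if fst x then 1 else 0) \<in> bdd_meas (triples \<nu>)"
    by (rule bdd_measI[of _ _ 1]; (measurable | simp))
  have "chi \<nu> p = (\<integral>x. (if fst x then 1 else 0) \<partial>full_law \<nu> p)"
    unfolding chi_def by (intro Bochner_Integration.integral_cong) auto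
  also have "\<dots> = (\<integral>z. par_f p z *
    (par_b p z * (1 / par_a p z) * 1 + par_b p z * (1 - 1 / par_a p z) * 1) \<partial>\<nu>)"
    unfolding integral_full_law[OF m] by simp
  also have "\<dots> = (\<integral>z. par_f p z * par_b p z \<partial>\<nu>)"
    by (intro Bochner_Integration.integral_cong refl) (simp add: algebra_simps)
  finally show ?thesis .
qed

end

text \<open>Domination is checked on each of the three cells. Under \<open>p\<close> the density of
  \<open>Z\<close> is at most \<open>1 / \<delta>\<^sup>2\<close> and the cell probability at most
  1; under \<open>q\<close> they are at least \<open>\<delta>\<close> and
  \<open>\<delta>\<^sup>2\<close>. This gives the fifth power.\<close>

lemma law_dominated:
  assumes "model \<delta> \<nu> p" "model \<delta> \<nu> q" and h: "h \<in> bdd_meas (triples \<nu>)" "\<And>x. 0 \<le> h x"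
  shows "(\<integral>x. h x \<partial>law \<nu> p) \<le> 1 / \<delta> ^ 5 * (\<integral>x. h x \<partial>law \<nu> q)"
proof -
  interpret p: model \<delta> \<nu> p by fact
  interpret q: model \<delta> \<nu> q by fact
  note sec = bdd_meas_section[OF bdd_meas_section[OF h(1)]]
  have "(\<integral>x. h x \<partial>law \<nu> p) \<le> (\<integral>z. 1 / \<delta> ^ 5 * (par_f q z *
    (par_b q z * (1 / par_a q z) * h (True, True, z) + (1 - par_b q z) * (1 / par_a q z) * h (False, True, z) +
    (1 - 1 / par_a q z) * h (False, False, z))) \<partial>\<nu>)"
    unfolding p.integral_law[OF h(1)]
  proof (intro integral_mono p.bdd_meas_integrable bdd_meas_mult bdd_meas_add bdd_meas_diff bdd_meas_const sec
      p.par_bdd q.par_bdd p.par_inv_a_bdd q.par_inv_a_bdd)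
    fix z assume z: "z \<in> space \<nu>"
    note b = p.bounds[OF z] and c = q.bounds[OF z]
    have fac: "par_f p z * x \<le> 1 / \<delta> ^ 5 * (par_f q z * y)" if "0 \<le> x" "x \<le> 1" "\<delta>\<^sup>2 \<le> y" for x y
    proof -
      have "par_f p z * x \<le> 1 / \<delta>\<^sup>2 * 1"
        using b that p.\<delta> by (intro mult_mono) auto
      also have "\<dots> = 1 / \<delta> ^ 5 * (\<delta> * \<delta>\<^sup>2)"
        using p.\<delta> by (simp add: field_simps eval_nat_numeral)
      also have "\<dots> \<le> 1 / \<delta> ^ 5 * (par_f q z * y)"
        using c that p.\<delta> by (intro mult_left_mono mult_mono) auto
      finally show ?thesis .
    qed
    have d2: "\<delta>\<^sup>2 \<le> u * v" if "\<delta> \<le> u" "\<delta> \<le> v" for u v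
      using mult_mono[OF that] that p.\<delta> by (simp add: power2_eq_square)
    have dd: "\<delta>\<^sup>2 \<le> \<delta>"
      using p.\<delta> c(11) by (simp add: power2_eq_square mult_left_le)
    have le1: "0 \<le> u * v" "u * v \<le> 1" if "0 \<le> u" "u \<le> 1" "0 \<le> v" "v \<le> 1" for u v :: real
      using that by (auto intro: mult_le_one)
    have u: "0 \<le> par_b p z" "par_b p z \<le> 1" "0 \<le> 1 / par_a p z" "1 / par_a p z \<le> 1"
      using b p.\<delta> by linarith+
    have e1: "par_f p z * (par_b p z * (1 / par_a p z)) \<le> 1 / \<delta> ^ 5 * (par_f q z * (par_b q z * (1 / par_a q z)))"
      using u c by (intro fac d2 le1) auto
    have e2: "par_f p z * ((1 - par_b p z) * (1 / par_a p z)) \<le>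
        1 / \<delta> ^ 5 * (par_f q z * ((1 - par_b q z) * (1 / par_a q z)))"
      using u c by (intro fac d2 le1) auto
    have e3: "par_f p z * (1 - 1 / par_a p z) \<le> 1 / \<delta> ^ 5 * (par_f q z * (1 - 1 / par_a q z))"
      using u c dd by (intro fac) auto
    from add_mono[OF add_mono[OF mult_right_mono[OF e1 h(2)] mult_right_mono[OF e2 h(2)]] mult_right_mono[OF e3 h(2)]]
    show "par_f p z *
       (par_b p z * (1 / par_a p z) * h (True, True, z) + (1 - par_b p z) * (1 / par_a p z) * h (False, True, z) +
        (1 - 1 / par_a p z) * h (False, False, z)) \<le> 1 / \<delta> ^ 5 * (par_f q z *
       (par_b q z * (1 / par_a q z) * h (True, True, z) + (1 - par_b q z) * (1 / par_a q z) * h (False, True, z) +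
        (1 - 1 / par_a q z) * h (False, False, z)))"
      unfolding distrib_left mult.assoc .
  qed
  then show ?thesis
    unfolding q.integral_law[OF h(1)] by simp
qed

subsection \<open>The weighted measures\<close>

locale weighted = model \<delta> \<nu> p for \<delta> :: real and \<nu> :: "'z measure" and p :: "'z param" +
  fixes aw bw :: "'z \<Rightarrow> real"
  assumes aw: "weight \<delta> \<nu> aw" and bw: "weight \<delta> \<nu> bw"
begin

definition wt :: "'z \<Rightarrow> real" where
  "wt z = aw z * bw z * par_g p z"

abbreviation \<mu> :: "'z measure" where
  "\<mu> \<equiv> wmeasure \<nu> aw bw p"

lemma weight_meas [measurable]: "aw \<in> borel_measurable \<nu>" "bw \<in> borel_measurable \<nu>" "wt \<in> borel_measurable \<nu>"
proof -
  show [measurable]: "aw \<in> borel_measurable \<nu>" "bw \<in> borel_measurable \<nu>"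
    using aw bw by (auto simp: weight_def)
  show "wt \<in> borel_measurable \<nu>"
    unfolding wt_def by measurable
qed

lemma weight_bounds:
  assumes "z \<in> space \<nu>"
  shows "\<delta> \<le> aw z" "aw z \<le> 1 / \<delta>" "\<delta> \<le> bw z" "bw z \<le> 1 / \<delta>"
  using aw bw assms by (auto simp: weight_def)

lemma wt_bounds:
  assumes "z \<in> space \<nu>"
  shows "\<delta> ^ 3 \<le> wt z" "wt z \<le> 1 / \<delta> ^ 3" "0 < wt z" "wt z \<le> 1 / \<delta>\<^sup>2 * par_f p z"
proof -
  note b = weight_bounds[OF assms] bounds[OF assms]
  show 1: "\<delta> ^ 3 \<le> wt z"
    using mult_mono[OF mult_mono[OF b(1,3)] b(11)] b \<delta> by (simp add: wt_def eval_nat_numeral mult.assoc)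
  have "aw z * bw z * par_g p z \<le> 1 / \<delta> * (1 / \<delta>) * (1 / \<delta>)"
    using b \<delta> by (intro mult_mono mult_nonneg_nonneg) auto
  then show "wt z \<le> 1 / \<delta> ^ 3"
    by (simp add: wt_def eval_nat_numeral mult.assoc)
  show "0 < wt z"
    using 1 \<delta> by (meson less_le_trans zero_less_power)
  have "aw z * bw z * par_g p z \<le> 1 / \<delta> * (1 / \<delta>) * par_f p z"
  proof (intro mult_mono mult_nonneg_nonneg)
    show "par_g p z \<le> par_f p z"
      using mult_right_mono[OF b(5), of "par_g p z"] b \<delta> by (simp add: par_f_def)
  qed (use b \<delta> in auto)
  then show "wt z \<le> 1 / \<delta>\<^sup>2 * par_f p z"
    by (simp add: wt_def power2_eq_square)
qed

lemma weight_bdd: "aw \<in> bdd_meas \<nu>" "bw \<in> bdd_meas \<nu>" "wt \<in> bdd_meas \<nu>"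
proof -
  have "\<bar>aw z\<bar> \<le> 1 / \<delta>" "\<bar>bw z\<bar> \<le> 1 / \<delta>" "\<bar>wt z\<bar> \<le> 1 / \<delta> ^ 3" if "z \<in> space \<nu>" for z
    using weight_bounds[OF that] wt_bounds[OF that] \<delta> by linarith+
  then show "aw \<in> bdd_meas \<nu>" "bw \<in> bdd_meas \<nu>" "wt \<in> bdd_meas \<nu>"
    using weight_meas by (blast intro: bdd_measI)+
qed

lemma inverse_bdd: "h \<in> bdd_meas \<nu> \<Longrightarrow> (\<And>z. z \<in> space \<nu> \<Longrightarrow> \<delta> \<le> h z) \<Longrightarrow> (\<lambda>z. 1 / h z) \<in> bdd_meas \<nu>"
proof (rule bdd_measI[of _ _ "1 / \<delta>"])
  assume h: "h \<in> bdd_meas \<nu>" "\<And>z. z \<in> space \<nu> \<Longrightarrow> \<delta> \<le> h z"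
  show "(\<lambda>z. 1 / h z) \<in> borel_measurable \<nu>"
    using bdd_meas_measurable[OF h(1)] by measurable
  fix z assume "z \<in> space \<nu>"
  then show "\<bar>1 / h z\<bar> \<le> 1 / \<delta>"
    using h(2)[of z] \<delta> by (simp add: frac_le)
qed

lemma space_\<mu>: "space \<mu> = space \<nu>" and sets_\<mu> [measurable_cong]: "sets \<mu> = sets \<nu>"
  by (auto simp: wmeasure_def)

lemma bdd_meas_\<mu>: "bdd_meas \<mu> = bdd_meas \<nu>"
  by (simp add: bdd_meas_def space_\<mu> measurable_cong_sets[OF sets_\<mu> refl])

lemma borel_\<mu>: "borel_measurable \<mu> = borel_measurable \<nu>"
  by (simp add: measurable_cong_sets[OF sets_\<mu> refl])

lemma \<mu>_eq: "\<mu> = density \<nu> (\<lambda>z. ennreal (wt z))"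
  by (simp add: wmeasure_def wt_def)

text \<open>The weight is positive everywhere, so \<open>\<nu>\<close> and the weighted measures of
  both parameters have the same null sets.\<close>

lemma AE_\<mu>: "(AE z in \<mu>. R z) \<longleftrightarrow> (AE z in \<nu>. R z)"
proof -
  have "(AE z in \<mu>. R z) \<longleftrightarrow> (AE z in \<nu>. 0 < ennreal (wt z) \<longrightarrow> R z)"
    unfolding \<mu>_eq by (rule AE_density) measurable
  also have "\<dots> \<longleftrightarrow> (AE z in \<nu>. R z)"
    by (intro AE_cong) (auto simp: wt_bounds(3))
  finally show ?thesis .
qed

lemma AE_wt_nonneg: "AE z in \<nu>. 0 \<le> wt z"
  by (intro AE_I2 less_imp_le wt_bounds(3))

lemma integral_\<mu>:
  assumes [measurable]: "h \<in> borel_measurable \<nu>"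
  shows "(\<integral>z. h z \<partial>\<mu>) = (\<integral>z. wt z * h z \<partial>\<nu>)"
  unfolding \<mu>_eq by (subst integral_density) (simp_all add: AE_wt_nonneg)

lemma integrable_\<mu>:
  assumes [measurable]: "h \<in> borel_measurable \<nu>"
  shows "integrable \<mu> h \<longleftrightarrow> integrable \<nu> (\<lambda>z. wt z * h z)"
  unfolding \<mu>_eq by (subst integrable_density) (simp_all add: AE_wt_nonneg)

lemma finite_\<mu>: "finite_measure \<mu>"
proof
  have "emeasure \<mu> (space \<mu>) = (\<integral>\<^sup>+z. ennreal (wt z) \<partial>\<nu>)"
    unfolding \<mu>_eq by (subst emeasure_density) (auto intro!: nn_integral_cong)
  also have "\<dots> = ennreal (\<integral>z. wt z \<partial>\<nu>)"
    using wt_bounds(3) by (intro nn_integral_eq_integral bdd_meas_integrable weight_bdd) (auto intro!: AE_I2 less_imp_le)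
  finally show "emeasure \<mu> (space \<mu>) \<noteq> \<infinity>" by simp
qed

text \<open>Comparing the weight with the probability density of \<open>Z\<close>, rather than with
  a constant, makes the bound independent of the mass of \<open>\<nu>\<close>.\<close>

lemma measure_\<mu>: "measure \<mu> (space \<mu>) \<le> 1 / \<delta>\<^sup>2"
proof -
  have "measure \<mu> (space \<mu>) = (\<integral>z. 1 \<partial>\<mu>)" by simp
  also have "\<dots> = (\<integral>z. wt z \<partial>\<nu>)"
    by (subst integral_\<mu>) simp_all
  also have "\<dots> \<le> (\<integral>z. 1 / \<delta>\<^sup>2 * par_f p z \<partial>\<nu>)"
    by (intro integral_mono bdd_meas_integrable bdd_meas_intros weight_bdd par_bdd wt_bounds)
  also have "\<dots> = 1 / \<delta>\<^sup>2"
    by (simp add: integral_f)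
  finally show ?thesis .
qed

lemma AE_law_Z:
  assumes "AE z in \<nu>. R z"
  shows "AE x in law \<nu> p. R (Z_of x)"
proof -
  interpret P: prob_space "law \<nu> p" by (rule prob_space_law)
  obtain N where N: "N \<in> null_sets \<nu>" "{z \<in> space \<nu>. \<not> R z} \<subseteq> N"
    using assms by (auto simp: eventually_ae_filter)
  have Z [measurable]: "Z_of \<in> measurable (triples \<nu>) \<nu>"
    unfolding Z_of_def by measurable
  have [measurable]: "N \<in> sets \<nu>" using N by auto
  have ib: "(indicator N :: 'z \<Rightarrow> real) \<in> bdd_meas \<nu>"
  proof (rule bdd_measI[of _ _ 1])
    show "(indicator N :: 'z \<Rightarrow> real) \<in> borel_measurable \<nu>"
      by (rule borel_measurable_indicator) fact
    show "\<bar>indicator N z :: real\<bar> \<le> 1" for z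
      by (cases "z \<in> N") simp_all
  qed
  have iZ: "(\<lambda>x. indicator N (Z_of x) :: real) \<in> bdd_meas (triples \<nu>)"
    by (rule bdd_meas_comp[OF ib Z])
  have "(\<integral>x. indicator N (Z_of x) \<partial>law \<nu> p) = (0 :: real)"
    unfolding integral_law[OF iZ]
  proof (rule integral_eq_zero_AE)
    have "AE z in \<nu>. z \<notin> N" using N(1) by (rule AE_not_in)
    then show "AE z in \<nu>. par_f p z *
          (par_b p z * (1 / par_a p z) * indicator N (Z_of (True, True, z)) +
           (1 - par_b p z) * (1 / par_a p z) * indicator N (Z_of (False, True, z)) +
           (1 - 1 / par_a p z) * indicator N (Z_of (False, False, z))) = (0 :: real)"
      by eventually_elim (simp add: Z_of_def)
  qed
  note 0 = this
  have "AE x in law \<nu> p. indicator N (Z_of x) = (0 :: real)"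
    using 0 by (subst integral_nonneg_eq_0_iff_AE[symmetric])
      (auto intro!: P.bdd_meas_integrable simp: bdd_meas_law iZ)
  moreover have "AE x in law \<nu> p. x \<in> space (triples \<nu>)"
    using AE_space[of "law \<nu> p"] by (simp only: space_law)
  ultimately show ?thesis
    by eventually_elim (use N(2) in \<open>auto simp: Z_of_def space_pair_measure indicator_def split: if_splits\<close>)
qed

lemma Z_meas: "Z_of \<in> measurable (law \<nu> p) \<nu>"
proof -
  have "Z_of \<in> measurable (triples \<nu>) \<nu>"
    unfolding Z_of_def by measurable
  then show ?thesis
    unfolding measurable_cong_sets[OF sets_law refl] .
qed

end

locale two_models = p: weighted \<delta> \<nu> p aw bw + q: weighted \<delta> \<nu> phat aw bw
  for \<delta> :: real and \<nu> :: "'z measure" and p phat aw bw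
begin

abbreviation "\<mu>\<^sub>p \<equiv> wmeasure \<nu> aw bw p"
abbreviation "\<mu>\<^sub>q \<equiv> wmeasure \<nu> aw bw phat"

text \<open>The density of \<open>\<mu>\<^sub>p\<close> with respect to
  \<open>\<mu>\<^sub>q\<close>; the fixed weights cancel.\<close>

definition rho :: "'z \<Rightarrow> real" where
  "rho z = par_g p z / par_g phat z"

text \<open>Scaled so that integrating the product \<open>da * db\<close> over
  \<open>\<mu>\<^sub>p\<close> amounts to integrating the product of the two errors against
  \<open>g\<close>.\<close>

definition da :: "'z \<Rightarrow> real" where "da z = (par_a phat z - par_a p z) / aw z"
definition db :: "'z \<Rightarrow> real" where "db z = (par_b phat z - par_b p z) / bw z"

lemma div_bdd:
  assumes f: "f \<in> bdd_meas \<nu>" and h: "h \<in> bdd_meas \<nu>" "\<And>z. z \<in> space \<nu> \<Longrightarrow> \<delta> \<le> h z"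
  shows "(\<lambda>z. f z / h z) \<in> bdd_meas \<nu>"
proof -
  have "(\<lambda>z. f z * (1 / h z)) \<in> bdd_meas \<nu>"
    by (rule bdd_meas_mult[OF f p.inverse_bdd[OF h]])
  then show ?thesis by simp
qed

lemma quot_bdd: "rho \<in> bdd_meas \<nu>" "da \<in> bdd_meas \<nu>" "db \<in> bdd_meas \<nu>"
proof -
  show "rho \<in> bdd_meas \<nu>"
    unfolding rho_def[abs_def] by (intro div_bdd p.par_bdd q.par_bdd q.bounds(7))
  show "da \<in> bdd_meas \<nu>"
    unfolding da_def[abs_def] by (intro div_bdd bdd_meas_diff p.par_bdd q.par_bdd p.weight_bdd p.weight_bounds(1))
  show "db \<in> bdd_meas \<nu>"
    unfolding db_def[abs_def] by (intro div_bdd bdd_meas_diff p.par_bdd q.par_bdd p.weight_bdd p.weight_bounds(3))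
qed

lemma rho_bounds:
  assumes "z \<in> space \<nu>"
  shows "0 < rho z" "rho z \<le> 1 / \<delta>\<^sup>2"
proof -
  have "par_g p z / par_g phat z \<le> (1 / \<delta>) / \<delta>"
    using p.bounds[OF assms] q.bounds[OF assms] p.\<delta> by (intro frac_le) auto
  then show "rho z \<le> 1 / \<delta>\<^sup>2"
    by (simp add: rho_def power2_eq_square)
  show "0 < rho z"
    using p.bounds[OF assms] q.bounds[OF assms] p.\<delta> by (simp add: rho_def)
qed

lemma wt_rho:
  assumes "z \<in> space \<nu>"
  shows "q.wt z * rho z = p.wt z"
proof -
  have "par_g phat z \<noteq> 0"
    using q.bounds(7)[OF assms] p.\<delta> by linarith
  then show ?thesis
    by (simp add: q.wt_def p.wt_def rho_def)
qed

lemma integral_\<mu>\<^sub>p: "h \<in> borel_measurable \<nu> \<Longrightarrow> (\<integral>z. h z \<partial>\<mu>\<^sub>p) = (\<integral>z. rho z * h z \<partial>\<mu>\<^sub>q)"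
proof -
  assume h [measurable]: "h \<in> borel_measurable \<nu>"
  have [measurable]: "rho \<in> borel_measurable \<nu>"
    using quot_bdd(1) by (rule bdd_meas_measurable)
  show ?thesis
    by (subst p.integral_\<mu>[OF h], subst q.integral_\<mu>, measurable)
      (intro Bochner_Integration.integral_cong refl, simp add: wt_rho[symmetric] mult.assoc)
qed

end

subsection \<open>Kernels that agree almost everywhere\<close>

text \<open>Two distinct coordinates are independent, so a product null set is avoided: coordinate
  \<open>i\<close> is integrated out first with the others fixed. For equal coordinates this would
  fail, as the diagonal may carry the null set.\<close>

lemma AE_pair_PiM:
  assumes P: "prob_space P" and I: "finite I" "i \<in> I" "i' \<in> I" "i \<noteq> i'"
    and N: "N \<in> null_sets (P \<Otimes>\<^sub>M P)"
  shows "AE x in PiM I (\<lambda>_. P). (x i, x i') \<notin> N"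
proof -
  interpret one: prob_space P by fact
  interpret pair_sigma_finite P P ..
  interpret product_prob_space "\<lambda>_. P" I by unfold_locales
  let ?I = "I - {i}"
  have II: "insert i ?I = I" "i \<notin> ?I" "finite ?I" "i' \<in> ?I"
    using I by auto
  have Nm [measurable]: "N \<in> sets (P \<Otimes>\<^sub>M P)" using N by auto
  have pm: "(\<lambda>x. (x i, x i')) \<in> measurable (PiM I (\<lambda>_. P)) (P \<Otimes>\<^sub>M P)"
    using I by (intro measurable_Pair measurable_component_singleton)
  have fm: "(\<lambda>x. indicator N (x i, x i') :: ennreal) \<in> borel_measurable (PiM I (\<lambda>_. P))"
    using measurable_compose[OF pm borel_measurable_indicator[OF Nm]] by simp
  have "AE x in P \<Otimes>\<^sub>M P. x \<notin> N"
    using N by (rule AE_not_in)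
  then have "AE x in P. AE y in P. (fst (x, y), snd (x, y)) \<notin> N"
    using AE_pair[of "\<lambda>x. x \<notin> N"] by simp
  then have "AE y in P. AE x in P. (x, y) \<notin> N"
    using AE_commute[of "\<lambda>x y. (x, y) \<notin> N"] Nm by simp
  then have ae: "AE x in PiM ?I (\<lambda>_. P). AE y in P. (y, x i') \<notin> N"
    using II(4) by (intro product_prob_space.AE_component[of "\<lambda>_. P"]) unfold_locales
  have "(\<integral>\<^sup>+x. indicator N (x i, x i') \<partial>PiM I (\<lambda>_. P)) =
      (\<integral>\<^sup>+x. \<integral>\<^sup>+y. indicator N ((x(i := y)) i, (x(i := y)) i') \<partial>P \<partial>PiM ?I (\<lambda>_. P))"
    using product_nn_integral_insert[OF II(3,2), of "\<lambda>x. indicator N (x i, x i')"] fm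
    by (simp only: II(1))
  also have "\<dots> = (\<integral>\<^sup>+x. \<integral>\<^sup>+y. indicator N (y, x i') \<partial>P \<partial>PiM ?I (\<lambda>_. P))"
    using I(4) by simp
  also have "\<dots> = (\<integral>\<^sup>+x. 0 \<partial>PiM ?I (\<lambda>_. P))"
  proof (rule nn_integral_cong_AE)
    show "AE x in PiM ?I (\<lambda>_. P). (\<integral>\<^sup>+y. indicator N (y, x i') \<partial>P) = 0"
      using ae
    proof eventually_elim
      case (elim x)
      have "(\<integral>\<^sup>+y. indicator N (y, x i') \<partial>P) = (\<integral>\<^sup>+y. 0 \<partial>P)"
        using elim by (intro nn_integral_cong_AE) (auto simp: indicator_def)
      then show ?case by simp
    qed
  qed
  finally have "AE x in PiM I (\<lambda>_. P). indicator N (x i, x i') = (0 :: ennreal)"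
    using nn_integral_0_iff_AE[OF fm] by simp
  then show ?thesis
    by eventually_elim (simp add: indicator_def split: if_splits)
qed

section \<open>The factors of the estimator under the true and the estimated law\<close>

context two_models
begin

abbreviation "P \<equiv> law \<nu> p"
abbreviation "Q \<equiv> law \<nu> phat"

lemma Z_triples [measurable]: "Z_of \<in> measurable (triples \<nu>) \<nu>"
  unfolding Z_of_def by measurable

lemma of_bool_bdd:
  "(\<lambda>x. of_bool (fst x)) \<in> bdd_meas (triples \<nu>)" "(\<lambda>x. of_bool (fst (snd x))) \<in> bdd_meas (triples \<nu>)"
proof -
  have "(\<lambda>x. if fst x then 1 else 0) \<in> bdd_meas (triples \<nu>)"
    "(\<lambda>x. if fst (snd x) then 1 else 0) \<in> bdd_meas (triples \<nu>)"
    by (rule bdd_measI[of _ _ 1]; (measurable | simp))+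
  then show "(\<lambda>x. of_bool (fst x)) \<in> bdd_meas (triples \<nu>)" "(\<lambda>x. of_bool (fst (snd x))) \<in> bdd_meas (triples \<nu>)"
    by (simp_all add: of_bool_def)
qed

lemma factor_bdd: "A_hat phat bw \<in> bdd_meas (triples \<nu>)" "A_under aw bw \<in> bdd_meas (triples \<nu>)"
  "Y_hat phat aw \<in> bdd_meas (triples \<nu>)" "linear_part phat \<in> bdd_meas (triples \<nu>)"
proof -
  note c = bdd_meas_comp[OF _ Z_triples]
  note cs = c[OF p.weight_bdd(1)] c[OF p.weight_bdd(2)] c[OF q.par_bdd(1)] c[OF q.par_bdd(2)]
  have "A_hat phat bw = (\<lambda>x. (of_bool (fst (snd x)) * par_a phat (Z_of x) - 1) * bw (Z_of x))"
    "A_under aw bw = (\<lambda>x. of_bool (fst (snd x)) * aw (Z_of x) * bw (Z_of x))"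
    "Y_hat phat aw = (\<lambda>x. of_bool (fst (snd x)) * (of_bool (fst x) - par_b phat (Z_of x)) * aw (Z_of x))"
    "linear_part phat = (\<lambda>x. of_bool (fst (snd x)) * par_a phat (Z_of x) * (of_bool (fst x) - par_b phat (Z_of x)) +
       par_b phat (Z_of x))"
    by (auto simp: A_hat_def A_under_def Y_hat_def linear_part_def Z_of_def)
  then show "A_hat phat bw \<in> bdd_meas (triples \<nu>)" "A_under aw bw \<in> bdd_meas (triples \<nu>)"
    "Y_hat phat aw \<in> bdd_meas (triples \<nu>)" "linear_part phat \<in> bdd_meas (triples \<nu>)"
    using cs of_bool_bdd by (auto intro!: bdd_meas_mult bdd_meas_diff bdd_meas_add)
qed

text \<open>All densities refer to \<open>\<mu>\<^sub>q\<close>. An integral under the true law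
  therefore carries the factor \<open>rho\<close>, and the minus sign in \<open>V_fun\<close> comes
  from \<open>Y - b\<close> having its estimate subtracted. The functions \<open>w1_fun\<close>,
  \<open>w2_fun\<close>, \<open>w3_fun\<close> are conditional second moments under the estimated
  law, divided by the weight.\<close>

definition N_fun :: "'z \<Rightarrow> real" where "N_fun z = rho z - 1"
definition U_fun :: "'z \<Rightarrow> real" where "U_fun z = rho z * da z"
definition V_fun :: "'z \<Rightarrow> real" where "V_fun z = - (rho z * db z)"
definition w1_fun :: "'z \<Rightarrow> real" where "w1_fun z = (par_a phat z - 1) * par_a phat z * bw z / aw z"
definition w2_fun :: "'z \<Rightarrow> real" where "w2_fun z = aw z * bw z"
definition w3_fun :: "'z \<Rightarrow> real" where "w3_fun z = par_b phat z * (1 - par_b phat z) * aw z / bw z"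

lemma chain_fun_bdd: "N_fun \<in> bdd_meas \<nu>" "U_fun \<in> bdd_meas \<nu>" "V_fun \<in> bdd_meas \<nu>"
  "w1_fun \<in> bdd_meas \<nu>" "w2_fun \<in> bdd_meas \<nu>" "w3_fun \<in> bdd_meas \<nu>"
proof -
  note b = quot_bdd q.par_bdd p.weight_bdd p.weight_bounds
  show "N_fun \<in> bdd_meas \<nu>" "U_fun \<in> bdd_meas \<nu>" "V_fun \<in> bdd_meas \<nu>" "w2_fun \<in> bdd_meas \<nu>"
    unfolding N_fun_def[abs_def] U_fun_def[abs_def] V_fun_def[abs_def] w2_fun_def[abs_def]
    by (intro bdd_meas_diff bdd_meas_mult bdd_meas_uminus bdd_meas_const b)+
  show "w1_fun \<in> bdd_meas \<nu>"
    unfolding w1_fun_def[abs_def] by (intro div_bdd bdd_meas_diff bdd_meas_mult bdd_meas_const b)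
  show "w3_fun \<in> bdd_meas \<nu>"
    unfolding w3_fun_def[abs_def] by (intro div_bdd bdd_meas_diff bdd_meas_mult bdd_meas_const b)
qed

lemma integral_chain:
  assumes f: "f \<in> bdd_meas \<nu>"
  shows "(\<integral>x. A_hat phat bw x * f (Z_of x) \<partial>P) = (\<integral>z. U_fun z * f z \<partial>\<mu>\<^sub>q)"
    and "(\<integral>x. A_hat phat bw x * f (Z_of x) \<partial>Q) = 0"
    and "(\<integral>x. A_under aw bw x * f (Z_of x) \<partial>P) - (\<integral>x. A_under aw bw x * f (Z_of x) \<partial>Q) =
      (\<integral>z. N_fun z * f z \<partial>\<mu>\<^sub>q)"
    and "(\<integral>x. Y_hat phat aw x * f (Z_of x) \<partial>P) = (\<integral>z. V_fun z * f z \<partial>\<mu>\<^sub>q)"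
    and "(\<integral>x. Y_hat phat aw x * f (Z_of x) \<partial>Q) = 0"
    and "(\<integral>x. (A_hat phat bw x)\<^sup>2 * f (Z_of x) \<partial>Q) = (\<integral>z. w1_fun z * f z \<partial>\<mu>\<^sub>q)"
    and "(\<integral>x. (A_under aw bw x)\<^sup>2 * f (Z_of x) \<partial>Q) = (\<integral>z. w2_fun z * f z \<partial>\<mu>\<^sub>q)"
    and "(\<integral>x. (Y_hat phat aw x)\<^sup>2 * f (Z_of x) \<partial>Q) = (\<integral>z. w3_fun z * f z \<partial>\<mu>\<^sub>q)"
proof -
  have fZ: "(\<lambda>x. f (Z_of x)) \<in> bdd_meas (triples \<nu>)"
    by (rule bdd_meas_comp[OF f Z_triples])
  have Zs: "Z_of (u, t, z) = z" for u t and z :: 'z by (simp add: Z_of_def)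
  note bd = bdd_meas_mult[OF _ fZ] bdd_meas_mult[OF bdd_meas_power fZ]
  note fs = A_hat_def A_under_def Y_hat_def
  have \<mu>: "(\<integral>z. h z * f z \<partial>\<mu>\<^sub>q) = (\<integral>z. q.wt z * (h z * f z) \<partial>\<nu>)" if "h \<in> bdd_meas \<nu>" for h
    using that f by (intro q.integral_\<mu> bdd_meas_measurable bdd_meas_mult)
  have nz: "par_a p z \<noteq> 0" "par_a phat z \<noteq> 0" "par_g phat z \<noteq> 0" "aw z \<noteq> 0" "bw z \<noteq> 0" if "z \<in> space \<nu>" for z
    using p.bounds[OF that] q.bounds[OF that] p.weight_bounds[OF that] p.\<delta> by auto
  show "(\<integral>x. A_hat phat bw x * f (Z_of x) \<partial>P) = (\<integral>z. U_fun z * f z \<partial>\<mu>\<^sub>q)"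
    unfolding p.integral_law[OF bd(1)[OF factor_bdd(1)]] \<mu>[OF chain_fun_bdd(2)]
  proof (intro Bochner_Integration.integral_cong refl)
    fix z assume "z \<in> space \<nu>"
    note n = nz[OF this]
    show "par_f p z * (par_b p z * (1 / par_a p z) * (A_hat phat bw (True, True, z) * f (Z_of (True, True, z))) +
        (1 - par_b p z) * (1 / par_a p z) * (A_hat phat bw (False, True, z) * f (Z_of (False, True, z))) +
        (1 - 1 / par_a p z) * (A_hat phat bw (False, False, z) * f (Z_of (False, False, z)))) =
       q.wt z * (U_fun z * f z)"
      using n by (simp add: Zs fs par_f_def q.wt_def U_fun_def rho_def da_def divide_simps) (simp add: algebra_simps)?
  qed
  show "(\<integral>x. A_hat phat bw x * f (Z_of x) \<partial>Q) = 0"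
    unfolding q.integral_law[OF bd(1)[OF factor_bdd(1)]]
  proof (intro integral_eq_zero_AE AE_I2)
    fix z assume "z \<in> space \<nu>"
    note n = nz[OF this]
    show "par_f phat z * (par_b phat z * (1 / par_a phat z) * (A_hat phat bw (True, True, z) * f (Z_of (True, True, z))) +
        (1 - par_b phat z) * (1 / par_a phat z) * (A_hat phat bw (False, True, z) * f (Z_of (False, True, z))) +
        (1 - 1 / par_a phat z) * (A_hat phat bw (False, False, z) * f (Z_of (False, False, z)))) = 0"
      using n by (simp add: Zs fs divide_simps) (simp add: algebra_simps)?
  qed
  show "(\<integral>x. Y_hat phat aw x * f (Z_of x) \<partial>P) = (\<integral>z. V_fun z * f z \<partial>\<mu>\<^sub>q)"
    unfolding p.integral_law[OF bd(1)[OF factor_bdd(3)]] \<mu>[OF chain_fun_bdd(3)]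
  proof (intro Bochner_Integration.integral_cong refl)
    fix z assume "z \<in> space \<nu>"
    note n = nz[OF this]
    show "par_f p z * (par_b p z * (1 / par_a p z) * (Y_hat phat aw (True, True, z) * f (Z_of (True, True, z))) +
        (1 - par_b p z) * (1 / par_a p z) * (Y_hat phat aw (False, True, z) * f (Z_of (False, True, z))) +
        (1 - 1 / par_a p z) * (Y_hat phat aw (False, False, z) * f (Z_of (False, False, z)))) =
       q.wt z * (V_fun z * f z)"
      using n by (simp add: Zs fs par_f_def q.wt_def V_fun_def rho_def db_def divide_simps) (simp add: algebra_simps)?
  qed
  show "(\<integral>x. Y_hat phat aw x * f (Z_of x) \<partial>Q) = 0"
    unfolding q.integral_law[OF bd(1)[OF factor_bdd(3)]]
  proof (intro integral_eq_zero_AE AE_I2)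
    fix z assume "z \<in> space \<nu>"
    note n = nz[OF this]
    show "par_f phat z * (par_b phat z * (1 / par_a phat z) * (Y_hat phat aw (True, True, z) * f (Z_of (True, True, z))) +
        (1 - par_b phat z) * (1 / par_a phat z) * (Y_hat phat aw (False, True, z) * f (Z_of (False, True, z))) +
        (1 - 1 / par_a phat z) * (Y_hat phat aw (False, False, z) * f (Z_of (False, False, z)))) = 0"
      using n by (simp add: Zs fs divide_simps) (simp add: algebra_simps)?
  qed
  show "(\<integral>x. (A_hat phat bw x)\<^sup>2 * f (Z_of x) \<partial>Q) = (\<integral>z. w1_fun z * f z \<partial>\<mu>\<^sub>q)"
    unfolding q.integral_law[OF bd(2)[OF factor_bdd(1)]] \<mu>[OF chain_fun_bdd(4)]
  proof (intro Bochner_Integration.integral_cong refl)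
    fix z assume "z \<in> space \<nu>"
    note n = nz[OF this]
    show "par_f phat z * (par_b phat z * (1 / par_a phat z) * ((A_hat phat bw (True, True, z))\<^sup>2 * f (Z_of (True, True, z))) +
        (1 - par_b phat z) * (1 / par_a phat z) * ((A_hat phat bw (False, True, z))\<^sup>2 * f (Z_of (False, True, z))) +
        (1 - 1 / par_a phat z) * ((A_hat phat bw (False, False, z))\<^sup>2 * f (Z_of (False, False, z)))) =
       q.wt z * (w1_fun z * f z)"
      using n by (simp add: Zs fs par_f_def q.wt_def w1_fun_def divide_simps) (simp add: power2_eq_square algebra_simps)?
  qed
  show "(\<integral>x. (A_under aw bw x)\<^sup>2 * f (Z_of x) \<partial>Q) = (\<integral>z. w2_fun z * f z \<partial>\<mu>\<^sub>q)"
    unfolding q.integral_law[OF bd(2)[OF factor_bdd(2)]] \<mu>[OF chain_fun_bdd(5)]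
  proof (intro Bochner_Integration.integral_cong refl)
    fix z assume "z \<in> space \<nu>"
    note n = nz[OF this]
    show "par_f phat z * (par_b phat z * (1 / par_a phat z) * ((A_under aw bw (True, True, z))\<^sup>2 * f (Z_of (True, True, z))) +
        (1 - par_b phat z) * (1 / par_a phat z) * ((A_under aw bw (False, True, z))\<^sup>2 * f (Z_of (False, True, z))) +
        (1 - 1 / par_a phat z) * ((A_under aw bw (False, False, z))\<^sup>2 * f (Z_of (False, False, z)))) =
       q.wt z * (w2_fun z * f z)"
      using n by (simp add: Zs fs par_f_def q.wt_def w2_fun_def divide_simps) (simp add: power2_eq_square algebra_simps)?
  qed
  show "(\<integral>x. (Y_hat phat aw x)\<^sup>2 * f (Z_of x) \<partial>Q) = (\<integral>z. w3_fun z * f z \<partial>\<mu>\<^sub>q)"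
    unfolding q.integral_law[OF bd(2)[OF factor_bdd(3)]] \<mu>[OF chain_fun_bdd(6)]
  proof (intro Bochner_Integration.integral_cong refl)
    fix z assume "z \<in> space \<nu>"
    note n = nz[OF this]
    show "par_f phat z * (par_b phat z * (1 / par_a phat z) * ((Y_hat phat aw (True, True, z))\<^sup>2 * f (Z_of (True, True, z))) +
        (1 - par_b phat z) * (1 / par_a phat z) * ((Y_hat phat aw (False, True, z))\<^sup>2 * f (Z_of (False, True, z))) +
        (1 - 1 / par_a phat z) * ((Y_hat phat aw (False, False, z))\<^sup>2 * f (Z_of (False, False, z)))) =
       q.wt z * (w3_fun z * f z)"
      using n by (simp add: Zs fs par_f_def q.wt_def w3_fun_def divide_simps) (simp add: power2_eq_square algebra_simps)?
  qed
  show "(\<integral>x. A_under aw bw x * f (Z_of x) \<partial>P) - (\<integral>x. A_under aw bw x * f (Z_of x) \<partial>Q) =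
      (\<integral>z. N_fun z * f z \<partial>\<mu>\<^sub>q)"
  proof -
    have e: "(\<integral>x. A_under aw bw x * f (Z_of x) \<partial>law \<nu> r) = (\<integral>z. par_g r z * aw z * bw z * f z \<partial>\<nu>)"
      if r: "model \<delta> \<nu> r" for r
      unfolding model.integral_law[OF r bd(1)[OF factor_bdd(2)]]
    proof (intro Bochner_Integration.integral_cong refl)
      fix z assume "z \<in> space \<nu>"
      then have "par_a r z \<noteq> 0" using model.bounds(1)[OF r] by fastforce
      then show "par_f r z * (par_b r z * (1 / par_a r z) * (A_under aw bw (True, True, z) * f (Z_of (True, True, z))) +
        (1 - par_b r z) * (1 / par_a r z) * (A_under aw bw (False, True, z) * f (Z_of (False, True, z))) +
        (1 - 1 / par_a r z) * (A_under aw bw (False, False, z) * f (Z_of (False, False, z)))) =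
        par_g r z * aw z * bw z * f z"
        by (simp add: Zs fs par_f_def divide_simps) (simp add: algebra_simps)?
    qed
    have i: "integrable \<nu> (\<lambda>z. par_g r z * aw z * bw z * f z)" if "model \<delta> \<nu> r" for r
      by (intro p.bdd_meas_integrable bdd_meas_mult model.par_bdd[OF that] p.weight_bdd f)
    show ?thesis
      unfolding e[OF p.model_axioms] e[OF q.model_axioms] \<mu>[OF chain_fun_bdd(1)]
        Bochner_Integration.integral_diff[OF i[OF p.model_axioms] i[OF q.model_axioms], symmetric]
    proof (intro Bochner_Integration.integral_cong refl)
      fix z assume "z \<in> space \<nu>"
      note n = nz[OF this]
      show "par_g p z * aw z * bw z * f z - par_g phat z * aw z * bw z * f z = q.wt z * (N_fun z * f z)"
        using n by (simp add: q.wt_def N_fun_def rho_def divide_simps) (simp add: algebra_simps)?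
    qed
  qed
qed


lemma chain_measurable:
  fixes u :: "nat \<Rightarrow> 'w \<Rightarrow> bool \<times> bool \<times> 'z"
  assumes K: "(\<lambda>(x, z). K x z) \<in> borel_measurable (\<nu> \<Otimes>\<^sub>M \<nu>)" and j: "2 \<le> j"
    and u: "\<And>i. i \<in> {1..j} \<Longrightarrow> u i \<in> measurable W (triples \<nu>)"
  shows "(\<lambda>\<omega>. chain phat aw bw K j (\<lambda>i. u i \<omega>)) \<in> borel_measurable W"
proof -
  note fm = factor_bdd[THEN bdd_meas_measurable]
  have Z: "(\<lambda>\<omega>. Z_of (u i \<omega>)) \<in> measurable W \<nu>" if "i \<in> {1..j}" for i
    using measurable_compose[OF u[OF that] Z_triples] .
  have "(\<lambda>\<omega>. K (Z_of (u i \<omega>)) (Z_of (u (Suc i) \<omega>))) \<in> borel_measurable W" if "i \<in> {1..<j}" for i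
  proof -
    have "i \<in> {1..j}" "Suc i \<in> {1..j}" using that by auto
    from measurable_compose[OF measurable_Pair[OF Z[OF this(1)] Z[OF this(2)]] K]
    show ?thesis by simp
  qed
  moreover have "(\<lambda>\<omega>. A_under aw bw (u i \<omega>)) \<in> borel_measurable W" if "i \<in> {2..<j}" for i
    using that by (intro measurable_compose[OF u fm(2)]) auto
  moreover have "(\<lambda>\<omega>. A_hat phat bw (u 1 \<omega>)) \<in> borel_measurable W"
    "(\<lambda>\<omega>. Y_hat phat aw (u j \<omega>)) \<in> borel_measurable W"
    using j by (intro measurable_compose[OF u fm(1)] measurable_compose[OF u fm(3)]; simp)+
  ultimately show ?thesis
    unfolding chain_def by (intro borel_measurable_times borel_measurable_prod)
qed

lemma sets_PQ: "sets P = sets (triples \<nu>)" "sets Q = sets (triples \<nu>)"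
  by (simp_all add: p.sets_law q.sets_law)

lemma measurable_P: "measurable W P = measurable W (triples \<nu>)" "measurable W Q = measurable W (triples \<nu>)"
  by (simp_all only: measurable_cong_sets[OF refl sets_PQ(1)] measurable_cong_sets[OF refl sets_PQ(2)])

lemma tuple_component:
  assumes "\<sigma> \<in> distinct_tuples n j" "i \<in> {1..j}"
  shows "(\<lambda>x. x (\<sigma> i)) \<in> measurable (sample_law \<nu> p n) (triples \<nu>)"
proof -
  have "\<sigma> i \<in> {1..n}"
    using assms by (auto simp: distinct_tuples_def)
  then show ?thesis
    unfolding sample_law_def using measurable_component_singleton[of "\<sigma> i" "{1..n}" "\<lambda>_. P"]
    by (simp only: measurable_P)
qed

lemma chi_hat_measurable:
  assumes K: "(\<lambda>(x, z). K x z) \<in> borel_measurable (\<nu> \<Otimes>\<^sub>M \<nu>)"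
  shows "chi_hat \<nu> phat aw bw K m n \<in> borel_measurable (sample_law \<nu> p n)"
proof -
  let ?S = "sample_law \<nu> p n"
  have lin: "(\<lambda>x. emp_mean n (linear_part phat) x) \<in> borel_measurable ?S"
    unfolding emp_mean_def
  proof (intro borel_measurable_divide borel_measurable_sum borel_measurable_const)
    fix i assume "i \<in> {1..n}"
    then have "(\<lambda>x. x i) \<in> measurable ?S (triples \<nu>)"
      unfolding sample_law_def using measurable_component_singleton[of i "{1..n}" "\<lambda>_. P"]
      by (simp only: measurable_P)
    then show "(\<lambda>x. linear_part phat (x i)) \<in> borel_measurable ?S"
      using measurable_compose factor_bdd(4)[THEN bdd_meas_measurable] by blast
  qed
  have "(\<lambda>x. cond_exp_iid Q j B (chain phat aw bw K j) (\<lambda>i. x (\<sigma> i))) \<in> borel_measurable ?S"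
    if j: "2 \<le> j" and s: "\<sigma> \<in> distinct_tuples n j" for j B \<sigma>
  proof -
    interpret Qp: prob_space Q by (rule q.prob_space_law)
    interpret QJ: prob_space "PiM {1..j} (\<lambda>_. Q)"
      by (intro prob_space_PiM q.prob_space_law)
    let ?u = "\<lambda>i \<omega>. if i \<in> B then fst \<omega> (\<sigma> i) else snd \<omega> i"
    have u: "?u i \<in> measurable (?S \<Otimes>\<^sub>M PiM {1..j} (\<lambda>_. Q)) (triples \<nu>)" if i: "i \<in> {1..j}" for i
    proof (cases "i \<in> B")
      case True
      then show ?thesis
        using measurable_compose[OF measurable_fst tuple_component[OF s i]] by simp
    next
      case False
      have "(\<lambda>y. y i) \<in> measurable (PiM {1..j} (\<lambda>_. Q)) (triples \<nu>)"
        using measurable_component_singleton[OF i, of "\<lambda>_. Q"] by (simp only: measurable_P)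
      then show ?thesis
        using False measurable_compose[OF measurable_snd] by simp
    qed
    have "(\<lambda>\<omega>. chain phat aw bw K j (\<lambda>i. ?u i \<omega>)) \<in> borel_measurable (?S \<Otimes>\<^sub>M PiM {1..j} (\<lambda>_. Q))"
      using chain_measurable[OF K j, of ?u] u by blast
    then have "(\<lambda>x. \<integral>y. chain phat aw bw K j (\<lambda>i. ?u i (x, y)) \<partial>PiM {1..j} (\<lambda>_. Q)) \<in> borel_measurable ?S"
      by (intro QJ.borel_measurable_lebesgue_integral) (simp add: case_prod_unfold)
    then show ?thesis
      unfolding cond_exp_iid_def by (simp only: fst_conv snd_conv cong: if_cong)
  qed
  then have "(\<lambda>x. ustat n j (degen Q j (chain phat aw bw K j)) x) \<in> borel_measurable ?S" if "2 \<le> j" for j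
    unfolding ustat_def degen_def using that
    by (intro borel_measurable_divide borel_measurable_sum borel_measurable_times borel_measurable_const)
  with lin show ?thesis
    unfolding chi_hat_def[abs_def]
    by (intro borel_measurable_add borel_measurable_sum borel_measurable_times borel_measurable_const) auto
qed

text \<open>The kernel is evaluated only at pairs of distinct positions. Because the degenerate part
  replaces some sample points by fresh draws from the estimated law, three kinds of pairs occur: two
  sample points, two fresh points, and one of each. Every kind avoids the exceptional null set for
  its own reason.\<close>

lemma chi_hat_AE_eq:
  assumes K: "(\<lambda>(x, z). K x z) \<in> borel_measurable (\<nu> \<Otimes>\<^sub>M \<nu>)"
    and K': "(\<lambda>(x, z). K' x z) \<in> borel_measurable (\<nu> \<Otimes>\<^sub>M \<nu>)"
    and eq: "AE x in \<nu> \<Otimes>\<^sub>M \<nu>. K (fst x) (snd x) = K' (fst x) (snd x)"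
  shows "AE x in sample_law \<nu> p n. chi_hat \<nu> phat aw bw K m n x = chi_hat \<nu> phat aw bw K' m n x"
proof -
  let ?S = "sample_law \<nu> p n"
  interpret Pp: prob_space P by (rule p.prob_space_law)
  interpret Qp: prob_space Q by (rule q.prob_space_law)
  interpret \<nu>\<nu>: pair_sigma_finite \<nu> \<nu> ..
  let ?R = "\<lambda>z z'. K z z' = K' z z'"
  have [measurable]: "(\<lambda>x. K (fst x) (snd x)) \<in> borel_measurable (\<nu> \<Otimes>\<^sub>M \<nu>)"
    "(\<lambda>x. K' (fst x) (snd x)) \<in> borel_measurable (\<nu> \<Otimes>\<^sub>M \<nu>)"
    using K K' by (simp_all add: case_prod_unfold)
  have Rs: "{x \<in> space (\<nu> \<Otimes>\<^sub>M \<nu>). ?R (fst x) (snd x)} \<in> sets (\<nu> \<Otimes>\<^sub>M \<nu>)"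
    by measurable
  have R1: "AE z in \<nu>. AE z' in \<nu>. ?R z z'"
    using \<nu>\<nu>.AE_pair[OF eq] by simp
  then have R2: "AE z in \<nu>. AE z' in \<nu>. ?R z' z"
    using \<nu>\<nu>.AE_commute[OF Rs] by simp
  have pairs: "AE x in PiM I (\<lambda>_. law \<nu> r). \<forall>i\<in>I. \<forall>i'\<in>I. i \<noteq> i' \<longrightarrow> ?R (Z_of (x i)) (Z_of (x i'))"
    if r: "weighted \<delta> \<nu> r aw bw" and I: "finite I" for r and I :: "nat set"
  proof -
    interpret r: weighted \<delta> \<nu> r aw bw by fact
    interpret rp: prob_space "law \<nu> r" by (rule r.prob_space_law)
    interpret rr: pair_sigma_finite "law \<nu> r" "law \<nu> r" ..
    have Zr [measurable]: "Z_of \<in> measurable (law \<nu> r) \<nu>" by (rule r.Z_meas)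
    have ZZ: "(\<lambda>x. (Z_of (fst x), Z_of (snd x))) \<in> measurable (law \<nu> r \<Otimes>\<^sub>M law \<nu> r) (\<nu> \<Otimes>\<^sub>M \<nu>)"
      by measurable
    have m: "(\<lambda>x. K (Z_of (fst x)) (Z_of (snd x))) \<in> borel_measurable (law \<nu> r \<Otimes>\<^sub>M law \<nu> r)"
      "(\<lambda>x. K' (Z_of (fst x)) (Z_of (snd x))) \<in> borel_measurable (law \<nu> r \<Otimes>\<^sub>M law \<nu> r)"
      using measurable_compose[OF ZZ K] measurable_compose[OF ZZ K'] by simp_all
    let ?N = "{x \<in> space (law \<nu> r \<Otimes>\<^sub>M law \<nu> r). K (Z_of (fst x)) (Z_of (snd x)) \<noteq> K' (Z_of (fst x)) (Z_of (snd x))}"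
    have Nm: "?N \<in> sets (law \<nu> r \<Otimes>\<^sub>M law \<nu> r)"
      using m by measurable
    have "AE x in law \<nu> r. AE z' in \<nu>. ?R (Z_of x) z'"
      by (rule r.AE_law_Z[OF R1])
    then have "AE x in law \<nu> r. AE x' in law \<nu> r. ?R (Z_of x) (Z_of x')"
      by eventually_elim (rule r.AE_law_Z)
    then have "AE x in law \<nu> r \<Otimes>\<^sub>M law \<nu> r. ?R (Z_of (fst x)) (Z_of (snd x))"
      using m by (intro rr.AE_pair_measure) (simp_all, measurable)
    then have null: "?N \<in> null_sets (law \<nu> r \<Otimes>\<^sub>M law \<nu> r)"
      by (rule iffD1[OF AE_iff_null[OF Nm]])
    have "AE x in PiM I (\<lambda>_. law \<nu> r). i \<noteq> i' \<longrightarrow> ?R (Z_of (x i)) (Z_of (x i'))" if "i \<in> I" "i' \<in> I" for i i'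
    proof (cases "i = i'")
      case False
      have "AE x in PiM I (\<lambda>_. law \<nu> r). x \<in> space (PiM I (\<lambda>_. law \<nu> r))" by (rule AE_space)
      with AE_pair_PiM[OF r.prob_space_law I that False null] show ?thesis
      proof eventually_elim
        case (elim x)
        have "x i \<in> space (law \<nu> r)" "x i' \<in> space (law \<nu> r)"
          using elim(2) that by (auto simp: space_PiM PiE_def Pi_def)
        then show ?case
          using elim(1) by (auto simp: space_pair_measure)
      qed
    qed simp
    then show ?thesis
      using I by (simp add: AE_ball_countable countable_finite)
  qed
  \<comment> \<open>For the mixed pairs: almost every sample point has full sections of the set of
    agreement in both directions, as the sample point may precede or follow the fresh one in the
    chain.\<close>
  have single: "AE x in ?S. \<forall>i\<in>{1..n}. (AE z' in \<nu>. ?R (Z_of (x i)) z') \<and> (AE z' in \<nu>. ?R z' (Z_of (x i)))"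
  proof -
    interpret product_prob_space "\<lambda>_. P" "{1..n}" by unfold_locales
    have "AE x in ?S. (AE z' in \<nu>. ?R (Z_of (x i)) z') \<and> (AE z' in \<nu>. ?R z' (Z_of (x i)))"
      if "i \<in> {1..n}" for i
      unfolding sample_law_def
    proof (rule AE_component[OF that])
      show "AE x in P. (AE z' in \<nu>. ?R (Z_of x) z') \<and> (AE z' in \<nu>. ?R z' (Z_of x))"
        using p.AE_law_Z[OF R1] p.AE_law_Z[OF R2] by eventually_elim simp
    qed
    then show ?thesis
      by (simp add: AE_ball_countable)
  qed
  have "AE x in ?S. x \<in> space ?S" by (rule AE_space)
  moreover have "AE x in ?S. \<forall>i\<in>{1..n}. \<forall>i'\<in>{1..n}. i \<noteq> i' \<longrightarrow> ?R (Z_of (x i)) (Z_of (x i'))"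
    unfolding sample_law_def by (rule pairs[OF p.weighted_axioms]) simp
  ultimately show ?thesis
    using single
  proof eventually_elim
    case (elim x)
    note xs = elim(1)[unfolded sample_law_def] and pr = elim(2) and sg = elim(3)
    have ce: "cond_exp_iid Q j B (chain phat aw bw K j) (\<lambda>i. x (\<sigma> i)) =
        cond_exp_iid Q j B (chain phat aw bw K' j) (\<lambda>i. x (\<sigma> i))"
      if j: "2 \<le> j" and s: "\<sigma> \<in> distinct_tuples n j" for j B \<sigma>
    proof -
      interpret product_prob_space "\<lambda>_. Q" "{1..j}" by unfold_locales
      have \<sigma>: "\<sigma> i \<in> {1..n}" if "i \<in> {1..j}" for i
        using s that by (auto simp: distinct_tuples_def)
      have \<sigma>i: "\<sigma> i \<noteq> \<sigma> (Suc i)" if "i \<in> {1..<j}" for i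
      proof
        assume eq: "\<sigma> i = \<sigma> (Suc i)"
        have inj: "inj_on \<sigma> {1..j}"
          using s by (simp add: distinct_tuples_def)
        have "i \<in> {1..j}" "Suc i \<in> {1..j}" using that by auto
        then have "i = Suc i"
          by (rule inj_onD[OF inj eq])
        then show False by simp
      qed
      let ?u = "\<lambda>i y. if i \<in> B then x (\<sigma> i) else y i"
      have u: "?u i \<in> measurable (PiM {1..j} (\<lambda>_. Q)) (triples \<nu>)" if i: "i \<in> {1..j}" for i
      proof (cases "i \<in> B")
        case True
        have "x (\<sigma> i) \<in> space P"
          using PiE_mem[OF xs[unfolded space_PiM] \<sigma>[OF i]] .
        then show ?thesis using True by (simp add: p.space_law)
      next
        case False
        then show ?thesis
          using measurable_component_singleton[OF i, of "\<lambda>_. Q"] by (simp only: measurable_P if_False)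
      qed
      have cq: "AE y in PiM {1..j} (\<lambda>_. Q). AEP (Z_of (y i))" if "AE z' in \<nu>. AEP z'" "i \<in> {1..j}" for AEP i
        using q.AE_law_Z[OF that(1)] by (rule AE_component[OF that(2)])
      have "AE y in PiM {1..j} (\<lambda>_. Q). ?R (Z_of (?u i y)) (Z_of (?u (Suc i) y))" if i: "i \<in> {1..<j}" for i
      proof -
        have ii: "i \<in> {1..j}" "Suc i \<in> {1..j}" using i by auto
        show ?thesis
        proof (cases "i \<in> B"; cases "Suc i \<in> B")
          assume "i \<in> B" "Suc i \<in> B"
          then show ?thesis
            using pr[rule_format, OF \<sigma>[OF ii(1)] \<sigma>[OF ii(2)] \<sigma>i[OF i]] by simp
        next
          assume B: "i \<in> B" "Suc i \<notin> B"
          have "AE z' in \<nu>. ?R (Z_of (x (\<sigma> i))) z'" using sg \<sigma>[OF ii(1)] by blast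
          from cq[OF this ii(2)] show ?thesis using B by simp
        next
          assume B: "i \<notin> B" "Suc i \<in> B"
          have "AE z' in \<nu>. ?R z' (Z_of (x (\<sigma> (Suc i))))" using sg \<sigma>[OF ii(2)] by blast
          from cq[OF this ii(1)] show ?thesis using B by simp
        next
          assume B: "i \<notin> B" "Suc i \<notin> B"
          have "AE y in PiM {1..j} (\<lambda>_. Q). \<forall>i\<in>{1..j}. \<forall>i'\<in>{1..j}. i \<noteq> i' \<longrightarrow> ?R (Z_of (y i)) (Z_of (y i'))"
            by (rule pairs[OF q.weighted_axioms]) simp
          then show ?thesis
            by eventually_elim (use B ii in auto)
        qed
      qed
      then have "AE y in PiM {1..j} (\<lambda>_. Q). \<forall>i\<in>{1..<j}. ?R (Z_of (?u i y)) (Z_of (?u (Suc i) y))"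
        by (simp add: AE_ball_countable)
      then have "AE y in PiM {1..j} (\<lambda>_. Q). chain phat aw bw K j (\<lambda>i. ?u i y) = chain phat aw bw K' j (\<lambda>i. ?u i y)"
        by eventually_elim (simp add: chain_def)
      then show ?thesis
        unfolding cond_exp_iid_def
        by (intro integral_cong_AE chain_measurable[OF K j u] chain_measurable[OF K' j u])
    qed
    show ?case
      unfolding chi_hat_def ustat_def degen_def
      by (intro arg_cong2[where f = "(+)"] arg_cong2[where f = "(*)"] arg_cong2[where f = "(/)"] sum.cong refl ce) auto
  qed
qed

end

subsection \<open>Hoelder's inequality\<close>

lemma Lp_norm_nonneg [simp]: "0 \<le> Lp_norm M s f"
  by (simp add: Lp_norm_def)

context finite_measure
begin

lemma powr_bdd:
  assumes f: "f \<in> bdd_meas M" and s: "0 < s"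
  shows "(\<lambda>x. \<bar>f x\<bar> powr s) \<in> bdd_meas M"
proof -
  obtain C where C: "0 \<le> C" "\<And>x. x \<in> space M \<Longrightarrow> \<bar>f x\<bar> \<le> C"
    using bdd_meas_bound[OF f] by metis
  have [measurable]: "f \<in> borel_measurable M" using f by (rule bdd_meas_measurable)
  show ?thesis
  proof (rule bdd_measI)
    show "(\<lambda>x. \<bar>f x\<bar> powr s) \<in> borel_measurable M" by measurable
    fix x assume "x \<in> space M"
    then show "\<bar>\<bar>f x\<bar> powr s\<bar> \<le> C powr s"
      using C s by (simp add: powr_mono2)
  qed
qed

lemma bdd_Lp_space: "f \<in> bdd_meas M \<Longrightarrow> 0 < s \<Longrightarrow> f \<in> Lp_space M s"
  by (simp add: Lp_space_def bdd_meas_measurable bdd_meas_integrable powr_bdd)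

lemma Lp_norm_powr: "0 < s \<Longrightarrow> Lp_norm M s f powr s = (\<integral>x. \<bar>f x\<bar> powr s \<partial>M)"
  by (simp add: Lp_norm_def powr_powr)

lemma Lp_norm_0_AE:
  assumes f: "f \<in> bdd_meas M" and s: "0 < s" and 0: "Lp_norm M s f = 0"
  shows "AE x in M. f x = 0"
proof -
  have "(\<integral>x. \<bar>f x\<bar> powr s \<partial>M) = 0"
    using Lp_norm_powr[OF s, of f] 0 by simp
  then have "AE x in M. \<bar>f x\<bar> powr s = 0"
    using bdd_meas_integrable[OF powr_bdd[OF f s]] by (subst (asm) integral_nonneg_eq_0_iff_AE) auto
  then show ?thesis by eventually_elim simp
qed

lemma Hoelder:
  assumes f: "f \<in> bdd_meas M" and g: "g \<in> bdd_meas M" and pq: "1 < p" "1 < q" "1 / p + 1 / q = 1"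
  shows "(\<integral>x. \<bar>f x * g x\<bar> \<partial>M) \<le> Lp_norm M p f * Lp_norm M q g"
proof (cases "Lp_norm M p f = 0 \<or> Lp_norm M q g = 0")
  case True
  then have "AE x in M. \<bar>f x * g x\<bar> = 0"
  proof
    assume "Lp_norm M p f = 0"
    then show ?thesis using Lp_norm_0_AE[OF f, of p] pq by (auto elim: AE_mp)
  next
    assume "Lp_norm M q g = 0"
    then show ?thesis using Lp_norm_0_AE[OF g, of q] pq by (auto elim: AE_mp)
  qed
  then have "(\<integral>x. \<bar>f x * g x\<bar> \<partial>M) = 0"
    by (rule integral_eq_zero_AE)
  then show ?thesis by simp
next
  case False
  let ?A = "Lp_norm M p f" and ?B = "Lp_norm M q g"
  have AB: "0 < ?A" "0 < ?B"
    using False Lp_norm_nonneg[of M p f] Lp_norm_nonneg[of M q g] by linarith+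
  note i = bdd_meas_integrable[OF powr_bdd[OF f]] bdd_meas_integrable[OF powr_bdd[OF g]]
  have "(\<integral>x. \<bar>f x * g x\<bar> / (?A * ?B) \<partial>M) \<le>
      (\<integral>x. \<bar>f x\<bar> powr p / (p * ?A powr p) + \<bar>g x\<bar> powr q / (q * ?B powr q) \<partial>M)"
  proof (rule integral_mono)
    show "integrable M (\<lambda>x. \<bar>f x * g x\<bar> / (?A * ?B))"
      by (intro bdd_meas_integrable bdd_meas_intros f g)
    show "integrable M (\<lambda>x. \<bar>f x\<bar> powr p / (p * ?A powr p) + \<bar>g x\<bar> powr q / (q * ?B powr q))"
      using i pq by auto
    fix x
    have "(\<bar>f x\<bar> / ?A) * (\<bar>g x\<bar> / ?B) \<le> (\<bar>f x\<bar> / ?A) powr p / p + (\<bar>g x\<bar> / ?B) powr q / q"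
      using AB pq by (intro Youngs_inequality) auto
    then show "\<bar>f x * g x\<bar> / (?A * ?B) \<le> \<bar>f x\<bar> powr p / (p * ?A powr p) + \<bar>g x\<bar> powr q / (q * ?B powr q)"
      using AB by (simp add: abs_mult powr_divide mult.commute)
  qed
  also have "\<dots> = (\<integral>x. \<bar>f x\<bar> powr p \<partial>M) / (p * ?A powr p) + (\<integral>x. \<bar>g x\<bar> powr q \<partial>M) / (q * ?B powr q)"
    using i pq by (subst Bochner_Integration.integral_add) auto
  also have "\<dots> = 1 / p + 1 / q"
  proof -
    have "(\<integral>x. \<bar>f x\<bar> powr p \<partial>M) = ?A powr p" "(\<integral>x. \<bar>g x\<bar> powr q \<partial>M) = ?B powr q"
      using Lp_norm_powr[of p f] Lp_norm_powr[of q g] pq by auto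
    moreover have "?A powr p \<noteq> 0" "?B powr q \<noteq> 0" using AB by auto
    ultimately show ?thesis by simp
  qed
  finally show ?thesis
    using pq AB by (simp add: divide_le_eq)
qed

text \<open>Hoelder's inequality for the \<open>u\<close>-th powers, with the conjugate exponents
  \<open>t / u\<close> and \<open>s / u\<close>.\<close>

lemma Lp_norm_mult:
  assumes f: "f \<in> bdd_meas M" and g: "g \<in> bdd_meas M"
    and s: "0 < s" "0 < t" "0 < u" "1 / u = 1 / t + 1 / s"
  shows "Lp_norm M u (\<lambda>x. f x * g x) \<le> Lp_norm M t f * Lp_norm M s g"
proof -
  let ?F = "\<lambda>x. \<bar>f x\<bar> powr u" and ?G = "\<lambda>x. \<bar>g x\<bar> powr u"
  have "0 < 1 / t" "0 < 1 / s" using s by simp_all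
  then have "1 / t < 1 / u" "1 / s < 1 / u"
    unfolding s(4) by linarith+
  then have 1: "1 < t / u" "1 < s / u"
    using s(1-3) by (simp_all add: field_simps)
  have 2: "1 / (t / u) + 1 / (s / u) = 1"
  proof -
    have "1 / (t / u) + 1 / (s / u) = u * (1 / t + 1 / s)"
      by (simp add: distrib_left)
    then show ?thesis
      using s(3) unfolding s(4)[symmetric] by simp
  qed
  have n: "Lp_norm M (t / u) ?F = Lp_norm M t f powr u" "Lp_norm M (s / u) ?G = Lp_norm M s g powr u"
    using s by (simp_all add: Lp_norm_def powr_powr)
  have "(\<integral>x. \<bar>f x * g x\<bar> powr u \<partial>M) = (\<integral>x. \<bar>?F x * ?G x\<bar> \<partial>M)"
    by (simp add: abs_mult powr_mult)
  also have "\<dots> \<le> Lp_norm M (t / u) ?F * Lp_norm M (s / u) ?G"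
    using s by (intro Hoelder powr_bdd f g 1 2) auto
  also have "\<dots> = (Lp_norm M t f * Lp_norm M s g) powr u"
    by (simp add: n powr_mult)
  finally have "(\<integral>x. \<bar>f x * g x\<bar> powr u \<partial>M) powr (1 / u) \<le> ((Lp_norm M t f * Lp_norm M s g) powr u) powr (1 / u)"
    using s by (intro powr_mono2) auto
  then show ?thesis
    using s(3) by (simp add: Lp_norm_def[of M u] powr_powr)
qed

lemma Lp_norm_le:
  assumes f: "f \<in> bdd_meas M" and g: "g \<in> bdd_meas M" and s: "0 < s" and c: "0 \<le> c"
    and le: "AE x in M. \<bar>f x\<bar> \<le> c * \<bar>g x\<bar>"
  shows "Lp_norm M s f \<le> c * Lp_norm M s g"
proof -
  have "(\<integral>x. \<bar>f x\<bar> powr s \<partial>M) \<le> (\<integral>x. c powr s * \<bar>g x\<bar> powr s \<partial>M)"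
  proof (rule integral_mono_AE)
    show "integrable M (\<lambda>x. \<bar>f x\<bar> powr s)" "integrable M (\<lambda>x. c powr s * \<bar>g x\<bar> powr s)"
      using bdd_meas_integrable[OF powr_bdd[OF f s]] bdd_meas_integrable[OF powr_bdd[OF g s]] by auto
    show "AE x in M. \<bar>f x\<bar> powr s \<le> c powr s * \<bar>g x\<bar> powr s"
      using le
    proof eventually_elim
      case (elim x)
      then show ?case
        using powr_mono2[OF less_imp_le[OF s] _ elim] c by (simp add: powr_mult)
    qed
  qed
  also have "\<dots> = (c * Lp_norm M s g) powr s"
    using c s by (simp add: powr_mult Lp_norm_powr)
  finally have "(\<integral>x. \<bar>f x\<bar> powr s \<partial>M) powr (1 / s) \<le> ((c * Lp_norm M s g) powr s) powr (1 / s)"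
    using s by (intro powr_mono2) auto
  then show ?thesis
    using s c by (simp add: Lp_norm_def[of M s f] powr_powr)
qed

lemma Lp_norm_mult_sup:
  assumes f: "f \<in> bdd_meas M" and g: "g \<in> bdd_meas M" and s: "0 < s" and c: "0 \<le> c"
    "\<And>x. x \<in> space M \<Longrightarrow> \<bar>f x\<bar> \<le> c"
  shows "Lp_norm M s (\<lambda>x. f x * g x) \<le> c * Lp_norm M s g"
  using c by (intro Lp_norm_le bdd_meas_mult f g s AE_I2) (auto simp: abs_mult intro!: mult_right_mono)

lemma Lp_norm_cong_AE:
  assumes f: "f \<in> borel_measurable M" and g: "g \<in> borel_measurable M" and eq: "AE x in M. f x = g x"
  shows "Lp_norm M s f = Lp_norm M s g"
proof -
  have "(\<integral>x. \<bar>f x\<bar> powr s \<partial>M) = (\<integral>x. \<bar>g x\<bar> powr s \<partial>M)"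
    using f g by (intro integral_cong_AE) (auto intro: AE_mp[OF eq])
  then show ?thesis by (simp add: Lp_norm_def)
qed

end

subsection \<open>The bias\<close>

context bdd_proj
begin

lemma coef_cong_AE:
  assumes "f \<in> bdd_meas M" "h \<in> bdd_meas M" "AE x in M. f x = h x" "a \<in> D"
  shows "coef f a = coef h a"
  unfolding coef_def using assms phi[OF assms(4)]
  by (intro integral_cong_AE) (auto dest!: bdd_meas_measurable elim: AE_mp)

lemma proj_eqI: "(\<And>a. a \<in> D \<Longrightarrow> coef f a = coef h a) \<Longrightarrow> proj f = proj h"
  by (auto simp: proj_def)

end

context chain_op
begin

text \<open>The first operation in either case is the projection, so only the projection of the
  argument is seen.\<close>

lemma proj_S_pow_cong: "proj f = proj h \<Longrightarrow> proj ((S ^^ i) f) = proj ((S ^^ i) h)"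
proof (cases i)
  case (Suc n)
  assume "proj f = proj h"
  then have "S f = S h"
    by (auto simp: S_def fun_eq_iff)
  then show ?thesis
    unfolding Suc by (simp add: funpow_swap1)
qed simp

lemma S_add:
  assumes "f \<in> bdd_meas M" "h \<in> bdd_meas M"
  shows "S (\<lambda>z. f z + h z) z = S f z + S h z"
  unfolding S_def proj_def
  by (simp add: coef_add assms distrib_right sum.distrib distrib_left cong: sum.cong)

lemma S_pow_add:
  assumes "f \<in> bdd_meas M" "h \<in> bdd_meas M"
  shows "(S ^^ i) (\<lambda>z. f z + h z) = (\<lambda>z. (S ^^ i) f z + (S ^^ i) h z)"
proof (induction i)
  case (Suc i)
  have "(S ^^ Suc i) (\<lambda>z. f z + h z) = S (\<lambda>z. (S ^^ i) f z + (S ^^ i) h z)"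
    using Suc by simp
  also have "\<dots> = (\<lambda>z. S ((S ^^ i) f) z + S ((S ^^ i) h) z)"
    by (intro ext S_add S_pow_bdd assms)
  finally show ?case by simp
qed simp

lemma proj_S_pow_add:
  assumes "f \<in> bdd_meas M" "h \<in> bdd_meas M"
  shows "proj ((S ^^ i) (\<lambda>z. f z + h z)) z = proj ((S ^^ i) f) z + proj ((S ^^ i) h) z"
  unfolding S_pow_add[OF assms]
  by (simp add: proj_def coef_add S_pow_bdd assms distrib_right sum.distrib cong: sum.cong)

end

lemma alternating_telescope:
  fixes r :: "nat \<Rightarrow> real"
  shows "(\<Sum>i<Suc n. (-1) ^ i * (r i + r (Suc i))) = r 0 + (-1) ^ n * r (Suc n)"
  by (induction n) (simp_all add: algebra_simps)

context two_models
begin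

text \<open>Write q for the true projection of \<open>db\<close>, and let r_i be \<Pi> (N \<Pi>)^i q
  with the estimated projection \<Pi>. Equality of the ranges gives \<Pi> (\<open>rho\<close>
  \<open>db\<close>) = \<Pi> (\<open>rho\<close> q) and \<Pi> q = q; since \<open>rho\<close> = 1 +
  N, the chain of order \<open>i + 2\<close> yields r_i + r_(i+1) up to sign, and the alternating
  sum telescopes. Its first term, combined with the bias of the linear part, is a product of two
  projection residuals.\<close>

lemma bias_identity:
  assumes h: "bdd_proj \<mu>\<^sub>q D \<phi>" and g: "bdd_proj \<mu>\<^sub>p D' \<psi>"
    and hg: "\<And>a. a \<in> D \<Longrightarrow> AE z in \<nu>. bdd_proj.proj \<mu>\<^sub>p D' \<psi> (\<phi> a) z = \<phi> a z"
    and gh: "\<And>a. a \<in> D' \<Longrightarrow> AE z in \<nu>. bdd_proj.proj \<mu>\<^sub>q D \<phi> (\<psi> a) z = \<psi> a z"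
    and m: "2 \<le> m"
  defines "pr \<equiv> bdd_proj.proj \<mu>\<^sub>p D' \<psi>" and "ph \<equiv> bdd_proj.proj \<mu>\<^sub>q D \<phi>"
    and "S \<equiv> chain_op.S \<mu>\<^sub>q D \<phi> N_fun"
  shows "- (\<integral>z. da z * db z \<partial>\<mu>\<^sub>p) + (\<Sum>j=2..m. (-1) ^ (j - 1) * (\<integral>z. U_fun z * ph ((S ^^ (j - 2)) V_fun) z \<partial>\<mu>\<^sub>q)) =
    - (\<integral>z. (da z - pr da z) * (db z - pr db z) \<partial>\<mu>\<^sub>p) + (-1) ^ m * (\<integral>z. da z * ph ((S ^^ (m - 1)) (pr db)) z \<partial>\<mu>\<^sub>p)"
proof -
  interpret g: bdd_proj \<mu>\<^sub>p D' \<psi> by (rule g)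
  interpret h: chain_op \<mu>\<^sub>q D \<phi> N_fun
    by (intro chain_op.intro h chain_op_axioms.intro) (simp add: q.bdd_meas_\<mu> chain_fun_bdd)
  note PI = pr_def ph_def S_def
  note bq = q.bdd_meas_\<mu> and bp = p.bdd_meas_\<mu>
  have [simp]: "pr f \<in> bdd_meas \<nu>" "ph f \<in> bdd_meas \<nu>" for f
    unfolding PI using g.proj_bdd h.proj_bdd by (simp_all add: bq bp)
  have phi: "\<phi> a \<in> bdd_meas \<nu>" if "a \<in> D" for a
    using h.phi[OF that] by (simp add: bq)
  have \<rho>: "(\<integral>z. f z * (rho z * k z) \<partial>\<mu>\<^sub>q) = (\<integral>z. f z * k z \<partial>\<mu>\<^sub>p)" if "f \<in> bdd_meas \<nu>" "k \<in> bdd_meas \<nu>" for f k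
    using integral_\<mu>\<^sub>p[OF bdd_meas_measurable[OF bdd_meas_mult[OF that]]] by (simp add: mult.left_commute)
  let ?q = "pr db"
  \<comment> \<open>Against a function of the common range, \<open>rho * db\<close> in the estimated
    measure is \<open>db\<close> in the true measure, where it may be replaced by its true
    projection.\<close>
  have coef1: "h.coef (\<lambda>z. rho z * db z) a = h.coef (\<lambda>z. rho z * ?q z) a" if a: "a \<in> D" for a
  proof -
    have "(\<integral>z. \<phi> a z * ?q z \<partial>\<mu>\<^sub>p) = (\<integral>z. pr (\<phi> a) z * db z \<partial>\<mu>\<^sub>p)"
      unfolding PI using phi[OF a] by (intro g.proj_adjoint) (simp_all add: bp quot_bdd)
    also have "\<dots> = (\<integral>z. \<phi> a z * db z \<partial>\<mu>\<^sub>p)"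
    proof (rule integral_cong_AE)
      show "AE z in \<mu>\<^sub>p. pr (\<phi> a) z * db z = \<phi> a z * db z"
        unfolding p.AE_\<mu> PI using hg[OF a] by eventually_elim simp
      show "(\<lambda>z. pr (\<phi> a) z * db z) \<in> borel_measurable \<mu>\<^sub>p" "(\<lambda>z. \<phi> a z * db z) \<in> borel_measurable \<mu>\<^sub>p"
        unfolding p.borel_\<mu> by (intro bdd_meas_measurable bdd_meas_mult phi[OF a] quot_bdd; simp)+
    qed
    finally show ?thesis
      unfolding h.coef_def using \<rho>[OF phi[OF a] quot_bdd(3)] \<rho>[OF phi[OF a], of ?q] by simp
  qed
  have q_fix: "AE z in \<nu>. ph ?q z = ?q z"
  proof -
    have "AE z in \<nu>. \<forall>a\<in>D'. ph (\<psi> a) z = \<psi> a z"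
      using gh g.finD unfolding PI by (simp add: AE_ball_countable countable_finite)
    then show ?thesis
    proof eventually_elim
      case (elim z)
      have "ph ?q z = (\<Sum>a\<in>D'. g.coef db a * ph (\<psi> a) z)"
        unfolding pr_def ph_def g.proj_def using g.phi by (intro h.proj_sum) (simp add: bp bq)
      then show ?case
        using elim by (simp add: pr_def g.proj_def)
    qed
  qed
  define r where "r i z = ph ((S ^^ i) ?q) z" for i z
  have r_bdd [simp]: "r i \<in> bdd_meas \<nu>" for i
    unfolding r_def by simp
  have qb: "?q \<in> bdd_meas \<mu>\<^sub>q" "(\<lambda>z. rho z * ?q z) \<in> bdd_meas \<mu>\<^sub>q" "(\<lambda>z. rho z * db z) \<in> bdd_meas \<mu>\<^sub>q"
    "(\<lambda>z. N_fun z * ?q z) \<in> bdd_meas \<mu>\<^sub>q"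
    unfolding bq by (simp, (intro bdd_meas_mult quot_bdd chain_fun_bdd; simp)+)
  \<comment> \<open>The two summands of \<open>rho = 1 + N_fun\<close> produce two consecutive
    remainders; inserting the projection after \<open>N_fun\<close> is allowed because
    \<open>?q\<close> is fixed by it.\<close>
  have step: "ph ((S ^^ i) (\<lambda>z. rho z * db z)) z = r i z + r (Suc i) z" for i z
  proof -
    have "ph ((S ^^ i) (\<lambda>z. rho z * db z)) z = ph ((S ^^ i) (\<lambda>z. rho z * ?q z)) z"
      unfolding ph_def S_def by (rule fun_cong, intro h.proj_S_pow_cong h.proj_eqI coef1)
    also have "(\<lambda>z. rho z * ?q z) = (\<lambda>z. ?q z + N_fun z * ?q z)"
      by (auto simp: N_fun_def algebra_simps)
    also have "ph ((S ^^ i) (\<lambda>z. ?q z + N_fun z * ?q z)) z = r i z + ph ((S ^^ i) (\<lambda>z. N_fun z * ?q z)) z"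
      unfolding r_def ph_def S_def by (intro h.proj_S_pow_add qb)
    also have "ph ((S ^^ i) (\<lambda>z. N_fun z * ?q z)) = ph ((S ^^ i) (S ?q))"
    proof -
      have "AE z in \<mu>\<^sub>q. N_fun z * ?q z = S ?q z"
        unfolding q.AE_\<mu> using q_fix by eventually_elim (simp add: S_def h.S_def ph_def)
      then show ?thesis
        unfolding ph_def S_def by (intro h.proj_S_pow_cong h.proj_eqI h.coef_cong_AE qb h.S_bdd)
    qed
    also have "ph ((S ^^ i) (S ?q)) z = r (Suc i) z"
      by (simp add: r_def funpow_swap1)
    finally show ?thesis .
  qed
  \<comment> \<open>Written as a sum over one element so that linearity of the iterates, available
    for finite combinations, extracts the sign.\<close>
  have V: "V_fun = (\<lambda>z. \<Sum>i\<in>{0::nat}. (-1) * (rho z * db z))"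
    by (auto simp: V_fun_def)
  have PV: "ph ((S ^^ i) V_fun) z = - (r i z + r (Suc i) z)" for i z
  proof -
    have "(S ^^ i) V_fun = (\<lambda>y. \<Sum>k\<in>{0::nat}. (-1) * (S ^^ i) (\<lambda>z. rho z * db z) y)"
      unfolding V S_def by (intro ext h.S_pow_sum qb)
    then have "ph ((S ^^ i) V_fun) z = (\<Sum>k\<in>{0::nat}. (-1) * ph ((S ^^ i) (\<lambda>z. rho z * db z)) z)"
      unfolding ph_def S_def by (simp only:) (intro h.proj_sum h.S_pow_bdd qb)
    then show ?thesis by (simp add: step)
  qed
  let ?I = "\<lambda>i. \<integral>z. da z * r i z \<partial>\<mu>\<^sub>p"
  have dar: "integrable \<mu>\<^sub>p (\<lambda>z. da z * r i z)" for i
    by (intro g.bdd_meas_integrable) (simp add: bp bdd_meas_mult quot_bdd)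
  have chain_term: "(\<integral>z. U_fun z * ph ((S ^^ i) V_fun) z \<partial>\<mu>\<^sub>q) = - (?I i + ?I (Suc i))" for i
  proof -
    have "(\<integral>z. U_fun z * ph ((S ^^ i) V_fun) z \<partial>\<mu>\<^sub>q) = (\<integral>z. ph ((S ^^ i) V_fun) z * (rho z * da z) \<partial>\<mu>\<^sub>q)"
      by (simp add: U_fun_def mult.commute)
    also have "\<dots> = (\<integral>z. ph ((S ^^ i) V_fun) z * da z \<partial>\<mu>\<^sub>p)"
      by (intro \<rho> quot_bdd) simp
    also have "\<dots> = (\<integral>z. - (da z * r i z + da z * r (Suc i) z) \<partial>\<mu>\<^sub>p)"
      by (simp add: PV algebra_simps)
    also have "\<dots> = - (?I i + ?I (Suc i))"
      using dar by simp
    finally show ?thesis .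
  qed
  define n where "n = m - 2"
  have mn: "m = Suc (Suc n)" using m by (simp add: n_def)
  have "(\<Sum>j=2..m. (-1) ^ (j - 1) * (\<integral>z. U_fun z * ph ((S ^^ (j - 2)) V_fun) z \<partial>\<mu>\<^sub>q)) =
      (\<Sum>i<Suc n. (-1) ^ i * (?I i + ?I (Suc i)))"
  proof (rule sum.reindex_bij_witness[of _ "\<lambda>i. i + 2" "\<lambda>j. j - 2"])
    fix j assume j: "j \<in> {2..m}"
    then have "(-1 :: real) ^ (j - 1) = - ((-1) ^ (j - 2))"
      by (cases j; cases "j - 1") auto
    then show "(-1) ^ (j - 2) * (?I (j - 2) + ?I (Suc (j - 2))) =
        (-1) ^ (j - 1) * (\<integral>z. U_fun z * ph ((S ^^ (j - 2)) V_fun) z \<partial>\<mu>\<^sub>q)"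
      by (simp add: chain_term algebra_simps)
  qed (auto simp: mn)
  also have "\<dots> = ?I 0 + (-1) ^ n * ?I (Suc n)"
    by (rule alternating_telescope)
  also have "?I 0 = (\<integral>z. da z * ?q z \<partial>\<mu>\<^sub>p)"
  proof (rule integral_cong_AE)
    show "AE z in \<mu>\<^sub>p. da z * r 0 z = da z * ?q z"
      unfolding p.AE_\<mu> using q_fix by eventually_elim (simp add: r_def)
    show "(\<lambda>z. da z * r 0 z) \<in> borel_measurable \<mu>\<^sub>p" "(\<lambda>z. da z * ?q z) \<in> borel_measurable \<mu>\<^sub>p"
      unfolding p.borel_\<mu> by (intro bdd_meas_measurable bdd_meas_mult quot_bdd; simp)+
  qed
  finally have sum: "(\<Sum>j=2..m. (-1) ^ (j - 1) * (\<integral>z. U_fun z * ph ((S ^^ (j - 2)) V_fun) z \<partial>\<mu>\<^sub>q)) =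
      (\<integral>z. da z * ?q z \<partial>\<mu>\<^sub>p) + (-1) ^ m * ?I (m - 1)"
    by (simp add: mn)
  have "(\<integral>z. (da z - pr da z) * (db z - ?q z) \<partial>\<mu>\<^sub>p) =
      (\<integral>z. da z * db z - da z * ?q z - pr da z * db z + pr da z * ?q z \<partial>\<mu>\<^sub>p)"
    by (intro Bochner_Integration.integral_cong) (auto simp: algebra_simps)
  also have "\<dots> = (\<integral>z. da z * db z \<partial>\<mu>\<^sub>p) - (\<integral>z. da z * ?q z \<partial>\<mu>\<^sub>p) - (\<integral>z. pr da z * db z \<partial>\<mu>\<^sub>p) + (\<integral>z. pr da z * ?q z \<partial>\<mu>\<^sub>p)"
  proof -
    have i: "integrable \<mu>\<^sub>p (\<lambda>z. f z * k z)" if "f \<in> bdd_meas \<nu>" "k \<in> bdd_meas \<nu>" for f k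
      using that by (intro g.bdd_meas_integrable) (simp add: bp bdd_meas_mult)
    show ?thesis
      using i[OF quot_bdd(2,3)] i[OF quot_bdd(2), of ?q] i[OF _ quot_bdd(3), of "pr da"] i[of "pr da" ?q] by simp
  qed
  \<comment> \<open>The true projection is idempotent and self-adjoint, so two of the four terms
    cancel.\<close>
  also have "(\<integral>z. pr da z * ?q z \<partial>\<mu>\<^sub>p) = (\<integral>z. pr da z * db z \<partial>\<mu>\<^sub>p)"
    unfolding pr_def using g.proj_adjoint[of "g.proj da" db] by (simp add: g.proj_proj bp[symmetric] quot_bdd[folded bp])
  finally show ?thesis
    unfolding sum by (simp add: r_def)
qed

end

lemma sup_norm_bound:
  assumes f: "f \<in> bdd_meas M" and x: "x \<in> space M"
  shows "\<bar>f x\<bar> \<le> sup_norm (space M) f"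
proof -
  obtain C where C: "\<And>x. x \<in> space M \<Longrightarrow> \<bar>f x\<bar> \<le> C"
    using bdd_meas_bound[OF f] by metis
  show ?thesis
    unfolding sup_norm_def by (intro cSUP_upper x bdd_aboveI2[of _ _ C] C)
qed

lemma Hoelder_abs:
  assumes "finite_measure M" "f \<in> bdd_meas M" "g \<in> bdd_meas M" "1 < p" "1 < q" "1 / p + 1 / q = 1"
  shows "\<bar>\<integral>x. f x * g x \<partial>M\<bar> \<le> Lp_norm M p f * Lp_norm M q g"
  using integral_abs_bound[of M "\<lambda>x. f x * g x"] finite_measure.Hoelder[OF assms] by linarith

context two_models
begin

text \<open>The remainder is a chain with \<open>m - 1\<close> multiplications by the relative error
  of \<open>g\<close>. Starting from \<open>db\<close> in the space with exponent \<open>r\<close>,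
  each multiplication lowers the exponent a little by Hoelder, and each projection is bounded at the
  exponent reached. After the last one the exponent is conjugate to \<open>r\<close>, ready to be
  paired with \<open>da\<close>.\<close>

lemma bias_estimate:
  fixes r Bb :: real
  assumes h: "bdd_proj \<mu>\<^sub>q D \<phi>" and g: "bdd_proj \<mu>\<^sub>p D' \<psi>"
    and hg: "\<And>a. a \<in> D \<Longrightarrow> AE z in \<nu>. bdd_proj.proj \<mu>\<^sub>p D' \<psi> (\<phi> a) z = \<phi> a z"
    and gh: "\<And>a. a \<in> D' \<Longrightarrow> AE z in \<nu>. bdd_proj.proj \<mu>\<^sub>q D \<phi> (\<psi> a) z = \<psi> a z"
    and m: "2 \<le> m" and r: "2 \<le> r" and Bb: "0 \<le> Bb"
    and Bq: "\<And>s f. s \<in> exponents r \<Longrightarrow> f \<in> bdd_meas \<nu> \<Longrightarrow>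
      Lp_norm \<mu>\<^sub>p s (bdd_proj.proj \<mu>\<^sub>q D \<phi> f) \<le> Bb * Lp_norm \<mu>\<^sub>p s f"
    and Bp: "\<And>f. f \<in> bdd_meas \<nu> \<Longrightarrow> Lp_norm \<mu>\<^sub>p r (bdd_proj.proj \<mu>\<^sub>p D' \<psi> f) \<le> Bb * Lp_norm \<mu>\<^sub>p r f"
  defines "pr \<equiv> bdd_proj.proj \<mu>\<^sub>p D' \<psi>" and "ph \<equiv> bdd_proj.proj \<mu>\<^sub>q D \<phi>"
    and "S \<equiv> chain_op.S \<mu>\<^sub>q D \<phi> N_fun"
    and "ga \<equiv> \<lambda>z. par_a phat z - par_a p z" and "gb \<equiv> \<lambda>z. par_b phat z - par_b p z"
    and "gg \<equiv> \<lambda>z. par_g phat z - par_g p z"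
  defines "G \<equiv> if r = 2 then sup_norm (space \<nu>) gg else Lp_norm \<mu>\<^sub>p (real (m - 1) * r / (r - 2)) gg"
  shows "\<bar>- (\<integral>z. da z * db z \<partial>\<mu>\<^sub>p) + (\<Sum>j=2..m. (-1) ^ (j - 1) * (\<integral>z. U_fun z * ph ((S ^^ (j - 2)) V_fun) z \<partial>\<mu>\<^sub>q))\<bar>
    \<le> Bb ^ Suc m * (1 / \<delta>) ^ Suc m * (Lp_norm \<mu>\<^sub>p r ga * Lp_norm \<mu>\<^sub>p r gb * G ^ (m - 1)) +
      Lp_norm \<mu>\<^sub>p 2 (\<lambda>z. da z - pr da z) * Lp_norm \<mu>\<^sub>p 2 (\<lambda>z. db z - pr db z)"
proof -
  interpret g: bdd_proj \<mu>\<^sub>p D' \<psi> by (rule g)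
  interpret h: chain_op \<mu>\<^sub>q D \<phi> N_fun
    by (intro chain_op.intro h chain_op_axioms.intro) (simp add: q.bdd_meas_\<mu> chain_fun_bdd)
  note bq = q.bdd_meas_\<mu> and bp = p.bdd_meas_\<mu>
  have \<delta>: "0 < \<delta>" by (rule p.\<delta>)
  have pb [simp]: "pr f \<in> bdd_meas \<nu>" "ph f \<in> bdd_meas \<nu>" for f
    unfolding pr_def ph_def using g.proj_bdd h.proj_bdd by (simp_all add: bq bp)
  have gb: "ga \<in> bdd_meas \<nu>" "gb \<in> bdd_meas \<nu>" "gg \<in> bdd_meas \<nu>"
    unfolding ga_def gb_def gg_def by (intro bdd_meas_diff p.par_bdd q.par_bdd)+
  have r0: "0 < r" "1 < r" using r by simp_all
  define t where "t = real (m - 1) * r / (r - 2)"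
  define s where "s i = (if r = 2 then 2 else 1 / (1 / r + real i / t))" for i :: nat
  have t0: "0 < t" if "r \<noteq> 2"
    using that r m by (simp add: t_def)
  have s_inv: "1 / s i = 1 / r + real i / t" if "r \<noteq> 2" for i
    using that by (simp add: s_def)
  have it: "real i / t \<le> (r - 2) / r" if "r \<noteq> 2" "i \<le> m - 1" for i
  proof -
    have "real i / t \<le> real (m - 1) / t"
      using that t0 by (intro divide_right_mono) auto
    also have "\<dots> = (r - 2) / r"
      using that m r by (simp add: t_def)
    finally show ?thesis .
  qed
  have s_last: "1 / r + 1 / s (m - 1) = 1"
  proof (cases "r = 2")
    case False
    have "real (m - 1) / t = (r - 2) / r"
      using False m r by (simp add: t_def)
    then show ?thesis
      unfolding s_inv[OF False] using r0 by (simp add: field_simps)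
  qed (simp add: s_def)
  have s_pos: "0 < s i" for i
  proof (cases "r = 2")
    case False
    have "0 < 1 / r + real i / t"
      using t0[OF False] r0 by (intro add_pos_nonneg) auto
    then show ?thesis using False by (simp add: s_def)
  qed (simp add: s_def)
  have s_exp: "s i \<in> exponents r" if "i \<le> m - 1" for i
  proof (cases "r = 2")
    case False
    have "1 / r \<le> 1 / s i" "1 / s i \<le> 1 / r + (r - 2) / r"
      unfolding s_inv[OF False] using it[OF False that] t0[OF False] by auto
    moreover have "1 / r + (r - 2) / r = 1 / (r / (r - 1))"
      using r0 by (simp add: field_simps)
    ultimately have "s i \<le> r" "r / (r - 1) \<le> s i"
      using s_pos[of i] r0 by (auto simp: field_simps)
    then show ?thesis by (simp add: exponents_def)
  qed (simp add: s_def exponents_def)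
  define R where "R i = ph ((S ^^ i) (pr db))" for i
  have R_Suc: "R (Suc i) = ph (\<lambda>z. N_fun z * R i z)" for i
  proof -
    have "S ((S ^^ i) (pr db)) = (\<lambda>z. N_fun z * R i z)"
      by (auto simp: S_def h.S_def R_def ph_def)
    then show ?thesis by (simp add: R_def)
  qed
  have R_bdd: "R i \<in> bdd_meas \<nu>" for i by (simp add: R_def)
  have N_gg: "\<bar>N_fun z\<bar> \<le> 1 / \<delta> * \<bar>gg z\<bar>" if z: "z \<in> space \<nu>" for z
  proof -
    have g0: "\<delta> \<le> par_g phat z" using q.bounds(7)[OF z] .
    have "N_fun z = - gg z / par_g phat z"
      using g0 \<delta> by (simp add: N_fun_def rho_def gg_def field_simps)
    then have "\<bar>N_fun z\<bar> = \<bar>gg z\<bar> / par_g phat z"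
      using g0 \<delta> by simp
    also have "\<dots> \<le> \<bar>gg z\<bar> / \<delta>"
      using g0 \<delta> by (intro divide_left_mono) auto
    finally show ?thesis by simp
  qed
  have G0: "0 \<le> G"
  proof (cases "r = 2")
    case True
    obtain z where "z \<in> space \<nu>" using p.space_nonempty by auto
    from sup_norm_bound[OF gb(3) this] show ?thesis
      using True by (simp add: G_def)
  qed (simp add: G_def)
  have N_step: "Lp_norm \<mu>\<^sub>p (s (Suc i)) (\<lambda>z. N_fun z * f z) \<le> G / \<delta> * Lp_norm \<mu>\<^sub>p (s i) f"
    if f: "f \<in> bdd_meas \<nu>" for f i
  proof (cases "r = 2")
    case True
    have "\<bar>N_fun z\<bar> \<le> G / \<delta>" if z: "z \<in> space \<nu>" for z
    proof -
      have "1 / \<delta> * \<bar>gg z\<bar> \<le> 1 / \<delta> * G"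
        using sup_norm_bound[OF gb(3) z] True \<delta> by (intro mult_left_mono) (auto simp: G_def)
      then show ?thesis using N_gg[OF z] by simp
    qed
    then have "Lp_norm \<mu>\<^sub>p 2 (\<lambda>z. N_fun z * f z) \<le> G / \<delta> * Lp_norm \<mu>\<^sub>p 2 f"
      using f chain_fun_bdd(1) G0 \<delta> by (intro g.Lp_norm_mult_sup) (auto simp: bp p.space_\<mu>)
    then show ?thesis
      using True by (simp add: s_def)
  next
    case False
    have "1 / s (Suc i) = 1 / t + 1 / s i"
      unfolding s_inv[OF False] by (simp add: add_divide_distrib)
    then have "Lp_norm \<mu>\<^sub>p (s (Suc i)) (\<lambda>z. N_fun z * f z) \<le> Lp_norm \<mu>\<^sub>p t N_fun * Lp_norm \<mu>\<^sub>p (s i) f"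
      using f chain_fun_bdd(1) s_pos t0[OF False] by (intro g.Lp_norm_mult) (auto simp: bp)
    also have "Lp_norm \<mu>\<^sub>p t N_fun \<le> 1 / \<delta> * Lp_norm \<mu>\<^sub>p t gg"
      using chain_fun_bdd(1) gb(3) t0[OF False] \<delta> N_gg
      by (intro g.Lp_norm_le AE_I2) (auto simp: bp p.space_\<mu>)
    finally show ?thesis
      using False by (simp add: G_def t_def mult_right_mono)
  qed
  have r_exp: "r \<in> exponents r"
  proof -
    have "r * 1 \<le> r * (r - 1)" using r by (intro mult_left_mono) auto
    then have "r / (r - 1) \<le> r" using r by (simp add: divide_le_eq)
    then show ?thesis by (simp add: exponents_def)
  qed
  have s0: "s 0 = r" by (simp add: s_def)
  have R_bound: "Lp_norm \<mu>\<^sub>p (s i) (R i) \<le> Bb ^ (i + 2) * (G / \<delta>) ^ i * Lp_norm \<mu>\<^sub>p r db" if "i \<le> m - 1" for i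
    using that
  proof (induction i)
    case 0
    have "Lp_norm \<mu>\<^sub>p r (R 0) \<le> Bb * Lp_norm \<mu>\<^sub>p r (pr db)"
      using Bq[OF r_exp, of "pr db"] by (simp add: R_def ph_def)
    also have "\<dots> \<le> Bb * (Bb * Lp_norm \<mu>\<^sub>p r db)"
      unfolding pr_def using Bp[OF quot_bdd(3)] Bb by (intro mult_left_mono)
    finally show ?case by (simp add: s0 power2_eq_square mult.assoc)
  next
    case (Suc i)
    have "Lp_norm \<mu>\<^sub>p (s (Suc i)) (R (Suc i)) \<le> Bb * Lp_norm \<mu>\<^sub>p (s (Suc i)) (\<lambda>z. N_fun z * R i z)"
      unfolding R_Suc ph_def using Suc(2) by (intro Bq s_exp bdd_meas_mult chain_fun_bdd R_bdd)
    also have "\<dots> \<le> Bb * (G / \<delta> * Lp_norm \<mu>\<^sub>p (s i) (R i))"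
      using Bb by (intro mult_left_mono N_step R_bdd)
    also have "\<dots> \<le> Bb * (G / \<delta> * (Bb ^ (i + 2) * (G / \<delta>) ^ i * Lp_norm \<mu>\<^sub>p r db))"
      using Suc G0 \<delta> Bb by (intro mult_left_mono) auto
    also have "\<dots> = Bb ^ (Suc i + 2) * (G / \<delta>) ^ Suc i * Lp_norm \<mu>\<^sub>p r db"
      by simp
    finally show ?case .
  qed
  have da_le: "Lp_norm \<mu>\<^sub>p r da \<le> 1 / \<delta> * Lp_norm \<mu>\<^sub>p r ga" and db_le: "Lp_norm \<mu>\<^sub>p r db \<le> 1 / \<delta> * Lp_norm \<mu>\<^sub>p r gb"
  proof -
    have "\<bar>x / w\<bar> \<le> 1 / \<delta> * \<bar>x\<bar>" if "\<delta> \<le> w" for x w :: real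
    proof -
      have "\<bar>x\<bar> / w \<le> \<bar>x\<bar> / \<delta>"
        using that \<delta> by (intro divide_left_mono) auto
      then show ?thesis using that \<delta> by simp
    qed
    then have "\<bar>da z\<bar> \<le> 1 / \<delta> * \<bar>ga z\<bar>" "\<bar>db z\<bar> \<le> 1 / \<delta> * \<bar>gb z\<bar>" if "z \<in> space \<nu>" for z
      using p.weight_bounds[OF that] unfolding da_def db_def ga_def gb_def by blast+
    then show "Lp_norm \<mu>\<^sub>p r da \<le> 1 / \<delta> * Lp_norm \<mu>\<^sub>p r ga" "Lp_norm \<mu>\<^sub>p r db \<le> 1 / \<delta> * Lp_norm \<mu>\<^sub>p r gb"
      using r0 \<delta> quot_bdd gb by (auto intro!: g.Lp_norm_le AE_I2 simp: bp p.space_\<mu> simp del: times_divide_eq_left)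
  qed
  have "1 < s (m - 1)"
  proof -
    have "1 / s (m - 1) < 1" using s_last r0 by (smt (verit) zero_less_divide_1_iff)
    then show ?thesis using s_pos[of "m - 1"] by (simp add: divide_less_eq split: if_splits)
  qed
  then have "\<bar>\<integral>z. da z * R (m - 1) z \<partial>\<mu>\<^sub>p\<bar> \<le> Lp_norm \<mu>\<^sub>p r da * Lp_norm \<mu>\<^sub>p (s (m - 1)) (R (m - 1))"
    using r0 s_last quot_bdd R_bdd by (intro Hoelder_abs p.finite_\<mu>) (auto simp: bp)
  also have "\<dots> \<le> (1 / \<delta> * Lp_norm \<mu>\<^sub>p r ga) * (Bb ^ (m - 1 + 2) * (G / \<delta>) ^ (m - 1) * (1 / \<delta> * Lp_norm \<mu>\<^sub>p r gb))"
  proof (rule mult_mono)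
    have "Bb ^ (m - 1 + 2) * (G / \<delta>) ^ (m - 1) * Lp_norm \<mu>\<^sub>p r db \<le>
        Bb ^ (m - 1 + 2) * (G / \<delta>) ^ (m - 1) * (1 / \<delta> * Lp_norm \<mu>\<^sub>p r gb)"
      using db_le Bb G0 \<delta> by (intro mult_left_mono) auto
    then show "Lp_norm \<mu>\<^sub>p (s (m - 1)) (R (m - 1)) \<le>
        Bb ^ (m - 1 + 2) * (G / \<delta>) ^ (m - 1) * (1 / \<delta> * Lp_norm \<mu>\<^sub>p r gb)"
      using R_bound[of "m - 1"] by simp
  qed (use da_le \<delta> in auto)
  \<comment> \<open>\<open>m + 1\<close> projections: the true one, the estimated one applied to its
    result, and one after each multiplication. The powers of \<open>1 / \<delta>\<close> come from
    \<open>m - 1\<close> divisions by the estimated \<open>g\<close> and two divisions by the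
    weights.\<close>
  also have "\<dots> = Bb ^ Suc m * (1 / \<delta>) ^ Suc m * (Lp_norm \<mu>\<^sub>p r ga * Lp_norm \<mu>\<^sub>p r gb * G ^ (m - 1))"
  proof -
    obtain n where n: "m = Suc n" using m by (cases m) auto
    show ?thesis by (simp add: n power_divide ac_simps)
  qed
  finally have 1: "\<bar>\<integral>z. da z * R (m - 1) z \<partial>\<mu>\<^sub>p\<bar> \<le>
      Bb ^ Suc m * (1 / \<delta>) ^ Suc m * (Lp_norm \<mu>\<^sub>p r ga * Lp_norm \<mu>\<^sub>p r gb * G ^ (m - 1))" .
  have 2: "\<bar>\<integral>z. (da z - pr da z) * (db z - pr db z) \<partial>\<mu>\<^sub>p\<bar> \<le>
      Lp_norm \<mu>\<^sub>p 2 (\<lambda>z. da z - pr da z) * Lp_norm \<mu>\<^sub>p 2 (\<lambda>z. db z - pr db z)"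
    by (intro Hoelder_abs p.finite_\<mu>) (simp_all add: bp bdd_meas_diff quot_bdd)
  have "\<bar>(-1) ^ m * (\<integral>z. da z * R (m - 1) z \<partial>\<mu>\<^sub>p)\<bar> = \<bar>\<integral>z. da z * R (m - 1) z \<partial>\<mu>\<^sub>p\<bar>"
    by (simp add: abs_mult power_abs)
  then show ?thesis
    using bias_identity[OF h g hg gh m] 1 2 unfolding pr_def[symmetric] ph_def[symmetric] S_def[symmetric] R_def
    by linarith
qed

end

subsection \<open>Bounded orthonormal bases for the two projections\<close>

text \<open>Setting the basis to zero on the null set where the bound fails keeps all integrals, and
  a bound on the sum of squares then bounds each function everywhere.\<close>

lemma bounded_onb:
  assumes M: "finite_measure M" and onb: "onb M V d \<psi>"
    and c: "AE x in M. (\<Sum>a<d. (\<psi> a x)\<^sup>2) \<le> c" "0 \<le> c"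
  shows "\<exists>\<phi>. bdd_proj M {..<d} \<phi> \<and> (\<forall>a<d. AE x in M. \<phi> a x = \<psi> a x) \<and>
    (\<forall>x\<in>space M. (\<Sum>a<d. (\<phi> a x)\<^sup>2) \<le> c)"
proof -
  interpret finite_measure M by fact
  obtain N where N: "N \<in> null_sets M" "{x \<in> space M. \<not> (\<Sum>a<d. (\<psi> a x)\<^sup>2) \<le> c} \<subseteq> N"
    using c(1) unfolding eventually_ae_filter by blast
  have Nm [measurable]: "N \<in> sets M" using N(1) by auto
  have psi: "\<psi> a \<in> borel_measurable M" if "a < d" for a
    using onb that by (auto simp: onb_def dest: L2_measurable)
  define \<phi> where "\<phi> a x = (if x \<in> N then 0 else \<psi> a x)" for a x
  have ae: "AE x in M. \<phi> a x = \<psi> a x" for a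
    using AE_not_in[OF N(1)] by eventually_elim (simp add: \<phi>_def)
  have sq: "(\<Sum>a<d. (\<phi> a x)\<^sup>2) \<le> c" if "x \<in> space M" for x
    using N(2) that c(2) by (cases "x \<in> N") (auto simp: \<phi>_def)
  have m: "\<phi> a \<in> borel_measurable M" if "a < d" for a
    unfolding \<phi>_def[abs_def] using psi[OF that] by measurable
  have "bdd_proj M {..<d} \<phi>"
  proof
    show "finite {..<d}" by simp
    fix a assume a: "a \<in> {..<d}"
    show "\<phi> a \<in> bdd_meas M"
    proof (rule bdd_measI)
      show "\<phi> a \<in> borel_measurable M" using m a by simp
      fix x assume x: "x \<in> space M"
      have "(\<phi> a x)\<^sup>2 \<le> (\<Sum>a<d. (\<phi> a x)\<^sup>2)"
        using a by (intro member_le_sum) auto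
      also have "\<dots> \<le> c" by (rule sq[OF x])
      finally have "sqrt ((\<phi> a x)\<^sup>2) \<le> sqrt c" by (rule real_sqrt_le_mono)
      then show "\<bar>\<phi> a x\<bar> \<le> sqrt c" by simp
    qed
    fix b assume b: "b \<in> {..<d}"
    have "(\<integral>z. \<phi> a z * \<phi> b z \<partial>M) = (\<integral>z. \<psi> a z * \<psi> b z \<partial>M)"
    proof (rule integral_cong_AE)
      show "AE z in M. \<phi> a z * \<phi> b z = \<psi> a z * \<psi> b z"
        using ae[of a] ae[of b] by eventually_elim simp
    qed (use m psi a b in \<open>auto intro!: borel_measurable_times\<close>)
    then show "(\<integral>z. \<phi> a z * \<phi> b z \<partial>M) = (if a = b then 1 else 0)"
      using onb a b by (simp add: onb_def)
  qed
  then show ?thesis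
    using ae sq by blast
qed

lemma onb_Bessel:
  assumes onb: "onb M V d \<psi>" and h: "h \<in> Lp_space M 2"
  shows "(\<Sum>a<d. (\<integral>x. \<psi> a x * h x \<partial>M)\<^sup>2) \<le> (\<integral>x. (h x)\<^sup>2 \<partial>M)"
proof -
  have psi: "\<psi> a \<in> Lp_space M 2" if "a \<in> {..<d}" for a
    using onb that by (auto simp: onb_def)
  have orth: "(\<integral>x. \<psi> a x * \<psi> b x \<partial>M) = (if a = b then 1 else 0)" if "a < d" "b < d" for a b
    using onb that by (auto simp: onb_def)
  let ?c = "\<lambda>a. \<integral>x. \<psi> a x * h x \<partial>M"
  let ?s = "\<lambda>x. \<Sum>a<d. ?c a * \<psi> a x"
  have s: "?s \<in> Lp_space M 2" by (intro L2_sum psi)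
  have hs: "(\<integral>x. h x * ?s x \<partial>M) = (\<Sum>a<d. (?c a)\<^sup>2)"
    using psi h by (subst L2_inner_sum) (auto simp: power2_eq_square mult.commute)
  have "(\<integral>x. \<psi> a x * ?s x \<partial>M) = ?c a" if "a < d" for a
    using that orth psi by (subst L2_inner_sum) (auto simp: if_distrib[of "\<lambda>x. _ * x"] cong: if_cong)
  then have ss: "(\<integral>x. ?s x * ?s x \<partial>M) = (\<Sum>a<d. (?c a)\<^sup>2)"
    using psi s by (subst L2_inner_sum) (auto simp: power2_eq_square mult.commute)
  have "0 \<le> (\<integral>x. (h x - ?s x)\<^sup>2 \<partial>M)" by simp
  also have "\<dots> = (\<integral>x. (h x)\<^sup>2 - 2 * (h x * ?s x) + ?s x * ?s x \<partial>M)"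
    by (intro Bochner_Integration.integral_cong) (auto simp: power2_eq_square algebra_simps)
  also have "\<dots> = (\<integral>x. (h x)\<^sup>2 \<partial>M) - 2 * (\<integral>x. h x * ?s x \<partial>M) + (\<integral>x. ?s x * ?s x \<partial>M)"
    using h L2_mult[OF h s] L2_mult[OF s s]
    by (simp add: Lp_space_2_iff)
  finally show ?thesis unfolding hs ss by simp
qed

text \<open>Agreement almost everywhere on the product says nothing about the diagonal, which may be
  a null set. The reproducing identity writes \<open>K x x\<close> as an integral of
  \<open>K x z * K z x\<close> over \<open>z\<close>, and this integral only sees the kernel up to
  null sets.\<close>

lemma kernel_diagonal:
  assumes M: "finite_measure M" and K: "orth_proj_kernel M V K" and rep: "reproducing M K"
    and V: "V \<subseteq> Lp_space M 2" and onb: "onb M V d \<psi>"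
  shows "AE x in M. K x x = (\<Sum>a<d. (\<psi> a x)\<^sup>2)"
proof -
  interpret finite_measure M by fact
  interpret pair_sigma_finite M M ..
  have psi: "\<psi> a \<in> Lp_space M 2" if "a \<in> {..<d}" for a
    using onb that by (auto simp: onb_def)
  have orth: "(\<integral>x. \<psi> a x * \<psi> b x \<partial>M) = (if a = b then 1 else 0)" if "a < d" "b < d" for a b
    using onb that by (auto simp: onb_def)
  let ?s = "\<lambda>x z. \<Sum>a<d. \<psi> a x * \<psi> a z"
  have K_m: "(\<lambda>x. K (fst x) (snd x)) \<in> borel_measurable (M \<Otimes>\<^sub>M M)"
    using K by (simp add: orth_proj_kernel_def case_prod_unfold)
  have s_m: "(\<lambda>x. ?s (fst x) (snd x)) \<in> borel_measurable (M \<Otimes>\<^sub>M M)"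
  proof (intro borel_measurable_sum borel_measurable_times)
    fix a assume "a \<in> {..<d}"
    from L2_measurable[OF psi[OF this]]
    show "(\<lambda>x. \<psi> a (fst x)) \<in> borel_measurable (M \<Otimes>\<^sub>M M)" "(\<lambda>x. \<psi> a (snd x)) \<in> borel_measurable (M \<Otimes>\<^sub>M M)"
      by measurable
  qed
  have R: "AE x in M \<Otimes>\<^sub>M M. K (fst x) (snd x) = ?s (fst x) (snd x)"
    by (rule kernel_finite_rank(1)[OF M K V onb])
  have R1: "AE x in M. AE z in M. K x z = ?s x z"
    using AE_pair[OF R] by simp
  have "{x \<in> space (M \<Otimes>\<^sub>M M). K (fst x) (snd x) = ?s (fst x) (snd x)} \<in> sets (M \<Otimes>\<^sub>M M)"
    using K_m s_m by measurable
  from AE_commute[OF this] R1 have R2: "AE x in M. AE z in M. K z x = ?s z x"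
    by simp
  have "AE x in M. x \<in> space M" by (rule AE_space)
  with R1 R2 show ?thesis
  proof eventually_elim
    case (elim x)
    have "K x x = (\<integral>z. K x z * K z x \<partial>M)"
      using has_bochner_integral_integral_eq[of M "\<lambda>z. K x z * K z x" "K x x"] rep elim(3)
      by (simp add: reproducing_def)
    also have "\<dots> = (\<integral>z. ?s x z * ?s x z \<partial>M)"
    proof (rule integral_cong_AE)
      show "(\<lambda>z. K x z * K z x) \<in> borel_measurable M"
        using measurable_compose[OF measurable_Pair1'[OF elim(3), of M] K_m]
          measurable_compose[OF measurable_Pair2'[OF elim(3), of M] K_m]
        by simp
      show "(\<lambda>z. ?s x z * ?s x z) \<in> borel_measurable M"
        using psi by (intro borel_measurable_times borel_measurable_sum) (auto intro: L2_measurable)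
      show "AE z in M. K x z * K z x = ?s x z * ?s x z"
        using elim(1,2) by eventually_elim (simp add: mult.commute)
    qed
    also have "\<dots> = (\<Sum>a<d. \<psi> a x * (\<integral>z. ?s x z * \<psi> a z \<partial>M))"
      using psi by (intro L2_inner_sum L2_sum)
    also have "\<dots> = (\<Sum>a<d. (\<psi> a x)\<^sup>2)"
    proof (intro sum.cong refl)
      fix a assume a: "a \<in> {..<d}"
      have "(\<integral>z. ?s x z * \<psi> a z \<partial>M) = (\<integral>z. \<psi> a z * ?s x z \<partial>M)"
        by (simp add: mult.commute)
      also have "\<dots> = (\<Sum>b<d. \<psi> b x * (\<integral>z. \<psi> a z * \<psi> b z \<partial>M))"
        using psi a by (intro L2_inner_sum)
      also have "\<dots> = \<psi> a x"
        using a orth by (simp add: if_distrib[of "\<lambda>x. _ * x"] cong: if_cong)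
      finally show "\<psi> a x * (\<integral>z. ?s x z * \<psi> a z \<partial>M) = (\<psi> a x)\<^sup>2"
        by (simp add: power2_eq_square)
    qed
    finally show ?case .
  qed
qed

context two_models
begin

lemma L2_pq: "f \<in> Lp_space \<mu>\<^sub>p 2 \<Longrightarrow> f \<in> Lp_space \<mu>\<^sub>q 2"
proof -
  assume f: "f \<in> Lp_space \<mu>\<^sub>p 2"
  then have fm [measurable]: "f \<in> borel_measurable \<nu>"
    unfolding Lp_space_2_iff p.borel_\<mu> by blast
  have f2 [measurable]: "(\<lambda>z. (f z)\<^sup>2) \<in> borel_measurable \<nu>" by measurable
  have "integrable \<mu>\<^sub>p (\<lambda>z. (f z)\<^sup>2)"
    using f unfolding Lp_space_2_iff by blast
  then have "integrable \<nu> (\<lambda>z. p.wt z * (f z)\<^sup>2)"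
    by (rule iffD1[OF p.integrable_\<mu>[OF f2]])
  then have "integrable \<nu> (\<lambda>z. 1 / \<delta> ^ 6 * (p.wt z * (f z)\<^sup>2))"
    by (rule integrable_mult_right)
  then have "integrable \<nu> (\<lambda>z. q.wt z * (f z)\<^sup>2)"
  proof (rule Bochner_Integration.integrable_bound)
    show "(\<lambda>z. q.wt z * (f z)\<^sup>2) \<in> borel_measurable \<nu>" by measurable
    show "AE z in \<nu>. norm (q.wt z * (f z)\<^sup>2) \<le> norm (1 / \<delta> ^ 6 * (p.wt z * (f z)\<^sup>2))"
    proof (rule AE_I2)
      fix z assume z: "z \<in> space \<nu>"
      have "q.wt z \<le> 1 / \<delta> ^ 6 * \<delta> ^ 3"
        using q.wt_bounds(2)[OF z] p.\<delta> by (simp add: eval_nat_numeral)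
      also have "\<dots> \<le> 1 / \<delta> ^ 6 * p.wt z"
        using p.wt_bounds(1)[OF z] p.\<delta> by (intro mult_left_mono) auto
      finally have "q.wt z * (f z)\<^sup>2 \<le> 1 / \<delta> ^ 6 * p.wt z * (f z)\<^sup>2"
        by (rule mult_right_mono) simp
      moreover have "0 \<le> q.wt z * (f z)\<^sup>2"
        using q.wt_bounds(3)[OF z] by simp
      ultimately show "norm (q.wt z * (f z)\<^sup>2) \<le> norm (1 / \<delta> ^ 6 * (p.wt z * (f z)\<^sup>2))"
        unfolding mult.assoc real_norm_def by linarith
    qed
  qed
  then have "integrable \<mu>\<^sub>q (\<lambda>z. (f z)\<^sup>2)"
    by (rule iffD2[OF q.integrable_\<mu>[OF f2]])
  then show ?thesis
    unfolding Lp_space_2_iff q.borel_\<mu> using fm by blast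
qed

lemma L2_norm_pq:
  assumes f: "f \<in> Lp_space \<mu>\<^sub>p 2"
  shows "(\<integral>z. (f z)\<^sup>2 \<partial>\<mu>\<^sub>p) \<le> 1 / \<delta>\<^sup>2 * (\<integral>z. (f z)\<^sup>2 \<partial>\<mu>\<^sub>q)"
proof -
  have fm [measurable]: "f \<in> borel_measurable \<nu>"
    using f unfolding Lp_space_2_iff p.borel_\<mu> by blast
  have f2 [measurable]: "(\<lambda>z. (f z)\<^sup>2) \<in> borel_measurable \<nu>" by measurable
  have "integrable \<mu>\<^sub>p (\<lambda>z. (f z)\<^sup>2)" "integrable \<mu>\<^sub>q (\<lambda>z. (f z)\<^sup>2)"
    using f L2_pq[OF f] unfolding Lp_space_2_iff by blast+
  then have i: "integrable \<nu> (\<lambda>z. p.wt z * (f z)\<^sup>2)" "integrable \<nu> (\<lambda>z. q.wt z * (f z)\<^sup>2)"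
    unfolding p.integrable_\<mu>[OF f2] q.integrable_\<mu>[OF f2] .
  have "(\<integral>z. p.wt z * (f z)\<^sup>2 \<partial>\<nu>) \<le> (\<integral>z. 1 / \<delta>\<^sup>2 * (q.wt z * (f z)\<^sup>2) \<partial>\<nu>)"
  proof (rule integral_mono[OF i(1)])
    show "integrable \<nu> (\<lambda>z. 1 / \<delta>\<^sup>2 * (q.wt z * (f z)\<^sup>2))"
      using i(2) by (rule integrable_mult_right)
    fix z assume z: "z \<in> space \<nu>"
    have "q.wt z * rho z \<le> q.wt z * (1 / \<delta>\<^sup>2)"
      using rho_bounds(2)[OF z] q.wt_bounds(3)[OF z] by (intro mult_left_mono) auto
    then have "p.wt z * (f z)\<^sup>2 \<le> q.wt z * (1 / \<delta>\<^sup>2) * (f z)\<^sup>2"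
      unfolding wt_rho[OF z] by (rule mult_right_mono) simp
    then show "p.wt z * (f z)\<^sup>2 \<le> 1 / \<delta>\<^sup>2 * (q.wt z * (f z)\<^sup>2)"
      by (simp only: ac_simps)
  qed
  then show ?thesis
    unfolding p.integral_\<mu>[OF f2] q.integral_\<mu>[OF f2] by simp
qed

text \<open>Gram-Schmidt is run in both weighted spaces. The true kernel bounds the sum of squares
  of the true basis, that is, point evaluation on the common span in the true norm. As the two norms
  are comparable, point evaluation is also bounded in the estimated norm, which bounds the estimated
  basis.\<close>

lemma bounded_bases:
  fixes e :: "nat \<Rightarrow> 'z \<Rightarrow> real"
  assumes e: "\<forall>i\<in>{1..k}. e i \<in> Lp_space \<mu>\<^sub>p 2"
    and K: "orth_proj_kernel \<mu>\<^sub>p (span_upto e k) K" "reproducing \<mu>\<^sub>p K"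
    and diag: "\<And>x. x \<in> space \<nu> \<Longrightarrow> K x x \<le> \<kappa>" and \<kappa>: "0 \<le> \<kappa>"
    and Kh: "orth_proj_kernel \<mu>\<^sub>q (span_upto e k) Kh"
  shows "\<exists>d \<phi> d' \<psi>. bdd_proj \<mu>\<^sub>q {..<d} \<phi> \<and> bdd_proj \<mu>\<^sub>p {..<d'} \<psi> \<and>
    (\<forall>a<d. AE z in \<nu>. bdd_proj.proj \<mu>\<^sub>p {..<d'} \<psi> (\<phi> a) z = \<phi> a z) \<and>
    (\<forall>a<d'. AE z in \<nu>. bdd_proj.proj \<mu>\<^sub>q {..<d} \<phi> (\<psi> a) z = \<psi> a z) \<and>
    (\<forall>z\<in>space \<nu>. (\<Sum>a<d. (\<phi> a z)\<^sup>2) \<le> \<kappa> / \<delta>\<^sup>2) \<and>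
    (AE x in \<nu> \<Otimes>\<^sub>M \<nu>. Kh (fst x) (snd x) = bdd_proj.ker {..<d} \<phi> (fst x) (snd x)) \<and>
    (\<forall>f\<in>bdd_meas \<nu>. AE z in \<nu>. kernel_op \<mu>\<^sub>q Kh f z = bdd_proj.proj \<mu>\<^sub>q {..<d} \<phi> f z) \<and>
    (\<forall>f\<in>bdd_meas \<nu>. AE z in \<nu>. kernel_op \<mu>\<^sub>p K f z = bdd_proj.proj \<mu>\<^sub>p {..<d'} \<psi> f z) \<and>
    (\<forall>f\<in>bdd_meas \<nu>. \<forall>v. is_orth_proj \<mu>\<^sub>q (span_upto e k) f v \<longrightarrow>
      (AE z in \<nu>. v z = bdd_proj.proj \<mu>\<^sub>q {..<d} \<phi> f z))"
proof -
  let ?V = "span_upto e k"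
  interpret fp: finite_measure \<mu>\<^sub>p by (rule p.finite_\<mu>)
  interpret fq: finite_measure \<mu>\<^sub>q by (rule q.finite_\<mu>)
  have Vp: "?V \<subseteq> Lp_space \<mu>\<^sub>p 2"
    using span_upto_L2[OF e] by blast
  have Vq: "?V \<subseteq> Lp_space \<mu>\<^sub>q 2"
    using Vp L2_pq by blast
  obtain d' \<psi>0 where op: "onb \<mu>\<^sub>p ?V d' \<psi>0"
    using gram_schmidt[OF e] .
  have eq: "\<forall>i\<in>{1..k}. e i \<in> Lp_space \<mu>\<^sub>q 2"
    using e L2_pq by blast
  obtain d \<phi>0 where oq: "onb \<mu>\<^sub>q ?V d \<phi>0"
    using gram_schmidt[OF eq] .
  have psi0: "\<psi>0 a \<in> ?V" "\<psi>0 a \<in> Lp_space \<mu>\<^sub>p 2" if "a < d'" for a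
    using op that by (auto simp: onb_def)
  have phi0: "\<phi>0 a \<in> ?V" "\<phi>0 a \<in> Lp_space \<mu>\<^sub>q 2" if "a < d" for a
    using oq that by (auto simp: onb_def)
  have psi_sq: "AE x in \<nu>. (\<Sum>a<d'. (\<psi>0 a x)\<^sup>2) \<le> \<kappa>"
  proof -
    have "AE x in \<nu>. K x x = (\<Sum>a<d'. (\<psi>0 a x)\<^sup>2)"
      using kernel_diagonal[OF fp.finite_measure_axioms K Vp op] by (simp add: p.AE_\<mu>)
    moreover have "AE x in \<nu>. x \<in> space \<nu>" by (rule AE_space)
    ultimately show ?thesis
      by eventually_elim (use diag in force)
  qed
  have exp_phi: "AE x in \<nu>. \<forall>a\<in>{..<d}. \<phi>0 a x = (\<Sum>b<d'. (\<integral>y. \<psi>0 b y * \<phi>0 a y \<partial>\<mu>\<^sub>p) * \<psi>0 b x)"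
  proof -
    have "AE x in \<nu>. \<phi>0 a x = (\<Sum>b<d'. (\<integral>y. \<psi>0 b y * \<phi>0 a y \<partial>\<mu>\<^sub>p) * \<psi>0 b x)" if "a \<in> {..<d}" for a
      using op phi0(1)[of a] that by (simp add: onb_def p.AE_\<mu>)
    then show ?thesis by (simp add: AE_ball_countable)
  qed
  have phi_sq: "AE x in \<nu>. (\<Sum>a<d. (\<phi>0 a x)\<^sup>2) \<le> \<kappa> / \<delta>\<^sup>2"
    using exp_phi psi_sq
  proof eventually_elim
    case (elim x)
    \<comment> \<open>\<open>?h\<close> is the section at \<open>x\<close> of the estimated kernel:
      \<open>?s\<close> is both its value at \<open>x\<close> and its squared norm under the
      estimated weight. Evaluating it through the true basis and using Cauchy-Schwarz gives
      \<open>?s\<^sup>2 \<le> ?s * (\<kappa> / \<delta>\<^sup>2)\<close>.\<close>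
    let ?s = "\<Sum>a<d. (\<phi>0 a x)\<^sup>2"
    let ?h = "\<lambda>y. \<Sum>a<d. \<phi>0 a x * \<phi>0 a y"
    let ?t = "\<lambda>b. \<integral>y. \<psi>0 b y * ?h y \<partial>\<mu>\<^sub>p"
    have phi0p: "\<phi>0 a \<in> Lp_space \<mu>\<^sub>p 2" if "a \<in> {..<d}" for a
      using phi0(1)[of a] that Vp by blast
    have h: "?h \<in> Lp_space \<mu>\<^sub>p 2"
      by (intro L2_sum phi0p)
    have t: "?t b = (\<Sum>a<d. \<phi>0 a x * (\<integral>y. \<psi>0 b y * \<phi>0 a y \<partial>\<mu>\<^sub>p))" if "b < d'" for b
      using phi0p psi0(2)[OF that] by (intro L2_inner_sum)
    have "?s = (\<Sum>a<d. \<phi>0 a x * (\<Sum>b<d'. (\<integral>y. \<psi>0 b y * \<phi>0 a y \<partial>\<mu>\<^sub>p) * \<psi>0 b x))"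
      unfolding power2_eq_square using elim(1) by (intro sum.cong refl) (metis)
    also have "\<dots> = (\<Sum>b<d'. \<Sum>a<d. \<phi>0 a x * ((\<integral>y. \<psi>0 b y * \<phi>0 a y \<partial>\<mu>\<^sub>p) * \<psi>0 b x))"
      unfolding sum_distrib_left by (rule sum.swap)
    also have "\<dots> = (\<Sum>b<d'. ?t b * \<psi>0 b x)"
    proof (intro sum.cong refl)
      fix b assume "b \<in> {..<d'}"
      then show "(\<Sum>a<d. \<phi>0 a x * ((\<integral>y. \<psi>0 b y * \<phi>0 a y \<partial>\<mu>\<^sub>p) * \<psi>0 b x)) = ?t b * \<psi>0 b x"
        by (simp only: t lessThan_iff sum_distrib_right mult.assoc)
    qed
    finally have "?s\<^sup>2 = (\<Sum>b<d'. ?t b * \<psi>0 b x)\<^sup>2" by simp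
    also have "\<dots> \<le> (\<Sum>b<d'. (?t b)\<^sup>2) * (\<Sum>b<d'. (\<psi>0 b x)\<^sup>2)"
      by (rule Cauchy_Schwarz_ineq_sum)
    also have "\<dots> \<le> (1 / \<delta>\<^sup>2 * ?s) * \<kappa>"
    proof (intro mult_mono elim(2))
      have "(\<Sum>b<d'. (?t b)\<^sup>2) \<le> (\<integral>y. (?h y)\<^sup>2 \<partial>\<mu>\<^sub>p)"
        by (rule onb_Bessel[OF op h])
      also have "\<dots> \<le> 1 / \<delta>\<^sup>2 * (\<integral>y. (?h y)\<^sup>2 \<partial>\<mu>\<^sub>q)"
        by (rule L2_norm_pq[OF h])
      also have "(\<integral>y. (?h y)\<^sup>2 \<partial>\<mu>\<^sub>q) = (\<Sum>a<d. \<phi>0 a x * (\<integral>y. ?h y * \<phi>0 a y \<partial>\<mu>\<^sub>q))"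
        unfolding power2_eq_square using phi0(2) L2_pq[OF h] by (intro L2_inner_sum) auto
      also have "\<dots> = ?s"
      proof (intro sum.cong refl)
        fix a assume a: "a \<in> {..<d}"
        have "(\<integral>y. ?h y * \<phi>0 a y \<partial>\<mu>\<^sub>q) = (\<integral>y. \<phi>0 a y * ?h y \<partial>\<mu>\<^sub>q)"
          by (simp add: mult.commute)
        also have "\<dots> = (\<Sum>b<d. \<phi>0 b x * (\<integral>y. \<phi>0 a y * \<phi>0 b y \<partial>\<mu>\<^sub>q))"
          using phi0(2) a by (intro L2_inner_sum) auto
        also have "\<dots> = \<phi>0 a x"
          using a oq by (simp add: onb_def if_distrib[of "\<lambda>x. _ * x"] cong: if_cong)
        finally show "\<phi>0 a x * (\<integral>y. ?h y * \<phi>0 a y \<partial>\<mu>\<^sub>q) = (\<phi>0 a x)\<^sup>2"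
          by (simp add: power2_eq_square)
      qed
      finally show "(\<Sum>b<d'. (?t b)\<^sup>2) \<le> 1 / \<delta>\<^sup>2 * ?s" .
    qed (auto intro!: sum_nonneg divide_nonneg_nonneg)
    finally have "?s * ?s \<le> ?s * (\<kappa> / \<delta>\<^sup>2)"
      by (simp add: power2_eq_square mult.commute)
    moreover have "0 \<le> ?s" by (intro sum_nonneg) auto
    moreover have "s \<le> t" if "s * s \<le> s * t" "0 \<le> s" "0 \<le> t" for s t :: real
      using that by (cases "s = 0") (auto simp: mult_le_cancel_left)
    moreover have "0 \<le> \<kappa> / \<delta>\<^sup>2" using \<kappa> by simp
    ultimately show "?s \<le> \<kappa> / \<delta>\<^sup>2" by blast
  qed
  have psi_sq': "AE x in \<mu>\<^sub>p. (\<Sum>a<d'. (\<psi>0 a x)\<^sup>2) \<le> \<kappa>"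
    using psi_sq by (simp only: p.AE_\<mu>)
  obtain \<psi> where psi: "bdd_proj \<mu>\<^sub>p {..<d'} \<psi>" "\<forall>a<d'. AE x in \<mu>\<^sub>p. \<psi> a x = \<psi>0 a x"
    using bounded_onb[OF fp.finite_measure_axioms op psi_sq' \<kappa>] by blast
  have phi_sq': "AE x in \<mu>\<^sub>q. (\<Sum>a<d. (\<phi>0 a x)\<^sup>2) \<le> \<kappa> / \<delta>\<^sup>2"
    using phi_sq by (simp only: q.AE_\<mu>)
  have \<kappa>': "0 \<le> \<kappa> / \<delta>\<^sup>2" using \<kappa> by simp
  obtain \<phi> where phi: "bdd_proj \<mu>\<^sub>q {..<d} \<phi>" "\<forall>a<d. AE x in \<mu>\<^sub>q. \<phi> a x = \<phi>0 a x"
    "\<forall>x\<in>space \<mu>\<^sub>q. (\<Sum>a<d. (\<phi> a x)\<^sup>2) \<le> \<kappa> / \<delta>\<^sup>2"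
    using bounded_onb[OF fq.finite_measure_axioms oq phi_sq' \<kappa>'] by blast
  interpret g: bdd_proj \<mu>\<^sub>p "{..<d'}" \<psi> by (rule psi)
  interpret h: bdd_proj \<mu>\<^sub>q "{..<d}" \<phi> by (rule phi)
  have all_psi: "AE z in \<nu>. \<forall>a\<in>{..<d'}. \<psi> a z = \<psi>0 a z"
    using psi(2) by (simp add: AE_ball_countable p.AE_\<mu>)
  have all_phi: "AE z in \<nu>. \<forall>a\<in>{..<d}. \<phi> a z = \<phi>0 a z"
    using phi(2) by (simp add: AE_ball_countable q.AE_\<mu>)
  have gproj: "AE z in \<nu>. g.proj f z = (\<Sum>a<d'. (\<integral>y. \<psi>0 a y * f y \<partial>\<mu>\<^sub>p) * \<psi>0 a z)"
    if f: "f \<in> borel_measurable \<nu>" for f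
  proof -
    have "g.coef f a = (\<integral>y. \<psi>0 a y * f y \<partial>\<mu>\<^sub>p)" if "a < d'" for a
      unfolding g.coef_def
    proof (rule integral_cong_AE)
      show "AE y in \<mu>\<^sub>p. \<psi> a y * f y = \<psi>0 a y * f y"
        using psi(2)[rule_format, OF that] by eventually_elim simp
    qed (use that f psi0(2) g.phi in \<open>auto intro!: borel_measurable_times intro: L2_measurable bdd_meas_measurable simp: p.borel_\<mu>[symmetric]\<close>)
    with all_psi show ?thesis
      by (elim AE_mp) (intro AE_I2, auto simp: g.proj_def)
  qed
  have hproj: "AE z in \<nu>. h.proj f z = (\<Sum>a<d. (\<integral>y. \<phi>0 a y * f y \<partial>\<mu>\<^sub>q) * \<phi>0 a z)"
    if f: "f \<in> borel_measurable \<nu>" for f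
  proof -
    have "h.coef f a = (\<integral>y. \<phi>0 a y * f y \<partial>\<mu>\<^sub>q)" if "a < d" for a
      unfolding h.coef_def
    proof (rule integral_cong_AE)
      show "AE y in \<mu>\<^sub>q. \<phi> a y * f y = \<phi>0 a y * f y"
        using phi(2)[rule_format, OF that] by eventually_elim simp
    qed (use that f phi0(2) h.phi in \<open>auto intro!: borel_measurable_times intro: L2_measurable bdd_meas_measurable simp: q.borel_\<mu>[symmetric]\<close>)
    with all_phi show ?thesis
      by (elim AE_mp) (intro AE_I2, auto simp: h.proj_def)
  qed
  show ?thesis
  proof (intro exI conjI allI impI ballI)
    show "bdd_proj \<mu>\<^sub>q {..<d} \<phi>" "bdd_proj \<mu>\<^sub>p {..<d'} \<psi>" by fact+
    show "AE z in \<nu>. g.proj (\<phi> a) z = \<phi> a z" if a: "a < d" for a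
    proof -
      have m: "\<phi> a \<in> borel_measurable \<nu>" "\<phi>0 a \<in> borel_measurable \<nu>"
        using h.phi[of a] phi0(2)[OF a] a by (auto simp: q.borel_\<mu>[symmetric] intro: bdd_meas_measurable L2_measurable)
      have "g.proj (\<phi> a) = g.proj (\<phi>0 a)"
        unfolding g.proj_def g.coef_def fun_eq_iff
      proof (intro allI sum.cong refl arg_cong2[where f = "(*)"] integral_cong_AE)
        fix b assume b: "b \<in> {..<d'}"
        show "AE y in \<mu>\<^sub>p. \<psi> b y * \<phi> a y = \<psi> b y * \<phi>0 a y"
          using phi(2)[rule_format, OF a] unfolding p.AE_\<mu> q.AE_\<mu> by eventually_elim simp
        show "(\<lambda>y. \<psi> b y * \<phi> a y) \<in> borel_measurable \<mu>\<^sub>p" "(\<lambda>y. \<psi> b y * \<phi>0 a y) \<in> borel_measurable \<mu>\<^sub>p"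
          using m bdd_meas_measurable[OF g.phi[OF b]] by (auto simp: p.borel_\<mu>)
      qed
      then have "AE z in \<nu>. g.proj (\<phi> a) z = (\<Sum>b<d'. (\<integral>y. \<psi>0 b y * \<phi>0 a y \<partial>\<mu>\<^sub>p) * \<psi>0 b z)"
        using gproj[OF m(2)] by simp
      with exp_phi all_phi show ?thesis
        by eventually_elim (use a in auto)
    qed
    show "AE z in \<nu>. h.proj (\<psi> a) z = \<psi> a z" if a: "a < d'" for a
    proof -
      have m: "\<psi> a \<in> borel_measurable \<nu>" "\<psi>0 a \<in> borel_measurable \<nu>"
        using g.phi[of a] psi0(2)[OF a] a by (auto simp: p.borel_\<mu>[symmetric] intro: bdd_meas_measurable L2_measurable)
      have "h.proj (\<psi> a) = h.proj (\<psi>0 a)"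
        unfolding h.proj_def h.coef_def fun_eq_iff
      proof (intro allI sum.cong refl arg_cong2[where f = "(*)"] integral_cong_AE)
        fix b assume b: "b \<in> {..<d}"
        show "AE y in \<mu>\<^sub>q. \<phi> b y * \<psi> a y = \<phi> b y * \<psi>0 a y"
          using psi(2)[rule_format, OF a] unfolding p.AE_\<mu> q.AE_\<mu> by eventually_elim simp
        show "(\<lambda>y. \<phi> b y * \<psi> a y) \<in> borel_measurable \<mu>\<^sub>q" "(\<lambda>y. \<phi> b y * \<psi>0 a y) \<in> borel_measurable \<mu>\<^sub>q"
          using m bdd_meas_measurable[OF h.phi[OF b]] by (auto simp: q.borel_\<mu>)
      qed
      then have 1: "AE z in \<nu>. h.proj (\<psi> a) z = (\<Sum>b<d. (\<integral>y. \<phi>0 b y * \<psi>0 a y \<partial>\<mu>\<^sub>q) * \<phi>0 b z)"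
        using hproj[OF m(2)] by simp
      have 2: "AE z in \<nu>. \<psi>0 a z = (\<Sum>b<d. (\<integral>y. \<phi>0 b y * \<psi>0 a y \<partial>\<mu>\<^sub>q) * \<phi>0 b z)"
        using oq psi0(1)[OF a] by (simp add: onb_def q.AE_\<mu>)
      from 1 2 all_psi show ?thesis
        by eventually_elim (use a in auto)
    qed
    show "(\<Sum>a<d. (\<phi> a z)\<^sup>2) \<le> \<kappa> / \<delta>\<^sup>2" if "z \<in> space \<nu>" for z
      using phi(3) that by (simp add: q.space_\<mu>)
    show "AE z in \<nu>. kernel_op \<mu>\<^sub>q Kh f z = h.proj f z" if f: "f \<in> bdd_meas \<nu>" for f
    proof -
      have "f \<in> Lp_space \<mu>\<^sub>q 2"
        using f by (intro fq.bdd_meas_L2) (simp add: q.bdd_meas_\<mu>)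
      from kernel_finite_rank(2)[OF fq.finite_measure_axioms Kh Vq oq this]
      have "AE z in \<nu>. kernel_op \<mu>\<^sub>q Kh f z = (\<Sum>a<d. (\<integral>y. \<phi>0 a y * f y \<partial>\<mu>\<^sub>q) * \<phi>0 a z)"
        by (simp add: q.AE_\<mu>)
      with hproj[OF bdd_meas_measurable[OF f]] show ?thesis
        by eventually_elim simp
    qed
    show "AE z in \<nu>. kernel_op \<mu>\<^sub>p K f z = g.proj f z" if f: "f \<in> bdd_meas \<nu>" for f
    proof -
      have "f \<in> Lp_space \<mu>\<^sub>p 2"
        using f by (intro fp.bdd_meas_L2) (simp add: p.bdd_meas_\<mu>)
      from kernel_finite_rank(2)[OF fp.finite_measure_axioms K(1) Vp op this]
      have "AE z in \<nu>. kernel_op \<mu>\<^sub>p K f z = (\<Sum>a<d'. (\<integral>y. \<psi>0 a y * f y \<partial>\<mu>\<^sub>p) * \<psi>0 a z)"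
        by (simp add: p.AE_\<mu>)
      with gproj[OF bdd_meas_measurable[OF f]] show ?thesis
        by eventually_elim simp
    qed
    show "AE z in \<nu>. v z = h.proj f z" if f: "f \<in> bdd_meas \<nu>" and v: "is_orth_proj \<mu>\<^sub>q ?V f v" for f v
    proof -
      have "f \<in> Lp_space \<mu>\<^sub>q 2"
        using f by (intro fq.bdd_meas_L2) (simp add: q.bdd_meas_\<mu>)
      from onb_proj[OF oq this Vq v]
      have "AE z in \<nu>. v z = (\<Sum>a<d. (\<integral>y. \<phi>0 a y * f y \<partial>\<mu>\<^sub>q) * \<phi>0 a z)"
        by (simp add: q.AE_\<mu>)
      with hproj[OF bdd_meas_measurable[OF f]] show ?thesis
        by eventually_elim simp
    qed
    show "AE x in \<nu> \<Otimes>\<^sub>M \<nu>. Kh (fst x) (snd x) = h.ker (fst x) (snd x)"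
    proof -
      interpret qq: pair_sigma_finite \<mu>\<^sub>q \<mu>\<^sub>q ..
      interpret nn: pair_sigma_finite \<nu> \<nu> ..
      have K_m: "(\<lambda>x. Kh (fst x) (snd x)) \<in> borel_measurable (\<nu> \<Otimes>\<^sub>M \<nu>)"
        using Kh by (simp add: orth_proj_kernel_def case_prod_unfold q.sets_\<mu> cong: measurable_cong_sets)
      have phi_m [measurable]: "\<phi> a \<in> borel_measurable \<nu>" if "a \<in> {..<d}" for a
        using bdd_meas_measurable[OF h.phi[OF that]] by (simp add: q.borel_\<mu>)
      have k_m: "(\<lambda>x. h.ker (fst x) (snd x)) \<in> borel_measurable (\<nu> \<Otimes>\<^sub>M \<nu>)"
        unfolding h.ker_def by measurable
      have "AE x in \<mu>\<^sub>q. AE z in \<mu>\<^sub>q. Kh x z = (\<Sum>a<d. \<phi>0 a x * \<phi>0 a z)"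
        using qq.AE_pair[OF kernel_finite_rank(1)[OF fq.finite_measure_axioms Kh Vq oq]] by simp
      then have "AE x in \<nu>. AE z in \<nu>. Kh x z = (\<Sum>a<d. \<phi>0 a x * \<phi>0 a z)"
        by (simp add: q.AE_\<mu>)
      with all_phi have "AE x in \<nu>. AE z in \<nu>. Kh x z = h.ker x z"
      proof eventually_elim
        case (elim x)
        from elim(2) all_phi show ?case
          by eventually_elim (use elim(1) in \<open>simp add: h.ker_def\<close>)
      qed
      then show ?thesis
        using K_m k_m by (intro nn.AE_pair_measure) (simp_all, measurable)
    qed
  qed
qed

end

subsection \<open>Moments of the estimator\<close>

lemma ustat_one:
  fixes f :: "'x \<Rightarrow> real"
  shows "ustat n 1 (\<lambda>x. f (x 1)) = emp_mean n f"
proof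
  fix x :: "nat \<Rightarrow> 'x"
  let ?c = "\<lambda>i. \<lambda>s\<in>{1 :: nat}. i :: nat"
  have D: "distinct_tuples n 1 = ?c ` {1..n}"
  proof (intro equalityI subsetI)
    fix \<sigma> assume "\<sigma> \<in> distinct_tuples n 1"
    then have "\<sigma> \<in> {1} \<rightarrow>\<^sub>E {1..n}" by (simp add: distinct_tuples_def)
    then have "\<sigma> = ?c (\<sigma> 1)" "\<sigma> 1 \<in> {1..n}"
      by (auto simp: PiE_iff fun_eq_iff extensional_def)
    then show "\<sigma> \<in> ?c ` {1..n}" by blast
  qed (auto simp: distinct_tuples_def split: if_splits)
  have inj: "inj_on ?c {1..n}"
    by (rule inj_onI) (metis insertI1 restrict_apply')
  have "(\<Sum>\<sigma>\<in>distinct_tuples n 1. f (x (\<sigma> 1))) = (\<Sum>i=1..n. f (x i))"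
    unfolding D by (subst sum.reindex[OF inj]) simp
  moreover have "card (distinct_tuples n 1) = n"
    unfolding D card_image[OF inj] by simp
  ultimately show "ustat n 1 (\<lambda>x. f (x 1)) x = emp_mean n f x"
    unfolding ustat_def emp_mean_def by simp
qed

text \<open>The linear part is a U-statistic of order one with a kernel of rank one; the factor 2 is
  the counting factor \<open>2 ^ j\<close> for \<open>j = 1\<close>.\<close>

lemma emp_mean_moments:
  assumes P: "prob_space P" and f: "f \<in> bdd_meas P" and c: "\<And>x. x \<in> space P \<Longrightarrow> \<bar>f x\<bar> \<le> c" and n: "1 \<le> n"
  defines "X \<equiv> PiM {1..n} (\<lambda>_. P)" and "\<theta> \<equiv> \<integral>x. f x \<partial>P"
  shows "integrable X (emp_mean n f)" "(\<integral>x. emp_mean n f x \<partial>X) = \<theta>"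
    "integrable X (\<lambda>x. (emp_mean n f x - \<theta>)\<^sup>2)" "(\<integral>x. (emp_mean n f x - \<theta>)\<^sup>2 \<partial>X) \<le> 2 * c\<^sup>2 / real n"
proof -
  interpret P: prob_space P by fact
  interpret t: tensor_family P "{()}" "{1..1}" "\<lambda>_ _. f"
    by unfold_locales (use f in auto)
  have v: "t.partial_moment B \<le> c\<^sup>2" if B: "B \<subseteq> {1..1}" "B \<noteq> {}" for B
  proof -
    have "B = {1}" using B by auto
    then have "t.partial_moment B = (\<integral>x. f x * f x \<partial>P)"
      unfolding t.partial_moment_def partial_mean_def by simp
    also have "\<dots> \<le> (\<integral>x. c\<^sup>2 \<partial>P)"
    proof (intro integral_mono P.bdd_meas_integrable bdd_meas_intros f)
      fix x assume "x \<in> space P"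
      from c[OF this] show "f x * f x \<le> c\<^sup>2"
        using abs_le_square_iff[of "f x" c] by (simp add: power2_eq_square)
    qed
    also have "\<dots> = c\<^sup>2" by (simp add: P.prob_space)
    finally show ?thesis .
  qed
  have "tensor {()} {1..1} (\<lambda>_ _. f) = (\<lambda>x. f (x 1))"
    by (auto simp: tensor_def)
  then have e: "ustat n 1 (tensor {()} {1..1} (\<lambda>_ _. f)) = emp_mean n f"
    using ustat_one by simp
  note u = ustat_tensor[where v = "\<lambda>_. c\<^sup>2", OF t.tensor_family_axioms n v zero_le_power2, unfolded e]
  show "integrable X (emp_mean n f)" "(\<integral>x. emp_mean n f x \<partial>X) = \<theta>"
    "integrable X (\<lambda>x. (emp_mean n f x - \<theta>)\<^sup>2)" "(\<integral>x. (emp_mean n f x - \<theta>)\<^sup>2 \<partial>X) \<le> 2 * c\<^sup>2 / real n"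
    using u by (simp_all add: X_def \<theta>_def)
qed

text \<open>The sup norm of a projection is controlled by the L2 norm through the diagonal. The
  resulting constant grows with \<open>k\<close>, so it serves for integrability and for the mean,
  where no size of the variance is claimed.\<close>

lemma (in bdd_proj) proj_L4:
  assumes c: "\<And>z. z \<in> space M \<Longrightarrow> (\<Sum>a\<in>D. (\<phi> a z)\<^sup>2) \<le> c" and f: "f \<in> bdd_meas M"
  shows "(\<integral>z. proj f z ^ 4 \<partial>M) \<le> c * measure M (space M) * (\<integral>z. f z ^ 4 \<partial>M)"
proof (cases "space M = {}")
  case True
  then show ?thesis by (simp add: Bochner_Integration.integral_empty)
next
  case False
  then obtain z0 where "z0 \<in> space M" by blast
  have "0 \<le> (\<Sum>a\<in>D. (\<phi> a z0)\<^sup>2)" by (intro sum_nonneg) auto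
  with c[OF \<open>z0 \<in> space M\<close>] have c0: "0 \<le> c" by linarith
  define F where "F = (\<integral>z. (f z)\<^sup>2 \<partial>M)"
  have F0: "0 \<le> F" by (simp add: F_def)
  have pw: "(proj f z)\<^sup>2 \<le> c * F" if z: "z \<in> space M" for z
  proof -
    have "(proj f z)\<^sup>2 = (\<integral>y. ker z y * f y \<partial>M)\<^sup>2"
      by (simp add: integral_ker[OF f])
    also have "\<dots> \<le> (\<integral>y. (ker z y)\<^sup>2 \<partial>M) * (\<integral>y. (f y)\<^sup>2 \<partial>M)"
      by (rule bdd_meas_Cauchy_Schwarz) (simp_all add: f)
    also have "\<dots> \<le> c * F"
      unfolding integral_ker_sq F_def by (intro mult_right_mono c z) simp
    finally show ?thesis .
  qed
  have e4: "x ^ 4 = x\<^sup>2 * x\<^sup>2" for x :: real by (simp add: power4_eq_xxxx power2_eq_square)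
  have "(\<integral>z. proj f z ^ 4 \<partial>M) \<le> (\<integral>z. c * F * (proj f z)\<^sup>2 \<partial>M)"
    unfolding e4 by (intro integral_mono bdd_meas_integrable bdd_meas_intros proj_bdd mult_right_mono pw) auto
  also have "\<dots> = c * F * (\<integral>z. (proj f z)\<^sup>2 \<partial>M)" by simp
  also have "\<dots> \<le> c * F * F"
    unfolding F_def using c0 by (intro mult_left_mono proj_contraction f) auto
  also have "\<dots> = c * (\<integral>z. 1 * (f z)\<^sup>2 \<partial>M)\<^sup>2" by (simp add: F_def power2_eq_square)
  also have "\<dots> \<le> c * ((\<integral>z. 1\<^sup>2 \<partial>M) * (\<integral>z. ((f z)\<^sup>2)\<^sup>2 \<partial>M))"
    using c0 f by (intro mult_left_mono bdd_meas_Cauchy_Schwarz bdd_meas_intros)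
  also have "\<dots> = c * measure M (space M) * (\<integral>z. f z ^ 4 \<partial>M)"
    by (simp add: power_mult[symmetric])
  finally show ?thesis .
qed

lemma Lp_norm_4: "Lp_norm M 4 f ^ 4 = (\<integral>x. f x ^ 4 \<partial>M)"
proof -
  have "Lp_norm M 4 f ^ 4 = Lp_norm M 4 f powr 4"
    by (rule powr_numeral[symmetric]) simp
  also have "\<dots> = (\<integral>x. \<bar>f x\<bar> powr 4 \<partial>M)"
    by (simp add: Lp_norm_def powr_powr)
  also have "\<dots> = (\<integral>x. f x ^ 4 \<partial>M)"
    by (intro Bochner_Integration.integral_cong refl) simp
  finally show ?thesis .
qed

text \<open>Cauchy-Schwarz with the summable weights \<open>2 ^ j\<close>: the number
  \<open>m\<close> of terms is avoided, and the weight is exponential in \<open>j\<close> like the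
  rest.\<close>

lemma sum_squares_le:
  fixes x :: "nat \<Rightarrow> real"
  shows "(\<Sum>j=1..m. x j)\<^sup>2 \<le> (\<Sum>j=1..m. 2 ^ j * (x j)\<^sup>2)"
proof -
  have "(\<Sum>j=1..m. (1 / 2 :: real) ^ j) = 1 - (1 / 2) ^ m"
    by (induction m) auto
  then have g: "(\<Sum>j=1..m. (1 / 2 :: real) ^ j) \<le> 1" by simp
  have "(\<Sum>j=1..m. x j)\<^sup>2 = (\<Sum>j=1..m. sqrt ((1 / 2) ^ j) * (sqrt (2 ^ j) * x j))\<^sup>2"
    by (simp add: real_sqrt_mult[symmetric] mult.assoc[symmetric] power_mult_distrib[symmetric])
  also have "\<dots> \<le> (\<Sum>j=1..m. (sqrt ((1 / 2) ^ j))\<^sup>2) * (\<Sum>j=1..m. (sqrt (2 ^ j) * x j)\<^sup>2)"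
    by (rule Cauchy_Schwarz_ineq_sum)
  also have "\<dots> = (\<Sum>j=1..m. (1 / 2) ^ j) * (\<Sum>j=1..m. 2 ^ j * (x j)\<^sup>2)"
    by (simp add: power_mult_distrib)
  also have "\<dots> \<le> 1 * (\<Sum>j=1..m. 2 ^ j * (x j)\<^sup>2)"
    using g by (intro mult_right_mono sum_nonneg) auto
  finally show ?thesis by simp
qed

text \<open>One factor \<open>2 ^ j\<close> stems from splitting the square over the orders, the
  other from counting overlaps; together with \<open>C\<close>, at most three powers of
  \<open>A\<close> per order and \<open>1 / \<delta>\<^sup>2\<close> they make up the base
  \<open>4 * C * A ^ 3 / \<delta>\<^sup>2\<close>. Exchanging the sums over \<open>j\<close> and
  \<open>l\<close> gives the form of \<open>var_bound\<close>.\<close>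

lemma var_bound_le:
  fixes A C \<delta> \<epsilon> :: real
  assumes A: "1 \<le> A" and C: "1 \<le> C" and \<delta>: "0 < \<delta>" "\<delta> \<le> 1" and \<epsilon>: "0 \<le> \<epsilon>"
    and c: "c = 4 * C * A ^ 3 / \<delta>\<^sup>2 + 16 / \<delta>\<^sup>2" and m: "1 \<le> m"
  shows "2 * (8 / \<delta>\<^sup>2 / real n) + (\<Sum>j=2..m. 2 ^ j * (\<Sum>l=1..j. 2 ^ j * (real j / real n) ^ l *
      (C ^ l * (A ^ (2 * j + 1) * (\<epsilon> / \<delta>) ^ (2 * (j - l)) * real k ^ (l - 1))))) \<le> var_bound c \<epsilon> k m n"
    (is "?L \<le> _")
proof -
  let ?t = "\<lambda>j l. c ^ j * real j ^ (2 * l) * \<epsilon> ^ (2 * (j - l)) * (real k ^ (l - 1) / real n ^ l)"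
  let ?c = "4 * C * A ^ 3 / \<delta>\<^sup>2"
  have c0: "0 \<le> ?c" "?c \<le> c" "16 / \<delta>\<^sup>2 \<le> c" "0 \<le> c"
    using A C \<delta> by (auto simp: c)
  have "2 ^ j * (2 ^ j * (real j / real n) ^ l *
      (C ^ l * (A ^ (2 * j + 1) * (\<epsilon> / \<delta>) ^ (2 * (j - l)) * real k ^ (l - 1)))) \<le> ?t j l" if jl: "1 \<le> l" "l \<le> j" for j l
  proof -
    have d: "(1 / \<delta>) ^ (2 * (j - l)) \<le> (1 / \<delta>) ^ (2 * j)"
      using \<delta> jl by (intro power_increasing) auto
    have "2 ^ j * 2 ^ j * C ^ l * A ^ (2 * j + 1) * (1 / \<delta>) ^ (2 * (j - l)) \<le>
        4 ^ j * C ^ j * A ^ (3 * j) * (1 / \<delta>) ^ (2 * j)"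
      using A C jl \<delta> d by (intro mult_mono mult_nonneg_nonneg power_increasing)
        (auto simp: power_mult_distrib[symmetric] simp del: power_one_over)
    also have "\<dots> = ?c ^ j"
      by (simp add: power_mult_distrib power_divide power_mult)
    also have "\<dots> \<le> c ^ j"
      using c0 by (intro power_mono)
    finally have 1: "2 ^ j * 2 ^ j * C ^ l * A ^ (2 * j + 1) * (1 / \<delta>) ^ (2 * (j - l)) \<le> c ^ j" .
    have "real j ^ l \<le> real j ^ (2 * l)"
      using jl by (intro power_increasing) auto
    then have "2 ^ j * 2 ^ j * C ^ l * A ^ (2 * j + 1) * (1 / \<delta>) ^ (2 * (j - l)) * real j ^ l *
        (\<epsilon> ^ (2 * (j - l)) * (real k ^ (l - 1) / real n ^ l)) \<le>
      c ^ j * real j ^ (2 * l) * (\<epsilon> ^ (2 * (j - l)) * (real k ^ (l - 1) / real n ^ l))"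
      using 1 c0 \<epsilon> by (intro mult_right_mono mult_mono mult_nonneg_nonneg divide_nonneg_nonneg) auto
    then show ?thesis
      by (simp add: power_divide ac_simps)
  qed
  then have "(\<Sum>j=2..m. 2 ^ j * (\<Sum>l=1..j. 2 ^ j * (real j / real n) ^ l *
      (C ^ l * (A ^ (2 * j + 1) * (\<epsilon> / \<delta>) ^ (2 * (j - l)) * real k ^ (l - 1))))) \<le> (\<Sum>j=2..m. \<Sum>l=1..j. ?t j l)"
    unfolding sum_distrib_left by (intro sum_mono) auto
  \<comment> \<open>The linear part fills the term with \<open>j = l = 1\<close>, whose value is
    \<open>c / n\<close>; the summand \<open>16 / \<delta>\<^sup>2\<close> of \<open>c\<close> is
    there for it.\<close>
  moreover have "2 * (8 / \<delta>\<^sup>2 / real n) \<le> (\<Sum>l=1..1. ?t 1 l)"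
    using c0(3) divide_right_mono[OF c0(3), of "real n"] by simp
  ultimately have "?L \<le> (\<Sum>l=1..1. ?t 1 l) + (\<Sum>j=2..m. \<Sum>l=1..j. ?t j l)"
    by linarith
  also have "\<dots> = (\<Sum>j=1..m. \<Sum>l=1..j. ?t j l)"
    using m by (simp add: sum.atLeast_Suc_atMost numeral_2_eq_2)
  also have "\<dots> = (\<Sum>j\<in>{1..m}. \<Sum>l\<in>{l \<in> {1..m}. l \<le> j}. ?t j l)"
    by (intro sum.cong refl) auto
  also have "\<dots> = (\<Sum>l\<in>{1..m}. \<Sum>j\<in>{j \<in> {1..m}. l \<le> j}. ?t j l)"
    by (rule sum.swap_restrict) auto
  also have "\<dots> = (\<Sum>l=1..m. \<Sum>j=l..m. ?t j l)"
    by (intro sum.cong refl) auto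
  also have "\<dots> = var_bound c \<epsilon> k m n"
    unfolding var_bound_def sum_distrib_right ..
  finally show ?thesis .
qed

section \<open>Verification of the chain bounds for the two laws and assembly\<close>

context two_models
begin

abbreviation err :: real where "err \<equiv> eps \<nu> p phat aw bw"

lemma err_bounds:
  shows "0 \<le> err" "Lp_norm \<mu>\<^sub>p 4 (\<lambda>z. par_a phat z - par_a p z) \<le> err"
    "Lp_norm \<mu>\<^sub>p 4 (\<lambda>z. par_b phat z - par_b p z) \<le> err"
    "z \<in> space \<nu> \<Longrightarrow> \<bar>N_fun z\<bar> \<le> err / \<delta>"
proof -
  have sw: "Lp_norm \<mu>\<^sub>p 4 (\<lambda>z. f z - g z) = Lp_norm \<mu>\<^sub>p 4 (\<lambda>z. g z - f z)" for f g :: "'z \<Rightarrow> real"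
    by (simp add: Lp_norm_def abs_minus_commute)
  show a: "Lp_norm \<mu>\<^sub>p 4 (\<lambda>z. par_a phat z - par_a p z) \<le> err"
    unfolding sw[of "par_a phat"] eps_def Let_def by simp
  show "Lp_norm \<mu>\<^sub>p 4 (\<lambda>z. par_b phat z - par_b p z) \<le> err"
    unfolding sw[of "par_b phat"] eps_def Let_def by simp
  show "0 \<le> err"
    using a Lp_norm_nonneg order_trans by blast
  show "\<bar>N_fun z\<bar> \<le> err / \<delta>" if z: "z \<in> space \<nu>"
  proof -
    have g0: "\<delta> \<le> par_g phat z" using q.bounds(7)[OF z] .
    have "\<bar>par_g p z - par_g phat z\<bar> \<le> sup_norm (space \<nu>) (\<lambda>z. par_g p z - par_g phat z)"
      by (intro sup_norm_bound bdd_meas_diff p.par_bdd q.par_bdd z)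
    also have "\<dots> \<le> err"
      unfolding eps_def Let_def by simp
    finally have 1: "\<bar>par_g p z - par_g phat z\<bar> \<le> err" .
    have "N_fun z = (par_g p z - par_g phat z) / par_g phat z"
      using g0 p.\<delta> by (simp add: N_fun_def rho_def diff_divide_distrib)
    then have "\<bar>N_fun z\<bar> = \<bar>par_g p z - par_g phat z\<bar> / par_g phat z"
      using g0 p.\<delta> by simp
    also have "\<dots> \<le> err / \<delta>"
      using 1 g0 p.\<delta> by (intro frac_le) auto
    finally show ?thesis .
  qed
qed

text \<open>One factor \<open>rho\<close> turns the estimated measure into the true one, in which
  the error is measured. The remaining \<open>rho ^ 3\<close> costs \<open>1 / \<delta> ^ 6\<close>,
  and the fourth power of \<open>1 / w\<close> is absorbed into
  \<open>err / \<delta>\<close>.\<close>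

lemma quotient_L4:
  assumes x: "x \<in> bdd_meas \<nu>" and w: "w \<in> bdd_meas \<nu>" "\<And>z. z \<in> space \<nu> \<Longrightarrow> \<delta> \<le> w z"
    and le: "Lp_norm \<mu>\<^sub>p 4 x \<le> err"
  shows "(\<integral>z. (rho z * (x z / w z)) ^ 4 \<partial>\<mu>\<^sub>q) \<le> 1 / \<delta> ^ 6 * (err / \<delta>) ^ 4"
proof -
  interpret fp: finite_measure \<mu>\<^sub>p by (rule p.finite_\<mu>)
  have bd: "(\<lambda>z. rho z ^ 3 * (x z / w z) ^ 4) \<in> bdd_meas \<nu>"
    by (rule bdd_meas_mult[OF bdd_meas_power[OF quot_bdd(1)] bdd_meas_power[OF div_bdd[OF x w]]])
  have bd': "(\<lambda>z. (1 / \<delta>\<^sup>2) ^ 3 * ((1 / \<delta>) ^ 4 * x z ^ 4)) \<in> bdd_meas \<nu>"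
    by (rule bdd_meas_mult[OF bdd_meas_const bdd_meas_mult[OF bdd_meas_const bdd_meas_power[OF x]]])
  have "(\<integral>z. (rho z * (x z / w z)) ^ 4 \<partial>\<mu>\<^sub>q) = (\<integral>z. rho z * (rho z ^ 3 * (x z / w z) ^ 4) \<partial>\<mu>\<^sub>q)"
    by (intro Bochner_Integration.integral_cong refl) (simp add: power_mult_distrib eval_nat_numeral)
  also have "\<dots> = (\<integral>z. rho z ^ 3 * (x z / w z) ^ 4 \<partial>\<mu>\<^sub>p)"
    by (rule integral_\<mu>\<^sub>p[symmetric, OF bdd_meas_measurable[OF bd]])
  also have "\<dots> \<le> (\<integral>z. (1 / \<delta>\<^sup>2) ^ 3 * ((1 / \<delta>) ^ 4 * x z ^ 4) \<partial>\<mu>\<^sub>p)"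
  proof (intro integral_mono fp.bdd_meas_integrable)
    fix z assume "z \<in> space \<mu>\<^sub>p"
    then have z: "z \<in> space \<nu>" by (simp add: p.space_\<mu>)
    have "1 / w z \<le> 1 / \<delta>" "0 < w z"
      using w(2)[OF z] p.\<delta> by (auto intro!: frac_le)
    then have "(1 / w z) ^ 4 * x z ^ 4 \<le> (1 / \<delta>) ^ 4 * x z ^ 4"
      by (intro mult_right_mono power_mono) auto
    then have "(x z / w z) ^ 4 \<le> (1 / \<delta>) ^ 4 * x z ^ 4"
      by (simp add: power_divide)
    then show "rho z ^ 3 * (x z / w z) ^ 4 \<le> (1 / \<delta>\<^sup>2) ^ 3 * ((1 / \<delta>) ^ 4 * x z ^ 4)"
      using rho_bounds[OF z] by (intro mult_mono power_mono) auto
  qed (simp_all only: p.bdd_meas_\<mu> bd bd')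
  also have "\<dots> = 1 / \<delta> ^ 6 * ((1 / \<delta>) ^ 4 * Lp_norm \<mu>\<^sub>p 4 x ^ 4)"
    by (simp add: Lp_norm_4 power_divide)
  also have "\<dots> \<le> 1 / \<delta> ^ 6 * ((1 / \<delta>) ^ 4 * err ^ 4)"
    using le p.\<delta> by (intro mult_left_mono power_mono) auto
  finally show ?thesis by (simp add: power_divide)
qed

lemma chain_weight_bounds:
  assumes z: "z \<in> space \<nu>"
  shows "0 \<le> w1_fun z \<and> w1_fun z \<le> 1 / \<delta> ^ 4" "0 \<le> w2_fun z \<and> w2_fun z \<le> 1 / \<delta> ^ 4"
    "0 \<le> w3_fun z \<and> w3_fun z \<le> 1 / \<delta> ^ 4"
proof -
  note \<delta> = p.\<delta>
  note b = q.bounds[OF z] p.weight_bounds[OF z]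
  have d1: "1 \<le> 1 / \<delta>" using \<delta> b(11) by simp
  have i: "1 / aw z \<le> 1 / \<delta>" "1 / bw z \<le> 1 / \<delta>" "0 < aw z" "0 < bw z"
    using b \<delta> by (auto intro!: frac_le)
  have p2: "1 / \<delta> * (1 / \<delta>) \<le> 1 / \<delta> ^ 4"
    using power_increasing[OF _ d1, of 2 4] by (simp add: power_divide power2_eq_square)
  have "(par_a phat z - 1) * par_a phat z * bw z * (1 / aw z) \<le> 1 / \<delta> * (1 / \<delta>) * (1 / \<delta>) * (1 / \<delta>)"
    using b i d1 \<delta> by (intro mult_mono mult_nonneg_nonneg) auto
  moreover have "0 \<le> w1_fun z"
    unfolding w1_fun_def using b i by (intro divide_nonneg_nonneg mult_nonneg_nonneg) auto
  ultimately show "0 \<le> w1_fun z \<and> w1_fun z \<le> 1 / \<delta> ^ 4"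
    by (simp add: w1_fun_def eval_nat_numeral mult.assoc)
  have "aw z * bw z \<le> 1 / \<delta> * (1 / \<delta>)"
    using b i d1 \<delta> by (intro mult_mono) auto
  then show "0 \<le> w2_fun z \<and> w2_fun z \<le> 1 / \<delta> ^ 4"
    using p2 i by (simp add: w2_fun_def)
  have "par_b phat z * (1 - par_b phat z) * aw z * (1 / bw z) \<le> 1 * 1 * (1 / \<delta>) * (1 / \<delta>)"
    using b i d1 \<delta> by (intro mult_mono mult_nonneg_nonneg) auto
  moreover have "0 \<le> w3_fun z"
    unfolding w3_fun_def using b i \<delta> by (intro divide_nonneg_nonneg mult_nonneg_nonneg) auto
  ultimately show "0 \<le> w3_fun z \<and> w3_fun z \<le> 1 / \<delta> ^ 4"
    using p2 by (simp add: w3_fun_def)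
qed

lemma linear_part_bound: "x \<in> space (law \<nu> p) \<Longrightarrow> \<bar>linear_part phat x\<bar> \<le> 2 / \<delta>"
proof -
  assume x: "x \<in> space (law \<nu> p)"
  obtain u t z where xe: "x = (u, t, z)" by (cases x) auto
  have z: "z \<in> space \<nu>"
    using x by (simp add: xe p.space_law space_pair_measure)
  note b = q.bounds[OF z]
  have "\<bar>of_bool t * par_a phat z * (of_bool u - par_b phat z)\<bar> \<le> 1 / \<delta> * 1"
    unfolding abs_mult using b p.\<delta> by (intro mult_mono) (auto simp: of_bool_def)
  moreover have "\<bar>par_b phat z\<bar> \<le> 1 / \<delta>"
  proof -
    have "1 \<le> 1 / \<delta>" using p.\<delta> b(11) by simp
    then show ?thesis using b p.\<delta> by linarith
  qed
  ultimately show ?thesis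
    unfolding xe linear_part_def by simp
qed

definition chain_mean :: "nat set \<Rightarrow> (nat \<Rightarrow> 'z \<Rightarrow> real) \<Rightarrow> nat \<Rightarrow> real" where
  "chain_mean D \<phi> m = (\<Sum>j=2..m. (-1) ^ (j - 1) *
     (\<integral>z. U_fun z * bdd_proj.proj \<mu>\<^sub>q D \<phi> ((chain_op.S \<mu>\<^sub>q D \<phi> N_fun ^^ (j - 2)) V_fun) z \<partial>\<mu>\<^sub>q))"

text \<open>\<open>A\<close> is the sum of the three products it has to dominate, with mass bound
  \<open>1 / \<delta>\<^sup>2\<close>, second moment bound \<open>1 / \<delta> ^ 4\<close> and error
  constant \<open>1 / \<delta> ^ 6\<close>. The L4 constant \<open>b\<close> remains a parameter, so
  that it can be a crude value or one from an operator norm.\<close>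

lemma chi_hat_moments:
  fixes \<phi> :: "nat \<Rightarrow> 'z \<Rightarrow> real" and b c0 :: real
  assumes h: "bdd_proj \<mu>\<^sub>q D \<phi>"
    and sq: "\<forall>z\<in>space \<nu>. (\<Sum>a\<in>D. (\<phi> a z)\<^sup>2) \<le> c0 * real k" "0 \<le> c0" "1 \<le> k"
    and b: "\<forall>f\<in>bdd_meas \<nu>. (\<integral>z. bdd_proj.proj \<mu>\<^sub>q D \<phi> f z ^ 4 \<partial>\<mu>\<^sub>q) \<le> b * (\<integral>z. f z ^ 4 \<partial>\<mu>\<^sub>q)" "1 \<le> b"
    and m: "2 \<le> m" "m \<le> n"
  defines "X \<equiv> sample_law \<nu> p n" and "T \<equiv> chi_hat \<nu> phat aw bw (bdd_proj.ker D \<phi>) m n"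
    and "\<theta> \<equiv> (\<integral>x. linear_part phat x \<partial>law \<nu> p) + chain_mean D \<phi> m"
    and "A \<equiv> 1 / \<delta> ^ 6 + c0 / \<delta> ^ 4 + b / \<delta> ^ 10"
  shows "integrable X T \<and> (\<integral>x. T x \<partial>X) = \<theta> \<and> integrable X (\<lambda>x. (T x - \<theta>)\<^sup>2) \<and>
    (\<integral>x. (T x - \<theta>)\<^sup>2 \<partial>X) \<le> var_bound (4 * (1 / \<delta> ^ 5) * A ^ 3 / \<delta>\<^sup>2 + 16 / \<delta>\<^sup>2) err k m n"
proof -
  note \<delta> = p.\<delta>
  have \<delta>1: "\<delta> \<le> 1" by (rule p.delta_le_1)
  have inv1: "1 \<le> 1 / \<delta> ^ i" for i
    using \<delta> \<delta>1 by (simp add: power_le_one)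
  interpret fq: finite_measure \<mu>\<^sub>q by (rule q.finite_\<mu>)
  note bq = q.bdd_meas_\<mu>
  have bP: "bdd_meas P = bdd_meas (triples \<nu>)" by (rule p.bdd_meas_law)
  interpret e: chain_estimate \<mu>\<^sub>q D \<phi> N_fun U_fun V_fun w1_fun w2_fun w3_fun "err / \<delta>" b c0 "real k"
    "1 / \<delta> ^ 6" "1 / \<delta>\<^sup>2" "1 / \<delta> ^ 4" A P Q "A_hat phat bw" "A_under aw bw" "Y_hat phat aw" Z_of "1 / \<delta> ^ 5"
  proof (intro chain_estimate.intro chain_bound.intro chain_model.intro chain_sum.intro chain_op.intro h
      chain_op_axioms.intro chain_sum_axioms.intro chain_bound_axioms.intro chain_model_axioms.intro
      chain_estimate_axioms.intro; (unfold bq q.space_\<mu> bP)?)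
    show "N_fun \<in> bdd_meas \<nu>" "U_fun \<in> bdd_meas \<nu>" "V_fun \<in> bdd_meas \<nu>"
      "w1_fun \<in> bdd_meas \<nu>" "w2_fun \<in> bdd_meas \<nu>" "w3_fun \<in> bdd_meas \<nu>"
      by (rule chain_fun_bdd)+
    show "0 \<le> err / \<delta>" using err_bounds(1) \<delta> by simp
    show "(\<integral>z. U_fun z ^ 4 \<partial>\<mu>\<^sub>q) \<le> 1 / \<delta> ^ 6 * (err / \<delta>) ^ 4"
      unfolding U_fun_def da_def
      by (intro quotient_L4 bdd_meas_diff p.par_bdd q.par_bdd p.weight_bdd p.weight_bounds err_bounds)
    have "(\<integral>z. (rho z * ((par_b phat z - par_b p z) / bw z)) ^ 4 \<partial>\<mu>\<^sub>q) \<le> 1 / \<delta> ^ 6 * (err / \<delta>) ^ 4"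
      by (intro quotient_L4 bdd_meas_diff p.par_bdd q.par_bdd p.weight_bdd p.weight_bounds err_bounds)
    then show "(\<integral>z. V_fun z ^ 4 \<partial>\<mu>\<^sub>q) \<le> 1 / \<delta> ^ 6 * (err / \<delta>) ^ 4"
      by (simp add: V_fun_def db_def)
    show "measure \<mu>\<^sub>q (space \<nu>) \<le> 1 / \<delta>\<^sup>2" using q.measure_\<mu> by (simp add: q.space_\<mu>)
    have "0 \<le> 1 / \<delta> ^ 6" "0 \<le> c0 / \<delta> ^ 4" "0 \<le> b / \<delta> ^ 10"
      using \<delta> sq b by auto
    then show "1 / \<delta> ^ 4 * (1 / \<delta>\<^sup>2) \<le> A" "1 / \<delta> ^ 4 * c0 \<le> A" "1 / \<delta> ^ 4 * b * (1 / \<delta> ^ 6) \<le> A"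
      unfolding A_def by (simp_all add: power_add[symmetric])
    show "prob_space P" "prob_space Q" by (rule p.prob_space_law q.prob_space_law)+
    show "sets P = sets Q" by (simp add: p.sets_law q.sets_law)
    show "Z_of \<in> measurable P \<mu>\<^sub>q"
      using p.Z_meas unfolding measurable_cong_sets[OF refl q.sets_\<mu>] .
    show "(\<integral>x. f x \<partial>P) \<le> 1 / \<delta> ^ 5 * (\<integral>x. f x \<partial>Q)" if "f \<in> bdd_meas (triples \<nu>)" "\<And>x. 0 \<le> f x" for f
      by (rule law_dominated[OF p.model_axioms q.model_axioms that])
    show "\<bar>N_fun z\<bar> \<le> err / \<delta>" if "z \<in> space \<nu>" for z using that by (rule err_bounds(4))
    show "0 \<le> w1_fun z \<and> w1_fun z \<le> 1 / \<delta> ^ 4" "0 \<le> w2_fun z \<and> w2_fun z \<le> 1 / \<delta> ^ 4"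
      "0 \<le> w3_fun z \<and> w3_fun z \<le> 1 / \<delta> ^ 4" if "z \<in> space \<nu>" for z
      using that by (rule chain_weight_bounds)+
    show "(\<Sum>a\<in>D. (\<phi> a z)\<^sup>2) \<le> c0 * real k" if "z \<in> space \<nu>" for z using that sq(1) by blast
    show "(\<integral>z. bdd_proj.proj \<mu>\<^sub>q D \<phi> f z ^ 4 \<partial>\<mu>\<^sub>q) \<le> b * (\<integral>z. f z ^ 4 \<partial>\<mu>\<^sub>q)" if "f \<in> bdd_meas \<nu>" for f
      using that b(1) by blast
    show "0 \<le> c0" "1 \<le> b" by fact+
    show "1 \<le> real k" using sq(3) by simp
    show "1 \<le> 1 / \<delta> ^ 6" "1 \<le> 1 / \<delta>\<^sup>2" "1 \<le> 1 / \<delta> ^ 4" by (rule inv1)+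
    show "0 \<le> 1 / \<delta> ^ 5" using \<delta> by simp
    show "A_hat phat bw \<in> bdd_meas (triples \<nu>)" "A_under aw bw \<in> bdd_meas (triples \<nu>)"
      "Y_hat phat aw \<in> bdd_meas (triples \<nu>)" by (rule factor_bdd)+
  qed (rule chain_fun_bdd | (rule integral_chain, assumption))+
  have K: "chain phat aw bw e.ker j = e.kchain j" for j
    by (auto simp: chain_def e.kchain_def fun_eq_iff)
  \<comment> \<open>Index 1 holds the empirical mean, so that the linear part and the U-statistics
    form a single sum over the orders 1 to \<open>m\<close>.\<close>
  define u where "u j = (if j = 1 then emp_mean n (linear_part phat)
    else (\<lambda>x. (-1) ^ (j - 1) * ustat n j (degen Q j (e.kchain j)) x))" for j
  define \<tau> where "\<tau> j = (if j = 1 then \<integral>x. linear_part phat x \<partial>P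
    else (-1) ^ (j - 1) * (\<integral>z. U_fun z * e.proj ((e.S ^^ (j - 2)) V_fun) z \<partial>\<mu>\<^sub>q))" for j
  define v where "v j = (if j = 1 then 2 * (2 / \<delta>)\<^sup>2 / real n else (\<Sum>l=1..j. 2 ^ j * (real j / real n) ^ l *
      ((1 / \<delta> ^ 5) ^ l * (A ^ (2 * j + 1) * (err / \<delta>) ^ (2 * (j - l)) * real k ^ (l - 1)))))" for j
  have split: "(\<Sum>j=1..m. f j) = f 1 + (\<Sum>j=2..m. f j)" for f :: "nat \<Rightarrow> real"
    using m by (simp add: sum.atLeast_Suc_atMost numeral_2_eq_2)
  have T: "T x = (\<Sum>j=1..m. u j x)" for x
    unfolding split T_def chi_hat_def K by (auto simp: u_def intro!: sum.cong)
  have \<theta>: "\<theta> = (\<Sum>j=1..m. \<tau> j)"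
    unfolding split \<theta>_def chain_mean_def by (auto simp: \<tau>_def intro!: sum.cong)
  have X: "X = PiM {1..n} (\<lambda>_. P)" by (simp add: X_def sample_law_def)
  have u: "integrable X (u j)" "(\<integral>x. u j x \<partial>X) = \<tau> j" "integrable X (\<lambda>x. (u j x - \<tau> j)\<^sup>2)"
    "(\<integral>x. (u j x - \<tau> j)\<^sup>2 \<partial>X) \<le> v j" if j: "j \<in> {1..m}" for j
  proof -
    have "integrable X (u j) \<and> (\<integral>x. u j x \<partial>X) = \<tau> j \<and> integrable X (\<lambda>x. (u j x - \<tau> j)\<^sup>2) \<and>
      (\<integral>x. (u j x - \<tau> j)\<^sup>2 \<partial>X) \<le> v j"
    proof (cases "j = 1")
      case True
      have lb: "linear_part phat \<in> bdd_meas P" using factor_bdd(4) by (simp only: bP)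
      have n1: "1 \<le> n" using m by simp
      note em = emp_mean_moments[OF p.prob_space_law lb linear_part_bound n1]
      show ?thesis
        using em True by (simp add: u_def \<tau>_def v_def X)
    next
      case False
      then have j2: "2 \<le> j" "j \<le> n" using j m by auto
      note uc = e.ustat_chain[OF j2]
      let ?t = "\<integral>z. U_fun z * e.proj ((e.S ^^ (j - 2)) V_fun) z \<partial>\<mu>\<^sub>q"
      have s: "((-1) ^ i * x - (-1) ^ i * y)\<^sup>2 = (x - y)\<^sup>2" for i and x y :: real
        by (simp add: right_diff_distrib[symmetric] power_mult_distrib power_mult[symmetric] mult.commute[of i 2] del: right_diff_distrib)
      show ?thesis
        using False uc by (simp add: u_def \<tau>_def v_def X s)
    qed
    then show "integrable X (u j)" "(\<integral>x. u j x \<partial>X) = \<tau> j" "integrable X (\<lambda>x. (u j x - \<tau> j)\<^sup>2)"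
      "(\<integral>x. (u j x - \<tau> j)\<^sup>2 \<partial>X) \<le> v j" by blast+
  qed
  have iT: "integrable X T"
    unfolding T[abs_def] using u(1) by (intro Bochner_Integration.integrable_sum) auto
  have ET: "(\<integral>x. T x \<partial>X) = \<theta>"
    unfolding T \<theta> using u(1,2) by (subst Bochner_Integration.integral_sum) auto
  have d: "(T x - \<theta>)\<^sup>2 \<le> (\<Sum>j=1..m. 2 ^ j * (u j x - \<tau> j)\<^sup>2)" for x
    unfolding T \<theta> sum_subtractf[symmetric] by (rule sum_squares_le)
  have iS: "integrable X (\<lambda>x. \<Sum>j=1..m. 2 ^ j * (u j x - \<tau> j)\<^sup>2)"
    using u(3) by (intro Bochner_Integration.integrable_sum integrable_mult_right) auto
  have i2: "integrable X (\<lambda>x. (T x - \<theta>)\<^sup>2)"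
  proof (rule Bochner_Integration.integrable_bound[OF iS])
    show "(\<lambda>x. (T x - \<theta>)\<^sup>2) \<in> borel_measurable X"
      using borel_measurable_integrable[OF iT] by measurable
    show "AE x in X. norm ((T x - \<theta>)\<^sup>2) \<le> norm (\<Sum>j=1..m. 2 ^ j * (u j x - \<tau> j)\<^sup>2)"
      using d by (intro AE_I2) (auto intro: order_trans abs_ge_self)
  qed
  have "(\<integral>x. (T x - \<theta>)\<^sup>2 \<partial>X) \<le> (\<integral>x. (\<Sum>j=1..m. 2 ^ j * (u j x - \<tau> j)\<^sup>2) \<partial>X)"
    by (intro integral_mono i2 iS d)
  also have "\<dots> = (\<Sum>j=1..m. 2 ^ j * (\<integral>x. (u j x - \<tau> j)\<^sup>2 \<partial>X))"
    using u(3) by (subst Bochner_Integration.integral_sum) auto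
  also have "\<dots> \<le> (\<Sum>j=1..m. 2 ^ j * v j)"
    using u(4) by (intro sum_mono mult_left_mono) auto
  also have "\<dots> = 2 * (8 / \<delta>\<^sup>2 / real n) + (\<Sum>j=2..m. 2 ^ j * (\<Sum>l=1..j. 2 ^ j * (real j / real n) ^ l *
      ((1 / \<delta> ^ 5) ^ l * (A ^ (2 * j + 1) * (err / \<delta>) ^ (2 * (j - l)) * real k ^ (l - 1)))))"
    unfolding split by (simp add: v_def power_divide)
  also have "\<dots> \<le> var_bound (4 * (1 / \<delta> ^ 5) * A ^ 3 / \<delta>\<^sup>2 + 16 / \<delta>\<^sup>2) err k m n"
    using m by (intro var_bound_le e.A1 inv1 \<delta> \<delta>1 err_bounds refl) auto
  finally show ?thesis using iT ET i2 by blast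
qed


text \<open>Given \<open>Z\<close>, the bias of the linear part is
  \<open>(ahat / a - 1) * (b - bhat)\<close>, with hats for the estimated functions. Multiplied by
  \<open>f = a * g\<close> it is minus the product of the two errors times \<open>g\<close>.\<close>

lemma integral_linear_part: "(\<integral>x. linear_part phat x \<partial>law \<nu> p) = chi \<nu> p - (\<integral>z. da z * db z \<partial>\<mu>\<^sub>p)"
proof -
  have i: "integrable \<nu> (\<lambda>z. par_f p z * par_b p z)" "integrable \<nu> (\<lambda>z. p.wt z * (da z * db z))"
    by (intro p.bdd_meas_integrable bdd_meas_mult p.par_bdd p.weight_bdd quot_bdd)+
  have "(\<integral>x. linear_part phat x \<partial>law \<nu> p) = (\<integral>z. par_f p z * par_b p z - p.wt z * (da z * db z) \<partial>\<nu>)"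
    unfolding p.integral_law[OF factor_bdd(4)]
  proof (intro Bochner_Integration.integral_cong refl)
    fix z assume z: "z \<in> space \<nu>"
    have "par_a p z \<noteq> 0" "aw z \<noteq> 0" "bw z \<noteq> 0"
      using p.bounds[OF z] p.weight_bounds[OF z] p.\<delta> by auto
    then show "par_f p z * (par_b p z * (1 / par_a p z) * linear_part phat (True, True, z) +
        (1 - par_b p z) * (1 / par_a p z) * linear_part phat (False, True, z) +
        (1 - 1 / par_a p z) * linear_part phat (False, False, z)) =
        par_f p z * par_b p z - p.wt z * (da z * db z)"
      by (simp add: linear_part_def par_f_def p.wt_def da_def db_def divide_simps) (simp add: algebra_simps)?
  qed
  also have "\<dots> = (\<integral>z. par_f p z * par_b p z \<partial>\<nu>) - (\<integral>z. p.wt z * (da z * db z) \<partial>\<nu>)"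
    using i by (rule Bochner_Integration.integral_diff)
  also have "(\<integral>z. p.wt z * (da z * db z) \<partial>\<nu>) = (\<integral>z. da z * db z \<partial>\<mu>\<^sub>p)"
    by (intro p.integral_\<mu>[symmetric] bdd_meas_measurable bdd_meas_mult quot_bdd)
  finally show ?thesis by (simp add: p.chi_eq)
qed

lemma kernel_norm_le:
  assumes T: "maps_Lp \<mu>\<^sub>p s T B" and f: "f \<in> bdd_meas \<nu>" and g: "g \<in> bdd_meas \<nu>" and s: "0 < s"
    and ae: "AE z in \<nu>. T f z = g z"
  shows "Lp_norm \<mu>\<^sub>p s g \<le> \<bar>B\<bar> * Lp_norm \<mu>\<^sub>p s f"
proof -
  interpret fp: finite_measure \<mu>\<^sub>p by (rule p.finite_\<mu>)
  have f': "f \<in> Lp_space \<mu>\<^sub>p s"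
    using f s by (intro fp.bdd_Lp_space) (simp_all add: p.bdd_meas_\<mu>)
  have Tf: "T f \<in> Lp_space \<mu>\<^sub>p s" "Lp_norm \<mu>\<^sub>p s (T f) \<le> B * Lp_norm \<mu>\<^sub>p s f"
    using T f' by (auto simp: maps_Lp_def)
  have "Lp_norm \<mu>\<^sub>p s g = Lp_norm \<mu>\<^sub>p s (T f)"
  proof (rule fp.Lp_norm_cong_AE)
    show "AE z in \<mu>\<^sub>p. g z = T f z" using ae by (simp add: p.AE_\<mu> eq_commute)
    show "g \<in> borel_measurable \<mu>\<^sub>p" using bdd_meas_measurable[OF g] by (simp add: p.borel_\<mu>)
    show "T f \<in> borel_measurable \<mu>\<^sub>p" using Tf(1) by (simp add: Lp_space_def)
  qed
  also have "\<dots> \<le> \<bar>B\<bar> * Lp_norm \<mu>\<^sub>p s f"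
    using Tf(2) mult_right_mono[OF abs_ge_self[of B] Lp_norm_nonneg[of \<mu>\<^sub>p s f]] by linarith
  finally show ?thesis .
qed

text \<open>The factor \<open>1 + \<bar>B'\<bar>\<close> in place of \<open>B'\<close> secures that
  the constant is at least 1, as the chain bounds require; the fourth power turns a norm bound into
  one for fourth moments.\<close>

lemma orth_proj_L4:
  assumes Kh: "orth_proj_kernel \<mu>\<^sub>q V Kh" and B: "proj_norm_le \<mu>\<^sub>q V 4 B'"
    and f: "f \<in> bdd_meas \<nu>" and g: "g \<in> bdd_meas \<nu>"
    and ae: "\<And>v. is_orth_proj \<mu>\<^sub>q V f v \<Longrightarrow> AE z in \<nu>. v z = g z"
  shows "(\<integral>z. g z ^ 4 \<partial>\<mu>\<^sub>q) \<le> (1 + \<bar>B'\<bar>) ^ 4 * (\<integral>z. f z ^ 4 \<partial>\<mu>\<^sub>q)"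
proof -
  interpret fq: finite_measure \<mu>\<^sub>q by (rule q.finite_\<mu>)
  have f': "f \<in> Lp_space \<mu>\<^sub>q 2" "f \<in> Lp_space \<mu>\<^sub>q 4"
    using f by (auto intro!: fq.bdd_Lp_space simp: q.bdd_meas_\<mu>)
  obtain v where v: "is_orth_proj \<mu>\<^sub>q V f v"
    using Kh f'(1) unfolding orth_proj_kernel_def by blast
  then have vB: "v \<in> Lp_space \<mu>\<^sub>q 4" "Lp_norm \<mu>\<^sub>q 4 v \<le> B' * Lp_norm \<mu>\<^sub>q 4 f"
    using B f' unfolding proj_norm_le_def by blast+
  have "Lp_norm \<mu>\<^sub>q 4 g = Lp_norm \<mu>\<^sub>q 4 v"
  proof (rule fq.Lp_norm_cong_AE)
    show "AE z in \<mu>\<^sub>q. g z = v z" using ae[OF v] by (simp add: q.AE_\<mu> eq_commute)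
    show "g \<in> borel_measurable \<mu>\<^sub>q" using bdd_meas_measurable[OF g] by (simp add: q.borel_\<mu>)
    show "v \<in> borel_measurable \<mu>\<^sub>q" using vB(1) by (simp add: Lp_space_def)
  qed
  also have "\<dots> \<le> (1 + \<bar>B'\<bar>) * Lp_norm \<mu>\<^sub>q 4 f"
    by (intro order_trans[OF vB(2)] mult_right_mono) (use abs_ge_self[of B'] in linarith, simp)
  finally have "Lp_norm \<mu>\<^sub>q 4 g ^ 4 \<le> ((1 + \<bar>B'\<bar>) * Lp_norm \<mu>\<^sub>q 4 f) ^ 4"
    by (intro power_mono) auto
  then show ?thesis
    by (simp add: Lp_norm_4 power_mult_distrib)
qed

text \<open>Absolute values are taken of \<open>B\<close>, \<open>Ck\<close> and \<open>B'\<close>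
  because their signs are not fixed. The moments of the finite rank estimator are used twice: with a
  crude L4 constant for integrability and the mean, and with the given operator norm for the
  variance.\<close>

lemma estimator_bounds:
  fixes e :: "nat \<Rightarrow> 'z \<Rightarrow> real" and r B Ck :: real
  assumes e: "\<forall>i\<in>{1..k}. e i \<in> Lp_space \<mu>\<^sub>p 2" and k: "1 \<le> k"
    and K: "orth_proj_kernel \<mu>\<^sub>p (span_upto e k) K" "reproducing \<mu>\<^sub>p K" "\<forall>x\<in>space \<nu>. K x x \<le> Ck * real k"
    and Kh: "orth_proj_kernel \<mu>\<^sub>q (span_upto e k) Kh"
    and Lp: "\<forall>s\<in>exponents r. maps_Lp \<mu>\<^sub>p s (kernel_op \<mu>\<^sub>p K) B \<and> maps_Lp \<mu>\<^sub>p s (kernel_op \<mu>\<^sub>q Kh) B"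
    and r: "2 \<le> r" and m: "2 \<le> m" "m \<le> n"
  defines "X \<equiv> sample_law \<nu> p n" and "T \<equiv> chi_hat \<nu> phat aw bw Kh m n"
  shows "integrable X T \<and> integrable X (\<lambda>x. (T x)\<^sup>2) \<and>
    \<bar>(\<integral>x. T x \<partial>X) - chi \<nu> p\<bar> \<le> (1 + \<bar>B\<bar> ^ Suc m * (1 / \<delta>) ^ Suc m) * bias_bound r m \<nu> p phat aw bw K \<and>
    (\<forall>B'. proj_norm_le \<mu>\<^sub>q (span_upto e k) 4 B' \<longrightarrow> (\<integral>x. (T x - (\<integral>x. T x \<partial>X))\<^sup>2 \<partial>X) \<le>
      var_bound (4 * (1 / \<delta> ^ 5) * (1 / \<delta> ^ 6 + \<bar>Ck\<bar> / \<delta>\<^sup>2 / \<delta> ^ 4 + (1 + \<bar>B'\<bar>) ^ 4 / \<delta> ^ 10) ^ 3 / \<delta>\<^sup>2 + 16 / \<delta>\<^sup>2)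
        err k m n)"
proof -
  note \<delta> = p.\<delta>
  let ?\<kappa> = "\<bar>Ck\<bar> * real k" and ?c0 = "\<bar>Ck\<bar> / \<delta>\<^sup>2"
  have diag: "K x x \<le> ?\<kappa>" if "x \<in> space \<nu>" for x
    using K(3) that mult_right_mono[OF abs_ge_self[of Ck], of "real k"] by fastforce
  have \<kappa>: "0 \<le> ?\<kappa>" by simp
  obtain d \<phi> d' \<psi> where h: "bdd_proj \<mu>\<^sub>q {..<d} \<phi>" and g: "bdd_proj \<mu>\<^sub>p {..<d'} \<psi>"
    and hg: "\<forall>a<d. AE z in \<nu>. bdd_proj.proj \<mu>\<^sub>p {..<d'} \<psi> (\<phi> a) z = \<phi> a z"
    and gh: "\<forall>a<d'. AE z in \<nu>. bdd_proj.proj \<mu>\<^sub>q {..<d} \<phi> (\<psi> a) z = \<psi> a z"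
    and sq: "\<forall>z\<in>space \<nu>. (\<Sum>a<d. (\<phi> a z)\<^sup>2) \<le> ?\<kappa> / \<delta>\<^sup>2"
    and ker: "AE x in \<nu> \<Otimes>\<^sub>M \<nu>. Kh (fst x) (snd x) = bdd_proj.ker {..<d} \<phi> (fst x) (snd x)"
    and opq: "\<forall>f\<in>bdd_meas \<nu>. AE z in \<nu>. kernel_op \<mu>\<^sub>q Kh f z = bdd_proj.proj \<mu>\<^sub>q {..<d} \<phi> f z"
    and opp: "\<forall>f\<in>bdd_meas \<nu>. AE z in \<nu>. kernel_op \<mu>\<^sub>p K f z = bdd_proj.proj \<mu>\<^sub>p {..<d'} \<psi> f z"
    and ov: "\<forall>f\<in>bdd_meas \<nu>. \<forall>v. is_orth_proj \<mu>\<^sub>q (span_upto e k) f v \<longrightarrow>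
      (AE z in \<nu>. v z = bdd_proj.proj \<mu>\<^sub>q {..<d} \<phi> f z)"
    using bounded_bases[OF e K(1,2) diag \<kappa> Kh] by blast
  interpret g: bdd_proj \<mu>\<^sub>p "{..<d'}" \<psi> by (rule g)
  interpret h: bdd_proj \<mu>\<^sub>q "{..<d}" \<phi> by (rule h)
  have pb: "g.proj f \<in> bdd_meas \<nu>" "h.proj f \<in> bdd_meas \<nu>" for f
    using g.proj_bdd h.proj_bdd by (simp_all add: p.bdd_meas_\<mu> q.bdd_meas_\<mu>)
  have sq': "\<forall>z\<in>space \<nu>. (\<Sum>a<d. (\<phi> a z)\<^sup>2) \<le> ?c0 * real k"
    using sq by (simp add: field_simps)
  have c0: "0 \<le> ?c0" by simp
  define Tk where "Tk = chi_hat \<nu> phat aw bw h.ker m n"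
  define \<theta> where "\<theta> = (\<integral>x. linear_part phat x \<partial>law \<nu> p) + chain_mean {..<d} \<phi> m"
  have Khm: "(\<lambda>(x, z). Kh x z) \<in> borel_measurable (\<nu> \<Otimes>\<^sub>M \<nu>)"
    using Kh unfolding orth_proj_kernel_def measurable_cong_sets[OF sets_pair_measure_cong[OF q.sets_\<mu> q.sets_\<mu>] refl] by blast
  have kerm: "(\<lambda>(x, z). h.ker x z) \<in> borel_measurable (\<nu> \<Otimes>\<^sub>M \<nu>)"
  proof -
    have [measurable]: "\<phi> a \<in> borel_measurable \<nu>" if "a \<in> {..<d}" for a
      using bdd_meas_measurable[OF h.phi[OF that]] by (simp add: q.borel_\<mu>)
    show ?thesis
      unfolding h.ker_def case_prod_unfold by measurable
  qed
  have Tm: "T \<in> borel_measurable X" "Tk \<in> borel_measurable X"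
    unfolding T_def Tk_def X_def by (intro chi_hat_measurable Khm kerm)+
  have TT: "AE x in X. T x = Tk x"
    unfolding T_def Tk_def X_def by (rule chi_hat_AE_eq[OF Khm kerm ker])
  have transfer: "integrable X T \<and> (\<integral>x. T x \<partial>X) = \<theta> \<and> integrable X (\<lambda>x. (T x - \<theta>)\<^sup>2) \<and>
    (\<integral>x. (T x - \<theta>)\<^sup>2 \<partial>X) \<le> v"
    if "integrable X Tk \<and> (\<integral>x. Tk x \<partial>X) = \<theta> \<and> integrable X (\<lambda>x. (Tk x - \<theta>)\<^sup>2) \<and>
      (\<integral>x. (Tk x - \<theta>)\<^sup>2 \<partial>X) \<le> v" for v
  proof -
    have TT2: "AE x in X. (T x - \<theta>)\<^sup>2 = (Tk x - \<theta>)\<^sup>2"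
      using TT by eventually_elim simp
    have m2: "(\<lambda>x. (T x - \<theta>)\<^sup>2) \<in> borel_measurable X" "(\<lambda>x. (Tk x - \<theta>)\<^sup>2) \<in> borel_measurable X"
      using Tm by measurable
    show ?thesis
      using that integrable_cong_AE[OF Tm TT] integral_cong_AE[OF Tm TT] integrable_cong_AE[OF m2 TT2]
        integral_cong_AE[OF m2 TT2] by simp
  qed
  \<comment> \<open>Available before any \<open>B'\<close> is given; its dependence on
    \<open>k\<close> is harmless, since only the mean and integrability are read off from
    it.\<close>
  define b0 where "b0 = 1 + ?c0 * real k * measure \<mu>\<^sub>q (space \<mu>\<^sub>q)"
  have b0: "\<forall>f\<in>bdd_meas \<nu>. (\<integral>z. h.proj f z ^ 4 \<partial>\<mu>\<^sub>q) \<le> b0 * (\<integral>z. f z ^ 4 \<partial>\<mu>\<^sub>q)" "1 \<le> b0"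
  proof -
    show "1 \<le> b0" unfolding b0_def by (simp add: measure_nonneg)
    have "(\<integral>z. h.proj f z ^ 4 \<partial>\<mu>\<^sub>q) \<le> b0 * (\<integral>z. f z ^ 4 \<partial>\<mu>\<^sub>q)" if f: "f \<in> bdd_meas \<nu>" for f
    proof -
      have "(\<integral>z. h.proj f z ^ 4 \<partial>\<mu>\<^sub>q) \<le> ?c0 * real k * measure \<mu>\<^sub>q (space \<mu>\<^sub>q) * (\<integral>z. f z ^ 4 \<partial>\<mu>\<^sub>q)"
        using sq' f by (intro h.proj_L4) (simp_all only: q.space_\<mu> q.bdd_meas_\<mu>)
      moreover have "0 \<le> (\<integral>z. f z ^ 4 \<partial>\<mu>\<^sub>q)" by (simp add: integral_nonneg_AE)
      ultimately show ?thesis unfolding b0_def distrib_right by linarith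
    qed
    then show "\<forall>f\<in>bdd_meas \<nu>. (\<integral>z. h.proj f z ^ 4 \<partial>\<mu>\<^sub>q) \<le> b0 * (\<integral>z. f z ^ 4 \<partial>\<mu>\<^sub>q)" by blast
  qed
  note mom = transfer[OF chi_hat_moments[OF h sq' c0 k _ _ m, folded X_def Tk_def \<theta>_def]]
  have base: "integrable X T" "(\<integral>x. T x \<partial>X) = \<theta>" "integrable X (\<lambda>x. (T x - \<theta>)\<^sup>2)"
    using mom[OF b0] by blast+
  interpret X: prob_space X
    unfolding X_def sample_law_def by (intro prob_space_PiM p.prob_space_law)
  have i2: "integrable X (\<lambda>x. (T x)\<^sup>2)"
  proof -
    have "(\<lambda>x. (T x)\<^sup>2) = (\<lambda>x. (T x - \<theta>)\<^sup>2 + (2 * \<theta> * T x - \<theta>\<^sup>2))"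
      by (simp add: fun_eq_iff power2_eq_square algebra_simps)
    then show ?thesis
      using base by simp
  qed
  have r_exp: "r \<in> exponents r"
  proof -
    have "r * 1 \<le> r * (r - 1)" using r by (intro mult_left_mono) auto
    then have "r / (r - 1) \<le> r" using r by (simp add: divide_le_eq)
    then show ?thesis by (simp add: exponents_def)
  qed
  have s_pos: "0 < s" if "s \<in> exponents r" for s
  proof -
    have "0 < r / (r - 1)" using r by simp
    then show ?thesis using that by (auto simp: exponents_def)
  qed
  have Bq: "Lp_norm \<mu>\<^sub>p s (h.proj f) \<le> \<bar>B\<bar> * Lp_norm \<mu>\<^sub>p s f" if "s \<in> exponents r" "f \<in> bdd_meas \<nu>" for s f
    using Lp opq that s_pos pb by (intro kernel_norm_le[where T = "kernel_op \<mu>\<^sub>q Kh"]) auto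
  have Bp: "Lp_norm \<mu>\<^sub>p r (g.proj f) \<le> \<bar>B\<bar> * Lp_norm \<mu>\<^sub>p r f" if "f \<in> bdd_meas \<nu>" for f
    using Lp opp that r_exp s_pos pb by (intro kernel_norm_le[where T = "kernel_op \<mu>\<^sub>p K"]) auto
  have resid: "Lp_norm \<mu>\<^sub>p 2 (\<lambda>z. f z - kernel_op \<mu>\<^sub>p K f z) = Lp_norm \<mu>\<^sub>p 2 (\<lambda>z. f z - g.proj f z)"
    if f: "f \<in> bdd_meas \<nu>" for f
  proof (rule g.Lp_norm_cong_AE)
    have "AE z in \<mu>\<^sub>p. kernel_op \<mu>\<^sub>p K f z = g.proj f z" using opp f by (simp add: p.AE_\<mu>)
    then show "AE z in \<mu>\<^sub>p. f z - kernel_op \<mu>\<^sub>p K f z = f z - g.proj f z" by eventually_elim simp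
    have fm: "f \<in> borel_measurable \<mu>\<^sub>p" using bdd_meas_measurable[OF f] by (simp add: p.borel_\<mu>)
    have "kernel_op \<mu>\<^sub>p K f \<in> borel_measurable \<mu>\<^sub>p"
    proof -
      have "f \<in> Lp_space \<mu>\<^sub>p r"
        using f s_pos[OF r_exp] by (intro g.bdd_Lp_space) (simp_all add: p.bdd_meas_\<mu>)
      then have "kernel_op \<mu>\<^sub>p K f \<in> Lp_space \<mu>\<^sub>p r"
        using Lp r_exp by (auto simp: maps_Lp_def)
      then show ?thesis by (simp add: Lp_space_def)
    qed
    with fm show "(\<lambda>z. f z - kernel_op \<mu>\<^sub>p K f z) \<in> borel_measurable \<mu>\<^sub>p" by measurable
    show "(\<lambda>z. f z - g.proj f z) \<in> borel_measurable \<mu>\<^sub>p"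
      using fm bdd_meas_measurable[OF g.proj_bdd] by measurable
  qed
  define G where "G = (if r = 2 then sup_norm (space \<nu>) (\<lambda>z. par_g phat z - par_g p z)
    else Lp_norm \<mu>\<^sub>p (real (m - 1) * r / (r - 2)) (\<lambda>z. par_g phat z - par_g p z))"
  define I1 where "I1 = Lp_norm \<mu>\<^sub>p r (\<lambda>z. par_a phat z - par_a p z) * Lp_norm \<mu>\<^sub>p r (\<lambda>z. par_b phat z - par_b p z) * G ^ (m - 1)"
  define I2 where "I2 = Lp_norm \<mu>\<^sub>p 2 (\<lambda>z. da z - g.proj da z) * Lp_norm \<mu>\<^sub>p 2 (\<lambda>z. db z - g.proj db z)"
  have bb: "bias_bound r m \<nu> p phat aw bw K = I1 + I2"
    unfolding bias_bound_def Let_def I1_def I2_def G_def resid[OF quot_bdd(2), symmetric] resid[OF quot_bdd(3), symmetric]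
    by (simp add: da_def[abs_def] db_def[abs_def])
  have G0: "0 \<le> G"
  proof (cases "r = 2")
    case True
    obtain z where z: "z \<in> space \<nu>" using p.space_nonempty by auto
    have "\<bar>par_g phat z - par_g p z\<bar> \<le> G"
      unfolding G_def using True sup_norm_bound[OF bdd_meas_diff[OF q.par_bdd(3) p.par_bdd(3)] z] by simp
    then show ?thesis by linarith
  qed (simp add: G_def)
  have I0: "0 \<le> I1" "0 \<le> I2"
    using G0 by (simp_all add: I1_def I2_def)
  have bias: "\<bar>\<theta> - chi \<nu> p\<bar> \<le> \<bar>B\<bar> ^ Suc m * (1 / \<delta>) ^ Suc m * I1 + I2"
    using bias_estimate[OF h g _ _ m(1) r _ Bq Bp] hg gh
    unfolding \<theta>_def integral_linear_part chain_mean_def I1_def I2_def G_def by simp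
  \<comment> \<open>The two error terms have different constants; the sum of the constants covers
    both.\<close>
  also have "\<dots> \<le> (1 + \<bar>B\<bar> ^ Suc m * (1 / \<delta>) ^ Suc m) * (I1 + I2)"
  proof -
    have "0 \<le> \<bar>B\<bar> ^ Suc m * (1 / \<delta>) ^ Suc m" using \<delta> by (intro mult_nonneg_nonneg zero_le_power) auto
    from mult_nonneg_nonneg[OF this I0(2)] I0(1) show ?thesis
      unfolding distrib_left distrib_right mult_1 by linarith
  qed
  finally have bias: "\<bar>(\<integral>x. T x \<partial>X) - chi \<nu> p\<bar> \<le>
      (1 + \<bar>B\<bar> ^ Suc m * (1 / \<delta>) ^ Suc m) * bias_bound r m \<nu> p phat aw bw K"
    unfolding bb base(2) .
  have var: "(\<integral>x. (T x - (\<integral>x. T x \<partial>X))\<^sup>2 \<partial>X) \<le>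
      var_bound (4 * (1 / \<delta> ^ 5) * (1 / \<delta> ^ 6 + ?c0 / \<delta> ^ 4 + (1 + \<bar>B'\<bar>) ^ 4 / \<delta> ^ 10) ^ 3 / \<delta>\<^sup>2 + 16 / \<delta>\<^sup>2) err k m n"
    if B': "proj_norm_le \<mu>\<^sub>q (span_upto e k) 4 B'" for B'
  proof -
    have b: "\<forall>f\<in>bdd_meas \<nu>. (\<integral>z. h.proj f z ^ 4 \<partial>\<mu>\<^sub>q) \<le> (1 + \<bar>B'\<bar>) ^ 4 * (\<integral>z. f z ^ 4 \<partial>\<mu>\<^sub>q)"
      using ov by (intro ballI orth_proj_L4[OF Kh B'] pb) auto
    have b1: "1 \<le> (1 + \<bar>B'\<bar>) ^ 4"
      by (rule one_le_power) simp
    show ?thesis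
      unfolding base(2) using mom[OF b b1] by blast
  qed
  show ?thesis
    using base(1) i2 bias var by blast
qed

end

theorem theorem8p1:
  fixes \<delta> Ck :: real
  assumes "0 < \<delta>"
  shows "\<exists>(c :: real \<Rightarrow> real \<Rightarrow> real \<Rightarrow> real \<Rightarrow> real \<Rightarrow> real \<Rightarrow> real \<Rightarrow> real \<Rightarrow> real) (Cv :: real).
    0 < Cv \<and>
    (\<forall>(r :: real) (B :: real) (m :: nat). 2 \<le> r \<longrightarrow> 2 \<le> m \<longrightarrow>
      (\<exists>Cb > 0. \<forall>(n :: nat) (k :: nat) (\<nu> :: 'z measure) p phat aw bw e K Khat.
        m \<le> n \<longrightarrow> setting \<delta> Ck r B k \<nu> p phat aw bw e K Khat \<longrightarrow>
        (let S = sample_law \<nu> p n; T = chi_hat \<nu> phat aw bw Khat m n in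
          integrable S T \<and> integrable S (\<lambda>x. (T x)\<^sup>2) \<and>
          \<bar>prob_space.expectation S T - chi \<nu> p\<bar> \<le> Cb * bias_bound r m \<nu> p phat aw bw K \<and>
          (\<forall>B'. (\<forall>l\<in>{1..k}. \<forall>s\<in>exponents r.
                   proj_norm_le (wmeasure \<nu> aw bw phat) (span_upto e l) s B') \<longrightarrow>
            prob_space.variance S T
              \<le> Cv * var_bound
                   (c (sup_norm (space \<nu>) aw) (sup_norm (space \<nu>) bw)
                      (sup_norm (space \<nu>) (\<lambda>z. 1 / par_a p z)) (sup_norm (space \<nu>) (par_b p))
                      (sup_norm (space (law \<nu> p)) (\<lambda>x. obs_density p x / obs_density phat x))
                      (sup_norm (space \<nu>) (\<lambda>z. par_g p z / par_g phat z)) B' r)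
                   (eps \<nu> p phat aw bw) k m n))))"
    (is "\<exists>c Cv. 0 < Cv \<and> ?R c Cv")
proof -
  \<comment> \<open>The base from \<open>var_bound_le\<close> with domination constant
    \<open>1 / \<delta> ^ 5\<close>, diagonal constant
    \<open>\<bar>Ck\<bar> / \<delta>\<^sup>2\<close> for the estimated kernel and L4 constant
    \<open>(1 + \<bar>B'\<bar>) ^ 4\<close>. All uniform bounds of the model enter through
    \<open>\<delta>\<close>.\<close>
  define c where "c B' = 4 * (1 / \<delta> ^ 5) * (1 / \<delta> ^ 6 + \<bar>Ck\<bar> / \<delta>\<^sup>2 / \<delta> ^ 4 + (1 + \<bar>B'\<bar>) ^ 4 / \<delta> ^ 10) ^ 3 / \<delta>\<^sup>2 + 16 / \<delta>\<^sup>2" for B' :: real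
  have "?R (\<lambda>_ _ _ _ _ _ B' _. c B') 1"
  proof (intro allI impI)
    fix r B :: real and m :: nat
    assume r: "2 \<le> r" and m: "2 \<le> m"
    have "0 \<le> \<bar>B\<bar> ^ Suc m * (1 / \<delta>) ^ Suc m"
      using assms by (intro mult_nonneg_nonneg zero_le_power) auto
    then have Cb: "0 < 1 + \<bar>B\<bar> ^ Suc m * (1 / \<delta>) ^ Suc m" by linarith
    show "\<exists>Cb > 0. \<forall>(n :: nat) (k :: nat) (\<nu> :: 'z measure) p phat aw bw e K Khat.
        m \<le> n \<longrightarrow> setting \<delta> Ck r B k \<nu> p phat aw bw e K Khat \<longrightarrow>
        (let S = sample_law \<nu> p n; T = chi_hat \<nu> phat aw bw Khat m n in
          integrable S T \<and> integrable S (\<lambda>x. (T x)\<^sup>2) \<and>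
          \<bar>prob_space.expectation S T - chi \<nu> p\<bar> \<le> Cb * bias_bound r m \<nu> p phat aw bw K \<and>
          (\<forall>B'. (\<forall>l\<in>{1..k}. \<forall>s\<in>exponents r.
                   proj_norm_le (wmeasure \<nu> aw bw phat) (span_upto e l) s B') \<longrightarrow>
            prob_space.variance S T
              \<le> 1 * var_bound (c B') (eps \<nu> p phat aw bw) k m n))"
    proof (intro exI[of _ "1 + \<bar>B\<bar> ^ Suc m * (1 / \<delta>) ^ Suc m"] conjI Cb allI impI)
      fix n k :: nat and \<nu> :: "'z measure" and p phat aw bw e K Khat
      assume mn: "m \<le> n" and set: "setting \<delta> Ck r B k \<nu> p phat aw bw e K Khat"
      interpret two_models \<delta> \<nu> p phat aw bw
        by unfold_locales (use assms set in \<open>auto simp: setting_def\<close>)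
      have s: "\<forall>i\<in>{1..k}. e i \<in> Lp_space (wmeasure \<nu> aw bw p) 2" "1 \<le> k"
        "orth_proj_kernel (wmeasure \<nu> aw bw p) (span_upto e k) K" "reproducing (wmeasure \<nu> aw bw p) K"
        "\<forall>x\<in>space \<nu>. K x x \<le> Ck * real k"
        "orth_proj_kernel (wmeasure \<nu> aw bw phat) (span_upto e k) Khat"
        "\<forall>s\<in>exponents r. maps_Lp (wmeasure \<nu> aw bw p) s (kernel_op (wmeasure \<nu> aw bw p) K) B \<and>
           maps_Lp (wmeasure \<nu> aw bw p) s (kernel_op (wmeasure \<nu> aw bw phat) Khat) B"
        using set unfolding setting_def by blast+
      \<comment> \<open>The variance bound takes the operator norm at the full span and at exponent
        4.\<close>
      have k4: "k \<in> {1..k}" "4 \<in> exponents r"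
        using s(2) by (auto simp: exponents_def)
      show "let S = sample_law \<nu> p n; T = chi_hat \<nu> phat aw bw Khat m n in
          integrable S T \<and> integrable S (\<lambda>x. (T x)\<^sup>2) \<and>
          \<bar>prob_space.expectation S T - chi \<nu> p\<bar> \<le>
            (1 + \<bar>B\<bar> ^ Suc m * (1 / \<delta>) ^ Suc m) * bias_bound r m \<nu> p phat aw bw K \<and>
          (\<forall>B'. (\<forall>l\<in>{1..k}. \<forall>s\<in>exponents r.
                   proj_norm_le (wmeasure \<nu> aw bw phat) (span_upto e l) s B') \<longrightarrow>
            prob_space.variance S T
              \<le> 1 * var_bound (c B') (eps \<nu> p phat aw bw) k m n)"
        unfolding Let_def mult_1 c_def using estimator_bounds[OF s r m mn] k4 by blast
    qed
  qed
  then show ?thesis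
    by (intro exI[of _ "\<lambda>_ _ _ _ _ _ B' _. c B'"] exI[of _ "1 :: real"] conjI zero_less_one)
qed

end
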